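(* Let $q\ge 3$. Let $\mathcal M_q$ be the space of $q\times q$ complex matrices and $\mathbf P(\mathcal M_q)$ its projectivization. Let $J(x)=(x_{i,j}^{-1})$ (entrywise reciprocal) and $I(x)=x^{-1}$ (matrix inverse), both viewed as birational involutions of $\mathbf P(\mathcal M_q)$, and let $K_q=I\circ J$. Then the dynamical degree $$\delta(K_q)=\lim_{n\to\infty}\big(\deg(K_q^n)\big)^{1/n}$$ equals the largest modulus of a root of the polynomial $\lambda^2-(q^2-4q+2)\lambda+1$.
   Context: For a rational self-map $f$ of projective space, $\deg(f)$ is the common degree of homogeneous polynomials without common factor representing $f$, and $f^n=f\circ\cdots\circ f$ ($n$ times). *)

theory Defs
  imports "HOL-Analysis.Analysis" "HOL-Library.Poly_Mapping" "HOL-Combinatorics.Permutations"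
begin

text \<open>Multivariate polynomials over the complex numbers in the matrix-entry variables
  x_(i,j), represented as finitely supported maps from monomials (finitely supported
  exponent vectors) to coefficients. Multiplication is the convolution product of
  Poly_Mapping, making this a commutative ring.\<close>

type_synonym var = "nat \<times> nat"
type_synonym cpoly = "(var \<Rightarrow>\<^sub>0 nat) \<Rightarrow>\<^sub>0 complex"

definition pvar :: "var \<Rightarrow> cpoly" where
  "pvar v = Poly_Mapping.single (Poly_Mapping.single v 1) 1"

definition pconst :: "complex \<Rightarrow> cpoly" where
  "pconst c = Poly_Mapping.single 0 c"

definition mon_deg :: "(var \<Rightarrow>\<^sub>0 nat) \<Rightarrow> nat" where
  "mon_deg m = (\<Sum>v\<in>Poly_Mapping.keys m. Poly_Mapping.lookup m v)"

definition homogeneous_of_degree :: "nat \<Rightarrow> cpoly \<Rightarrow> bool" where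
  "homogeneous_of_degree d p \<longleftrightarrow> (\<forall>m\<in>Poly_Mapping.keys p. mon_deg m = d)"

definition psubst :: "(var \<Rightarrow> cpoly) \<Rightarrow> cpoly \<Rightarrow> cpoly" where
  "psubst G p = (\<Sum>m\<in>Poly_Mapping.keys p.
      pconst (Poly_Mapping.lookup p m) *
      (\<Prod>v\<in>Poly_Mapping.keys m. G v ^ Poly_Mapping.lookup m v))"

definition coords :: "nat \<Rightarrow> var set" where
  "coords q = {0..<q} \<times> {0..<q}"

definition tcomp :: "(var \<Rightarrow> cpoly) \<Rightarrow> (var \<Rightarrow> cpoly) \<Rightarrow> (var \<Rightarrow> cpoly)" where
  "tcomp F G = (\<lambda>v. psubst G (F v))"

definition titer :: "(var \<Rightarrow> cpoly) \<Rightarrow> nat \<Rightarrow> (var \<Rightarrow> cpoly)" where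
  "titer F n = ((\<lambda>H. tcomp F H) ^^ n) pvar"

text \<open>Degree of the rational self-map of P^N represented by the tuple F
  (coordinates indexed by V): the common degree of a tuple G of homogeneous
  polynomials without nonconstant common factor representing the same map,
  i.e. G not identically zero and G proportional to F (F_v G_w = F_w G_v).\<close>
definition rat_map_deg :: "var set \<Rightarrow> (var \<Rightarrow> cpoly) \<Rightarrow> nat" where
  "rat_map_deg V F = (THE d. \<exists>G.
      (\<forall>v\<in>V. homogeneous_of_degree d (G v)) \<and>
      (\<exists>v\<in>V. G v \<noteq> 0) \<and>
      (\<forall>h. (\<forall>v\<in>V. h dvd G v) \<longrightarrow> h dvd 1) \<and>
      (\<forall>v\<in>V. \<forall>w\<in>V. F v * G w = F w * G v))"

text \<open>J(x) = (1/x_(i,j)), homogenised by multiplying with the product of all entries.\<close>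
definition J_map :: "nat \<Rightarrow> var \<Rightarrow> cpoly" where
  "J_map q = (\<lambda>v. \<Prod>w\<in>coords q - {v}. pvar w)"

text \<open>I(x) = x^(-1) = adj(x)/det(x), projectively the adjugate:
  adj(x)_(j,i) = sum over permutations s with s i = j of sign s * prod_(k ~= i) x_(k, s k)
  (cofactor of the entry (i,j), via the Leibniz formula).\<close>
definition I_map :: "nat \<Rightarrow> var \<Rightarrow> cpoly" where
  "I_map q = (\<lambda>(j, i). \<Sum>s\<in>{s. s permutes {0..<q} \<and> s i = j}.
      pconst (of_int (sign s)) * (\<Prod>k\<in>{0..<q} - {i}. pvar (k, s k)))"

definition K_map :: "nat \<Rightarrow> var \<Rightarrow> cpoly" where
  "K_map q = tcomp (I_map q) (J_map q)"

end

theory Submission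
  imports Defs "Jordan_Normal_Form.Determinant"
begin

text \<open>Let \<open>x\<close> be the generic matrix and \<open>M\<^sub>n = K\<^sup>n(x)\<close>, with entries in the field of rational
  functions. For a prime polynomial \<open>p\<close> with valuation \<open>v\<close> consider the sequences
  \<open>m(n) = min v((M\<^sub>n)\<^sub>i\<^sub>j)\<close>, \<open>s(n) = v(product of the entries of M\<^sub>n)\<close> and
  \<open>c(n) = v(det (J M\<^sub>n))\<close>. The degree of \<open>K\<^sup>n\<close> is \<open>1\<close> minus the total degree of the divisor
  with multiplicities \<open>m(n)\<close>. With \<open>P = 1 + (2q - 2)z + z\<^sup>2\<close>, the generating functions satisfy
  \<open>z(1 + z)P c + (P\<^sup>2 - q\<^sup>2 z(1 + z)\<^sup>2) m + z(1 + z)\<^sup>2 s = 0\<close> at every prime: \<open>I\<close> and \<open>J\<close> are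
  involutions of the function field which permute all prime divisors except \<open>det x = 0\<close> and
  \<open>x\<^sub>i\<^sub>j = 0\<close> respectively, so a generic divisor only shifts the sequences by one step; the
  determinant divisor returns to itself under \<open>I J I\<close> with an explicit correction; and for
  \<open>q \<ge> 4\<close> the forward orbit of \<open>x\<^sub>i\<^sub>j = 0\<close> never becomes exceptional again, so its sequences are
  explicit. Multiplying over all primes turns this into an identity of degrees, which gives
  \<open>(1 - z)\<^sup>2 (1 - (q\<^sup>2 - 4q + 2)z + z\<^sup>2) (\<Sum>n. deg(K\<^sup>n) z\<^sup>n) = P (1 + (q - 1)z)\<close>. For \<open>q = 3\<close>, where
  orbits do degenerate, \<open>K\<^sup>3(x)\<close> is the transpose of \<open>x\<close> with rescaled rows and columns, so the
  degrees grow at most linearly.\<close>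

text \<open>The divisor bookkeeping usually done on a blow-up is replaced by valuations of the
  function field. Each of the two exceptional divisors contributes rational series with denominator
  \<open>1 - z\<close>, and the coefficients of the identity are the linear form, unique up to a
  factor, that kills both contributions. Two obstacles shape the proof. Along
  \<open>det x = 0\<close> the map degenerates: the order of \<open>det (J I x)\<close> there has to
  be found from an explicit factorization of the matrix, and for I J I x only bounds on denominators
  are accessible; that I J I is an involution turns the bound into an equality. For
  \<open>x_ij = 0\<close> all iterates must be controlled. It suffices that, for each
  \<open>n\<close>, a single complex point of the divisor has an orbit that avoids zero entries and
  zero determinants once the forced zeros are scaled out; such a point is found near the line of
  matrices with constant diagonal and constant off-diagonal, where K is a Moebius map of one
  variable. The passage to degrees uses that a homogeneous fraction without zeros or poles has
  degree 0, applied to one product for each coefficient.\<close>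

section \<open>Evaluation of polynomials\<close>

hide_const (open) Determinants.det Finite_Cartesian_Product.mat Finite_Cartesian_Product.row
  Finite_Cartesian_Product.vec

definition mon_val :: "(var \<Rightarrow> 'b::comm_ring_1) \<Rightarrow> (var \<Rightarrow>\<^sub>0 nat) \<Rightarrow> 'b" where
  "mon_val g m = (\<Prod>v\<in>Poly_Mapping.keys m. g v ^ Poly_Mapping.lookup m v)"

lemma mon_val_superset:
  assumes "finite S" "Poly_Mapping.keys m \<subseteq> S"
  shows "mon_val g m = (\<Prod>v\<in>S. g v ^ Poly_Mapping.lookup m v)"
  unfolding mon_val_def
  by (rule prod.mono_neutral_left) (use assms in \<open>auto simp: in_keys_iff\<close>)

lemma mon_val_add: "mon_val g (m + n) = mon_val g m * mon_val g n"
proof -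
  let ?S = "Poly_Mapping.keys m \<union> Poly_Mapping.keys n"
  have "mon_val g (m + n) = (\<Prod>v\<in>?S. g v ^ Poly_Mapping.lookup (m + n) v)"
    by (rule mon_val_superset) (auto dest!: subsetD[OF Poly_Mapping.keys_add])
  also have "\<dots> = (\<Prod>v\<in>?S. g v ^ Poly_Mapping.lookup m v) * (\<Prod>v\<in>?S. g v ^ Poly_Mapping.lookup n v)"
    by (simp add: lookup_add power_add prod.distrib)
  also have "\<dots> = mon_val g m * mon_val g n"
    by (subst (1 2) mon_val_superset[of ?S]) auto
  finally show ?thesis .
qed

definition ins :: "(complex \<Rightarrow> 'b::comm_ring_1) \<Rightarrow> (var \<Rightarrow> 'b) \<Rightarrow> cpoly \<Rightarrow> 'b" where
  "ins \<iota> g p = (\<Sum>m\<in>Poly_Mapping.keys p. \<iota> (Poly_Mapping.lookup p m) * mon_val g m)"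

lemma poly_mapping_sum_single:
  "(p :: 'a \<Rightarrow>\<^sub>0 'b::comm_monoid_add) = (\<Sum>m\<in>Poly_Mapping.keys p. Poly_Mapping.single m (Poly_Mapping.lookup p m))"
  by (rule poly_mapping_eqI) (simp add: lookup_sum lookup_single when_def sum.delta in_keys_iff)

context
  fixes \<iota> :: "complex \<Rightarrow> 'b::comm_ring_1" and g :: "var \<Rightarrow> 'b"
  assumes hom: "comm_ring_hom \<iota>"
begin

interpretation comm_ring_hom \<iota> by (rule hom)

lemma ins_superset:
  assumes "finite S" "Poly_Mapping.keys p \<subseteq> S"
  shows "ins \<iota> g p = (\<Sum>m\<in>S. \<iota> (Poly_Mapping.lookup p m) * mon_val g m)"
  unfolding ins_def
  by (rule sum.mono_neutral_left) (use assms in \<open>auto simp: in_keys_iff\<close>)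

lemma ins_0: "ins \<iota> g 0 = 0"
  by (simp add: ins_def)

lemma ins_add: "ins \<iota> g (p + p') = ins \<iota> g p + ins \<iota> g p'"
proof -
  let ?S = "Poly_Mapping.keys p \<union> Poly_Mapping.keys p'"
  have "ins \<iota> g (p + p') = (\<Sum>m\<in>?S. \<iota> (Poly_Mapping.lookup (p + p') m) * mon_val g m)"
    by (rule ins_superset) (auto dest!: subsetD[OF Poly_Mapping.keys_add])
  also have "\<dots> = (\<Sum>m\<in>?S. \<iota> (Poly_Mapping.lookup p m) * mon_val g m) +
      (\<Sum>m\<in>?S. \<iota> (Poly_Mapping.lookup p' m) * mon_val g m)"
    by (simp add: lookup_add hom_add distrib_right sum.distrib)
  also have "\<dots> = ins \<iota> g p + ins \<iota> g p'"
    by (subst (1 2) ins_superset[of ?S]) auto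
  finally show ?thesis .
qed

lemma ins_sum: "ins \<iota> g (sum f A) = (\<Sum>a\<in>A. ins \<iota> g (f a))"
  by (induction A rule: infinite_finite_induct) (auto simp: ins_0 ins_add)

lemma ins_single: "ins \<iota> g (Poly_Mapping.single m c) = \<iota> c * mon_val g m"
  by (simp add: ins_def)

lemma ins_mult: "ins \<iota> g (p * p') = ins \<iota> g p * ins \<iota> g p'"
proof -
  have "p * p' = (\<Sum>m\<in>Poly_Mapping.keys p. Poly_Mapping.single m (Poly_Mapping.lookup p m)) *
      (\<Sum>m\<in>Poly_Mapping.keys p'. Poly_Mapping.single m (Poly_Mapping.lookup p' m))"
    using poly_mapping_sum_single[of p] poly_mapping_sum_single[of p'] by simp
  also have "ins \<iota> g \<dots> = (\<Sum>m\<in>Poly_Mapping.keys p. \<iota> (Poly_Mapping.lookup p m) * mon_val g m) *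
     (\<Sum>m\<in>Poly_Mapping.keys p'. \<iota> (Poly_Mapping.lookup p' m) * mon_val g m)"
    by (simp add: sum_product ins_sum mult_single ins_single mon_val_add hom_mult mult_ac)
  finally show ?thesis by (simp add: ins_def)
qed

lemma ins_1: "ins \<iota> g 1 = 1"
  using ins_single[of 0 1] by (simp add: mon_val_def)

lemma ins_pconst: "ins \<iota> g (pconst c) = \<iota> c"
  by (simp add: pconst_def ins_single mon_val_def)

lemma ins_pvar: "ins \<iota> g (pvar v) = g v"
  by (simp add: pvar_def ins_single mon_val_def)

end

lemma pconst_hom: "comm_ring_hom pconst"
  by unfold_locales (auto simp: pconst_def single_add mult_single)

lemma psubst_ins: "psubst G = ins pconst G"
  by (auto simp: psubst_def ins_def mon_val_def)

lemma mon_val_pvar: "mon_val pvar m = Poly_Mapping.single m 1"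
proof -
  have pw: "pvar v ^ k = Poly_Mapping.single (Poly_Mapping.single v k) 1" for v k
    by (induction k) (auto simp: pvar_def mult_single simp flip: single_add)
  have *: "(\<Prod>v\<in>S. Poly_Mapping.single (f v) (1::complex)) = Poly_Mapping.single (\<Sum>v\<in>S. f v) 1"
    if "finite S" for S and f :: "var \<Rightarrow> (var \<Rightarrow>\<^sub>0 nat)"
    using that by (induction S rule: finite_induct) (auto simp: mult_single)
  show ?thesis unfolding mon_val_def pw
    by (subst *) (auto simp flip: poly_mapping_sum_single)
qed

lemma ins_pvar_id: "ins pconst pvar p = p"
  by (subst (2) poly_mapping_sum_single[of p])
    (simp add: ins_def mon_val_pvar pconst_def mult_single)

text \<open>The type \<open>cpoly\<close> itself cannot be made an instance of \<^class>\<open>idom\<close>: that instance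
  of \<^type>\<open>poly_mapping\<close> needs a linear order on the variables, which
  \<^theory>\<open>HOL-Library.Product_Order\<close> precludes.\<close>

typedef mpoly = "UNIV :: cpoly set" morphisms rep_mp abs_mp ..

setup_lifting type_definition_mpoly

instantiation mpoly :: comm_ring_1
begin
lift_definition zero_mpoly :: mpoly is 0 .
lift_definition one_mpoly :: mpoly is 1 .
lift_definition plus_mpoly :: "mpoly \<Rightarrow> mpoly \<Rightarrow> mpoly" is "(+)" .
lift_definition minus_mpoly :: "mpoly \<Rightarrow> mpoly \<Rightarrow> mpoly" is "(-)" .
lift_definition uminus_mpoly :: "mpoly \<Rightarrow> mpoly" is uminus .
lift_definition times_mpoly :: "mpoly \<Rightarrow> mpoly \<Rightarrow> mpoly" is "(*)" .
instance by standard (transfer; simp add: algebra_simps)+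
end

lift_definition C :: "complex \<Rightarrow> mpoly" is pconst .
lift_definition V :: "var \<Rightarrow> mpoly" is pvar .
lift_definition ev :: "(complex \<Rightarrow> 'b::comm_ring_1) \<Rightarrow> (var \<Rightarrow> 'b) \<Rightarrow> mpoly \<Rightarrow> 'b" is ins .

lemma C_hom: "comm_ring_hom C"
  by unfold_locales (transfer; auto simp: pconst_def single_add mult_single)+

lemma ev_hom:
  assumes "comm_ring_hom \<iota>" shows "comm_ring_hom (ev \<iota> g)"
proof
  show "ev \<iota> g 0 = 0" by (simp add: ev.rep_eq zero_mpoly.rep_eq ins_0[OF assms])
  show "ev \<iota> g 1 = 1" by (simp add: ev.rep_eq one_mpoly.rep_eq ins_1[OF assms])
  show "ev \<iota> g (x + y) = ev \<iota> g x + ev \<iota> g y" for x y by (simp add: ev.rep_eq plus_mpoly.rep_eq ins_add[OF assms])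
  show "ev \<iota> g (x * y) = ev \<iota> g x * ev \<iota> g y" for x y by (simp add: ev.rep_eq times_mpoly.rep_eq ins_mult[OF assms])
qed

lemma ev_C [simp]: "comm_ring_hom \<iota> \<Longrightarrow> ev \<iota> g (C c) = \<iota> c"
  by (simp add: ev.rep_eq C.rep_eq ins_pconst)

lemma ev_V [simp]: "comm_ring_hom \<iota> \<Longrightarrow> ev \<iota> g (V v) = g v"
  by (simp add: ev.rep_eq V.rep_eq ins_pvar)

lemma mpoly_expand: "f = (\<Sum>m\<in>Poly_Mapping.keys (rep_mp f). C (Poly_Mapping.lookup (rep_mp f) m) * mon_val V m)"
proof -
  have "ev C V f = f"
  proof -
    have 1: "abs_mp (\<Sum>m\<in>S. h m) = (\<Sum>m\<in>S. abs_mp (h m))" for S and h :: "(var \<Rightarrow>\<^sub>0 nat) \<Rightarrow> cpoly"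
      by (induction S rule: infinite_finite_induct) (auto simp flip: plus_mpoly.abs_eq zero_mpoly_def)
    have 2: "abs_mp (\<Prod>v\<in>S. h v) = (\<Prod>v\<in>S. abs_mp (h v))" for S and h :: "var \<Rightarrow> cpoly"
      by (induction S rule: infinite_finite_induct) (auto simp flip: times_mpoly.abs_eq one_mpoly_def)
    have 3: "abs_mp (h ^ n) = abs_mp h ^ n" for h n
      by (induction n) (auto simp flip: times_mpoly.abs_eq one_mpoly_def)
    have 4: "mon_val V m = abs_mp (mon_val pvar m)" for m
      by (simp add: mon_val_def 2 3 V_def)
    have "ev C V f = abs_mp (ins pconst pvar (rep_mp f))"
      by (simp add: ev_def ins_def 1 4 C_def times_mpoly.abs_eq)
    thus ?thesis by (simp add: ins_pvar_id rep_mp_inverse)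
  qed
  thus ?thesis by (simp add: ev_def ins_def)
qed

text \<open>Replaces sums over monomials: closure properties and identities of ring homomorphisms
  are checked on constants and variables and then propagated through sums and products.\<close>

lemma mp_induct [case_names C V add mult]:
  assumes "\<And>c. P (C c)" "\<And>v. P (V v)" "\<And>f g. P f \<Longrightarrow> P g \<Longrightarrow> P (f + g)"
    "\<And>f g. P f \<Longrightarrow> P g \<Longrightarrow> P (f * g)"
  shows "P f"
proof -
  interpret C: comm_ring_hom C by (rule C_hom)
  have 0: "P 0" using assms(1)[of 0] by simp
  have 1: "P 1" using assms(1)[of 1] by simp
  have pw: "P (V v ^ n)" for v n by (induction n) (auto simp: 1 assms)
  have pr: "P (\<Prod>v\<in>S. h v)" if "\<And>v. P (h v)" for S and h :: "var \<Rightarrow> mpoly"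
    using that by (induction S rule: infinite_finite_induct) (auto simp: 1 assms)
  have sm: "P (\<Sum>v\<in>S. h v)" if "\<And>v. P (h v)" for S and h :: "(var \<Rightarrow>\<^sub>0 nat) \<Rightarrow> mpoly"
    using that by (induction S rule: infinite_finite_induct) (auto simp: 0 assms)
  show ?thesis
    by (subst mpoly_expand, unfold mon_val_def) (intro sm assms pr pw)
qed

lemma hom_unique:
  assumes "comm_ring_hom \<phi>" "comm_ring_hom \<psi>" "\<And>c. \<phi> (C c) = \<psi> (C c)" "\<And>v. \<phi> (V v) = \<psi> (V v)"
  shows "\<phi> f = \<psi> f"
proof -
  interpret a: comm_ring_hom \<phi> by fact
  interpret b: comm_ring_hom \<psi> by fact
  show ?thesis by (induction f rule: mp_induct) (auto simp: assms a.hom_add b.hom_add a.hom_mult b.hom_mult)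
qed

section \<open>Unique factorization\<close>

text \<open>The subring of polynomials in the variables \<open>A\<close>, given by generators and
  not through the monomials that occur, so that rule induction works on it. Restricting to finitely
  many variables opens integrality and unique factorization to induction on
  \<open>A\<close>.\<close>

inductive_set PV :: "var set \<Rightarrow> mpoly set" for A where
  PV_C: "C c \<in> PV A"
| PV_V: "v \<in> A \<Longrightarrow> V v \<in> PV A"
| PV_add: "f \<in> PV A \<Longrightarrow> g \<in> PV A \<Longrightarrow> f + g \<in> PV A"
| PV_mult: "f \<in> PV A \<Longrightarrow> g \<in> PV A \<Longrightarrow> f * g \<in> PV A"

lemma C_0 [simp]: "C 0 = 0" and C_1 [simp]: "C 1 = 1"
  and C_add: "C (a + b) = C a + C b" and C_mult: "C (a * b) = C a * C b"
  and C_uminus: "C (- a) = - C a"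
proof -
  interpret comm_ring_hom C by (rule C_hom)
  show "C 0 = 0" "C 1 = 1" "C (a + b) = C a + C b" "C (a * b) = C a * C b" "C (- a) = - C a"
    by (simp_all add: hom_add hom_mult hom_uminus)
qed

lemma PV_mono: "f \<in> PV A \<Longrightarrow> A \<subseteq> B \<Longrightarrow> f \<in> PV B"
  by (induction rule: PV.induct) (auto intro: PV.intros)

lemma PV_0 [simp]: "0 \<in> PV A" and PV_1 [simp]: "1 \<in> PV A"
  using PV_C[of 0] PV_C[of 1] by auto

lemma PV_uminus: "f \<in> PV A \<Longrightarrow> - f \<in> PV A"
  using PV_mult[OF PV_C[of "-1"], of f A] by (simp add: C_uminus)

lemma PV_diff: "f \<in> PV A \<Longrightarrow> g \<in> PV A \<Longrightarrow> f - g \<in> PV A"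
  using PV_add[OF _ PV_uminus[of g A], of f] by simp

lemma PV_power: "f \<in> PV A \<Longrightarrow> f ^ n \<in> PV A"
  by (induction n) (auto intro: PV_mult)

lemma PV_sum: "(\<And>i. i \<in> S \<Longrightarrow> f i \<in> PV A) \<Longrightarrow> sum f S \<in> PV A"
  by (induction S rule: infinite_finite_induct) (auto intro: PV_add)

lemma PV_finite: "\<exists>A. finite A \<and> f \<in> PV A"
proof (induction f rule: mp_induct)
  case (C c) show ?case by (rule exI[of _ "{}"]) (auto intro: PV_C)
next
  case (V v) show ?case by (rule exI[of _ "{v}"]) (auto intro: PV_V)
next
  case (add f g)
  then obtain A B where "finite A" "f \<in> PV A" "finite B" "g \<in> PV B" by blast
  thus ?case by (intro exI[of _ "A \<union> B"]) (auto intro!: PV_add intro: PV_mono)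
next
  case (mult f g)
  then obtain A B where "finite A" "f \<in> PV A" "finite B" "g \<in> PV B" by blast
  thus ?case by (intro exI[of _ "A \<union> B"]) (auto intro!: PV_mult intro: PV_mono)
qed

lemma PV_empty: "f \<in> PV {} \<Longrightarrow> \<exists>c. f = C c"
  by (induction rule: PV.induct) (auto simp flip: C_add C_mult)

section \<open>Polynomials viewed as univariate polynomials in one chosen variable\<close>

lemma id_hom: "comm_ring_hom (\<lambda>x. x)"
  by unfold_locales auto

lemma C_inj [simp]: "C a = C b \<longleftrightarrow> a = b"
  using ev_C[OF id_hom, of "\<lambda>_. 0" a] ev_C[OF id_hom, of "\<lambda>_. 0" b] by metis

lemma C_eq_0 [simp]: "C a = 0 \<longleftrightarrow> a = 0"
  using C_inj[of a 0] by (simp del: C_inj)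

lemma constP_hom: "comm_ring_hom (\<lambda>c. [:C c:])"
  by unfold_locales (auto simp: C_add C_mult)

text \<open>Singles out \<open>x\<close> as the polynomial variable and leaves the other variables
  in the coefficients. The coefficient type is still \<open>mpoly\<close>; that the coefficients are
  free of \<open>x\<close> is the content of \<open>UX_coeff\<close>.\<close>

definition UX :: "var \<Rightarrow> mpoly \<Rightarrow> mpoly poly" where
  "UX x = ev (\<lambda>c. [:C c:]) (\<lambda>w. if w = x then [:0, 1:] else [:V w:])"

lemma UX_hom: "comm_ring_hom (UX x)"
  unfolding UX_def by (rule ev_hom[OF constP_hom])

lemma UX_C [simp]: "UX x (C c) = [:C c:]" and UX_V: "UX x (V w) = (if w = x then [:0, 1:] else [:V w:])"
  by (simp_all add: UX_def constP_hom)

lemma UX_add: "UX x (f + g) = UX x f + UX x g" and UX_mult: "UX x (f * g) = UX x f * UX x g"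
  and UX_diff: "UX x (f - g) = UX x f - UX x g" and UX_power: "UX x (f ^ n) = UX x f ^ n"
  and UX_0 [simp]: "UX x 0 = 0" and UX_1 [simp]: "UX x 1 = 1"
proof -
  interpret comm_ring_hom "UX x" by (rule UX_hom)
  show "UX x (f + g) = UX x f + UX x g" "UX x (f * g) = UX x f * UX x g"
    "UX x (f - g) = UX x f - UX x g" "UX x (f ^ n) = UX x f ^ n" "UX x 0 = 0" "UX x 1 = 1"
    by (simp_all add: hom_add hom_mult hom_minus hom_power)
qed

lemma poly_UX: "poly (UX x f) (V x) = f"
  by (induction f rule: mp_induct) (auto simp: UX_V UX_add UX_mult)

lemma UX_eq_0 [simp]: "UX x f = 0 \<longleftrightarrow> f = 0"
  using poly_UX[of x f] by auto

lemma UX_free: "f \<in> PV A \<Longrightarrow> x \<notin> A \<Longrightarrow> UX x f = [:f:]"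
  by (induction rule: PV.induct) (auto simp: UX_V UX_add UX_mult)

lemma UX_coeff: "f \<in> PV (insert x A) \<Longrightarrow> coeff (UX x f) i \<in> PV A"
proof (induction arbitrary: i rule: PV.induct)
  case (PV_C c)
  thus ?case by (auto simp: coeff_pCons split: nat.splits intro: PV.intros)
next
  case (PV_V v)
  thus ?case by (auto simp: UX_V coeff_pCons split: nat.splits intro: PV.intros)
next
  case (PV_add f g)
  thus ?case by (auto simp: UX_add intro: PV.intros)
next
  case (PV_mult f g)
  thus ?case by (auto simp: UX_mult coeff_mult intro!: PV.intros PV_sum)
qed

text \<open>Induction on the variables: the coefficient of the product at the sum of the two degrees
  is the product of the leading coefficients, which live in one variable fewer. The argument avoids
  degree formulas for products, since these presuppose the integrality to be shown.\<close>

lemma mpoly_no_zero_divisors_aux: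
  assumes "finite A" "f \<in> PV A" "g \<in> PV A" "f * g = 0"
  shows "f = 0 \<or> g = 0"
  using assms
proof (induction A arbitrary: f g rule: finite_induct)
  case empty
  then obtain c d where "f = C c" "g = C d" using PV_empty by blast
  with empty show ?case by (auto simp flip: C_mult)
next
  case (insert x A)
  let ?f = "UX x f" and ?g = "UX x g"
  have "UX x (f * g) = 0" using insert by simp
  hence "coeff (?f * ?g) (degree ?f + degree ?g) = 0" by (simp add: UX_mult)
  hence "lead_coeff ?f * lead_coeff ?g = 0" by (simp add: coeff_mult_degree_sum)
  moreover have "lead_coeff ?f \<in> PV A" "lead_coeff ?g \<in> PV A" by (intro UX_coeff insert)+
  ultimately have "lead_coeff ?f = 0 \<or> lead_coeff ?g = 0" using insert.IH by blast
  thus ?case by (metis leading_coeff_0_iff UX_eq_0)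
qed

instance mpoly :: idom
proof
  fix f g :: mpoly assume "f \<noteq> 0" "g \<noteq> 0"
  moreover obtain A B where "finite A" "f \<in> PV A" "finite B" "g \<in> PV B" using PV_finite by metis
  hence "finite (A \<union> B)" "f \<in> PV (A \<union> B)" "g \<in> PV (A \<union> B)" by (auto intro: PV_mono)
  ultimately show "f * g \<noteq> 0" using mpoly_no_zero_divisors_aux by blast
qed

text \<open>The substitution of \<open>t x\<close> for \<open>x\<close> with a new variable
  \<open>t\<close>; the coefficient of \<open>t^i\<close> is the homogeneous component of degree
  \<open>i\<close>.\<close>

definition GR :: "mpoly \<Rightarrow> mpoly poly" where
  "GR = ev (\<lambda>c. [:C c:]) (\<lambda>w. [:0, V w:])"

lemma GR_hom: "comm_ring_hom GR"
  unfolding GR_def by (rule ev_hom[OF constP_hom])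

lemma GR_C [simp]: "GR (C c) = [:C c:]" and GR_V [simp]: "GR (V w) = [:0, V w:]"
  by (simp_all add: GR_def constP_hom)

lemma GR_add: "GR (f + g) = GR f + GR g" and GR_mult: "GR (f * g) = GR f * GR g"
  and GR_diff: "GR (f - g) = GR f - GR g" and GR_power: "GR (f ^ n) = GR f ^ n"
  and GR_0 [simp]: "GR 0 = 0" and GR_1 [simp]: "GR 1 = 1"
proof -
  interpret comm_ring_hom GR by (rule GR_hom)
  show "GR (f + g) = GR f + GR g" "GR (f * g) = GR f * GR g"
    "GR (f - g) = GR f - GR g" "GR (f ^ n) = GR f ^ n" "GR 0 = 0" "GR 1 = 1"
    by (simp_all add: hom_add hom_mult hom_minus hom_power)
qed

lemma poly_GR_1: "poly (GR f) 1 = f"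
  by (induction f rule: mp_induct) (auto simp: GR_add GR_mult)

lemma poly_GR_0: "\<exists>c. poly (GR f) 0 = C c"
proof (induction f rule: mp_induct)
  case (V v) show ?case by (rule exI[of _ 0]) simp
qed (auto simp: GR_add GR_mult simp flip: C_add C_mult)

lemma GR_eq_0 [simp]: "GR f = 0 \<longleftrightarrow> f = 0"
  using poly_GR_1[of f] by auto

definition tdeg :: "mpoly \<Rightarrow> nat" where "tdeg f = degree (GR f)"

lemma tdeg_mult: "f \<noteq> 0 \<Longrightarrow> g \<noteq> 0 \<Longrightarrow> tdeg (f * g) = tdeg f + tdeg g"
  by (simp add: tdeg_def GR_mult degree_mult_eq)

lemma tdeg_C [simp]: "tdeg (C c) = 0"
  by (simp add: tdeg_def)

lemma tdeg_1 [simp]: "tdeg 1 = 0"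
  by (simp add: tdeg_def)

text \<open>At \<open>t = 1\<close> the polynomial \<open>GR f\<close> gives back \<open>f\<close>,
  at \<open>t = 0\<close> it gives a constant; in degree 0 the two values agree.\<close>

lemma tdeg_0_const: "tdeg f = 0 \<Longrightarrow> \<exists>c. f = C c"
proof -
  assume "tdeg f = 0"
  then obtain c where c: "GR f = [:c:]" unfolding tdeg_def by (metis degree_eq_zeroE)
  with poly_GR_1[of f] poly_GR_0[of f] show ?thesis by auto
qed

lemma unit_iff: "f dvd 1 \<longleftrightarrow> f \<noteq> 0 \<and> tdeg f = 0" for f :: mpoly
proof
  assume "f dvd 1"
  then obtain g where g: "1 = f * g" by (auto elim: dvdE)
  hence "f \<noteq> 0" "g \<noteq> 0" by auto
  hence "tdeg f + tdeg g = 0" using tdeg_mult[of f g] g by simp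
  thus "f \<noteq> 0 \<and> tdeg f = 0" using \<open>f \<noteq> 0\<close> by simp
next
  assume "f \<noteq> 0 \<and> tdeg f = 0"
  then obtain c where c: "f = C c" "c \<noteq> 0" using tdeg_0_const by force
  hence "f * C (1 / c) = 1" by (simp flip: C_mult)
  thus "f dvd 1" by (metis dvd_triv_left)
qed

lemma irreducible_factor:
  assumes "f \<noteq> 0" "\<not> f dvd 1"
  shows "\<exists>p :: mpoly. irreducible p \<and> p dvd f"
  using assms
proof (induction "tdeg f" arbitrary: f rule: less_induct)
  case less
  show ?case
  proof (cases "irreducible f")
    case False
    then obtain a b where ab: "f = a * b" "\<not> a dvd 1" "\<not> b dvd 1"
      using less.prems by (auto simp: irreducible_def)
    hence nz: "a \<noteq> 0" "b \<noteq> 0" using less.prems by auto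
    hence "tdeg b > 0" using ab unit_iff by auto
    hence "tdeg a < tdeg f" using ab nz by (simp add: tdeg_mult)
    with less.hyps[of a] ab nz show ?thesis by (metis dvd_mult2)
  qed auto
qed

lemma PV_factor_step:
  assumes "f \<in> PV (insert x A')" "f * g \<in> PV A" "x \<notin> A" "f * g \<noteq> 0"
  shows "f \<in> PV A'"
proof -
  have "UX x f * UX x g = [:f * g:]" using UX_free[OF assms(2,3)] by (simp add: UX_mult)
  hence "degree (UX x f) + degree (UX x g) = 0"
    using assms(4) by (metis degree_mult_eq degree_pCons_0 UX_eq_0 mult_eq_0_iff)
  hence "degree (UX x f) = 0" by simp
  then obtain c where c: "UX x f = [:c:]" by (metis degree_eq_zeroE)
  have "f = c" using poly_UX[of x f] c by simp
  moreover have "coeff (UX x f) 0 \<in> PV A'" by (rule UX_coeff) fact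
  ultimately show ?thesis using c by simp
qed

lemma PV_factor:
  assumes "f * g \<in> PV A" "f * g \<noteq> 0"
  shows "f \<in> PV A"
proof -
  have "f \<in> PV (A \<union> B) \<Longrightarrow> f \<in> PV A" if "finite B" for B
    using that
  proof (induction B rule: finite_induct)
    case (insert x B)
    show ?case
    proof (cases "x \<in> A")
      case False
      with insert PV_factor_step[of f x "A \<union> B" g A] assms show ?thesis by auto
    qed (use insert in \<open>auto simp: insert_absorb\<close>)
  qed auto
  moreover obtain B where "finite B" "f \<in> PV B" using PV_finite by blast
  ultimately show ?thesis by (metis PV_mono Un_upper2)
qed

lemma PV_factor2: "f * g \<in> PV A \<Longrightarrow> f * g \<noteq> 0 \<Longrightarrow> g \<in> PV A"
  using PV_factor[of g f A] by (simp add: mult.commute)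

text \<open>Primality tested only against polynomials in the variables \<open>A\<close>. This
  relative form is what can be carried through an induction that adds one variable at a
  time.\<close>

definition relprime :: "var set \<Rightarrow> mpoly \<Rightarrow> bool" where
  "relprime A p \<longleftrightarrow> (\<forall>f\<in>PV A. \<forall>g\<in>PV A. p dvd f * g \<longrightarrow> p dvd f \<or> p dvd g)"

section \<open>Gauss's lemma and pseudo-division\<close>

lemma UX_const_dvd:
  assumes "p \<in> PV A" "x \<notin> A"
  shows "p dvd f \<longleftrightarrow> (\<forall>i. p dvd coeff (UX x f) i)"
proof
  assume "p dvd f"
  then obtain h where "f = p * h" ..
  hence "UX x f = [:p:] * UX x h" using UX_free[OF assms] by (simp add: UX_mult)
  thus "\<forall>i. p dvd coeff (UX x f) i" by simp
next
  assume "\<forall>i. p dvd coeff (UX x f) i"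
  hence "[:p:] dvd UX x f" by (simp add: const_poly_dvd_iff)
  then obtain h where "UX x f = [:p:] * h" ..
  hence "f = p * poly h (V x)" using poly_UX[of x f] by simp
  thus "p dvd f" by simp
qed

text \<open>Gauss's lemma: take the first coefficients of \<open>f\<close> and \<open>g\<close> that
  \<open>p\<close> does not divide; in the coefficient of the product at the sum of their indices,
  every other term is divisible by \<open>p\<close>.\<close>

lemma relprime_insert:
  assumes p: "p \<in> PV A" "x \<notin> A" "relprime A p"
  shows "relprime (insert x A) p"
  unfolding relprime_def
proof (intro ballI impI, rule ccontr)
  fix f g assume fg: "f \<in> PV (insert x A)" "g \<in> PV (insert x A)" "p dvd f * g"
    and neg: "\<not> (p dvd f \<or> p dvd g)"
  let ?a = "coeff (UX x f)" and ?b = "coeff (UX x g)"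
  define i where "i = (LEAST i. \<not> p dvd ?a i)"
  define j where "j = (LEAST j. \<not> p dvd ?b j)"
  have "\<exists>i. \<not> p dvd ?a i" "\<exists>i. \<not> p dvd ?b i" using neg UX_const_dvd[OF p(1,2)] by blast+
  hence ij: "\<not> p dvd ?a i" "\<not> p dvd ?b j" unfolding i_def j_def by (metis LeastI_ex)+
  have lt: "p dvd ?a k" if "k < i" for k using not_less_Least[of k "\<lambda>i. \<not> p dvd ?a i"] that by (simp add: i_def)
  have lt': "p dvd ?b k" if "k < j" for k using not_less_Least[of k "\<lambda>i. \<not> p dvd ?b i"] that by (simp add: j_def)
  have "p dvd coeff (UX x (f * g)) (i + j)" using fg(3) UX_const_dvd[OF p(1,2)] by blast
  also have "coeff (UX x (f * g)) (i + j) = (\<Sum>k\<le>i+j. ?a k * ?b (i + j - k))"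
    by (simp add: UX_mult coeff_mult)
  also have "\<dots> = ?a i * ?b j + (\<Sum>k\<in>{..i+j}-{i}. ?a k * ?b (i + j - k))"
    by (subst sum.remove[of _ i]) auto
  finally have "p dvd ?a i * ?b j + (\<Sum>k\<in>{..i+j}-{i}. ?a k * ?b (i + j - k))" .
  moreover have "p dvd (\<Sum>k\<in>{..i+j}-{i}. ?a k * ?b (i + j - k))"
  proof (rule dvd_sum)
    fix k assume k: "k \<in> {..i+j}-{i}"
    show "p dvd ?a k * ?b (i + j - k)"
    proof (cases "k < i")
      case False
      hence "i + j - k < j" using k by auto
      thus ?thesis using lt' by simp
    qed (simp add: lt)
  qed
  ultimately have "p dvd ?a i * ?b j" by (simp add: dvd_add_left_iff)
  with ij p(3) UX_coeff[OF fg(1)] UX_coeff[OF fg(2)] show False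
    unfolding relprime_def by blast
qed

text \<open>The coefficients do not form a field, so division with remainder in \<open>x\<close>
  works only after multiplying by a power of the leading coefficient of the divisor.\<close>

lemma pseudo_division:
  assumes "r \<in> PV (insert x A)" "r \<noteq> 0" "f \<in> PV (insert x A)"
  shows "\<exists>k. \<exists>s\<in>PV (insert x A). \<exists>t\<in>PV (insert x A). lead_coeff (UX x r) ^ k * f = r * s + t \<and>
      (t = 0 \<or> degree (UX x t) < degree (UX x r))"
  using assms(3)
proof (induction "degree (UX x f)" arbitrary: f rule: less_induct)
  case less
  let ?A = "PV (insert x A)"
  let ?c = "lead_coeff (UX x r)" and ?d = "lead_coeff (UX x f)"
  let ?n = "degree (UX x f)" and ?m = "degree (UX x r)"
  have cP: "?c \<in> ?A" "?d \<in> ?A"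
    using UX_coeff[OF assms(1)] UX_coeff[OF less.prems] by (meson PV_mono subset_insertI)+
  have Vx: "V x \<in> ?A" by (auto intro: PV.intros)
  show ?case
  proof (cases "?n < ?m")
    case True
    thus ?thesis using less.prems by (intro exI[of _ 0] bexI[of _ 0] bexI[of _ f]) auto
  next
    case False
    define f' where "f' = ?c * f - ?d * V x ^ (?n - ?m) * r"
    have f'P: "f' \<in> ?A" unfolding f'_def
      by (intro PV_diff PV_mult PV_power cP Vx assms less.prems)
    have cd: "UX x ?c = [:?c:]" "UX x ?d = [:?d:]" if "x \<notin> A"
      using UX_free[OF UX_coeff[OF assms(1)]] UX_free[OF UX_coeff[OF less.prems]] that by auto
    \<comment> \<open>Using \<open>A - {x}\<close> covers the case that \<open>x\<close> already
      belongs to \<open>A\<close>.\<close>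
    have cd: "UX x ?c = [:?c:]" "UX x ?d = [:?d:]"
      using UX_free[of _ "A - {x}" x] UX_coeff[of r x "A - {x}"] UX_coeff[of f x "A - {x}"] assms(1) less.prems
      by auto
    have Uf': "UX x f' = Polynomial.smult ?c (UX x f) - Polynomial.smult ?d (monom 1 (?n - ?m) * UX x r)"
      by (simp add: f'_def UX_diff UX_mult UX_power UX_V cd monom_altdef flip: mult_smult_left)
    have dle: "degree (UX x f') \<le> ?n"
      unfolding Uf' by (intro degree_diff_le order_trans[OF degree_smult_le] order_trans[OF degree_mult_le])
        (use False in \<open>auto intro: order_trans[OF add_right_mono[OF degree_monom_le]]\<close>)
    have "coeff (monom 1 (?n - ?m) * UX x r) ?n = ?c"
      using False by (simp add: coeff_monom_mult)
    hence c0: "coeff (UX x f') ?n = 0"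
      unfolding Uf' coeff_diff coeff_smult by (simp add: mult.commute)
    have "f' = 0 \<or> degree (UX x f') < ?n"
      using dle c0 by (metis le_neq_implies_less leading_coeff_0_iff UX_eq_0)
    thus ?thesis
    proof
      assume "f' = 0"
      hence "?c ^ 1 * f = r * (?d * V x ^ (?n - ?m)) + 0" by (simp add: f'_def mult_ac)
      moreover have "?d * V x ^ (?n - ?m) \<in> ?A" by (intro PV_mult PV_power cP Vx)
      ultimately show ?thesis by (metis PV_0)
    next
      assume "degree (UX x f') < ?n"
      then obtain k s t where *: "s \<in> ?A" "t \<in> ?A" "?c ^ k * f' = r * s + t"
         "t = 0 \<or> degree (UX x t) < ?m"
        using less.hyps[of f'] f'P by blast
      have "?c ^ Suc k * f = ?c ^ k * f' + ?c ^ k * (?d * V x ^ (?n - ?m) * r)"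
        by (simp add: f'_def algebra_simps)
      also have "\<dots> = r * (s + ?c ^ k * (?d * V x ^ (?n - ?m))) + t"
        unfolding *(3) by (simp add: algebra_simps)
      finally have "?c ^ Suc k * f = r * (s + ?c ^ k * (?d * V x ^ (?n - ?m))) + t" .
      moreover have "s + ?c ^ k * (?d * V x ^ (?n - ?m)) \<in> ?A"
        by (intro PV_add PV_mult PV_power cP Vx *)
      ultimately show ?thesis using * by blast
    qed
  qed
qed

text \<open>Each prime factor of \<open>c\<close> divides \<open>p * s\<close>. It cannot divide the
  irreducible \<open>p\<close>, for \<open>p\<close> would then be a constant multiple of it and lie
  in \<open>PV A\<close>; hence it divides \<open>s\<close> and can be cancelled.\<close>

lemma cancel_const:
  assumes rp: "\<forall>\<pi>\<in>PV A. irreducible \<pi> \<longrightarrow> relprime B \<pi>" and "A \<subseteq> B"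
    and p: "irreducible p" "p \<in> PV B" "p \<notin> PV A"
    and c: "c \<in> PV A" "c \<noteq> 0" and eq: "c * g = p * s" and gs: "g \<in> PV B" "s \<in> PV B"
  shows "p dvd g"
  using c eq gs
proof (induction "tdeg c" arbitrary: c s rule: less_induct)
  case less
  show ?case
  proof (cases "c dvd 1")
    case True
    then obtain d where d: "1 = c * d" ..
    have "g = (c * g) * d" using d by (metis mult.commute mult.left_commute mult_1_left)
    thus ?thesis using less.prems by simp
  next
    case False
    then obtain \<pi> c' where pi: "irreducible \<pi>" "c = \<pi> * c'" using irreducible_factor less.prems by (metis dvdE)
    have P: "\<pi> \<in> PV A" "c' \<in> PV A" using PV_factor PV_factor2 less.prems pi by metis+
    have nz: "\<pi> \<noteq> 0" "c' \<noteq> 0" using less.prems pi by auto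
    have "\<pi> dvd p * s" using less.prems pi by (metis dvd_triv_left mult.assoc)
    hence "\<pi> dvd p \<or> \<pi> dvd s" using rp[rule_format, OF P(1) pi(1)] p less.prems unfolding relprime_def by blast
    moreover have "\<not> \<pi> dvd p"
    proof
      assume "\<pi> dvd p"
      then obtain e where e: "p = \<pi> * e" ..
      hence "e dvd 1" using p(1) pi(1) by (auto simp: irreducible_def)
      then obtain k where "e = C k" using unit_iff tdeg_0_const by blast
      hence "p \<in> PV A" using e P by (auto intro: PV.intros)
      thus False using p by blast
    qed
    ultimately obtain s' where s': "s = \<pi> * s'" by (auto elim: dvdE)
    have eq': "c' * g = p * s'" using less.prems(3) s' pi nz by (simp add: mult.left_commute mult.assoc)
    have "s' \<in> PV B"
    proof (cases "s = 0")
      case True thus ?thesis using s' nz by simp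
    next
      case False thus ?thesis using s' less.prems PV_factor2 by metis
    qed
    moreover have "tdeg \<pi> > 0" using pi unit_iff nz by (auto simp: irreducible_def)
    hence "tdeg c' < tdeg c" using pi nz by (simp add: tdeg_mult)
    ultimately show ?thesis using less.hyps[of c' s'] P nz eq' less.prems by blast
  qed
qed

text \<open>Each prime factor of \<open>c\<close> divides \<open>r\<close> or \<open>s\<close> and
  is taken out of the one that it divides; what remains of \<open>r\<close> and \<open>s\<close> is
  a factorization of \<open>p\<close> itself.\<close>

lemma split_const:
  assumes rp: "\<forall>\<pi>\<in>PV A. irreducible \<pi> \<longrightarrow> relprime B \<pi>" and "A \<subseteq> B"
    and c: "c \<in> PV A" "c \<noteq> 0" and eq: "c * p = r * s" and rs: "r \<in> PV B" "s \<in> PV B" "p \<noteq> 0"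
  shows "\<exists>c1\<in>PV A. \<exists>c2 r1 s1. p = r1 * s1 \<and> r = c1 * r1 \<and> s = c2 * s1"
  using c eq rs
proof (induction "tdeg c" arbitrary: c r s rule: less_induct)
  case less
  show ?case
  proof (cases "c dvd 1")
    case True
    then obtain d where d: "1 = c * d" ..
    have "p = (c * p) * d" "r = c * (r * d)" using d by (metis mult.commute mult.left_commute mult_1_left)+
    hence "p = (r * d) * s" "r = c * (r * d)" "s = 1 * s" using less.prems by (simp_all add: mult_ac)
    thus ?thesis using less.prems by blast
  next
    case False
    then obtain \<pi> c' where pi: "irreducible \<pi>" "c = \<pi> * c'" using irreducible_factor less.prems by (metis dvdE)
    have P: "\<pi> \<in> PV A" "c' \<in> PV A" using PV_factor PV_factor2 less.prems pi by metis+
    have nz: "\<pi> \<noteq> 0" "c' \<noteq> 0" using less.prems pi by auto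
    have rsnz: "r \<noteq> 0" "s \<noteq> 0" using less.prems by auto
    have "tdeg \<pi> > 0" using pi unit_iff nz by (auto simp: irreducible_def)
    hence lt: "tdeg c' < tdeg c" using pi nz by (simp add: tdeg_mult)
    have "\<pi> dvd r * s" using less.prems pi by (metis dvd_triv_left mult.assoc)
    hence "\<pi> dvd r \<or> \<pi> dvd s" using rp[rule_format, OF P(1) pi(1)] less.prems unfolding relprime_def by blast
    thus ?thesis
    proof
      assume "\<pi> dvd r"
      then obtain r' where r': "r = \<pi> * r'" ..
      have "c' * p = r' * s" using less.prems(3) r' pi nz by (simp add: mult.left_commute mult.assoc)
      moreover have "r' \<in> PV B" using r' less.prems PV_factor2 rsnz by metis
      ultimately obtain c1 c2 r1 s1 where "c1 \<in> PV A" "p = r1 * s1" "r' = c1 * r1" "s = c2 * s1"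
        using less.hyps[OF lt P(2) nz(2)] less.prems by metis
      thus ?thesis using r' P by (intro bexI[of _ "\<pi> * c1"] exI[of _ c2] exI[of _ r1] exI[of _ s1])
         (auto intro: PV.intros simp: mult_ac)
    next
      assume "\<pi> dvd s"
      then obtain s' where s': "s = \<pi> * s'" ..
      have "c' * p = r * s'" using less.prems(3) s' pi nz by (simp add: mult.left_commute mult.assoc)
      moreover have "s' \<in> PV B" using s' less.prems PV_factor2 rsnz by metis
      ultimately obtain c1 c2 r1 s1 where "c1 \<in> PV A" "p = r1 * s1" "r = c1 * r1" "s' = c2 * s1"
        using less.hyps[OF lt P(2) nz(2)] less.prems by metis
      thus ?thesis using s' P by (intro bexI[of _ "c1"] exI[of _ "\<pi> * c2"] exI[of _ r1] exI[of _ s1])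
         (auto intro: PV.intros simp: mult_ac)
    qed
  qed
qed

text \<open>Induction on the variables. The step is a Bezout argument over the fractions of the
  smaller ring, with denominators cleared by powers of a leading coefficient.\<close>

lemma irreducible_relprime:
  assumes "finite A" "irreducible p" "p \<in> PV A"
  shows "relprime A p"
  using assms
proof (induction A arbitrary: p rule: finite_induct)
  case empty
  then obtain c where "p = C c" using PV_empty by blast
  hence "p = 0 \<or> p dvd 1" using unit_iff by auto
  thus ?case using empty by (auto simp: irreducible_def)
next
  case (insert x A)
  let ?B = "insert x A"
  have rp: "\<forall>\<pi>\<in>PV A. irreducible \<pi> \<longrightarrow> relprime ?B \<pi>"
    using relprime_insert insert by blast
  show ?case
  proof (cases "p \<in> PV A")
    case True
    thus ?thesis using rp insert by blast
  next
    case pA: False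
    show ?thesis unfolding relprime_def
    proof (intro ballI impI, rule ccontr)
      fix f g assume fg: "f \<in> PV ?B" "g \<in> PV ?B" "p dvd f * g" and neg: "\<not> (p dvd f \<or> p dvd g)"
      \<comment> \<open>The nonzero members of the ideal generated by \<open>p\<close> and
        \<open>f\<close>. One of least degree in \<open>x\<close> divides \<open>p\<close> and
        \<open>f\<close> up to powers of its leading coefficient, since a nonzero pseudo-remainder
        would be a member of smaller degree.\<close>
      define I where "I = (\<lambda>r. r \<in> PV ?B \<and> r \<noteq> 0 \<and> (\<exists>\<alpha>\<in>PV ?B. \<exists>\<beta>\<in>PV ?B. r = \<alpha> * p + \<beta> * f))"
      have "p \<noteq> 0" using insert.prems by (auto simp: irreducible_def)
      have "I p" unfolding I_def using insert.prems \<open>p \<noteq> 0\<close>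
        by (intro conjI bexI[of _ 1 "PV ?B"] bexI[of _ 0 "PV ?B"]) auto
      then obtain r where r: "I r" and rmin: "\<And>t. I t \<Longrightarrow> degree (UX x r) \<le> degree (UX x t)"
        using ex_has_least_nat[of I p "\<lambda>t. degree (UX x t)"] by blast
      obtain \<alpha> \<beta> where ab: "\<alpha> \<in> PV ?B" "\<beta> \<in> PV ?B" "r = \<alpha> * p + \<beta> * f" and r0: "r \<noteq> 0" "r \<in> PV ?B"
        using r unfolding I_def by blast
      define c where "c = lead_coeff (UX x r)"
      have cA: "c \<in> PV A" unfolding c_def by (rule UX_coeff) fact
      have c0: "c \<noteq> 0" unfolding c_def using r0 by simp
      have ckA: "c ^ k \<in> PV A" "c ^ k \<in> PV ?B" "c ^ k \<noteq> 0" for k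
        using cA c0 PV_power PV_mono[of "c ^ k" A ?B] by auto
      have div: "\<exists>k. \<exists>s\<in>PV ?B. c ^ k * h = r * s" if h: "h \<in> PV ?B" "h = \<gamma> * p + \<delta> * f" "\<gamma> \<in> PV ?B" "\<delta> \<in> PV ?B" for h \<gamma> \<delta>
      proof -
        obtain k s t where *: "s \<in> PV ?B" "t \<in> PV ?B" "c ^ k * h = r * s + t" 
          "t = 0 \<or> degree (UX x t) < degree (UX x r)"
          using pseudo_division[OF r0(2,1) h(1)] unfolding c_def by blast
        have "t = c ^ k * h - r * s" using * by simp
        also have "\<dots> = (c ^ k * \<gamma> - \<alpha> * s) * p + (c ^ k * \<delta> - \<beta> * s) * f"
          unfolding h(2) ab(3) by (simp add: algebra_simps)
        finally have "t = (c ^ k * \<gamma> - \<alpha> * s) * p + (c ^ k * \<delta> - \<beta> * s) * f" .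
        moreover have "c ^ k * \<gamma> - \<alpha> * s \<in> PV ?B" "c ^ k * \<delta> - \<beta> * s \<in> PV ?B"
          by (intro PV_diff PV_mult ckA h ab *)+
        ultimately have "t \<noteq> 0 \<Longrightarrow> I t" unfolding I_def using *(2) by blast
        hence "t = 0" using rmin[of t] * by fastforce
        thus ?thesis using * by auto
      qed
      obtain k s where ks: "s \<in> PV ?B" "c ^ k * p = r * s" using div[of p 1 0] insert.prems by auto
      obtain k' s' where ks': "s' \<in> PV ?B" "c ^ k' * f = r * s'" using div[of f 0 1] fg by auto
      obtain h where h: "f * g = p * h" using fg by (auto elim: dvdE)
      have hB: "h \<in> PV ?B"
      proof (cases "f * g = 0")
        case True thus ?thesis using h \<open>p \<noteq> 0\<close> by auto
      next
        case False
        moreover have "p * h \<in> PV ?B" using PV_mult[OF fg(1,2)] h by simp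
        ultimately show ?thesis using PV_factor2[of p h ?B] h by simp
      qed
      note cancel = cancel_const[OF rp subset_insertI insert.prems pA]
      \<comment> \<open>If \<open>r\<close> is free of \<open>x\<close>, the Bezout relation
        multiplied by \<open>g\<close> makes \<open>r * g\<close> a multiple of \<open>p\<close>,
        hence also \<open>g\<close>. Otherwise \<open>r\<close> contains a nonconstant factor of
        \<open>p\<close>, thus \<open>p\<close> itself up to a unit, and \<open>p\<close> divides
        \<open>f\<close>.\<close>
      show False
      proof (cases "r \<in> PV A")
        case True
        have "r * g = p * (\<alpha> * g + \<beta> * h)" 
          unfolding ab(3) using h by (simp add: algebra_simps)
        hence "p dvd g" by (rule cancel[OF True r0(1)]) (auto intro: PV_add PV_mult ab fg hB)
        thus False using neg by blast
      next
        case rA: False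
        obtain c1 c2 r1 s1 where *: "c1 \<in> PV A" "p = r1 * s1" "r = c1 * r1" "s = c2 * s1"
          using split_const[OF rp subset_insertI ckA(1,3) ks(2) r0(2) ks(1) \<open>p \<noteq> 0\<close>] by blast
        have "\<not> r1 dvd 1"
        proof
          assume "r1 dvd 1"
          then obtain e where "r1 = C e" using unit_iff tdeg_0_const by blast
          hence "r \<in> PV A" using * by (auto intro: PV.intros)
          thus False using rA by blast
        qed
        hence "s1 dvd 1" using insert.prems(1) * by (auto simp: irreducible_def)
        then obtain e where e: "1 = s1 * e" ..
        have "r1 = p * e" using * e by (metis mult.assoc mult.right_neutral)
        hence "c ^ k' * f = (c1 * (p * e)) * s'" using ks'(2) *(3) by simp
        hence "c ^ k' * f = p * (e * c1 * s')" by (simp only: mult_ac)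
        moreover have "e \<in> PV ?B" using PV_factor2[of s1 e ?B] e[symmetric] by auto
        hence "e * c1 * s' \<in> PV ?B" using *(1) ks'(1) by (meson PV_mono PV_mult subset_insertI)
        ultimately have "p dvd f" using cancel[OF ckA(1,3)] fg by blast
        thus False using neg by blast
      qed
    qed
  qed
qed

theorem irreducible_prime_elem:
  assumes "irreducible (p :: mpoly)"
  shows "prime_elem p"
  unfolding prime_elem_def
proof (intro conjI allI impI)
  show "p \<noteq> 0" "\<not> p dvd 1" using assms by (auto simp: irreducible_def)
  fix f g assume d: "p dvd f * g"
  obtain A B D where "finite A" "p \<in> PV A" "finite B" "f \<in> PV B" "finite D" "g \<in> PV D"
    using PV_finite by metis
  hence *: "finite (A \<union> B \<union> D)" "p \<in> PV (A \<union> B \<union> D)" "f \<in> PV (A \<union> B \<union> D)" "g \<in> PV (A \<union> B \<union> D)"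
    by (auto intro: PV_mono)
  show "p dvd f \<or> p dvd g"
    using irreducible_relprime[OF *(1) assms *(2)] * d unfolding relprime_def by blast
qed

lemma prime_factor_exists:
  assumes "f \<noteq> 0" "\<not> f dvd 1"
  obtains p :: mpoly where "prime_elem p" "p dvd f"
  using irreducible_factor[OF assms] irreducible_prime_elem by blast

section \<open>Valuations and homogeneous fractions\<close>

locale valuation =
  fixes v :: "'a::field \<Rightarrow> int"
  assumes v_mult: "x \<noteq> 0 \<Longrightarrow> y \<noteq> 0 \<Longrightarrow> v (x * y) = v x + v y"
    and v_add: "x \<noteq> 0 \<Longrightarrow> y \<noteq> 0 \<Longrightarrow> x + y \<noteq> 0 \<Longrightarrow> min (v x) (v y) \<le> v (x + y)"
begin

lemma v_1 [simp]: "v 1 = 0" using v_mult[of 1 1] by simp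

lemma v_inverse: "x \<noteq> 0 \<Longrightarrow> v (inverse x) = - v x"
  using v_mult[of x "inverse x"] by simp

lemma v_divide: "x \<noteq> 0 \<Longrightarrow> y \<noteq> 0 \<Longrightarrow> v (x / y) = v x - v y"
  by (simp add: divide_inverse v_mult v_inverse)

lemma v_uminus: "v (- x) = v x"
proof -
  have "v (-1) + v (-1) = 0" using v_mult[of "-1" "-1"] by simp
  hence "v (-1) = 0" by simp
  thus ?thesis using v_mult[of "-1" x] by (cases "x = 0") auto
qed

lemma v_power: "x \<noteq> 0 \<Longrightarrow> v (x ^ n) = int n * v x"
  by (induction n) (auto simp: v_mult algebra_simps)

lemma v_prod: "(\<And>i. i \<in> S \<Longrightarrow> f i \<noteq> 0) \<Longrightarrow> v (prod f S) = (\<Sum>i\<in>S. v (f i))"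
  by (induction S rule: infinite_finite_induct) (auto simp: v_mult)

text \<open>The value \<open>v 0\<close> is an unspecified integer; \<open>vge\<close> treats it as
  infinite, which keeps the closure rules free of case distinctions.\<close>

definition vge :: "int \<Rightarrow> 'a \<Rightarrow> bool" where "vge n x \<longleftrightarrow> x = 0 \<or> n \<le> v x"

lemma vge_0 [simp]: "vge n 0" by (simp add: vge_def)

lemma vge_add: "vge n x \<Longrightarrow> vge n y \<Longrightarrow> vge n (x + y)"
  using v_add[of x y] by (cases "x = 0"; cases "y = 0"; cases "x + y = 0") (auto simp: vge_def)

lemma vge_uminus: "vge n (- x) = vge n x"
  by (auto simp: vge_def v_uminus)

lemma vge_diff: "vge n x \<Longrightarrow> vge n y \<Longrightarrow> vge n (x - y)"
  using vge_add[of n x "- y"] by (simp add: vge_uminus)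

lemma vge_mult: "vge m x \<Longrightarrow> vge n y \<Longrightarrow> vge (m + n) (x * y)"
  by (cases "x = 0"; cases "y = 0") (auto simp: vge_def v_mult)

lemma vge_mult0: "vge 0 x \<Longrightarrow> vge 0 y \<Longrightarrow> vge 0 (x * y)"
  using vge_mult[of 0 x 0 y] by simp

lemma vge_sum: "(\<And>i. i \<in> S \<Longrightarrow> vge n (f i)) \<Longrightarrow> vge n (sum f S)"
  by (induction S rule: infinite_finite_induct) (auto intro: vge_add)

lemma vge_prod: "(\<And>i. i \<in> S \<Longrightarrow> vge 0 (f i)) \<Longrightarrow> vge 0 (prod f S)"
  by (induction S rule: infinite_finite_induct) (auto intro: vge_mult0 simp: vge_def[of 0 1])

text \<open>Units of the valuation ring are recognised modulo its maximal ideal; this allows a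
  determinant to be replaced by a simpler congruent one.\<close>

lemma unit_cong:
  assumes "x \<noteq> 0" "v x = 0" "vge 1 (y - x)"
  shows "y \<noteq> 0 \<and> v y = 0"
proof -
  have y0: "y \<noteq> 0" using assms by (auto simp: vge_def v_uminus)
  have "vge 0 (x + (y - x))" by (rule vge_add) (use assms in \<open>auto simp: vge_def\<close>)
  hence "v y \<ge> 0" using y0 by (auto simp: vge_def)
  moreover have "v y \<le> 0"
  proof (rule ccontr)
    assume "\<not> v y \<le> 0"
    hence "vge 1 (y - (y - x))" by (intro vge_diff assms) (auto simp: vge_def)
    thus False using assms by (auto simp: vge_def)
  qed
  ultimately show ?thesis using y0 by simp
qed

lemma vge_1_prod_diff:
  assumes "finite S" "\<And>i. i \<in> S \<Longrightarrow> vge 0 (f i)" "\<And>i. i \<in> S \<Longrightarrow> vge 0 (g i)"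
    "\<And>i. i \<in> S \<Longrightarrow> vge 1 (f i - g i)"
  shows "vge 1 (prod f S - prod g S)"
  using assms
proof (induction S rule: finite_induct)
  case (insert x S)
  have "prod f (insert x S) - prod g (insert x S) = f x * (prod f S - prod g S) + (f x - g x) * prod g S"
    using insert by (simp add: algebra_simps)
  moreover have "vge 1 (f x * (prod f S - prod g S))" "vge 1 ((f x - g x) * prod g S)"
    using vge_mult[of 0 "f x" 1] vge_mult[of 1 "f x - g x" 0] insert vge_prod[of S g] by auto
  ultimately show ?case by (auto intro: vge_add)
qed auto

end

section \<open>The fraction field and its valuations at prime polynomials\<close>

abbreviation F :: "mpoly \<Rightarrow> mpoly fract" where "F \<equiv> to_fract"

lemma F_hom: "comm_ring_hom F"
  by unfold_locales auto

lemma fract_cases: obtains a b where "x = F a / F b" "b \<noteq> 0"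
  by (cases x) (auto simp: to_fract_def)

lemma F_prod: "F (prod f S) = (\<Prod>i\<in>S. F (f i))"
proof -
  interpret comm_ring_hom F by (rule F_hom)
  show ?thesis by (rule hom_prod)
qed

lemma F_power: "F (f ^ n) = F f ^ n"
  by (induction n) auto

definition ordp :: "mpoly \<Rightarrow> mpoly \<Rightarrow> nat" where
  "ordp p f = (GREATEST k. p ^ k dvd f)"

lemma ordp_eqI:
  assumes "prime_elem p" "\<not> p dvd f"
  shows "ordp p (p ^ k * f) = k"
  unfolding ordp_def
proof (rule Greatest_equality)
  fix m assume "p ^ m dvd p ^ k * f"
  show "m \<le> k"
  proof (rule ccontr)
    assume "\<not> m \<le> k"
    hence "p ^ Suc k dvd p ^ m" by (intro le_imp_power_dvd) auto
    hence "p ^ k * p dvd p ^ k * f" using \<open>p ^ m dvd _\<close> by (metis dvd_trans power_Suc2)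
    thus False using assms by auto
  qed
qed auto

lemma prime_tdeg: "prime_elem p \<Longrightarrow> tdeg p > 0"
  using unit_iff[of p] by (auto simp: prime_elem_def)

lemma ordp_decomp:
  assumes "prime_elem p" "f \<noteq> 0"
  obtains g where "f = p ^ ordp p f * g" "\<not> p dvd g"
proof -
  have "\<exists>k g. f = p ^ k * g \<and> \<not> p dvd g" using assms(2)
  proof (induction "tdeg f" arbitrary: f rule: less_induct)
    case less
    show ?case
    proof (cases "p dvd f")
      case True
      then obtain g where g: "f = p * g" ..
      hence "tdeg g < tdeg f" using prime_tdeg[OF assms(1)] less.prems by (subst g, subst tdeg_mult) auto
      then obtain k h where "g = p ^ k * h" "\<not> p dvd h" using less.hyps[of g] g less.prems by auto
      thus ?thesis using g by (intro exI[of _ "Suc k"] exI[of _ h]) auto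
    next
      case False
      thus ?thesis by (intro exI[of _ 0] exI[of _ f]) auto
    qed
  qed
  thus ?thesis using ordp_eqI[OF assms(1)] that by metis
qed

lemma ordp_mult:
  assumes "prime_elem p" "f \<noteq> 0" "g \<noteq> 0"
  shows "ordp p (f * g) = ordp p f + ordp p g"
proof -
  obtain f' where f': "f = p ^ ordp p f * f'" "\<not> p dvd f'" using ordp_decomp assms by blast
  obtain g' where g': "g = p ^ ordp p g * g'" "\<not> p dvd g'" using ordp_decomp assms by blast
  have "f * g = (p ^ ordp p f * f') * (p ^ ordp p g * g')"
    using f'(1) g'(1) by metis
  also have "\<dots> = p ^ (ordp p f + ordp p g) * (f' * g')"
    by (simp only: power_add mult_ac)
  finally have "f * g = p ^ (ordp p f + ordp p g) * (f' * g')" .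
  moreover have "\<not> p dvd f' * g'" using f'(2) g'(2) assms(1) by (simp add: prime_elem_dvd_mult_iff)
  ultimately show ?thesis using ordp_eqI[OF assms(1)] by simp
qed

lemma ordp_ge:
  assumes "prime_elem p" "f \<noteq> 0"
  shows "k \<le> ordp p f \<longleftrightarrow> p ^ k dvd f"
proof
  obtain g where g: "f = p ^ ordp p f * g" "\<not> p dvd g" using ordp_decomp assms by blast
  show "p ^ k dvd f" if "k \<le> ordp p f"
    using le_imp_power_dvd[OF that, of p] g(1) by (metis dvd_mult2)
  assume "p ^ k dvd f"
  then obtain h where h: "f = p ^ k * h" ..
  hence "h \<noteq> 0" "p ^ k \<noteq> 0" using assms by auto
  moreover have "ordp p (p ^ k) = k" using ordp_eqI[OF assms(1), of 1 k] assms(1) by (auto simp: prime_elem_def)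
  ultimately show "k \<le> ordp p f" using ordp_mult[OF assms(1), of "p ^ k" h] h by simp
qed

lemma ordp_pos_iff: "prime_elem p \<Longrightarrow> f \<noteq> 0 \<Longrightarrow> ordp p f > 0 \<longleftrightarrow> p dvd f"
  using ordp_ge[of p f 1] by (simp add: Suc_le_eq)

definition valp :: "mpoly \<Rightarrow> mpoly fract \<Rightarrow> int" where
  "valp p x = (SOME n. \<exists>a b. a \<noteq> 0 \<and> b \<noteq> 0 \<and> x = F a / F b \<and> n = int (ordp p a) - int (ordp p b))"

lemma valp_F:
  assumes "prime_elem p" "a \<noteq> 0" "b \<noteq> 0"
  shows "valp p (F a / F b) = int (ordp p a) - int (ordp p b)"
proof -
  have "valp p (F a / F b) = (SOME n. n = int (ordp p a) - int (ordp p b))"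
    unfolding valp_def
  proof (intro arg_cong[where f = Eps] ext iffI)
    fix n assume "\<exists>a' b'. a' \<noteq> 0 \<and> b' \<noteq> 0 \<and> F a / F b = F a' / F b' \<and> n = int (ordp p a') - int (ordp p b')"
    then obtain a' b' where *: "a' \<noteq> 0" "b' \<noteq> 0" "F a / F b = F a' / F b'" "n = int (ordp p a') - int (ordp p b')"
      by blast
    hence "F a * F b' = F a' * F b" using assms by (simp add: field_simps)
    hence "a * b' = a' * b" by (simp flip: to_fract_mult)
    hence "ordp p a + ordp p b' = ordp p a' + ordp p b" using ordp_mult assms * by metis
    thus "n = int (ordp p a) - int (ordp p b)" using * by simp
  qed (use assms in blast)
  thus ?thesis by simp
qed

lemma valp_to_fract: "prime_elem p \<Longrightarrow> a \<noteq> 0 \<Longrightarrow> valp p (F a) = int (ordp p a)"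
  using valp_F[of p a 1] ordp_eqI[of p 1 0] by (auto simp: prime_elem_def)

lemma valp_valuation:
  assumes "prime_elem p" shows "valuation (valp p)"
proof
  fix x y :: "mpoly fract" assume nz: "x \<noteq> 0" "y \<noteq> 0"
  obtain a b where ab: "x = F a / F b" "b \<noteq> 0" by (rule fract_cases)
  obtain c d where cd: "y = F c / F d" "d \<noteq> 0" by (rule fract_cases)
  have nz': "a \<noteq> 0" "c \<noteq> 0" using nz ab cd by auto
  have "x * y = F (a * c) / F (b * d)" using ab cd by simp
  thus "valp p (x * y) = valp p x + valp p y"
    using ab cd nz' assms by (simp add: valp_F ordp_mult del: to_fract_mult)
  assume xy: "x + y \<noteq> 0"
  have eq: "x + y = F (a * d + c * b) / F (b * d)" using ab cd by (simp add: field_simps)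
  have nz'': "a * d + c * b \<noteq> 0"
  proof
    assume *: "a * d + c * b = 0"
    have "x + y = 0" unfolding eq * by simp
    thus False using xy by simp
  qed
  define k where "k = min (ordp p a + ordp p d) (ordp p c + ordp p b)"
  have "p ^ k dvd a * d" "p ^ k dvd c * b"
    using ab cd nz' assms by (subst ordp_ge[symmetric]; simp add: ordp_mult k_def)+
  hence "p ^ k dvd a * d + c * b" by simp
  hence "k \<le> ordp p (a * d + c * b)" using ordp_ge assms nz'' by blast
  thus "min (valp p x) (valp p y) \<le> valp p (x + y)"
    unfolding eq unfolding ab(1) cd(1) using ab cd nz' nz'' assms
    by (simp add: valp_F ordp_mult k_def del: to_fract_mult to_fract_add)
qed

text \<open>Common prime factors are cancelled in turn until only units remain. In this way
  information at each prime separately becomes information about degrees.\<close>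

lemma tdeg_eq_of_ordp:
  assumes "a \<noteq> 0" "b \<noteq> 0" "\<And>p. prime_elem p \<Longrightarrow> ordp p a = ordp p b"
  shows "tdeg a = tdeg b"
  using assms
proof (induction "tdeg a" arbitrary: a b rule: less_induct)
  case less
  show ?case
  proof (cases "a dvd 1")
    case True
    have "b dvd 1"
    proof (rule ccontr)
      assume "\<not> b dvd 1"
      then obtain p where p: "prime_elem p" "p dvd b" using prime_factor_exists less.prems by blast
      hence "p dvd a" using less.prems ordp_pos_iff by metis
      thus False using True p by (metis dvd_trans prime_elem_def)
    qed
    thus ?thesis using True unit_iff by simp
  next
    case False
    then obtain p where p: "prime_elem p" "p dvd a" using prime_factor_exists less.prems by blast
    hence "p dvd b" using less.prems ordp_pos_iff by metis
    obtain a' where a': "a = p * a'" using p by (auto elim: dvdE)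
    obtain b' where b': "b = p * b'" using \<open>p dvd b\<close> by (auto elim: dvdE)
    have nz: "p \<noteq> 0" "a' \<noteq> 0" "b' \<noteq> 0" using a' b' less.prems by auto
    have "tdeg a' < tdeg a" using prime_tdeg[OF p(1)] a' nz by (simp add: tdeg_mult)
    moreover have "ordp r a' = ordp r b'" if "prime_elem r" for r
      using less.prems(3)[OF that] a' b' ordp_mult[OF that] nz by simp
    ultimately have "tdeg a' = tdeg b'" using less.hyps nz by blast
    thus ?thesis using a' b' nz by (simp add: tdeg_mult)
  qed
qed

text \<open>Homogeneity as \<open>f(t x) = t^d f(x)\<close>; the zero polynomial has every
  degree.\<close>

definition hm :: "nat \<Rightarrow> mpoly \<Rightarrow> bool" where "hm d f \<longleftrightarrow> GR f = monom f d"

lemma hm_C [simp]: "hm 0 (C c)" and hm_V [simp]: "hm 1 (V w)" and hm_0 [simp]: "hm d 0" and hm_1 [simp]: "hm 0 1"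
  by (simp_all add: hm_def monom_altdef)

lemma V_neq_0 [simp]: "V w \<noteq> 0"
proof
  assume "V w = 0"
  hence "ev (\<lambda>x. x) (\<lambda>_. 1) (V w) = ev (\<lambda>x. x) (\<lambda>_. 1) (C 0)" by simp
  thus False by (simp add: ev_V[OF id_hom] ev_C[OF id_hom] del: C_0)
qed

lemma hm_add: "hm d f \<Longrightarrow> hm d g \<Longrightarrow> hm d (f + g)"
  by (simp add: hm_def GR_add add_monom)

lemma hm_mult: "hm d f \<Longrightarrow> hm e g \<Longrightarrow> hm (d + e) (f * g)"
  by (simp add: hm_def GR_mult mult_monom)

lemma hm_power: "hm d f \<Longrightarrow> hm (n * d) (f ^ n)"
  by (induction n) (auto dest: hm_mult)

lemma hm_tdeg: "hm d f \<Longrightarrow> f \<noteq> 0 \<Longrightarrow> tdeg f = d"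
  by (simp add: hm_def tdeg_def degree_monom_eq)

text \<open>For a homogeneous product, the degree in \<open>t\<close> and the order at
  \<open>t = 0\<close> of its image under \<open>GR\<close> coincide. Both are additive and the
  order never exceeds the degree, so they coincide for each factor.\<close>

lemma hm_factor:
  assumes "hm d (a * b)" "a * b \<noteq> 0"
  shows "hm (tdeg a) a"
proof -
  let ?A = "GR a" and ?B = "GR b"
  have nz: "?A \<noteq> 0" "?B \<noteq> 0" using assms by auto
  have eq: "?A * ?B = monom (a * b) d" using assms by (simp add: hm_def GR_mult)
  have "degree (?A * ?B) = d" unfolding eq using assms(2) by (simp add: degree_monom_eq)
  hence "degree ?A + degree ?B = d" using nz by (simp add: degree_mult_eq)
  moreover have "order 0 (?A * ?B) = d" unfolding eq using assms(2) by (simp add: order_0_monom)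
  hence "order 0 ?A + order 0 ?B = d" using nz by (subst order_mult[symmetric]) auto
  moreover have "order 0 ?A \<le> degree ?A" "order 0 ?B \<le> degree ?B" using nz by (simp_all add: order_degree)
  ultimately have "order 0 ?A = degree ?A" by linarith
  define n where "n = degree ?A"
  have "monom 1 n dvd ?A" using monom_1_dvd_iff[OF nz(1)] \<open>order 0 ?A = degree ?A\<close> by (simp add: n_def)
  then obtain h where h: "?A = monom 1 n * h" ..
  have "h \<noteq> 0" using h nz by auto
  hence "degree (monom 1 n * h) = n + degree h" by (simp add: degree_mult_eq degree_monom_eq)
  hence "degree ?A = n + degree h" by (simp only: h)
  hence "degree h = 0" using n_def by linarith
  then obtain c where c: "h = [:c:]" by (rule degree_eq_zeroE)
  have "?A = monom 1 n * monom c 0" unfolding monom_0 c[symmetric] by (rule h)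
  also have "\<dots> = monom c n" by (simp only: mult_monom mult_1_left add_0_right)
  finally have A: "?A = monom c n" .
  have "poly (monom c n) 1 = c" by (simp add: poly_monom)
  hence "a = c" using poly_GR_1[of a] A by simp
  thus ?thesis using A by (simp add: hm_def tdeg_def n_def)
qed

text \<open>The polynomials met while \<open>h\<close> is built up need not be homogeneous, so the
  induction speaks of all homogeneous components at once; as some of these vanish,
  \<open>P i 0\<close> is asked for every \<open>i\<close>.\<close>

lemma hm_induct [consumes 2, case_names 0 C V add mult]:
  assumes "hm e h" "h \<in> PV A" 
    and P: "\<And>i. P i 0" "\<And>c. P 0 (C c)" "\<And>w. w \<in> A \<Longrightarrow> P 1 (V w)"
      "\<And>i f g. P i f \<Longrightarrow> P i g \<Longrightarrow> P i (f + g)"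
      "\<And>i j f g. P i f \<Longrightarrow> P j g \<Longrightarrow> P (i + j) (f * g)"
  shows "P e h"
proof -
  have sum: "P i (sum f S)" if "\<And>k. k \<in> S \<Longrightarrow> P i (f k)" for i f and S :: "nat set"
    using that by (induction S rule: infinite_finite_induct) (auto intro: P)
  have "P i (coeff (GR h) i)" for i
    using assms(2)
  proof (induction arbitrary: i rule: PV.induct)
    case (PV_C c)
    thus ?case using P(1,2) by (cases i) auto
  next
    case (PV_V w)
    show ?case
    proof (cases "i = 1")
      case False
      hence "coeff (GR (V w)) i = 0" by (cases i) (auto simp: coeff_pCons split: nat.splits)
      thus ?thesis using P(1) by simp
    qed (use P(3) PV_V in simp)
  next
    case (PV_add f g)
    thus ?case by (auto simp: GR_add intro: P)
  next
    case (PV_mult f g)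
    have "P (k + (i - k)) (coeff (GR f) k * coeff (GR g) (i - k))" for k
      by (intro P PV_mult)
    hence "P i (coeff (GR f) k * coeff (GR g) (i - k))" if "k \<le> i" for k using that by (metis le_add_diff_inverse)
    thus ?case by (auto simp: GR_mult coeff_mult intro!: sum)
  qed
  from this[of e] show ?thesis using assms(1) by (simp add: hm_def)
qed

section \<open>Homogeneous fractions in the matrix entries\<close>

locale mdim =
  fixes q :: nat
  assumes q0: "0 < q"
begin

text \<open>Zero counts as homogeneous of every degree. The restriction to \<open>coords q\<close>
  matters because I and J act on the matrix entries alone and fix the infinitely many other
  variables; only fractions in the entries have their degree reversed.\<close>

definition hq :: "int \<Rightarrow> mpoly fract \<Rightarrow> bool" where
  "hq d x \<longleftrightarrow> (\<exists>a b m n. a \<in> PV (coords q) \<and> b \<in> PV (coords q) \<and> hm m a \<and> hm n b \<and> b \<noteq> 0 \<and> x = F a / F b \<and> d = int m - int n)"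

lemma hq_0 [simp]: "hq d 0"
proof -
  have "V (0, 0) \<in> PV (coords q)" using q0 by (auto simp: coords_def intro: PV_V)
  hence "V (0, 0) ^ nat (- d) \<in> PV (coords q)" by (rule PV_power)
  moreover have "hm (nat (- d)) (V (0, 0) ^ nat (- d))" using hm_power[OF hm_V, of "nat (- d)"] by simp
  moreover have "hm (nat d) 0" "(0::mpoly) \<in> PV (coords q)" by auto
  moreover have "V (0, 0) ^ nat (- d) \<noteq> 0" "(0 :: mpoly fract) = F 0 / F (V (0, 0) ^ nat (- d))" by auto
  moreover have "d = int (nat d) - int (nat (- d))" by simp
  ultimately show ?thesis unfolding hq_def by blast
qed

lemma hq_F: "hm d f \<Longrightarrow> f \<in> PV (coords q) \<Longrightarrow> hq (int d) (F f)"
  unfolding hq_def by (intro exI[of _ f] exI[of _ 1] exI[of _ d] exI[of _ 0]) auto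

lemma hq_C [simp]: "hq 0 (F (C c))" and hq_1 [simp]: "hq 0 1"
  using hq_F[OF hm_C PV_C] hq_F[OF hm_1 PV_1] by auto

lemma hq_V: "w \<in> coords q \<Longrightarrow> hq 1 (F (V w))"
  using hq_F[OF hm_V PV_V] by auto

lemma hq_mult:
  assumes "hq d x" "hq e y" shows "hq (d + e) (x * y)"
proof -
  obtain a b m n where 1: "hm m a" "hm n b" "b \<noteq> 0" "x = F a / F b" "d = int m - int n" "a \<in> PV (coords q)" "b \<in> PV (coords q)" using assms(1) unfolding hq_def by blast
  obtain a' b' m' n' where 2: "hm m' a'" "hm n' b'" "b' \<noteq> 0" "y = F a' / F b'" "e = int m' - int n'" "a' \<in> PV (coords q)" "b' \<in> PV (coords q)" using assms(2) unfolding hq_def by blast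
  show ?thesis unfolding hq_def using 1 2 hm_mult[OF 1(1) 2(1)] hm_mult[OF 1(2) 2(2)]
    by (intro exI[of _ "a * a'"] exI[of _ "b * b'"] exI[of _ "m + m'"] exI[of _ "n + n'"]) (auto intro: PV_mult)
qed

lemma hq_add:
  assumes "hq d x" "hq d y" shows "hq d (x + y)"
proof -
  obtain a b m n where 1: "hm m a" "hm n b" "b \<noteq> 0" "x = F a / F b" "d = int m - int n" "a \<in> PV (coords q)" "b \<in> PV (coords q)" using assms(1) unfolding hq_def by blast
  obtain a' b' m' n' where 2: "hm m' a'" "hm n' b'" "b' \<noteq> 0" "y = F a' / F b'" "d = int m' - int n'" "a' \<in> PV (coords q)" "b' \<in> PV (coords q)" using assms(2) unfolding hq_def by blast
  have "hm (m + n') (a * b' + a' * b)"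
  proof (rule hm_add)
    show "hm (m + n') (a * b')" by (rule hm_mult 1 2)+
    have "m + n' = m' + n" using 1 2 by linarith
    thus "hm (m + n') (a' * b)" using hm_mult[OF 2(1) 1(2)] by simp
  qed
  moreover have "x + y = F (a * b' + a' * b) / F (b * b')" using 1 2 by (simp add: field_simps)
  moreover have "b * b' \<noteq> 0" "d = int (m + n') - int (n + n')" using 1 2 by auto
  moreover have "a * b' + a' * b \<in> PV (coords q)" "b * b' \<in> PV (coords q)" by (intro PV_add PV_mult 1 2)+
  ultimately show ?thesis unfolding hq_def using hm_mult[OF 1(2) 2(2)] by blast
qed

lemma hq_inverse:
  assumes "hq d x" shows "hq (- d) (inverse x)"
proof (cases "x = 0")
  case False
  obtain a b m n where 1: "hm m a" "hm n b" "b \<noteq> 0" "x = F a / F b" "d = int m - int n" "a \<in> PV (coords q)" "b \<in> PV (coords q)" using assms(1) unfolding hq_def by blast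
  thus ?thesis unfolding hq_def using False
    by (intro exI[of _ b] exI[of _ a] exI[of _ n] exI[of _ m]) auto
qed auto

lemma hq_divide: "hq d x \<Longrightarrow> hq e y \<Longrightarrow> hq (d - e) (x / y)"
  using hq_mult[OF _ hq_inverse, of d x e y] by (simp add: divide_inverse)

lemma hq_uminus: "hq d x \<Longrightarrow> hq d (- x)"
  using hq_mult[OF hq_C, of d x "-1"] by (simp add: C_uminus)

lemma hq_sum: "(\<And>i. i \<in> S \<Longrightarrow> hq d (f i)) \<Longrightarrow> hq d (sum f S)"
  by (induction S rule: infinite_finite_induct) (auto intro: hq_add)

lemma hq_prod: "finite S \<Longrightarrow> (\<And>i. i \<in> S \<Longrightarrow> hq (d i) (f i)) \<Longrightarrow> hq (sum d S) (prod f S)"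
  by (induction S rule: finite_induct) (auto intro: hq_mult)

lemma hq_power: "hq d x \<Longrightarrow> hq (int n * d) (x ^ n)"
  by (induction n) (auto dest: hq_mult simp: algebra_simps)

lemma hq_F_iff:
  assumes "hq d (F f)" "f \<noteq> 0"
  shows "hm (tdeg f) f \<and> d = int (tdeg f) \<and> f \<in> PV (coords q)"
proof -
  obtain a b m n where 1: "hm m a" "hm n b" "b \<noteq> 0" "F f = F a / F b" "d = int m - int n" "a \<in> PV (coords q)" "b \<in> PV (coords q)" using assms(1) unfolding hq_def by blast
  hence "F f * F b = F a" by simp
  hence a: "a = f * b" by (simp flip: to_fract_mult)
  moreover have "f * b \<noteq> 0" using assms 1 by auto
  ultimately have "hm (tdeg f) f" using hm_factor[of m f b] 1 by auto
  moreover have "m = tdeg f + n" using hm_tdeg[OF 1(1)] hm_tdeg[OF 1(2)] a 1(3) assms(2) by (simp add: tdeg_mult)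
  moreover have "f \<in> PV (coords q)" using PV_factor[of f b "coords q"] a 1 assms(2) by simp
  ultimately show ?thesis using 1 by auto
qed

lemma hq_unique:
  assumes "hq d x" "hq e x" "x \<noteq> 0" shows "d = e"
proof -
  have "hq (d - e) (F 1)" using hq_divide[OF assms(1,2)] assms(3) by simp
  thus ?thesis using hq_F_iff[of "d - e" 1] by simp
qed

text \<open>Plays the part of the product formula: without zeros or poles, numerator and denominator
  have the same degree. It turns the local identities into one about degrees.\<close>

lemma hq_val_0:
  assumes "hq d x" "x \<noteq> 0" "\<And>p. prime_elem p \<Longrightarrow> valp p x = 0"
  shows "d = 0"
proof -
  obtain a b m n where 1: "hm m a" "hm n b" "b \<noteq> 0" "x = F a / F b" "d = int m - int n" "a \<in> PV (coords q)" "b \<in> PV (coords q)" using assms(1) unfolding hq_def by blast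
  have "a \<noteq> 0" using 1 assms by auto
  have "tdeg a = tdeg b"
    by (rule tdeg_eq_of_ordp) (use \<open>a \<noteq> 0\<close> 1 assms(3) valp_F in force)+
  thus ?thesis using hm_tdeg[OF 1(1)] hm_tdeg[OF 1(2)] \<open>a \<noteq> 0\<close> 1 by simp
qed

end

section \<open>Extending injective substitutions to the fraction field\<close>

definition extF :: "(mpoly \<Rightarrow> 'b::field) \<Rightarrow> mpoly fract \<Rightarrow> 'b" where
  "extF \<phi> x = (SOME y. \<exists>a b. b \<noteq> 0 \<and> x = F a / F b \<and> y = \<phi> a / \<phi> b)"

lemma extF_F:
  assumes "comm_ring_hom \<phi>" "\<And>f. \<phi> f = 0 \<Longrightarrow> f = 0" "b \<noteq> 0"
  shows "extF \<phi> (F a / F b) = \<phi> a / \<phi> b"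
proof -
  interpret comm_ring_hom \<phi> by fact
  have "extF \<phi> (F a / F b) = (SOME y. y = \<phi> a / \<phi> b)"
    unfolding extF_def
  proof (intro arg_cong[where f = Eps] ext iffI)
    fix y assume "\<exists>a' b'. b' \<noteq> 0 \<and> F a / F b = F a' / F b' \<and> y = \<phi> a' / \<phi> b'"
    then obtain a' b' where *: "b' \<noteq> 0" "F a / F b = F a' / F b'" "y = \<phi> a' / \<phi> b'" by blast
    hence "F a * F b' = F a' * F b" using assms by (simp add: field_simps)
    hence "a * b' = a' * b" by (simp flip: to_fract_mult)
    hence "\<phi> a * \<phi> b' = \<phi> a' * \<phi> b" by (metis hom_mult)
    moreover have "\<phi> b \<noteq> 0" "\<phi> b' \<noteq> 0" using assms * by auto
    ultimately show "y = \<phi> a / \<phi> b" unfolding *(3) by (simp add: frac_eq_eq)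
  qed (use assms in blast)
  thus ?thesis by simp
qed

lemma extF_to_fract:
  assumes "comm_ring_hom \<phi>" "\<And>f. \<phi> f = 0 \<Longrightarrow> f = 0"
  shows "extF \<phi> (F a) = \<phi> a"
proof -
  interpret comm_ring_hom \<phi> by fact
  show ?thesis using extF_F[OF assms, of 1 a] by simp
qed

lemma extF_hom:
  assumes "comm_ring_hom \<phi>" "\<And>f. \<phi> f = 0 \<Longrightarrow> f = 0"
  shows "comm_ring_hom (extF \<phi>)"
proof -
  interpret comm_ring_hom \<phi> by fact
  note F = extF_F[OF assms] extF_to_fract[OF assms]
  show ?thesis
  proof
    show "extF \<phi> 0 = 0" "extF \<phi> 1 = 1" using F(2)[of 0] F(2)[of 1] by auto
    fix x y
    obtain a b where ab: "x = F a / F b" "b \<noteq> 0" by (rule fract_cases)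
    obtain c d where cd: "y = F c / F d" "d \<noteq> 0" by (rule fract_cases)
    have nz: "\<phi> b \<noteq> 0" "\<phi> d \<noteq> 0" using assms ab cd by auto
    have eq: "x + y = F (a * d + c * b) / F (b * d)" "x * y = F (a * c) / F (b * d)"
      using ab cd by (simp_all add: field_simps)
    show "extF \<phi> (x + y) = extF \<phi> x + extF \<phi> y" 
      unfolding eq unfolding ab(1) cd(1) using ab cd nz by (simp add: F field_simps hom_add hom_mult del: to_fract_add to_fract_mult)
    show "extF \<phi> (x * y) = extF \<phi> x * extF \<phi> y" 
      unfolding eq unfolding ab(1) cd(1) using ab cd nz by (simp add: F field_simps hom_add hom_mult del: to_fract_add to_fract_mult)
  qed
qed

lemma field_hom_facts:
  fixes \<phi> :: "'a::field \<Rightarrow> 'b::field"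
  assumes "comm_ring_hom \<phi>"
  shows field_hom_inverse: "\<phi> (inverse x) = inverse (\<phi> x)"
    and field_hom_divide: "\<phi> (x / y) = \<phi> x / \<phi> y"
    and field_hom_eq_0: "\<phi> x = 0 \<longleftrightarrow> x = 0"
proof -
  interpret comm_ring_hom \<phi> by fact
  show 0: "\<phi> x = 0 \<longleftrightarrow> x = 0" for x
  proof
    assume "\<phi> x = 0"
    show "x = 0"
    proof (rule ccontr)
      assume "x \<noteq> 0"
      hence "\<phi> x * \<phi> (inverse x) = 1" by (simp flip: hom_mult)
      thus False using \<open>\<phi> x = 0\<close> by simp
    qed
  qed auto
  show inv: "\<phi> (inverse x) = inverse (\<phi> x)" for x
  proof (cases "x = 0")
    case False
    hence "\<phi> x * \<phi> (inverse x) = 1" by (simp flip: hom_mult)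
    thus ?thesis by (metis inverse_unique)
  qed auto
  show "\<phi> (x / y) = \<phi> x / \<phi> y" by (simp add: divide_inverse hom_mult inv)
qed

text \<open>A birational involution \<open>\<phi>\<close> that is regular off \<open>E = 0\<close> permutes the prime divisors
  other than the components of \<open>E = 0\<close>.\<close>

lemma transport:
  fixes \<phi> :: "mpoly fract \<Rightarrow> mpoly fract"
  assumes hom: "comm_ring_hom \<phi>" and inv: "\<And>x. \<phi> (\<phi> x) = x"
    and E: "E \<noteq> 0" "\<phi> (F E) = inverse (F E)"
    and pol: "\<And>h. \<exists>k N. \<phi> (F h) = F k / F E ^ N"
    and p: "prime_elem p" "\<not> p dvd E"
  obtains p' where "prime_elem p'" "\<not> p' dvd E" "\<And>x. x \<noteq> 0 \<Longrightarrow> valp p (\<phi> x) = valp p' x"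
proof -
  interpret \<phi>: comm_ring_hom \<phi> by fact
  note fh = field_hom_facts[OF hom]
  interpret v: valuation "valp p" by (rule valp_valuation) fact
  have vF: "valp p (F a) = int (ordp p a)" if "a \<noteq> 0" for a using valp_to_fract p that by blast
  have E0: "valp p (F E) = 0" using vF[OF E(1)] ordp_pos_iff[OF p(1) E(1)] p(2) by simp
  have hompow: "\<phi> (x ^ n) = \<phi> x ^ n" for x n by (induction n) (auto simp: \<phi>.hom_mult)
  \<comment> \<open>The valuation pulled back along \<open>\<phi>\<close>. It is nonnegative on
    polynomials, because only powers of \<open>E\<close>, which is prime to \<open>p\<close>, occur
    as denominators; it remains to recognise it as the order at some prime.\<close>
  define w where "w h = valp p (\<phi> (F h))" for h
  have w_mult: "w (a * b) = w a + w b" if "a \<noteq> 0" "b \<noteq> 0" for a b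
    unfolding w_def using that by (simp add: \<phi>.hom_mult v.v_mult fh)
  have w_k: "w h = int (ordp p k)" "k \<noteq> 0" if "\<phi> (F h) = F k / F E ^ N" "h \<noteq> 0" for h k N
  proof -
    show k0: "k \<noteq> 0"
    proof
      assume "k = 0"
      hence "\<phi> (F h) = 0" using that by simp
      hence "F h = 0" by (simp only: fh(3))
      thus False using that by simp
    qed
    show "w h = int (ordp p k)" unfolding w_def that(1) using k0 E E0 
      by (simp add: v.v_divide v.v_power vF)
  qed
  have w_nonneg: "w h \<ge> 0" if "h \<noteq> 0" for h using pol[of h] w_k(1)[OF _ that] by (metis of_nat_0_le_iff)
  have p0: "p \<noteq> 0" using p by (auto simp: prime_elem_def)
  obtain g M where g: "\<phi> (F p) = F g / F E ^ M" using pol by blast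
  have g0: "g \<noteq> 0" using w_k(2)[OF g p0] .
  have "F g = \<phi> (F p) * F E ^ M" using g E by simp
  hence "\<phi> (F g) = \<phi> (\<phi> (F p) * F E ^ M)" by simp
  also have "\<dots> = F p * inverse (F E) ^ M" by (simp add: \<phi>.hom_mult hompow inv E(2))
  finally have "\<phi> (F g) = F p / F E ^ M" by (simp add: divide_inverse power_inverse)
  hence wg: "w g = 1" using w_k(1)[OF _ g0] ordp_eqI[of p 1 1] p by (auto simp: prime_elem_def)
  \<comment> \<open>Applied to the numerator \<open>g\<close> of \<open>\<phi> (F p)\<close>, which
    has \<open>w g = 1\<close>: a prime factor of \<open>g\<close> with positive \<open>w\<close> is
    the new divisor.\<close>
  have "\<exists>p'. prime_elem p' \<and> p' dvd g' \<and> w p' > 0" if "g' \<noteq> 0" "w g' > 0" for g'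
    using that
  proof (induction "tdeg g'" arbitrary: g' rule: less_induct)
    case less
    have "\<not> g' dvd 1"
    proof
      assume "g' dvd 1"
      then obtain e where e: "1 = g' * e" ..
      hence "w 1 = w g' + w e" using w_mult[of g' e] less.prems e by (metis mult_eq_0_iff one_neq_zero)
      moreover have "w 1 = 0" by (simp add: w_def)
      moreover have "w e \<ge> 0" using w_nonneg e by (metis mult_eq_0_iff one_neq_zero)
      ultimately show False using less.prems by simp
    qed
    then obtain r where r: "prime_elem r" "r dvd g'" using prime_factor_exists less.prems by blast
    then obtain g2 where g2: "g' = r * g2" by (auto elim: dvdE)
    have nz: "r \<noteq> 0" "g2 \<noteq> 0" using less.prems g2 by auto
    show ?case
    proof (cases "w r > 0")
      case False
      hence "w g2 > 0" using w_mult[OF nz] less.prems g2 by simp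
      moreover have "tdeg g2 < tdeg g'" using prime_tdeg[OF r(1)] nz g2 by (simp add: tdeg_mult)
      ultimately show ?thesis using less.hyps[of g2] nz g2 by (metis dvd_mult)
    qed (use r in blast)
  qed
  then obtain p' where p': "prime_elem p'" "p' dvd g" "w p' > 0" using g0 wg by force
  have p'0: "p' \<noteq> 0" using p' by (auto simp: prime_elem_def)
  obtain g2 where g2: "g = p' * g2" using p' by (auto elim: dvdE)
  have "g2 \<noteq> 0" using g2 g0 by auto
  hence wp': "w p' = 1" using w_mult[OF p'0 \<open>g2 \<noteq> 0\<close>] wg g2 p' w_nonneg[of g2] by simp
  have wE: "w E = 0" unfolding w_def E(2) using E E0 by (simp add: v.v_inverse)
  have p'E: "\<not> p' dvd E"
  proof
    assume "p' dvd E"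
    then obtain e where e: "E = p' * e" ..
    hence "e \<noteq> 0" using E by auto
    hence "w E = 1 + w e" using w_mult[OF p'0] e wp' by simp
    thus False using wE w_nonneg[OF \<open>e \<noteq> 0\<close>] by simp
  qed
  \<comment> \<open>If \<open>w h > 0\<close>, then \<open>p\<close> divides the numerator of
    \<open>\<phi> (F h)\<close>; applying \<open>\<phi>\<close> once more displays \<open>h\<close>,
    up to powers of \<open>E\<close>, as a multiple of \<open>g\<close> and hence of
    \<open>p'\<close>.\<close>
  have key: "p' dvd h" if h: "h \<noteq> 0" "w h > 0" for h
  proof -
    obtain k N where k: "\<phi> (F h) = F k / F E ^ N" using pol by blast
    have "ordp p k > 0" "k \<noteq> 0" using w_k[OF k h(1)] h(2) by auto
    hence "p dvd k" using ordp_pos_iff p by blast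
    then obtain k1 where k1: "k = p * k1" ..
    obtain k2 L where k2: "\<phi> (F k1) = F k2 / F E ^ L" using pol by blast
    have "F h = \<phi> (\<phi> (F h))" by (simp add: inv)
    also have "\<dots> = (F g / F E ^ M) * (F k2 / F E ^ L) * F E ^ N"
      unfolding k k1 by (simp add: fh \<phi>.hom_mult hompow g k2 E(2) power_inverse divide_inverse)
    finally have "F h * F E ^ (M + L) = F g * F k2 * F E ^ N" using E by (simp add: field_simps power_add)
    hence "h * E ^ (M + L) = g * k2 * E ^ N" by (simp flip: to_fract_mult F_power)
    hence "p' dvd h * E ^ (M + L)" using p'(2) by (simp add: dvd_mult2)
    thus ?thesis using p' p'E by (metis prime_elem_dvd_multD prime_elem_dvd_power)
  qed
  have wo: "w h = int (ordp p' h)" if h: "h \<noteq> 0" for h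
  proof -
    obtain h' where h': "h = p' ^ ordp p' h * h'" "\<not> p' dvd h'" using ordp_decomp p' h by blast
    have "h' \<noteq> 0" using h' by auto
    have "w h' = 0" using key[OF \<open>h' \<noteq> 0\<close>] h'(2) w_nonneg[OF \<open>h' \<noteq> 0\<close>] by force
    moreover have "w (p' ^ n) = int n" for n
      by (induction n) (auto simp: w_mult p'0 wp', simp add: w_def)
    ultimately have "w (p' ^ ordp p' h * h') = int (ordp p' h)" using \<open>h' \<noteq> 0\<close> p'0 by (simp add: w_mult)
    thus ?thesis unfolding h'(1)[symmetric] .
  qed
  have "valp p (\<phi> x) = valp p' x" if "x \<noteq> 0" for x
  proof -
    obtain a b where ab: "x = F a / F b" "b \<noteq> 0" by (rule fract_cases)
    hence a0: "a \<noteq> 0" using that by auto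
    have "valp p (\<phi> x) = w a - w b"
      unfolding ab(1) w_def fh using a0 ab fh(3) by (simp add: v.v_divide)
    thus ?thesis unfolding ab(1) using wo a0 ab valp_F[OF p'(1)] by simp
  qed
  thus ?thesis using that p' p'E by blast
qed

section \<open>The maps I, J and K on matrices of rational functions\<close>

lemma adj_mat_hom:
  assumes "comm_ring_hom h" "A \<in> carrier_mat n n"
  shows "adj_mat (map_mat h A) = map_mat h (adj_mat A)"
proof -
  interpret comm_ring_hom h by fact
  have del: "mat_delete (map_mat h A) i j = map_mat h (mat_delete A i j)" if "i < n" "j < n" for i j
    using assms(2) that by (intro eq_matI) (auto simp: mat_delete_def)
  have "cofactor (map_mat h A) i j = h (cofactor A i j)" if "i < n" "j < n" for i j
    using that by (simp add: cofactor_def del hom_mult hom_power hom_uminus)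
  thus ?thesis using assms(2) by (intro eq_matI) (auto simp: adj_mat_def)
qed

section \<open>The maps J, I and K for matrices over a field\<close>

definition Jm :: "'a::field mat \<Rightarrow> 'a mat" where "Jm A = map_mat inverse A"

text \<open>The inverse matrix when \<open>det A\<close> is nonzero and the zero matrix otherwise.
  Through the adjugate it commutes with field homomorphisms without any condition on the
  determinant.\<close>

definition Iv :: "'a::field mat \<Rightarrow> 'a mat" where "Iv A = inverse (det A) \<cdot>\<^sub>m adj_mat A"

definition Km :: "'a::field mat \<Rightarrow> 'a mat" where "Km A = Iv (Jm A)"

lemma Jm_carrier [simp]: "A \<in> carrier_mat n n \<Longrightarrow> Jm A \<in> carrier_mat n n"
  by (simp add: Jm_def)

lemma Im_carrier [simp]: "A \<in> carrier_mat n n \<Longrightarrow> Iv A \<in> carrier_mat n n"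
  by (auto simp: Iv_def adj_mat_def)

lemma dim_JIK [simp]: "dim_row (Jm A) = dim_row A" "dim_col (Jm A) = dim_col A"
  "dim_row (Iv A) = dim_row A" "dim_col (Iv A) = dim_col A"
  "dim_row (Km A) = dim_row A" "dim_col (Km A) = dim_col A"
  by (simp_all add: Jm_def Iv_def adj_mat_def Km_def)

lemma Km_carrier [simp]: "A \<in> carrier_mat n n \<Longrightarrow> Km A \<in> carrier_mat n n"
  by (simp add: Km_def)

lemma Jm_index [simp]: "A \<in> carrier_mat n n \<Longrightarrow> i < n \<Longrightarrow> j < n \<Longrightarrow> Jm A $$ (i, j) = inverse (A $$ (i, j))"
  by (auto simp: Jm_def)

lemma Jm_Jm [simp]: "Jm (Jm A) = A"
  by (rule eq_matI) (auto simp: Jm_def)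

lemma Im_inverse:
  assumes "A \<in> carrier_mat n n" "det A \<noteq> 0"
  shows "A * Iv A = 1\<^sub>m n" "Iv A * A = 1\<^sub>m n"
proof -
  note a = adj_mat[OF assms(1)]
  have "A * Iv A = inverse (det A) \<cdot>\<^sub>m (A * adj_mat A)"
    unfolding Iv_def by (rule mult_smult_distrib[OF assms(1) a(1)])
  also have "\<dots> = 1\<^sub>m n" unfolding a(2) using assms by (intro eq_matI) auto
  finally show "A * Iv A = 1\<^sub>m n" .
  have "Iv A * A = inverse (det A) \<cdot>\<^sub>m (adj_mat A * A)"
    unfolding Iv_def by (rule mult_smult_assoc_mat[OF a(1) assms(1)])
  also have "\<dots> = 1\<^sub>m n" unfolding a(3) using assms by (intro eq_matI) auto
  finally show "Iv A * A = 1\<^sub>m n" .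
qed

lemma Im_unique:
  assumes "A \<in> carrier_mat n n" "B \<in> carrier_mat n n" "A * B = 1\<^sub>m n"
  shows "det A \<noteq> 0" "Iv A = B"
proof -
  have "det A * det B = 1" using det_mult[OF assms(1,2)] assms(3) by simp
  thus d: "det A \<noteq> 0" by auto
  have I: "Iv A \<in> carrier_mat n n" using assms by simp
  have "Iv A = Iv A * (A * B)" using I assms by simp
  also have "\<dots> = (Iv A * A) * B" using assoc_mult_mat[OF I assms(1,2)] by simp
  also have "\<dots> = B" using Im_inverse(2)[OF assms(1) d] assms by simp
  finally show "Iv A = B" .
qed

lemma det_Im:
  assumes "A \<in> carrier_mat n n" "det A \<noteq> 0"
  shows "det (Iv A) = inverse (det A)"
proof -
  have "det A * det (Iv A) = 1" using det_mult[OF assms(1), of "Iv A"] Im_inverse[OF assms] assms by simp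
  thus ?thesis by (metis inverse_unique)
qed

lemma Im_Im: "A \<in> carrier_mat n n \<Longrightarrow> det A \<noteq> 0 \<Longrightarrow> Iv (Iv A) = A"
  by (rule Im_unique(2)[of _ n]) (auto simp: Im_inverse)

lemma adj_Im: "A \<in> carrier_mat n n \<Longrightarrow> det A \<noteq> 0 \<Longrightarrow> adj_mat A = det A \<cdot>\<^sub>m Iv A"
  by (rule eq_matI) (auto simp: Iv_def)

lemma adj_Im_index:
  assumes "A \<in> carrier_mat n n" "det A \<noteq> 0" "i < n" "j < n"
  shows "adj_mat A $$ (i, j) = det A * Iv A $$ (i, j)"
proof -
  show ?thesis unfolding adj_Im[OF assms(1,2)] using assms by simp
qed

lemma Im_hom:
  assumes "comm_ring_hom h" "A \<in> carrier_mat n n"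
  shows "Iv (map_mat h A) = map_mat h (Iv A)"
proof -
  interpret comm_ring_hom h by fact
  show ?thesis unfolding Iv_def adj_mat_hom[OF assms] hom_det
    by (rule eq_matI) (auto simp: hom_mult field_hom_inverse[OF assms(1)])
qed

lemma Jm_hom: "comm_ring_hom h \<Longrightarrow> Jm (map_mat h A) = map_mat h (Jm A)"
  by (rule eq_matI) (auto simp: Jm_def field_hom_inverse)

lemma Km_hom: "comm_ring_hom h \<Longrightarrow> A \<in> carrier_mat n n \<Longrightarrow> Km (map_mat h A) = map_mat h (Km A)"
  by (simp add: Km_def Jm_hom Im_hom[where n = n])

text \<open>The product of \<open>A\<close> with the diagonal matrix of \<open>d\<close> on the left
  and that of \<open>e\<close> on the right.\<close>

definition scl :: "nat \<Rightarrow> (nat \<Rightarrow> 'a::comm_ring_1) \<Rightarrow> 'a mat \<Rightarrow> (nat \<Rightarrow> 'a) \<Rightarrow> 'a mat" where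
  "scl n d A e = mat n n (\<lambda>(i, j). d i * A $$ (i, j) * e j)"

lemma scl_carrier [simp]: "scl n d A e \<in> carrier_mat n n"
  by (simp add: scl_def)

lemma scl_dim [simp]: "dim_row (scl n d A e) = n" "dim_col (scl n d A e) = n"
  by (simp_all add: scl_def)

lemma scl_index [simp]: "i < n \<Longrightarrow> j < n \<Longrightarrow> scl n d A e $$ (i, j) = d i * A $$ (i, j) * e j"
  by (simp add: scl_def)

lemma det_scl:
  assumes A: "A \<in> carrier_mat n n"
  shows "det (scl n d A e) = (\<Prod>i<n. d i) * det A * (\<Prod>i<n. e i)"
proof -
  have "(\<Prod>i = 0..<n. scl n d A e $$ (i, p i)) =
      (\<Prod>i<n. d i) * (\<Prod>i<n. e i) * (\<Prod>i = 0..<n. A $$ (i, p i))" if p: "p permutes {0..<n}" for p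
  proof -
    have "(\<Prod>i = 0..<n. scl n d A e $$ (i, p i)) = (\<Prod>i = 0..<n. d i * A $$ (i, p i) * e (p i))"
      using permutes_in_image[OF p] by (intro prod.cong) auto
    also have "\<dots> = (\<Prod>i = 0..<n. d i) * (\<Prod>i = 0..<n. A $$ (i, p i)) * (\<Prod>i = 0..<n. e (p i))"
      by (simp add: prod.distrib)
    also have "(\<Prod>i = 0..<n. e (p i)) = (\<Prod>i = 0..<n. e i)"
      using prod.permute[OF p, of e] by (simp add: o_def)
    finally show ?thesis by (simp add: lessThan_atLeast0 mult_ac)
  qed
  hence "det (scl n d A e) = (\<Sum>p | p permutes {0..<n}. signof p * ((\<Prod>i<n. d i) * (\<Prod>i<n. e i) * (\<Prod>i = 0..<n. A $$ (i, p i))))"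
    by (subst det_def'[of _ n]) (auto intro!: sum.cong)
  thus ?thesis by (subst det_def'[OF A]) (simp add: sum_distrib_left sum_distrib_right mult_ac)
qed

lemma Jm_scl:
  fixes A :: "'a::field mat"
  assumes "A \<in> carrier_mat n n"
  shows "Jm (scl n d A e) = scl n (\<lambda>i. inverse (d i)) (Jm A) (\<lambda>i. inverse (e i))"
  using assms by (intro eq_matI) (auto simp: Jm_def scl_def)

lemma Im_scl:
  fixes A :: "'a::field mat"
  assumes A: "A \<in> carrier_mat n n" and nz: "det A \<noteq> 0" "\<And>i. i < n \<Longrightarrow> d i \<noteq> 0" "\<And>i. i < n \<Longrightarrow> e i \<noteq> 0"
  shows "Iv (scl n d A e) = scl n (\<lambda>i. inverse (e i)) (Iv A) (\<lambda>i. inverse (d i))"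
proof (rule Im_unique(2)[of _ n])
  have I: "Iv A \<in> carrier_mat n n" using A by simp
  show "scl n d A e * scl n (\<lambda>i. inverse (e i)) (Iv A) (\<lambda>i. inverse (d i)) = 1\<^sub>m n"
  proof (rule eq_matI)
    fix i j assume ij: "i < dim_row (1\<^sub>m n :: 'a mat)" "j < dim_col (1\<^sub>m n :: 'a mat)"
    hence "(scl n d A e * scl n (\<lambda>i. inverse (e i)) (Iv A) (\<lambda>i. inverse (d i))) $$ (i, j) =
       (\<Sum>k = 0..<n. d i * A $$ (i, k) * e k * (inverse (e k) * Iv A $$ (k, j) * inverse (d j)))"
      by (simp add: scl_def scalar_prod_def)
    also have "\<dots> = (\<Sum>k = 0..<n. d i * (A $$ (i, k) * Iv A $$ (k, j)) * inverse (d j))"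
      using nz by (intro sum.cong) auto
    also have "\<dots> = d i * (\<Sum>k = 0..<n. A $$ (i, k) * Iv A $$ (k, j)) * inverse (d j)"
      by (simp add: sum_distrib_left sum_distrib_right)
    also have "(\<Sum>k = 0..<n. A $$ (i, k) * Iv A $$ (k, j)) = (A * Iv A) $$ (i, j)"
      using ij A I by (auto simp: scalar_prod_def)
    also have "\<dots> = (1\<^sub>m n :: 'a mat) $$ (i, j)" using Im_inverse(1)[OF A nz(1)] by simp
    finally show "(scl n d A e * scl n (\<lambda>i. inverse (e i)) (Iv A) (\<lambda>i. inverse (d i))) $$ (i, j) = 1\<^sub>m n $$ (i, j)"
      using ij nz by (auto split: if_splits)
  qed auto
qed auto

text \<open>J inverts both diagonal factors; I inverts them again and exchanges the sides, so K only
  exchanges them. Zeros and poles concentrated in rows and columns can thus be carried through the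
  iteration.\<close>

lemma Km_scl:
  fixes A :: "'a::field mat"
  assumes A: "A \<in> carrier_mat n n" and nz: "det (Jm A) \<noteq> 0" "\<And>i. i < n \<Longrightarrow> d i \<noteq> 0" "\<And>i. i < n \<Longrightarrow> e i \<noteq> 0"
  shows "Km (scl n d A e) = scl n e (Km A) d"
  unfolding Km_def by (subst Jm_scl[OF A], subst Im_scl) (use A nz in auto)

lemma hm_prod: "finite S \<Longrightarrow> (\<And>i. i \<in> S \<Longrightarrow> hm (d i) (f i)) \<Longrightarrow> hm (sum d S) (prod f S)"
  by (induction S rule: finite_induct) (auto intro: hm_mult)

lemma hm_sum: "(\<And>i. i \<in> S \<Longrightarrow> hm d (f i)) \<Longrightarrow> hm d (sum f S)"
  by (induction S rule: infinite_finite_induct) (auto intro: hm_add)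

lemma hm_uminus: "hm d f \<Longrightarrow> hm d (- f)"
  using hm_mult[OF hm_C[of "-1"], of d f] by (simp add: C_uminus)

lemma hm_det:
  assumes "A \<in> carrier_mat n n" "\<And>i j. i < n \<Longrightarrow> j < n \<Longrightarrow> hm 1 (A $$ (i, j))"
  shows "hm n (det A)"
  unfolding det_def'[OF assms(1)]
proof (rule hm_sum)
  fix p assume "p \<in> {p. p permutes {0..<n}}"
  hence p: "p permutes {0..<n}" by simp
  have "hm (\<Sum>i = 0..<n. 1) (\<Prod>i = 0..<n. A $$ (i, p i))"
    by (rule hm_prod) (use permutes_in_image[OF p] assms(2) in simp_all)
  hence "hm n (\<Prod>i = 0..<n. A $$ (i, p i))" by simp
  thus "hm n (signof p * (\<Prod>i = 0..<n. A $$ (i, p i)))" by (cases p rule: sign_cases) (simp_all add: hm_uminus)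
qed

lemma (in mdim) hq_det:
  assumes "A \<in> carrier_mat n n" "\<And>i j. i < n \<Longrightarrow> j < n \<Longrightarrow> hq d (A $$ (i, j))"
  shows "hq (int n * d) (det A)"
  unfolding det_def'[OF assms(1)]
proof (rule hq_sum)
  fix p assume "p \<in> {p. p permutes {0..<n}}"
  hence p: "p permutes {0..<n}" by simp
  have "hq (\<Sum>i = 0..<n. d) (\<Prod>i = 0..<n. A $$ (i, p i))"
    by (rule hq_prod) (use permutes_in_image[OF p] assms(2) in simp_all)
  hence "hq (int n * d) (\<Prod>i = 0..<n. A $$ (i, p i))" by simp
  thus "hq (int n * d) (signof p * (\<Prod>i = 0..<n. A $$ (i, p i)))" by (cases p rule: sign_cases) (simp_all add: hq_uminus)
qed

section \<open>J and I as involutions of the function field\<close>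

lemma FC_hom: "comm_ring_hom (\<lambda>c. F (C c))"
  by unfold_locales (auto simp: C_add C_mult)

text \<open>The variables outside the matrix stay fixed, so that a birational involution of matrices
  induces an involution of the whole field.\<close>

definition evM :: "nat \<Rightarrow> mpoly fract mat \<Rightarrow> mpoly \<Rightarrow> mpoly fract" where
  "evM q Z = ev (\<lambda>c. F (C c)) (\<lambda>w. if w \<in> coords q then Z $$ w else F (V w))"

lemma evM_hom: "comm_ring_hom (evM q Z)"
  unfolding evM_def by (rule ev_hom[OF FC_hom])

lemma evM_C [simp]: "evM q Z (C c) = F (C c)"
  and evM_V: "evM q Z (V w) = (if w \<in> coords q then Z $$ w else F (V w))"
  by (simp_all add: evM_def FC_hom)

definition XP :: "nat \<Rightarrow> mpoly mat" where "XP q = mat q q (\<lambda>w. V w)"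

definition XF :: "nat \<Rightarrow> mpoly fract mat" where "XF q = mat q q (\<lambda>w. F (V w))"

lemma XP_carrier [simp]: "XP q \<in> carrier_mat q q" and XF_carrier [simp]: "XF q \<in> carrier_mat q q"
  by (simp_all add: XP_def XF_def)

lemma XP_index [simp]: "i < q \<Longrightarrow> j < q \<Longrightarrow> XP q $$ (i, j) = V (i, j)"
  and XF_index [simp]: "i < q \<Longrightarrow> j < q \<Longrightarrow> XF q $$ (i, j) = F (V (i, j))"
  by (simp_all add: XP_def XF_def)

lemma map_F_XP: "map_mat F (XP q) = XF q"
  by (rule eq_matI) (auto simp: XP_def XF_def)

lemma map_evM_XP: "Z \<in> carrier_mat q q \<Longrightarrow> map_mat (evM q Z) (XP q) = Z"
  by (rule eq_matI) (auto simp: XP_def evM_V coords_def)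

definition dt :: "nat \<Rightarrow> mpoly" where "dt q = det (XP q)"

lemma F_dt: "F (dt q) = det (XF q)"
proof -
  interpret comm_ring_hom F by (rule F_hom)
  show ?thesis by (simp add: dt_def flip: map_F_XP)
qed

lemma evM_dt: "Z \<in> carrier_mat q q \<Longrightarrow> evM q Z (dt q) = det Z"
proof -
  interpret comm_ring_hom "evM q Z" by (rule evM_hom)
  show "Z \<in> carrier_mat q q \<Longrightarrow> evM q Z (dt q) = det Z" by (simp add: dt_def map_evM_XP flip: hom_det)
qed

definition evC :: "complex mat \<Rightarrow> mpoly \<Rightarrow> complex" where
  "evC c = ev (\<lambda>x. x) (\<lambda>w. c $$ w)"

lemma evC_hom: "comm_ring_hom (evC c)"
  unfolding evC_def by (rule ev_hom[OF id_hom])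

lemma evC_C [simp]: "evC c (C a) = a" and evC_V [simp]: "evC c (V w) = c $$ w"
  by (simp_all add: evC_def id_hom)

lemma map_evC_XP: "c \<in> carrier_mat q q \<Longrightarrow> map_mat (evC c) (XP q) = c"
  by (rule eq_matI) (auto simp: XP_def)

lemma evC_dt: "c \<in> carrier_mat q q \<Longrightarrow> evC c (dt q) = det c"
proof -
  interpret comm_ring_hom "evC c" by (rule evC_hom)
  show "c \<in> carrier_mat q q \<Longrightarrow> evC c (dt q) = det c" by (simp add: dt_def map_evC_XP flip: hom_det)
qed

lemma evC_0 [simp]: "evC c 0 = 0"
  using evC_C[of c 0] by (simp del: evC_C)

lemma dt_nz [simp]: "dt q \<noteq> 0"
proof
  assume "dt q = 0"
  hence "evC (1\<^sub>m q) (dt q) = 0" by simp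
  thus False by (simp add: evC_dt[of _ q])
qed

lemma det_XF_nz [simp]: "det (XF q) \<noteq> 0"
  by (simp flip: F_dt)

lemma hm_dt: "hm q (dt q)"
  unfolding dt_def by (rule hm_det) (simp_all del: One_nat_def)

text \<open>The second half of the hypothesis on \<open>Z\<close> says that substituting twice gives
  back each variable. It is phrased through the numerator \<open>k\<close> because
  \<open>evM q Z\<close> acts on fractions only once it is known to be injective. The pair of
  identities is stable under sums and products, and injectivity is one of its consequences.\<close>

lemma involution_ext:
  fixes Z :: "mpoly fract mat"
  assumes E: "E \<noteq> 0" "evM q Z E = inverse (F E)"
    and Z: "\<And>w. w \<in> coords q \<Longrightarrow> \<exists>k N. Z $$ w = F k / F E ^ N \<and> evM q Z k = F (V w) * evM q Z E ^ N"
  shows "evM q Z f = 0 \<Longrightarrow> f = 0"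
    and "extF (evM q Z) (extF (evM q Z) x) = x"
    and "\<exists>k N. extF (evM q Z) (F h) = F k / F E ^ N"
proof -
  interpret ev: comm_ring_hom "evM q Z" by (rule evM_hom)
  have evE0: "evM q Z E \<noteq> 0" using E by simp
  have P: "\<exists>k N. evM q Z h = F k / F E ^ N \<and> evM q Z k = F h * evM q Z E ^ N" for h
  proof (induction h rule: mp_induct)
    case (C c) show ?case by (rule exI[of _ "C c"], rule exI[of _ 0]) simp
  next
    case (V w) show ?case
    proof (cases "w \<in> coords q")
      case True thus ?thesis using Z[of w] by (simp add: evM_V)
    next
      case False thus ?thesis by (intro exI[of _ "V w"] exI[of _ 0]) (simp add: evM_V)
    qed
  next
    case (add f g)
    then obtain k N k' N' where 1: "evM q Z f = F k / F E ^ N" "evM q Z k = F f * evM q Z E ^ N"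
      and 2: "evM q Z g = F k' / F E ^ N'" "evM q Z k' = F g * evM q Z E ^ N'" by blast
    have "evM q Z (f + g) = F (k * E ^ N' + k' * E ^ N) / F E ^ (N + N')"
      using E(1) by (simp add: ev.hom_add 1 2 F_power field_simps power_add)
    moreover have "evM q Z (k * E ^ N' + k' * E ^ N) = F (f + g) * evM q Z E ^ (N + N')"
      by (simp add: ev.hom_add ev.hom_mult ev.hom_power 1 2 algebra_simps power_add)
    ultimately show ?case by blast
  next
    case (mult f g)
    then obtain k N k' N' where 1: "evM q Z f = F k / F E ^ N" "evM q Z k = F f * evM q Z E ^ N"
      and 2: "evM q Z g = F k' / F E ^ N'" "evM q Z k' = F g * evM q Z E ^ N'" by blast
    have "evM q Z (f * g) = F (k * k') / F E ^ (N + N')"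
      using E(1) by (simp add: ev.hom_mult 1 2 F_power field_simps power_add)
    moreover have "evM q Z (k * k') = F (f * g) * evM q Z E ^ (N + N')"
      by (simp add: ev.hom_mult ev.hom_power 1 2 algebra_simps power_add)
    ultimately show ?case by blast
  qed
  have inj: "f = 0" if "evM q Z f = 0" for f
  proof -
    obtain k N where kN: "evM q Z f = F k / F E ^ N" "evM q Z k = F f * evM q Z E ^ N" using P by blast
    hence "k = 0" using that E by simp
    thus ?thesis using kN(2) evE0 by simp
  qed
  thus "evM q Z f = 0 \<Longrightarrow> f = 0" by blast
  note ex = extF_to_fract[OF evM_hom inj] extF_F[OF evM_hom inj]
  interpret x: comm_ring_hom "extF (evM q Z)" by (rule extF_hom[OF evM_hom inj])
  note fh = field_hom_facts[OF extF_hom[OF evM_hom inj]]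
  have FF: "extF (evM q Z) (extF (evM q Z) (F h)) = F h" for h
  proof -
    obtain k N where kN: "evM q Z h = F k / F E ^ N" "evM q Z k = F h * evM q Z E ^ N" using P by blast
    have "extF (evM q Z) (extF (evM q Z) (F h)) = evM q Z k / evM q Z E ^ N"
      by (simp add: ex kN(1) fh x.hom_power)
    thus ?thesis using kN(2) evE0 by simp
  qed
  show "extF (evM q Z) (extF (evM q Z) x) = x"
  proof -
    obtain a b where ab: "x = F a / F b" "b \<noteq> 0" by (rule fract_cases)
    thus ?thesis by (simp add: fh FF)
  qed
  show "\<exists>k N. extF (evM q Z) (F h) = F k / F E ^ N" using P[of h] by (auto simp: ex)
qed

definition pX :: "nat \<Rightarrow> mpoly" where "pX q = (\<Prod>w\<in>coords q. V w)"

lemma finite_coords [simp]: "finite (coords q)"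
  by (simp add: coords_def)

lemma pX_nz [simp]: "pX q \<noteq> 0"
  by (simp add: pX_def)

definition phiJ :: "nat \<Rightarrow> mpoly fract \<Rightarrow> mpoly fract" where "phiJ q = extF (evM q (Jm (XF q)))"
definition phiI :: "nat \<Rightarrow> mpoly fract \<Rightarrow> mpoly fract" where "phiI q = extF (evM q (Iv (XF q)))"

lemma evM_J_V: "w \<in> coords q \<Longrightarrow> evM q (Jm (XF q)) (V w) = inverse (F (V w))"
  by (cases w) (auto simp: evM_V coords_def Jm_index[of _ q])

lemma evM_J_pX: "evM q (Jm (XF q)) (pX q) = inverse (F (pX q))"
proof -
  interpret comm_ring_hom "evM q (Jm (XF q))" by (rule evM_hom)
  show ?thesis by (simp add: pX_def hom_prod F_prod evM_J_V prod_inversef[symmetric])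
qed

lemma J_aux:
  assumes w: "w \<in> coords q"
  shows "\<exists>k N. Jm (XF q) $$ w = F k / F (pX q) ^ N \<and> evM q (Jm (XF q)) k = F (V w) * evM q (Jm (XF q)) (pX q) ^ N"
proof -
  interpret comm_ring_hom "evM q (Jm (XF q))" by (rule evM_hom)
  let ?k = "\<Prod>u\<in>coords q - {w}. V u"
  have p: "pX q = V w * ?k" unfolding pX_def by (rule prod.remove) (use w in auto)
  have k0: "?k \<noteq> 0" by simp
  have "Jm (XF q) $$ w = inverse (F (V w))" using evM_J_V[OF w] w by (simp add: evM_V)
  hence "Jm (XF q) $$ w = F ?k / F (pX q) ^ 1" unfolding p using k0 by (simp add: field_simps)
  moreover have "evM q (Jm (XF q)) (pX q) = inverse (F (V w)) * evM q (Jm (XF q)) ?k"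
    unfolding p by (simp only: hom_mult evM_J_V[OF w])
  hence "evM q (Jm (XF q)) ?k = F (V w) * evM q (Jm (XF q)) (pX q) ^ 1" by (simp add: field_simps)
  ultimately show ?thesis by blast
qed

lemma evM_I_dt: "evM q (Iv (XF q)) (dt q) = inverse (F (dt q))"
  by (subst evM_dt) (auto simp: det_Im[of _ q] F_dt)

lemma F_adj: "i < q \<Longrightarrow> j < q \<Longrightarrow> F (adj_mat (XP q) $$ (i, j)) = adj_mat (XF q) $$ (i, j)"
  using adj_mat_hom[OF F_hom, of "XP q" q] adj_mat(1)[of "XP q" q] by (auto simp: map_F_XP)

lemma evM_adj:
  "Z \<in> carrier_mat q q \<Longrightarrow> i < q \<Longrightarrow> j < q \<Longrightarrow> evM q Z (adj_mat (XP q) $$ (i, j)) = adj_mat Z $$ (i, j)"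
  using adj_mat_hom[OF evM_hom[of q Z], of "XP q" q] adj_mat(1)[of "XP q" q] by (auto simp: map_evM_XP)

lemma I_aux:
  assumes w: "w \<in> coords q"
  shows "\<exists>k N. Iv (XF q) $$ w = F k / F (dt q) ^ N \<and> evM q (Iv (XF q)) k = F (V w) * evM q (Iv (XF q)) (dt q) ^ N"
proof -
  obtain i j where ij: "w = (i, j)" "i < q" "j < q" using w by (cases w) (auto simp: coords_def)
  let ?k = "adj_mat (XP q) $$ w"
  have "Iv (XF q) $$ w = F ?k / F (dt q) ^ 1"
    using ij adj_mat(1)[of "XF q" q] by (simp add: F_adj F_dt Iv_def field_simps)
  moreover have "evM q (Iv (XF q)) ?k = det (Iv (XF q)) * Iv (Iv (XF q)) $$ w"
    unfolding ij(1) by (subst evM_adj) (use ij adj_Im_index[of "Iv (XF q)" q] in \<open>auto simp: det_Im[of _ q]\<close>)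
  hence "evM q (Iv (XF q)) ?k = F (V w) * evM q (Iv (XF q)) (dt q) ^ 1"
    using ij by (simp add: Im_Im[of _ q] evM_dt)
  ultimately show ?thesis by blast
qed

lemma J_inj: "evM q (Jm (XF q)) f = 0 \<Longrightarrow> f = 0" and phiJ_phiJ: "phiJ q (phiJ q x) = x"
  and phiJ_pol: "\<exists>k N. phiJ q (F h) = F k / F (pX q) ^ N"
  using involution_ext[OF pX_nz evM_J_pX J_aux] unfolding phiJ_def by blast+

lemma I_inj: "evM q (Iv (XF q)) f = 0 \<Longrightarrow> f = 0" and phiI_phiI: "phiI q (phiI q x) = x"
  and phiI_pol: "\<exists>k N. phiI q (F h) = F k / F (dt q) ^ N"
  using involution_ext[OF dt_nz evM_I_dt I_aux] unfolding phiI_def by blast+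

lemma phiJ_hom: "comm_ring_hom (phiJ q)" and phiI_hom: "comm_ring_hom (phiI q)"
  unfolding phiJ_def phiI_def by (rule extF_hom[OF evM_hom J_inj] extF_hom[OF evM_hom I_inj], assumption)+

lemma phiJ_F: "phiJ q (F h) = evM q (Jm (XF q)) h" and phiI_F: "phiI q (F h) = evM q (Iv (XF q)) h"
  unfolding phiJ_def phiI_def by (rule extF_to_fract[OF evM_hom J_inj] extF_to_fract[OF evM_hom I_inj], assumption)+

lemma map_phiJ: "map_mat (phiJ q) (XF q) = Jm (XF q)" and map_phiI: "map_mat (phiI q) (XF q) = Iv (XF q)"
proof -
  have d: "dim_row (XF q) = q" "dim_col (XF q) = q" by (simp_all add: XF_def)
  show "map_mat (phiJ q) (XF q) = Jm (XF q)" by (rule eq_matI) (simp_all add: d phiJ_F evM_V coords_def)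
  show "map_mat (phiI q) (XF q) = Iv (XF q)" by (rule eq_matI) (simp_all add: d phiI_F evM_V coords_def)
qed

section \<open>The determinant is prime\<close>

lemma XPF_dim [simp]: "dim_row (XP q) = q" "dim_col (XP q) = q" "dim_row (XF q) = q" "dim_col (XF q) = q"
  by (simp_all add: XP_def XF_def)

text \<open>The grading by the variables in \<open>S\<close> alone. With a row or a column for
  \<open>S\<close> it restricts how the determinant can factor.\<close>

definition GS :: "var set \<Rightarrow> mpoly \<Rightarrow> mpoly poly" where
  "GS S = ev (\<lambda>c. [:C c:]) (\<lambda>w. if w \<in> S then [:0, V w:] else [:V w:])"

definition Z0 :: "var set \<Rightarrow> mpoly \<Rightarrow> mpoly" where
  "Z0 S = ev C (\<lambda>w. if w \<in> S then 0 else V w)"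

lemma GS_hom: "comm_ring_hom (GS S)" unfolding GS_def by (rule ev_hom[OF constP_hom])
lemma Z0_hom: "comm_ring_hom (Z0 S)" unfolding Z0_def by (rule ev_hom[OF C_hom])

lemma GS_C [simp]: "GS S (C c) = [:C c:]" and GS_V: "GS S (V w) = (if w \<in> S then [:0, V w:] else [:V w:])"
  by (simp_all add: GS_def constP_hom)
lemma Z0_C [simp]: "Z0 S (C c) = C c" and Z0_V: "Z0 S (V w) = (if w \<in> S then 0 else V w)"
  by (simp_all add: Z0_def C_hom)

lemma GS_add: "GS S (f + g) = GS S f + GS S g" and GS_mult: "GS S (f * g) = GS S f * GS S g"
proof -
  interpret comm_ring_hom "GS S" by (rule GS_hom)
  show "GS S (f + g) = GS S f + GS S g" "GS S (f * g) = GS S f * GS S g" by (simp_all add: hom_add hom_mult)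
qed

lemma Z0_add: "Z0 S (f + g) = Z0 S f + Z0 S g" and Z0_mult: "Z0 S (f * g) = Z0 S f * Z0 S g"
proof -
  interpret comm_ring_hom "Z0 S" by (rule Z0_hom)
  show "Z0 S (f + g) = Z0 S f + Z0 S g" "Z0 S (f * g) = Z0 S f * Z0 S g" by (simp_all add: hom_add hom_mult)
qed

lemma Z0_0: "Z0 S 0 = 0"
  using Z0_C[of S 0] by (simp del: Z0_C)

lemma poly_GS_1: "poly (GS S f) 1 = f"
  by (induction f rule: mp_induct) (auto simp: GS_V GS_add GS_mult)

lemma poly_GS_0: "poly (GS S f) 0 = Z0 S f"
  by (induction f rule: mp_induct) (auto simp: GS_V GS_add GS_mult Z0_V Z0_add Z0_mult)

lemma GS_deg0: "degree (GS S f) = 0 \<Longrightarrow> Z0 S f = f"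
proof -
  assume "degree (GS S f) = 0"
  then obtain c where c: "GS S f = [:c:]" by (rule degree_eq_zeroE)
  show ?thesis using poly_GS_1[of S f] poly_GS_0[of S f] by (simp add: c)
qed

lemma Z0_subset: "Z0 S f = f \<Longrightarrow> S' \<subseteq> S \<Longrightarrow> Z0 S' f = f"
proof -
  assume a: "Z0 S f = f" "S' \<subseteq> S"
  have "Z0 S' (Z0 S f) = Z0 S f" using a(2)
    by (induction f rule: mp_induct) (auto simp: Z0_V Z0_add Z0_mult Z0_0)
  thus ?thesis using a by simp
qed

lemma Z0_PV: "f \<in> PV A \<Longrightarrow> Z0 S f \<in> PV (A - S)"
  by (induction rule: PV.induct) (auto simp: Z0_V Z0_add Z0_mult intro: PV.intros)

lemma constP_hom': "comm_ring_hom (\<lambda>c :: mpoly. [:c:])"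
  by unfold_locales auto

text \<open>The substitution multiplies one row or one column by \<open>t\<close>, and the
  determinant is linear in each of them.\<close>

lemma GS_line_dt:
  assumes "S = (\<lambda>l. (i, l)) ` {..<q} \<or> S = (\<lambda>l. (l, i)) ` {..<q}" "i < q"
  shows "degree (GS S (dt q)) = 1"
proof -
  interpret comm_ring_hom "GS S" by (rule GS_hom)
  interpret c: comm_ring_hom "\<lambda>c :: mpoly. [:c:]" by (rule constP_hom')
  define d :: "nat \<Rightarrow> mpoly poly" where "d = (\<lambda>k. if k = i then [:0, 1:] else 1)"
  have pd: "(\<Prod>k<q. d k) = [:0, 1:]" unfolding d_def using assms(2) by (simp add: prod.delta)
  have "map_mat (GS S) (XP q) = scl q d (map_mat (\<lambda>c. [:c:]) (XP q)) (\<lambda>_. 1) \<or>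
        map_mat (GS S) (XP q) = scl q (\<lambda>_. 1) (map_mat (\<lambda>c. [:c:]) (XP q)) d"
    using assms(1)
  proof
    assume S: "S = (\<lambda>l. (i, l)) ` {..<q}"
    show ?thesis by (rule disjI1, rule eq_matI) (auto simp: GS_V S d_def XP_def scl_def)
  next
    assume S: "S = (\<lambda>l. (l, i)) ` {..<q}"
    show ?thesis by (rule disjI2, rule eq_matI) (auto simp: GS_V S d_def XP_def scl_def)
  qed
  hence "det (map_mat (GS S) (XP q)) = [:0, 1:] * det (map_mat (\<lambda>c. [:c:]) (XP q))"
    by (elim disjE) (simp_all add: det_scl pd)
  hence "GS S (dt q) = [:0, 1:] * [:dt q:]" by (simp only: hom_det c.hom_det dt_def)
  thus ?thesis by simp
qed

text \<open>The permutation matrix exchanging \<open>i\<close> and \<open>j\<close>. It is its own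
  inverse, and its only nonzero entry in row \<open>i\<close> is at \<open>(i, j)\<close>; this
  makes it a test point for the determinant and its cofactors.\<close>

definition Pt :: "nat \<Rightarrow> nat \<Rightarrow> nat \<Rightarrow> complex mat" where
  "Pt q i j = mat q q (\<lambda>(k, l). if l = Transposition.transpose i j k then 1 else 0)"

lemma Pt_carrier [simp]: "Pt q i j \<in> carrier_mat q q"
  by (simp add: Pt_def)

lemma transpose_lt: "i < q \<Longrightarrow> j < q \<Longrightarrow> k < q \<Longrightarrow> Transposition.transpose i j k < (q :: nat)"
  by (auto simp: Transposition.transpose_def)

lemma Pt_Pt:
  assumes "i < q" "j < q"
  shows "Pt q i j * Pt q i j = 1\<^sub>m q"
proof (rule eq_matI)
  fix k l assume kl: "k < dim_row (1\<^sub>m q :: complex mat)" "l < dim_col (1\<^sub>m q :: complex mat)"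
  let ?t = "Transposition.transpose i j"
  have "(Pt q i j * Pt q i j) $$ (k, l) =
      (\<Sum>m = 0..<q. (if m = ?t k then 1 else 0) * (if l = ?t m then 1 else 0))"
    using kl by (simp add: Pt_def scalar_prod_def)
  also have "\<dots> = (\<Sum>m = 0..<q. if m = ?t k then (if l = k then 1 else 0) else 0)"
    by (rule sum.cong) auto
  also have "\<dots> = (if l = k then 1 else 0)"
    using transpose_lt[OF assms, of k] kl by (simp add: sum.delta)
  finally show "(Pt q i j * Pt q i j) $$ (k, l) = 1\<^sub>m q $$ (k, l)" using kl by auto
qed (auto simp: Pt_def)

lemma Pt_facts:
  assumes "i < q" "j < q"
  shows "det (Pt q i j) \<noteq> 0" "Iv (Pt q i j) = Pt q i j"
  using Im_unique[OF Pt_carrier Pt_carrier Pt_Pt[OF assms]] by auto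

lemma Pt_index: "i < q \<Longrightarrow> j < q \<Longrightarrow> Pt q i j $$ (i, j) = 1"
  by (simp add: Pt_def)

text \<open>The determinant really involves \<open>x_ij\<close>: at \<open>Pt q i j\<close> it is
  nonzero, but setting the entry \<open>(i, j)\<close> to 0 leaves a zero row.\<close>

lemma Z0_dt:
  assumes ij: "i < q" "j < q"
  shows "Z0 {(i, j)} (dt q) \<noteq> dt q"
proof
  assume eq: "Z0 {(i, j)} (dt q) = dt q"
  define g where "g = (\<lambda>w. Pt q i j $$ w)"
  define g' where "g' = g((i, j) := 0)"
  interpret a: comm_ring_hom "ev (\<lambda>x. x) g'" by (rule ev_hom[OF id_hom])
  have "ev (\<lambda>x. x) g (Z0 {(i, j)} f) = ev (\<lambda>x. x) g' f" for f
  proof -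
    interpret b: comm_ring_hom "ev (\<lambda>x. x) g" by (rule ev_hom[OF id_hom])
    show ?thesis
    proof (induction f rule: mp_induct)
      case (V v) thus ?case by (auto simp: id_hom Z0_V g'_def)
    qed (simp_all add: id_hom Z0_add Z0_mult a.hom_add a.hom_mult b.hom_add b.hom_mult)
  qed
  hence "ev (\<lambda>x. x) g (dt q) = ev (\<lambda>x. x) g' (dt q)" using eq by metis
  moreover have "ev (\<lambda>x. x) g (dt q) = det (Pt q i j)" using evC_dt[of "Pt q i j" q] by (simp add: evC_def g_def)
  moreover have "ev (\<lambda>x. x) g' (dt q) = 0"
  proof -
    let ?M = "map_mat (ev (\<lambda>x. x) g') (XP q)"
    have "ev (\<lambda>x. x) g' (dt q) = det ?M" by (simp add: dt_def)
    also have "\<dots> = (\<Sum>l<q. ?M $$ (i, l) * cofactor ?M i l)"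
      by (rule laplace_expansion_row) (use ij in auto)
    also have "\<dots> = 0"
    proof (rule sum.neutral, intro ballI)
      fix l assume "l \<in> {..<q}"
      hence "?M $$ (i, l) = g' (i, l)" using ij by (simp add: id_hom)
      also have "\<dots> = 0" using ij \<open>l \<in> {..<q}\<close> by (auto simp: g'_def g_def Pt_def)
      finally show "?M $$ (i, l) * cofactor ?M i l = 0" by simp
    qed
    finally show ?thesis .
  qed
  ultimately show False using Pt_facts[OF ij] by simp
qed

lemma PV_det:
  assumes "A \<in> carrier_mat n n" "\<And>i j. i < n \<Longrightarrow> j < n \<Longrightarrow> A $$ (i, j) \<in> PV B"
  shows "det A \<in> PV B"
  unfolding det_def'[OF assms(1)]
proof (rule PV_sum)
  have pr: "(\<Prod>i\<in>S. f i) \<in> PV B" if "\<And>i. i \<in> S \<Longrightarrow> f i \<in> PV B" for f and S :: "nat set"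
    using that by (induction S rule: infinite_finite_induct) (simp_all add: PV_mult)
  fix p assume "p \<in> {p. p permutes {0..<n}}"
  hence p: "p permutes {0..<n}" by simp
  have "(\<Prod>i = 0..<n. A $$ (i, p i)) \<in> PV B"
    by (rule pr) (use permutes_in_image[OF p] assms(2) in simp)
  thus "signof p * (\<Prod>i = 0..<n. A $$ (i, p i)) \<in> PV B"
    by (cases p rule: sign_cases) (simp_all add: PV_uminus)
qed

lemma dt_PV: "dt q \<in> PV (coords q)"
  unfolding dt_def by (rule PV_det[of _ q]) (simp_all add: coords_def PV_V)

context mdim
begin

text \<open>In a factorization each row and each column has degree 1 in one factor and 0 in the
  other. If \<open>g\<close> has degree 0 in row 0, no column can belong to \<open>g\<close>, since
  its entry in row 0 would then occur in neither factor although the determinant involves it. So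
  \<open>g\<close> contains no variable at all.\<close>

lemma prime_dt: "prime_elem (dt q)"
proof (rule irreducible_prime_elem, unfold irreducible_def, intro conjI allI impI)
  show "dt q \<noteq> 0" by simp
  show "\<not> dt q dvd 1" using unit_iff[of "dt q"] hm_tdeg[OF hm_dt, of q] q0 by simp
  fix f g assume fg: "dt q = f * g"
  let ?R = "\<lambda>i. (\<lambda>l. (i, l)) ` {..<q}" and ?C = "\<lambda>j. (\<lambda>l. (l, j)) ` {..<q}"
  have nz: "f \<noteq> 0" "g \<noteq> 0" using fg dt_nz[of q] by auto
  have GS_nz: "GS S h \<noteq> 0" if "h \<noteq> 0" for S h using poly_GS_1[of S h] that by auto
  have deg: "degree (GS S f) + degree (GS S g) = 1" if "S = ?R i \<or> S = ?C i" "i < q" for S i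
    using GS_line_dt[OF that] by (simp add: fg GS_mult degree_mult_eq GS_nz nz)
  have main: "g dvd 1" if fg: "dt q = f * g" "degree (GS (?R 0) g) = 0" 
     and deg: "\<And>S i. S = ?R i \<or> S = ?C i \<Longrightarrow> i < q \<Longrightarrow> degree (GS S f) + degree (GS S g) = 1" for f g
  proof -
    have gC: "Z0 (?C j) g = g" if j: "j < q" for j
    proof (rule ccontr)
      assume "Z0 (?C j) g \<noteq> g"
      hence "degree (GS (?C j) g) \<noteq> 0" using GS_deg0 by blast
      hence "degree (GS (?C j) f) = 0" using deg[of "?C j" j] j by simp
      hence "Z0 {(0, j)} f = f" using GS_deg0 Z0_subset[of "?C j" f "{(0, j)}"] q0 by force
      moreover have "Z0 {(0, j)} g = g" using GS_deg0[OF fg(2)] Z0_subset[of "?R 0" g "{(0, j)}"] j by force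
      ultimately have "Z0 {(0, j)} (dt q) = dt q" by (simp add: fg Z0_mult)
      thus False using Z0_dt q0 j by blast
    qed
    have "g \<in> PV (coords q)" using PV_factor2[of f g "coords q"] fg(1) dt_PV[of q] dt_nz[of q] by simp
    moreover have "g \<in> PV (coords q) \<Longrightarrow> g \<in> PV (coords q - (\<Union>j<n. ?C j))" if "n \<le> q" for n
      using that
    proof (induction n)
      case (Suc n)
      have "Z0 (?C n) g \<in> PV (coords q - (\<Union>j<n. ?C j) - ?C n)" using Suc by (intro Z0_PV) auto
      also have "coords q - (\<Union>j<n. ?C j) - ?C n = coords q - (\<Union>j<Suc n. ?C j)" by (auto simp: lessThan_Suc)
      finally show ?case using gC[of n] Suc by simp
    qed auto
    ultimately have "g \<in> PV (coords q - (\<Union>j<q. ?C j))" by blast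
    also have "coords q - (\<Union>j<q. ?C j) = {}" by (auto simp: coords_def)
    finally obtain c where c: "g = C c" using PV_empty by blast
    moreover have "g \<noteq> 0" using fg dt_nz[of q] by auto
    ultimately show "g dvd 1" by (simp add: unit_iff)
  qed
  have "degree (GS (?R 0) g) = 0 \<or> degree (GS (?R 0) f) = 0" using deg[of "?R 0" 0] q0 by auto
  thus "f dvd 1 \<or> g dvd 1"
  proof
    assume "degree (GS (?R 0) g) = 0"
    thus ?thesis using main[of f g] fg deg by blast
  next
    assume "degree (GS (?R 0) f) = 0"
    thus ?thesis using main[of g f] fg deg by (simp add: mult.commute add.commute)
  qed
qed

definition rp :: "nat \<Rightarrow> nat \<Rightarrow> mpoly" where "rp i j = adj_mat (XP q) $$ (i, j)"

lemma hm_PV_mat_delete: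
  assumes "i < q" "j < q"
  shows "mat_delete (XP q) i j \<in> carrier_mat (q - 1) (q - 1)"
    "a < q - 1 \<Longrightarrow> b < q - 1 \<Longrightarrow> \<exists>w\<in>coords q. mat_delete (XP q) i j $$ (a, b) = V w"
proof -
  show "mat_delete (XP q) i j \<in> carrier_mat (q - 1) (q - 1)" by (auto simp: mat_delete_def XP_def)
  show "\<exists>w\<in>coords q. mat_delete (XP q) i j $$ (a, b) = V w" if "a < q - 1" "b < q - 1"
    by (rule bexI[of _ "(if a < i then a else Suc a, if b < j then b else Suc b)"])
      (use that assms in \<open>auto simp: mat_delete_def coords_def\<close>)
qed

lemma rp_facts:
  assumes ij: "i < q" "j < q"
  shows "rp i j \<in> PV (coords q)" "hm (q - 1) (rp i j)" "rp i j \<noteq> 0"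
proof -
  let ?M = "mat_delete (XP q) j i"
  note M = hm_PV_mat_delete[OF ij(2,1)]
  have eq: "rp i j = (-1) ^ (j + i) * det ?M"
    using ij adj_mat(1)[of "XP q" q] by (simp add: rp_def adj_mat_def cofactor_def)
  have "hm (q - 1) (det ?M)"
  proof (rule hm_det[OF M(1)])
    fix a b assume "a < q - 1" "b < q - 1"
    then obtain w where "?M $$ (a, b) = V w" using M(2) by blast
    thus "hm 1 (?M $$ (a, b))" by (simp only: hm_V)
  qed
  hence "hm (q - 1) (- det ?M)" by (rule hm_uminus)
  thus "hm (q - 1) (rp i j)" unfolding eq using \<open>hm (q - 1) (det ?M)\<close> by (cases "even (j + i)") auto
  have "det ?M \<in> PV (coords q)" 
    by (rule PV_det[OF M(1)]) (use M(2) in \<open>metis PV_V\<close>)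
  thus "rp i j \<in> PV (coords q)" unfolding eq using PV_uminus by (cases "even (j + i)") auto
  show "rp i j \<noteq> 0"
  proof
    assume "rp i j = 0"
    hence "0 = evC (Pt q i j) (rp i j)" by simp
    also have "\<dots> = adj_mat (map_mat (evC (Pt q i j)) (XP q)) $$ (i, j)"
      using adj_mat_hom[OF evC_hom, of "XP q" q] adj_mat(1)[of "XP q" q] ij by (simp add: rp_def)
    also have "\<dots> = det (Pt q i j) * Pt q i j $$ (i, j)"
      using adj_Im_index[of "Pt q i j" q i j] Pt_facts[OF ij] ij by (simp add: map_evC_XP)
    finally show False using Pt_facts[OF ij] Pt_index[OF ij] by simp
  qed
qed

definition vd :: "mpoly fract \<Rightarrow> int" where "vd = valp (dt q)"

sublocale vd: valuation vd
  unfolding vd_def by (rule valp_valuation[OF prime_dt])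

lemma vd_F: "f \<noteq> 0 \<Longrightarrow> vd (F f) = int (ordp (dt q) f)"
  unfolding vd_def by (rule valp_to_fract[OF prime_dt])

lemma vd_vge0_F [simp]: "vd.vge 0 (F f)"
  by (cases "f = 0") (auto simp: vd.vge_def vd_F)

lemma vd_dt: "vd (F (dt q)) = 1"
  using ordp_eqI[OF prime_dt, of 1 1] prime_dt by (auto simp: vd_F prime_elem_def)

text \<open>A nonzero polynomial of degree \<open>q - 1\<close> is too small to be divisible by the
  determinant.\<close>

lemma vd_rp:
  assumes "i < q" "j < q"
  shows "vd (F (rp i j)) = 0"
proof -
  note r = rp_facts[OF assms]
  have "\<not> dt q dvd rp i j"
  proof
    assume "dt q dvd rp i j"
    then obtain h where h: "rp i j = dt q * h" ..
    hence "h \<noteq> 0" using r by auto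
    hence "tdeg (rp i j) = q + tdeg h" using h hm_tdeg[OF hm_dt dt_nz] by (simp add: tdeg_mult)
    thus False using hm_tdeg[OF r(2,3)] q0 by simp
  qed
  thus ?thesis using ordp_pos_iff[OF prime_dt r(3)] by (simp add: vd_F r)
qed

end

section \<open>The divisor of the determinant\<close>

lemma (in valuation) vge_1_det_diff:
  assumes "A \<in> carrier_mat n n" "B \<in> carrier_mat n n"
    "\<And>i j. i < n \<Longrightarrow> j < n \<Longrightarrow> vge 0 (A $$ (i, j))" "\<And>i j. i < n \<Longrightarrow> j < n \<Longrightarrow> vge 0 (B $$ (i, j))"
    "\<And>i j. i < n \<Longrightarrow> j < n \<Longrightarrow> vge 1 (A $$ (i, j) - B $$ (i, j))"
  shows "vge 1 (det A - det B)"
proof -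
  have "det A - det B = (\<Sum>p | p permutes {0..<n}. signof p * ((\<Prod>i = 0..<n. A $$ (i, p i)) - (\<Prod>i = 0..<n. B $$ (i, p i))))"
    unfolding det_def'[OF assms(1)] det_def'[OF assms(2)] by (simp add: sum_subtractf right_diff_distrib)
  moreover have "vge 1 (signof p * ((\<Prod>i = 0..<n. A $$ (i, p i)) - (\<Prod>i = 0..<n. B $$ (i, p i))))"
    if p: "p permutes {0..<n}" for p
  proof -
    have "vge 1 ((\<Prod>i = 0..<n. A $$ (i, p i)) - (\<Prod>i = 0..<n. B $$ (i, p i)))"
      by (rule vge_1_prod_diff) (use permutes_in_image[OF p] assms(3-5) in simp_all)
    moreover have "- (\<Prod>i = 0..<n. A $$ (i, p i)) + (\<Prod>i = 0..<n. B $$ (i, p i)) =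
       - ((\<Prod>i = 0..<n. A $$ (i, p i)) - (\<Prod>i = 0..<n. B $$ (i, p i)))" by simp
    ultimately show ?thesis
      by (cases p rule: sign_cases) (simp_all only: of_int_1 of_int_minus mult_1_left mult_minus_left vge_uminus)
  qed
  ultimately show ?thesis by (auto intro!: vge_sum)
qed

lemma Iv_mult:
  fixes A :: "'a::field mat"
  assumes "A \<in> carrier_mat n n" "B \<in> carrier_mat n n" "det A \<noteq> 0" "det B \<noteq> 0"
  shows "Iv (A * B) = Iv B * Iv A"
proof (rule Im_unique(2)[of _ n])
  have I: "Iv A \<in> carrier_mat n n" "Iv B \<in> carrier_mat n n" using assms by auto
  have "(A * B) * (Iv B * Iv A) = A * (B * (Iv B * Iv A))"
    by (rule assoc_mult_mat[OF assms(1,2) mult_carrier_mat[OF I(2,1)]])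
  also have "B * (Iv B * Iv A) = (B * Iv B) * Iv A"
    by (rule assoc_mult_mat[OF assms(2) I(2,1), symmetric])
  also have "\<dots> = Iv A" using Im_inverse(1)[OF assms(2,4)] left_mult_one_mat[OF I(1)] by simp
  finally show "(A * B) * (Iv B * Iv A) = 1\<^sub>m n" using Im_inverse(1)[OF assms(1,3)] by simp
qed (use assms in auto)

context mdim
begin

abbreviation "X \<equiv> XF q"
abbreviation "d \<equiv> F (dt q)"
abbreviation "r i j \<equiv> F (rp i j)"

text \<open>The images of the generic matrix under I, J I and I J I. Since \<open>d\<close> times
  \<open>YY\<close> is the adjugate, whose entries the determinant does not divide,
  \<open>YY\<close> has a simple pole and \<open>ZZ\<close> a simple zero in every entry along
  \<open>det x = 0\<close>.\<close>

definition "YY = Iv X"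
definition "ZZ = Jm YY"
definition "WW = Iv ZZ"

lemma YZW_carrier [simp]: "YY \<in> carrier_mat q q" "ZZ \<in> carrier_mat q q" "WW \<in> carrier_mat q q"
  by (simp_all add: YY_def ZZ_def WW_def)

lemma YZW_dim [simp]: "dim_row YY = q" "dim_col YY = q" "dim_row ZZ = q" "dim_col ZZ = q" "dim_row WW = q" "dim_col WW = q"
  by (simp_all add: YY_def ZZ_def WW_def)

lemma d_nz [simp]: "d \<noteq> 0" by simp

lemma r_nz: "i < q \<Longrightarrow> j < q \<Longrightarrow> r i j \<noteq> 0"
  using rp_facts(3) by simp

lemma r_YY: "i < q \<Longrightarrow> j < q \<Longrightarrow> r i j = d * YY $$ (i, j)"
  by (simp add: rp_def F_adj adj_Im_index[of _ q] F_dt YY_def)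

lemma YY_r: "i < q \<Longrightarrow> j < q \<Longrightarrow> YY $$ (i, j) = r i j / d"
  by (simp add: r_YY)

lemma ZZ_r: "i < q \<Longrightarrow> j < q \<Longrightarrow> ZZ $$ (i, j) = d / r i j"
  unfolding ZZ_def by (simp add: Jm_index[of _ q] YY_r)

section \<open>The order of \<open>det (J I x)\<close> along \<open>det x = 0\<close>\<close>

definition "m = q - 1"

lemma q_Suc: "q = Suc m" using q0 by (simp add: m_def)

lemma lt_m: "i < m \<longleftrightarrow> Suc i < q" using q_Suc by linarith

lemma int_m: "int m = int q - 1" using q_Suc by linarith

lemma sum_q: "(\<Sum>k = 0..<q. f k) = f 0 + (\<Sum>k = 0..<m. f (Suc k))"
  using sum.atLeast0_lessThan_Suc_shift[of f m, folded q_Suc] by (simp add: o_def)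

definition "BP = mat_delete (XP q) 0 0"

definition "b i j = F (adj_mat BP $$ (i, j))"

lemma BP_carrier: "BP \<in> carrier_mat m m"
  by (auto simp: BP_def mat_delete_def m_def)

lemma BP_index: "i < m \<Longrightarrow> j < m \<Longrightarrow> map_mat F BP $$ (i, j) = X $$ (Suc i, Suc j)"
  using BP_carrier by (auto simp: BP_def mat_delete_def lt_m)

lemma det_BP: "F (det BP) = r 0 0"
  using q0 by (simp add: rp_def adj_mat_def cofactor_def BP_def)

text \<open>Jacobi's identity for 2 by 2 minors of the adjugate. The inverse of the block
  \<open>BP\<close> of \<open>X\<close> is the Schur complement of \<open>YY $$ (0, 0)\<close> in
  \<open>YY\<close>. Modulo \<open>d\<close> the identity says that the adjugate has rank
  one.\<close>

lemma adj_minor: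
  assumes ij: "i < m" "j < m"
  shows "r 0 0 * r (Suc i) (Suc j) - r (Suc i) 0 * r 0 (Suc j) = d * b i j"
proof -
  interpret F: comm_ring_hom F by (rule F_hom)
  define Q where "Q = mat m m (\<lambda>(i, j). YY $$ (Suc i, Suc j) - YY $$ (Suc i, 0) * YY $$ (0, Suc j) / YY $$ (0, 0))"
  let ?B = "map_mat F BP"
  have B: "?B \<in> carrier_mat m m" using BP_carrier by simp
  have Y00: "YY $$ (0, 0) \<noteq> 0" using q0 r_nz by (simp add: YY_r)
  have XY: "(\<Sum>k = 0..<m. X $$ (i, Suc k) * YY $$ (Suc k, j)) = (if i = j then 1 else 0) - X $$ (i, 0) * YY $$ (0, j)"
    if "i < q" "j < q" for i j
  proof -
    have "(X * YY) $$ (i, j) = (\<Sum>k = 0..<q. X $$ (i, k) * YY $$ (k, j))"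
      using that by (simp add: scalar_prod_def)
    also have "\<dots> = X $$ (i, 0) * YY $$ (0, j) + (\<Sum>k = 0..<m. X $$ (i, Suc k) * YY $$ (Suc k, j))"
      by (rule sum_q)
    finally show ?thesis using that Im_inverse(1)[of X q] by (simp add: YY_def algebra_simps)
  qed
  have "?B * Q = 1\<^sub>m m"
  proof (rule eq_matI)
    fix i j assume ij: "i < dim_row (1\<^sub>m m :: mpoly fract mat)" "j < dim_col (1\<^sub>m m :: mpoly fract mat)"
    hence "(?B * Q) $$ (i, j) = (\<Sum>k = 0..<m. X $$ (Suc i, Suc k) * 
        (YY $$ (Suc k, Suc j) - YY $$ (Suc k, 0) * YY $$ (0, Suc j) / YY $$ (0, 0)))"
      using BP_carrier by (auto simp: scalar_prod_def BP_index Q_def simp del: index_map_mat intro!: sum.cong)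
    also have "\<dots> = (\<Sum>k = 0..<m. X $$ (Suc i, Suc k) * YY $$ (Suc k, Suc j)) -
       (\<Sum>k = 0..<m. X $$ (Suc i, Suc k) * YY $$ (Suc k, 0)) * (YY $$ (0, Suc j) / YY $$ (0, 0))"
      by (simp add: sum_subtractf right_diff_distrib sum_distrib_right sum_divide_distrib mult.assoc)
    also have "\<dots> = (if i = j then 1 else 0)"
      using ij Y00 q0 by (subst (1 2) XY) (auto simp: lt_m)
    finally show "(?B * Q) $$ (i, j) = 1\<^sub>m m $$ (i, j)" using ij by simp
  qed (use BP_carrier in \<open>auto simp: Q_def\<close>)
  hence I: "det ?B \<noteq> 0" "Iv ?B = Q" using Im_unique[OF B, of Q] by (auto simp: Q_def)
  have "b i j = adj_mat ?B $$ (i, j)"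
    using adj_mat_hom[OF F_hom BP_carrier] adj_mat(1)[OF BP_carrier] ij by (simp add: b_def)
  also have "\<dots> = r 0 0 * Q $$ (i, j)" using adj_Im_index[OF B I(1) ij] I(2) by (simp add: det_BP)
  also have "\<dots> = r 0 0 * (r (Suc i) (Suc j) / d - (r (Suc i) 0 / d) * (r 0 (Suc j) / d) / (r 0 0 / d))"
    using ij q0 by (simp add: Q_def YY_r lt_m)
  finally show ?thesis using r_nz[OF q0 q0] by (simp add: field_simps)
qed

definition "LL = mat m m (\<lambda>(i, j). - b i j / r (Suc i) (Suc j))"

lemma vge_div_unit: "vd.vge n x \<Longrightarrow> y \<noteq> 0 \<Longrightarrow> vd y = 0 \<Longrightarrow> vd.vge n (x / y)"
  by (cases "x = 0") (auto simp: vd.vge_def vd.v_divide)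

text \<open>Modulo \<open>d\<close>, the relation of rank one from \<open>adj_minor\<close> turns
  \<open>LL\<close> into a row and column scaling of the adjugate of \<open>BP\<close>, whose
  determinant times \<open>r 0 0\<close> is a power of the unit \<open>r 0 0\<close>.\<close>

lemma det_LL: "det LL \<noteq> 0" "vd (det LL) = 0"
proof -
  interpret F: comm_ring_hom F by (rule F_hom)
  define b' where "b' = map_mat F (adj_mat BP)"
  define L' where "L' = scl m (\<lambda>i. - r 0 0 / r (Suc i) 0) b' (\<lambda>j. 1 / r 0 (Suc j))"
  have b': "b' \<in> carrier_mat m m" using adj_mat(1)[OF BP_carrier] by (simp add: b'_def)
  have b'_ij: "b' $$ (i, j) = b i j" if "i < m" "j < m" for i j
    using that adj_mat(1)[OF BP_carrier] by (auto simp: b'_def b_def)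
  note r = r_nz[OF q0 q0] vd_rp[OF q0 q0]
  have rs: "r (Suc i) 0 \<noteq> 0" "r 0 (Suc i) \<noteq> 0" "vd (r (Suc i) 0) = 0" "vd (r 0 (Suc i)) = 0" if "i < m" for i
    using that q0 r_nz vd_rp by (auto simp: lt_m)
  have "adj_mat BP * BP = det BP \<cdot>\<^sub>m 1\<^sub>m m" using adj_mat(3)[OF BP_carrier] .
  hence "det (adj_mat BP * BP) = det BP ^ m" by simp
  hence "det (adj_mat BP) * det BP = det BP ^ m" using det_mult[OF adj_mat(1)[OF BP_carrier] BP_carrier] by simp
  hence "F (det (adj_mat BP)) * F (det BP) = F (det BP) ^ m" by (metis to_fract_mult F_power)
  hence e: "det b' * r 0 0 = r 0 0 ^ m" by (simp add: b'_def det_BP)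
  hence b'0: "det b' \<noteq> 0" using r by auto
  have "vd (det b') = 0"
    using arg_cong[OF e, of vd] b'0 r by (simp add: vd.v_mult vd.v_power)
  moreover have "vd (\<Prod>i<m. - r 0 0 / r (Suc i) 0) = 0"
    by (subst vd.v_prod) (use r rs in \<open>auto simp: vd.v_divide vd.v_uminus\<close>)
  moreover have "vd (\<Prod>j<m. 1 / r 0 (Suc j)) = 0"
    by (subst vd.v_prod) (use r rs in \<open>auto simp: vd.v_divide\<close>)
  ultimately have L'v: "det L' \<noteq> 0" "vd (det L') = 0"
    unfolding L'_def det_scl[OF b'] using b'0 r rs
    by (auto simp: vd.v_mult)
  have "vd.vge 1 (det LL - det L')"
  proof (rule vd.vge_1_det_diff[of _ m])
    show "LL \<in> carrier_mat m m" "L' \<in> carrier_mat m m" by (auto simp: LL_def L'_def)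
    fix i j assume ij: "i < m" "j < m"
    have rij: "r (Suc i) (Suc j) \<noteq> 0" "vd (r (Suc i) (Suc j)) = 0" using ij r_nz vd_rp by (auto simp: lt_m)
    have bv: "vd.vge 0 (b i j)" by (simp add: b_def)
    show "vd.vge 0 (LL $$ (i, j))" using ij rij bv by (auto simp: LL_def intro!: vge_div_unit simp: vd.vge_uminus)
    have L'ij: "L' $$ (i, j) = - (r 0 0 * b i j) / (r (Suc i) 0 * r 0 (Suc j))"
      using ij by (simp add: L'_def b'_ij)
    show "vd.vge 0 (L' $$ (i, j))" unfolding L'ij
      using rs ij bv r vd.vge_mult0[of "r 0 0" "b i j"] by (intro vge_div_unit) (auto simp: vd.v_mult vd.vge_uminus)
    have "LL $$ (i, j) - L' $$ (i, j) =
        b i j * (r 0 0 * r (Suc i) (Suc j) - r (Suc i) 0 * r 0 (Suc j)) / (r (Suc i) 0 * r 0 (Suc j) * r (Suc i) (Suc j))"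
      unfolding L'ij using ij rij rs[OF ij(1)] rs[OF ij(2)] by (simp add: LL_def field_simps)
    also have "\<dots> = (b i j * (d * b i j)) / (r (Suc i) 0 * r 0 (Suc j) * r (Suc i) (Suc j))"
      unfolding adj_minor[OF ij] ..
    also have "vd.vge 1 \<dots>"
    proof (rule vge_div_unit)
      have "vd.vge 1 d" by (simp add: vd.vge_def vd_dt)
      thus "vd.vge 1 (b i j * (d * b i j))" using vd.vge_mult[OF bv vd.vge_mult[of 1 d 0 "b i j"]] bv by simp
    qed (use rs ij rij in \<open>auto simp: vd.v_mult\<close>)
    finally show "vd.vge 1 (LL $$ (i, j) - L' $$ (i, j))" .
  qed
  thus "det LL \<noteq> 0" "vd (det LL) = 0" using vd.unit_cong[OF L'v] by auto
qed

text \<open>Arises by writing \<open>ZZ\<close> as a scaling of the matrix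
  \<open>r i 0 * r 0 j / r i j\<close> and subtracting its row 0 from the other rows: by
  \<open>adj_minor\<close> every difference is divisible by \<open>d\<close>, and \<open>NT\<close>
  keeps the quotients. Undoing this, \<open>NN\<close> below is a unipotent matrix times
  \<open>diag(1, d, ..., d)\<close> times \<open>NT\<close>.\<close>

definition "NT = mat q q (\<lambda>(i, j). if i = 0 then r 0 0 else if j = 0 then 0 else - b (i - 1) (j - 1) / r i j)"

lemma NT_carrier [simp]: "NT \<in> carrier_mat q q" by (simp add: NT_def)

lemma det_NT_eq: "det NT = r 0 0 * det LL"
proof -
  have "det NT = (\<Sum>i<q. NT $$ (i, 0) * cofactor NT i 0)"
    by (rule laplace_expansion_column) (use q0 in auto)
  also have "\<dots> = (\<Sum>i<q. if i = 0 then r 0 0 * cofactor NT 0 0 else 0)"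
    by (rule sum.cong) (use q0 in \<open>auto simp: NT_def\<close>)
  also have "\<dots> = r 0 0 * cofactor NT 0 0" using q0 by (simp add: sum.delta)
  also have "mat_delete NT 0 0 = LL"
    by (rule eq_matI) (auto simp: mat_delete_def NT_def LL_def m_def)
  hence "cofactor NT 0 0 = det LL" by (simp add: cofactor_def)
  finally show ?thesis .
qed

lemma det_NT: "det NT \<noteq> 0" "vd (det NT) = 0"
  unfolding det_NT_eq using det_LL r_nz[OF q0 q0] vd_rp[OF q0 q0] by (auto simp: vd.v_mult)

definition "low s = mat q q (\<lambda>(i, j). if i = j then 1 else if j = 0 then s else (0 :: mpoly fract))"

lemma low_carrier [simp]: "low s \<in> carrier_mat q q" by (simp add: low_def)

lemma low_mult:
  assumes "A \<in> carrier_mat q q" "i < q" "j < q"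
  shows "(low s * A) $$ (i, j) = (if i = 0 then A $$ (0, j) else s * A $$ (0, j) + A $$ (i, j))"
proof -
  have "(low s * A) $$ (i, j) = (\<Sum>k = 0..<q. (if i = k then 1 else if k = 0 then s else 0) * A $$ (k, j))"
    using assms by (auto simp: low_def scalar_prod_def intro!: sum.cong)
  also have "\<dots> = (\<Sum>k = 0..<q. (if k = i then A $$ (i, j) else 0) + (if k = 0 then (if i = 0 then 0 else s * A $$ (0, j)) else 0))"
    by (rule sum.cong) auto
  also have "\<dots> = (if i = 0 then A $$ (0, j) else s * A $$ (0, j) + A $$ (i, j))"
    using assms q0 by (simp add: sum.distrib sum.delta)
  finally show ?thesis .
qed

lemma low_inv: "low 1 * low (-1) = 1\<^sub>m q"
proof (rule eq_matI)
  fix i j assume ij: "i < dim_row (1\<^sub>m q :: mpoly fract mat)" "j < dim_col (1\<^sub>m q :: mpoly fract mat)"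
  show "(low 1 * low (-1)) $$ (i, j) = 1\<^sub>m q $$ (i, j)"
    using ij by (subst low_mult) (auto simp: low_def)
qed (auto simp: low_def)

lemma det_low: "det (low s) = 1"
proof -
  have "det (low s) = prod_list (diag_mat (low s))"
    by (rule det_lower_triangular[of q]) (auto simp: low_def)
  also have "diag_mat (low s) = replicate q 1" by (rule nth_equalityI) (auto simp: diag_mat_def low_def)
  finally show ?thesis by simp
qed

definition "DD i = (if i = (0::nat) then 1 else d)"

definition "NN = low 1 * scl q DD NT (\<lambda>_. 1)"

lemma NN_carrier [simp]: "NN \<in> carrier_mat q q" unfolding NN_def using low_carrier scl_carrier by (rule mult_carrier_mat)

lemma NN_index:
  assumes ij: "i < q" "j < q"
  shows "NN $$ (i, j) = r i 0 * r 0 j / r i j"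
proof -
  have NN: "NN $$ (i, j) = (if i = 0 then r 0 0 else if j = 0 then r 0 0 else r 0 0 - d * b (i - 1) (j - 1) / r i j)"
    unfolding NN_def using ij q0 by (subst low_mult) (auto simp: DD_def NT_def)
  show ?thesis
  proof (cases "i = 0 \<or> j = 0")
    case True
    thus ?thesis using ij r_nz by (auto simp: NN)
  next
    case False
    then obtain i' j' where ij': "i = Suc i'" "j = Suc j'" by (metis not0_implies_Suc)
    hence "i' < m" "j' < m" using ij by (auto simp: lt_m)
    from adj_minor[OF this] show ?thesis using r_nz[OF ij] unfolding NN unfolding ij' by (simp add: field_simps)
  qed
qed

lemma ZZ_NN: "ZZ = scl q (\<lambda>i. d / r i 0) NN (\<lambda>j. 1 / r 0 j)"
proof (rule eq_matI)
  fix i j assume "i < dim_row (scl q (\<lambda>i. d / r i 0) NN (\<lambda>j. 1 / r 0 j))" "j < dim_col (scl q (\<lambda>i. d / r i 0) NN (\<lambda>j. 1 / r 0 j))"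
  hence ij: "i < q" "j < q" by auto
  thus "ZZ $$ (i, j) = scl q (\<lambda>i. d / r i 0) NN (\<lambda>j. 1 / r 0 j) $$ (i, j)"
    using r_nz[OF ij(1) q0] r_nz[OF q0 ij(2)] by (simp add: ZZ_r NN_index)
qed auto

lemma prod_DD: "(\<Prod>i<q. DD i) = d ^ m"
  using prod.lessThan_Suc_shift[of DD m, folded q_Suc] by (simp add: DD_def)

lemma det_NN: "det NN = d ^ m * det NT"
  unfolding NN_def by (subst det_mult[of _ q]) (auto simp: det_low det_scl prod_DD)

definition "RR = (\<Prod>i<q. r i 0) * (\<Prod>j<q. r 0 j)"

lemma RR_nz: "RR \<noteq> 0" and vd_RR: "vd RR = 0"
proof -
  have "vd (\<Prod>i<q. r i 0) = 0" "vd (\<Prod>j<q. r 0 j) = 0"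
    by (subst vd.v_prod; use r_nz vd_rp q0 in auto)+
  thus "RR \<noteq> 0" "vd RR = 0" using r_nz q0 by (auto simp: RR_def vd.v_mult)
qed

lemma det_ZZ: "det ZZ = d ^ (q + m) * det NT / RR"
proof -
  have nz: "(\<Prod>i<q. r i 0) \<noteq> 0" "(\<Prod>j<q. r 0 j) \<noteq> 0" using r_nz q0 by auto
  show ?thesis
    unfolding ZZ_NN using nz
    by (subst det_scl[OF NN_carrier]) (simp add: det_NN prod_dividef RR_def power_add field_simps)
qed

lemma det_ZZ_nz [simp]: "det ZZ \<noteq> 0"
  unfolding det_ZZ using det_NT RR_nz by simp

text \<open>The factor \<open>d\<close> occurs \<open>q\<close> times from the row scaling in
  \<open>ZZ_NN\<close> and \<open>q - 1\<close> times from \<open>DD\<close>; everything else is a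
  unit.\<close>

lemma vd_det_ZZ: "vd (det ZZ) = 2 * int q - 1"
  unfolding det_ZZ using det_NT RR_nz vd_RR
  by (simp add: vd.v_divide vd.v_mult vd.v_power vd_dt int_m)

section \<open>Denominators of the entries of I J I x\<close>

definition "Pr = (\<Prod>w\<in>coords q. case w of (i, j) \<Rightarrow> rp i j)"

lemma Pr_nz: "F Pr \<noteq> 0" 
  using rp_facts(3) by (auto simp: Pr_def coords_def)

text \<open>Polynomial up to the denominator \<open>Pr ^ n\<close>. The exponent is recorded so that
  sums and determinants can be put over one denominator that is prime to \<open>d\<close>.\<close>

definition pl :: "nat \<Rightarrow> mpoly fract \<Rightarrow> bool" where "pl n x \<longleftrightarrow> (\<exists>f. x * F Pr ^ n = F f)"

lemma pl_F [simp]: "pl 0 (F f)" by (auto simp: pl_def)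

lemma pl_F': "pl n (F f)" unfolding pl_def by (rule exI[of _ "f * Pr ^ n"]) (simp add: F_power)

lemma pl_mult: "pl n x \<Longrightarrow> pl k y \<Longrightarrow> pl (n + k) (x * y)"
proof -
  assume "pl n x" "pl k y"
  then obtain f g where fg: "x * F Pr ^ n = F f" "y * F Pr ^ k = F g" by (auto simp: pl_def)
  have "(x * y) * F Pr ^ (n + k) = (x * F Pr ^ n) * (y * F Pr ^ k)" by (simp only: power_add mult_ac)
  also have "\<dots> = F (f * g)" unfolding fg by simp
  finally have "(x * y) * F Pr ^ (n + k) = F (f * g)" .
  thus ?thesis unfolding pl_def by blast
qed

lemma pl_0: "pl n 0" using pl_F'[of n 0] by simp
lemma pl_1: "pl 0 1" using pl_F[of 1] by simp

lemma pl_add: "pl n x \<Longrightarrow> pl n y \<Longrightarrow> pl n (x + y)"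
proof -
  assume "pl n x" "pl n y"
  then obtain f g where "x * F Pr ^ n = F f" "y * F Pr ^ n = F g" by (auto simp: pl_def)
  hence "(x + y) * F Pr ^ n = F (f + g)" by (simp add: distrib_right)
  thus ?thesis unfolding pl_def by blast
qed

lemma pl_uminus: "pl n x \<Longrightarrow> pl n (- x)"
proof -
  assume "pl n x"
  then obtain f where "x * F Pr ^ n = F f" by (auto simp: pl_def)
  hence "(- x) * F Pr ^ n = F (- f)" by simp
  thus ?thesis unfolding pl_def by blast
qed

lemma pl_sum: "(\<And>i. i \<in> S \<Longrightarrow> pl n (f i)) \<Longrightarrow> pl n (sum f S)"
  by (induction S rule: infinite_finite_induct) (auto intro: pl_add pl_0)

lemma pl_prod: "finite S \<Longrightarrow> (\<And>i. i \<in> S \<Longrightarrow> pl 1 (f i)) \<Longrightarrow> pl (card S) (prod f S)"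
proof (induction S rule: finite_induct)
  case (insert x S)
  thus ?case using pl_mult[of 1 "f x" "card S"] by simp
qed (simp add: pl_1)

lemma pl_det:
  assumes "A \<in> carrier_mat n n" "\<And>i j. i < n \<Longrightarrow> j < n \<Longrightarrow> pl 1 (A $$ (i, j))"
  shows "pl n (det A)"
  unfolding det_def'[OF assms(1)]
proof (rule pl_sum)
  fix p assume "p \<in> {p. p permutes {0..<n}}"
  hence p: "p permutes {0..<n}" by simp
  have "pl (card {0..<n}) (\<Prod>i = 0..<n. A $$ (i, p i))"
    by (rule pl_prod) (use permutes_in_image[OF p] assms(2) in simp_all)
  thus "pl n (signof p * (\<Prod>i = 0..<n. A $$ (i, p i)))"
    by (cases p rule: sign_cases) (simp_all add: pl_uminus)
qed

lemma pl_NT: "i < q \<Longrightarrow> j < q \<Longrightarrow> pl 1 (NT $$ (i, j))"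
proof -
  assume ij: "i < q" "j < q"
  have "pl 1 (F f / r i j)" for f
  proof -
    have "Pr = rp i j * (\<Prod>w\<in>coords q - {(i, j)}. case w of (i, j) \<Rightarrow> rp i j)"
      unfolding Pr_def by (subst prod.remove[of _ "(i, j)"]) (use ij in \<open>auto simp: coords_def\<close>)
    then obtain g where "Pr = rp i j * g" by blast
    hence "F f / r i j * F Pr ^ 1 = F (f * g)" using r_nz[OF ij] by simp
    thus ?thesis unfolding pl_def by blast
  qed
  from this[of "- adj_mat BP $$ (i - 1, j - 1)"] show ?thesis
    using ij by (auto simp: NT_def b_def pl_F' pl_0)
qed

lemma pl_adj_NT:
  assumes ij: "i < q" "j < q"
  shows "pl m (adj_mat NT $$ (i, j))"
proof -
  let ?M = "mat_delete NT j i"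
  have M: "?M \<in> carrier_mat m m" by (auto simp: mat_delete_def m_def NT_def)
  have "pl 1 (?M $$ (a, b))" if ab: "a < m" "b < m" for a b
  proof -
    have eq: "?M $$ (a, b) = NT $$ (if a < j then a else Suc a, if b < i then b else Suc b)"
      using ab by (simp add: mat_delete_def m_def NT_def)
    have "(if a < j then a else Suc a) < q" "(if b < i then b else Suc b) < q"
      using ab by (auto simp: lt_m)
    thus ?thesis unfolding eq by (rule pl_NT)
  qed
  hence p: "pl m (det ?M)" by (rule pl_det[OF M])
  have "adj_mat NT $$ (i, j) = (-1) ^ (j + i) * det ?M"
    using ij by (simp add: adj_mat_def cofactor_def NT_def)
  thus ?thesis using p pl_uminus by (cases "even (j + i)") auto
qed

text \<open>Of the two factors \<open>d\<close>, one undoes the row scaling of \<open>ZZ_NN\<close>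
  and one the matrix \<open>DD\<close>; the latter spares row 0, whence the extra \<open>d\<close>
  at \<open>k = 0\<close>.\<close>

lemma WW_index:
  assumes ij: "i < q" "j < q"
  shows "WW $$ (i, j) * d ^ 2 * det NT = r 0 i * r j 0 * (\<Sum>k = 0..<q. adj_mat NT $$ (i, k) * (if k = 0 then d else 1) * low (-1) $$ (k, j))"
proof -
  have D0: "DD k \<noteq> 0" for k by (simp add: DD_def)
  have sc: "det (scl q DD NT (\<lambda>_. 1)) \<noteq> 0" using det_NT by (simp add: det_scl prod_DD)
  have IL: "Iv (low 1) = low (-1)" by (rule Im_unique(2)[OF low_carrier low_carrier low_inv])
  have INN: "Iv NN = scl q (\<lambda>_. 1) (Iv NT) (\<lambda>k. inverse (DD k)) * low (-1)"
    unfolding NN_def using sc det_NT D0 by (subst Iv_mult[of _ q]) (auto simp: det_low IL Im_scl)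
  have "WW = scl q (\<lambda>i. r 0 i) (Iv NN) (\<lambda>j. r j 0 / d)"
    unfolding WW_def ZZ_NN using r_nz q0 det_NN det_NT by (subst Im_scl) auto
  hence "WW $$ (i, j) = r 0 i * Iv NN $$ (i, j) * (r j 0 / d)" using ij by simp
  also have "Iv NN $$ (i, j) = (\<Sum>k = 0..<q. Iv NT $$ (i, k) * inverse (DD k) * low (-1) $$ (k, j))"
    unfolding INN using ij by (auto simp: scalar_prod_def low_def intro!: sum.cong)
  finally have W: "WW $$ (i, j) = r 0 i * (\<Sum>k = 0..<q. Iv NT $$ (i, k) * inverse (DD k) * low (-1) $$ (k, j)) * (r j 0 / d)" .
  have "(\<Sum>k = 0..<q. Iv NT $$ (i, k) * inverse (DD k) * low (-1) $$ (k, j)) * (d * det NT) =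
     (\<Sum>k = 0..<q. adj_mat NT $$ (i, k) * (if k = 0 then d else 1) * low (-1) $$ (k, j))"
    unfolding sum_distrib_right
  proof (rule sum.cong[OF refl])
    fix k assume "k \<in> {0..<q}"
    thus "Iv NT $$ (i, k) * inverse (DD k) * low (-1) $$ (k, j) * (d * det NT) =
        adj_mat NT $$ (i, k) * (if k = 0 then d else 1) * low (-1) $$ (k, j)"
      using adj_Im_index[OF NT_carrier det_NT(1), of i k] ij by (auto simp: DD_def field_simps)
  qed
  thus ?thesis unfolding W by (simp add: field_simps power2_eq_square)
qed

text \<open>A unit along \<open>det x = 0\<close> for which \<open>d ^ 2 * ell\<close> clears the
  denominators of I J I x; hence poles along the determinant have order at most 2.\<close>

definition "ell = F Pr ^ q * det NT"

lemma WW_ell: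
  assumes ij: "i < q" "j < q"
  shows "\<exists>f. WW $$ (i, j) * d ^ 2 * ell = F f"
proof -
  have low: "pl 0 (low (-1) $$ (k, j))" if "k < q" for k
    using that ij pl_F[of 1] pl_F[of "-1"] pl_0 by (auto simp: low_def)
  have "pl (m + 0 + 0) (adj_mat NT $$ (i, k) * (if k = 0 then d else 1) * low (-1) $$ (k, j))" if k: "k < q" for k
    by (intro pl_mult pl_adj_NT low ij k) (auto simp: pl_1)
  hence "pl m (\<Sum>k = 0..<q. adj_mat NT $$ (i, k) * (if k = 0 then d else 1) * low (-1) $$ (k, j))"
    by (intro pl_sum) simp
  hence "pl (0 + 0 + m) (WW $$ (i, j) * d ^ 2 * det NT)"
    unfolding WW_index[OF ij] by (intro pl_mult pl_F)
  then obtain f where "WW $$ (i, j) * d ^ 2 * det NT * F Pr ^ m = F f" by (auto simp: pl_def)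
  hence "WW $$ (i, j) * d ^ 2 * ell = F (f * Pr)"
    using power_Suc[of "F Pr" m, folded q_Suc] by (simp add: ell_def mult_ac)
  thus ?thesis by blast
qed

section \<open>Homogeneous degrees of the matrices involved\<close>

lemma hq_r: "i < q \<Longrightarrow> j < q \<Longrightarrow> hq (int q - 1) (r i j)"
  using hq_F[OF rp_facts(2,1), of i j] q0 by (simp add: of_nat_diff)

lemma hq_d: "hq (int q) d"
  by (rule hq_F[OF hm_dt dt_PV])

lemma hq_X: "i < q \<Longrightarrow> j < q \<Longrightarrow> hq 1 (X $$ (i, j))"
  by (simp add: hq_V coords_def)

lemma hq_Jm:
  assumes "A \<in> carrier_mat q q" "\<And>i j. i < q \<Longrightarrow> j < q \<Longrightarrow> hq e (A $$ (i, j))" "i < q" "j < q"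
  shows "hq (- e) (Jm A $$ (i, j))"
  using assms by (simp add: Jm_index[of _ q] hq_inverse)

lemma hq_Iv:
  assumes A: "A \<in> carrier_mat q q" "\<And>i j. i < q \<Longrightarrow> j < q \<Longrightarrow> hq e (A $$ (i, j))" and ij: "i < q" "j < q"
  shows "hq (- e) (Iv A $$ (i, j))"
proof -
  let ?M = "mat_delete A j i"
  have M: "?M \<in> carrier_mat m m" using A(1) by (auto simp: mat_delete_def m_def)
  have "hq e (?M $$ (a, b))" if ab: "a < m" "b < m" for a b
  proof -
    have eq: "?M $$ (a, b) = A $$ (if a < j then a else Suc a, if b < i then b else Suc b)"
      using ab A(1) by (auto simp: mat_delete_def m_def)
    have "(if a < j then a else Suc a) < q" "(if b < i then b else Suc b) < q"
      using ab by (auto simp: lt_m)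
    thus ?thesis unfolding eq by (rule A(2))
  qed
  hence h: "hq (int m * e) (det ?M)" by (rule hq_det[OF M])
  have "adj_mat A $$ (i, j) = (-1) ^ (j + i) * det ?M"
    using ij A(1) by (simp add: adj_mat_def cofactor_def)
  hence h': "hq (int m * e) (adj_mat A $$ (i, j))" using h hq_uminus by (cases "even (j + i)") auto
  have "Iv A $$ (i, j) = inverse (det A) * adj_mat A $$ (i, j)"
    using ij A(1) adj_mat(1)[OF A(1)] by (simp add: Iv_def)
  moreover have "hq (- (int q * e) + int m * e) (inverse (det A) * adj_mat A $$ (i, j))"
    by (intro hq_mult hq_inverse hq_det A h')
  moreover have "- (int q * e) + int m * e = - e" by (simp add: int_m algebra_simps)
  ultimately show ?thesis by simp
qed

lemma hq_YY: "i < q \<Longrightarrow> j < q \<Longrightarrow> hq (-1) (YY $$ (i, j))"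
  unfolding YY_def by (rule hq_Iv[OF XF_carrier hq_X])

lemma hq_ZZ: "i < q \<Longrightarrow> j < q \<Longrightarrow> hq 1 (ZZ $$ (i, j))"
  unfolding ZZ_def using hq_Jm[OF YZW_carrier(1) hq_YY] by simp

lemma hq_WW: "i < q \<Longrightarrow> j < q \<Longrightarrow> hq (-1) (WW $$ (i, j))"
  unfolding WW_def by (rule hq_Iv[OF YZW_carrier(2) hq_ZZ])

section \<open>The involution I J I and the determinant divisor\<close>

definition "sig x = phiI q (phiJ q (phiI q x))"

lemma sig_hom: "comm_ring_hom sig"
proof -
  interpret I: comm_ring_hom "phiI q" by (rule phiI_hom)
  interpret J: comm_ring_hom "phiJ q" by (rule phiJ_hom)
  show ?thesis by unfold_locales (auto simp: sig_def I.hom_add J.hom_add I.hom_mult J.hom_mult)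
qed

sublocale sig: comm_ring_hom sig by (rule sig_hom)

lemma sig_sig: "sig (sig x) = x"
  by (simp add: sig_def phiI_phiI phiJ_phiJ)

lemmas sig_field = field_hom_facts[OF sig_hom]

lemma map_sig_X: "map_mat sig X = WW"
proof -
  have "map_mat sig X = map_mat (phiI q) (map_mat (phiJ q) (map_mat (phiI q) X))"
    by (rule eq_matI) (auto simp: sig_def)
  also have "\<dots> = map_mat (phiI q) (Iv (Jm X))"
    by (simp add: map_phiI map_phiJ flip: Im_hom[OF phiJ_hom XF_carrier])
  also have "\<dots> = Iv (Jm (Iv X))"
    by (simp add: map_phiI flip: Im_hom[OF phiI_hom, of _ q] Jm_hom[OF phiI_hom])
  finally show ?thesis by (simp add: WW_def ZZ_def YY_def)
qed

lemma sig_F: "sig (F h) = evM q WW h"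
proof -
  interpret ev: comm_ring_hom "evM q WW" by (rule evM_hom)
  show ?thesis
  proof (induction h rule: mp_induct)
    case (V w)
    show ?case
    proof (cases "w \<in> coords q")
      case True
      then obtain i j where ij: "w = (i, j)" "i < q" "j < q" by (cases w) (auto simp: coords_def)
      have "map_mat sig X $$ (i, j) = sig (F (V w))" using ij by simp
      thus ?thesis using True ij by (simp add: map_sig_X evM_V)
    next
      case False
      thus ?thesis by (simp add: evM_V sig_def phiI_F phiJ_F)
    qed
  next
    case (C c)
    show ?case by (simp add: sig_def phiI_F phiJ_F)
  qed (simp_all add: sig.hom_add sig.hom_mult ev.hom_add ev.hom_mult)
qed

text \<open>The relation aimed at is \<open>vd (sig f) = vd f - 2 deg f\<close>; here the weight
  \<open>k\<close> stands in the place of \<open>vd f\<close>. Weights are additive, so that of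
  \<open>ell\<close> follows from those of \<open>d\<close>, the \<open>r i j\<close> and
  \<open>det ZZ\<close>, where \<open>sig\<close> can be computed.\<close>

definition "wtd k f \<longleftrightarrow> f \<noteq> 0 \<and> (\<exists>e. hq e f \<and> vd (sig f) = k - 2 * e)"

lemma wtd_mult: "wtd k f \<Longrightarrow> wtd l g \<Longrightarrow> wtd (k + l) (f * g)"
proof -
  assume "wtd k f" "wtd l g"
  then obtain e e' where "f \<noteq> 0" "hq e f" "vd (sig f) = k - 2 * e" "g \<noteq> 0" "hq e' g" "vd (sig g) = l - 2 * e'"
    by (auto simp: wtd_def)
  thus ?thesis unfolding wtd_def
    by (intro conjI exI[of _ "e + e'"]) (auto simp: hq_mult sig.hom_mult vd.v_mult sig_field)
qed

lemma wtd_inverse: "wtd k f \<Longrightarrow> wtd (- k) (inverse f)"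
proof -
  assume "wtd k f"
  then obtain e where "f \<noteq> 0" "hq e f" "vd (sig f) = k - 2 * e" by (auto simp: wtd_def)
  thus ?thesis unfolding wtd_def
    by (intro conjI exI[of _ "- e"]) (auto simp: hq_inverse sig_field vd.v_inverse)
qed

lemma wtd_1: "wtd 0 1"
  unfolding wtd_def by (intro conjI exI[of _ 0]) auto

lemma wtd_power: "wtd k f \<Longrightarrow> wtd (int n * k) (f ^ n)"
proof (induction n)
  case (Suc n)
  thus ?case using wtd_mult[of k f "int n * k" "f ^ n"] by (simp add: algebra_simps)
qed (simp add: wtd_1)

lemma wtd_prod: "(\<And>i. i \<in> S \<Longrightarrow> wtd 0 (f i)) \<Longrightarrow> wtd 0 (prod f S)"
proof (induction S rule: infinite_finite_induct)
  case (insert x S)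
  thus ?case using wtd_mult[of 0 "f x" 0 "prod f S"] by simp
qed (simp_all add: wtd_1)

lemma det_WW: "det WW = inverse (det ZZ)"
  unfolding WW_def by (rule det_Im) auto

lemma Iv_WW: "Iv WW = ZZ"
  unfolding WW_def by (rule Im_Im[of _ q]) auto

lemma wtd_d: "wtd 1 d"
  unfolding wtd_def
proof (intro conjI exI[of _ "int q"])
  have "sig d = inverse (det ZZ)" by (simp add: sig_F evM_dt det_WW)
  thus "vd (sig d) = 1 - 2 * int q" by (simp add: vd.v_inverse vd_det_ZZ)
qed (auto simp: hq_d)

lemma wtd_r:
  assumes ij: "i < q" "j < q"
  shows "wtd 0 (r i j)"
  unfolding wtd_def
proof (intro conjI exI[of _ "int q - 1"])
  have dW: "det WW \<noteq> 0" by (simp add: det_WW)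
  have "sig (r i j) = adj_mat WW $$ (i, j)" unfolding sig_F rp_def by (rule evM_adj) (use ij in auto)
  also have "\<dots> = inverse (det ZZ) * (d / r i j)"
    using adj_Im_index[OF YZW_carrier(3) dW ij] by (simp add: Iv_WW det_WW ZZ_r ij)
  finally show "vd (sig (r i j)) = 0 - 2 * (int q - 1)"
    using r_nz[OF ij] vd_rp[OF ij] by (simp add: vd.v_mult vd.v_inverse vd.v_divide vd_det_ZZ vd_dt)
qed (use r_nz hq_r ij in auto)

lemma wtd_det_ZZ: "wtd (2 * int q - 1) (det ZZ)"
  unfolding wtd_def
proof (intro conjI exI[of _ "int q"])
  have "map_mat sig ZZ = Jm (Iv WW)"
    unfolding ZZ_def YY_def by (simp add: map_sig_X flip: Jm_hom[OF sig_hom] Im_hom[OF sig_hom XF_carrier])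
  also have "\<dots> = YY" by (simp add: Iv_WW) (simp add: ZZ_def)
  finally have "sig (det ZZ) = det YY" by (simp flip: sig.hom_det)
  also have "\<dots> = inverse d" unfolding YY_def by (simp add: det_Im[of _ q] F_dt)
  finally show "vd (sig (det ZZ)) = 2 * int q - 1 - 2 * int q" by (simp add: vd.v_inverse vd_dt)
  show "hq (int q) (det ZZ)" using hq_det[OF YZW_carrier(2) hq_ZZ] by simp
qed auto

lemma ell_eq: "ell = F Pr ^ q * (det ZZ * RR * inverse (d ^ (q + m)))"
  using RR_nz by (simp add: ell_def det_ZZ field_simps)

lemma wtd_ell: "wtd 0 ell"
proof -
  have "wtd 0 (F Pr)" unfolding Pr_def F_prod
    by (rule wtd_prod) (auto simp: coords_def intro!: wtd_r)
  hence 1: "wtd 0 (F Pr ^ q)" using wtd_power[of 0 "F Pr" q] by simp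
  have "wtd 0 (\<Prod>i<q. r i 0)" "wtd 0 (\<Prod>j<q. r 0 j)" by (auto intro!: wtd_prod wtd_r q0)
  hence 2: "wtd 0 RR" unfolding RR_def using wtd_mult[of 0 _ 0] by simp
  have "wtd (0 + (2 * int q - 1 + 0 + - (int (q + m) * 1))) ell"
    unfolding ell_eq by (intro wtd_mult 1 2 wtd_det_ZZ wtd_inverse wtd_power wtd_d)
  thus ?thesis by (simp add: int_m)
qed

lemma vd_ell: "ell \<noteq> 0" "vd ell = 0"
proof -
  have "vd (F Pr) = 0" unfolding Pr_def F_prod
    by (subst vd.v_prod) (auto simp: coords_def rp_facts vd_rp intro!: sum.neutral)
  thus "ell \<noteq> 0" "vd ell = 0" using Pr_nz det_NT by (auto simp: ell_def vd.v_mult vd.v_power)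
qed

lemma sig_poly_num:
  assumes h: "hm e h" "h \<in> PV (coords q)"
  shows "\<exists>k. sig (F h) * (d ^ 2 * ell) ^ e = F k"
proof -
  interpret ev: comm_ring_hom "evM q WW" by (rule evM_hom)
  have "\<exists>k. evM q WW h * (d ^ 2 * ell) ^ e = F k" using h
  proof (induction rule: hm_induct)
    case (0 i) show ?case by (rule exI[of _ 0]) simp
  next
    case (C c) show ?case by (rule exI[of _ "C c"]) simp
  next
    case (V w)
    then obtain i j where "w = (i, j)" "i < q" "j < q" by (cases w) (auto simp: coords_def)
    thus ?case using WW_ell[of i j] V by (simp add: evM_V mult.assoc)
  next
    case (add i f g)
    then obtain a b where "evM q WW f * (d ^ 2 * ell) ^ i = F a" "evM q WW g * (d ^ 2 * ell) ^ i = F b" by blast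
    thus ?case by (intro exI[of _ "a + b"]) (simp add: ev.hom_add distrib_right)
  next
    case (mult i j f g)
    then obtain a b where ab: "evM q WW f * (d ^ 2 * ell) ^ i = F a" "evM q WW g * (d ^ 2 * ell) ^ j = F b" by blast
    have "evM q WW (f * g) * (d ^ 2 * ell) ^ (i + j) =
        (evM q WW f * (d ^ 2 * ell) ^ i) * (evM q WW g * (d ^ 2 * ell) ^ j)"
      by (simp only: ev.hom_mult power_add mult_ac)
    thus ?case unfolding ab by (intro exI[of _ "a * b"]) simp
  qed
  thus ?thesis by (simp add: sig_F)
qed

lemma sig_poly_hq:
  assumes h: "hm e h" "h \<in> PV (coords q)"
  shows "hq (- int e) (sig (F h))"
proof -
  interpret ev: comm_ring_hom "evM q WW" by (rule evM_hom)
  have "hq (- int e) (evM q WW h)" using h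
  proof (induction rule: hm_induct)
    case (V w)
    thus ?case using hq_WW by (auto simp: evM_V coords_def)
  next
    case (mult i j f g)
    thus ?case using hq_mult[of "- int i" _ "- int j"] by (simp add: ev.hom_mult)
  qed (auto simp: ev.hom_add intro: hq_add)
  thus ?thesis by (simp add: sig_F)
qed

lemma sig_poly:
  assumes h: "hm e h" "h \<in> PV (coords q)" "h \<noteq> 0" and dl: "hq dl ell"
  obtains k where "sig (F h) * (d ^ 2 * ell) ^ e = F k" "k \<noteq> 0" "hm (tdeg k) k" "k \<in> PV (coords q)"
    "int (tdeg k) = - int e + int e * (2 * int q + dl)"
    "vd (sig (F h)) + 2 * int e = int (ordp (dt q) k)"
proof -
  obtain k where k: "sig (F h) * (d ^ 2 * ell) ^ e = F k" using sig_poly_num[OF h(1,2)] by blast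
  have s0: "sig (F h) \<noteq> 0" using h(3) sig_field by simp
  hence k0: "k \<noteq> 0" using k vd_ell d_nz by auto
  have "hq (- int e + int e * (int 2 * int q + dl)) (sig (F h) * (d ^ 2 * ell) ^ e)"
    by (intro hq_mult hq_power hq_d dl sig_poly_hq h)
  from hq_F_iff[OF this[unfolded k] k0]
  have *: "hm (tdeg k) k" "k \<in> PV (coords q)" "int (tdeg k) = - int e + int e * (2 * int q + dl)" by auto
  have "vd (sig (F h) * (d ^ 2 * ell) ^ e) = vd (sig (F h)) + 2 * int e"
    using s0 vd_ell by (simp add: vd.v_mult vd.v_power vd_dt)
  hence "vd (sig (F h)) + 2 * int e = int (ordp (dt q) k)" unfolding k using vd_F[OF k0] by simp
  thus ?thesis using that k k0 * by blast
qed

text \<open>Clearing denominators gives only an inequality. Were it strict, the cleared image would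
  be \<open>d * k1\<close>; applying the involution again and using the inequality for
  \<open>k1\<close> would give \<open>vd (F h) \<ge> 1\<close>, although the determinant does not
  divide \<open>h\<close>.\<close>

lemma sig_val_unit:
  assumes h: "hm e h" "h \<in> PV (coords q)" "\<not> dt q dvd h"
  shows "vd (sig (F h)) = - 2 * int e"
proof (rule ccontr)
  assume neg: "vd (sig (F h)) \<noteq> - 2 * int e"
  obtain dl where dl: "hq dl ell" "vd (sig ell) = - 2 * dl" "ell \<noteq> 0" using wtd_ell by (auto simp: wtd_def)
  have h0: "h \<noteq> 0" using h by auto
  obtain k where k: "sig (F h) * (d ^ 2 * ell) ^ e = F k" "k \<noteq> 0" "hm (tdeg k) k" "k \<in> PV (coords q)"
    "int (tdeg k) = - int e + int e * (2 * int q + dl)"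
    "vd (sig (F h)) + 2 * int e = int (ordp (dt q) k)"
    using sig_poly[OF h(1,2) h0 dl(1)] by blast
  have "ordp (dt q) k > 0" using k(6) neg by linarith
  hence "dt q dvd k" using ordp_pos_iff[OF prime_dt k(2)] by blast
  then obtain k1 where k1: "k = dt q * k1" ..
  have k10: "k1 \<noteq> 0" using k1 k by auto
  have k1P: "k1 \<in> PV (coords q)" using PV_factor2[of "dt q" k1] k1 k by simp
  have k1h: "hm (tdeg k1) k1" using hm_factor[of "tdeg k" k1 "dt q"] k1 k by (simp add: mult.commute)
  have tk: "tdeg k = q + tdeg k1" using k1 k10 hm_tdeg[OF hm_dt dt_nz] by (simp add: tdeg_mult)
  obtain k2 where k2: "vd (sig (F k1)) + 2 * int (tdeg k1) = int (ordp (dt q) k2)"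
    using sig_poly[OF k1h k1P k10 dl(1)] by blast
  have sd: "vd (sig d) = 1 - 2 * int q" using wtd_d hq_unique[OF _ hq_d] by (auto simp: wtd_def)
  have nz: "sig d \<noteq> 0" "sig ell \<noteq> 0" "sig (F k1) \<noteq> 0" using dl k10 by (auto simp: sig_field)
  have "sig (sig (F h) * (d ^ 2 * ell) ^ e) = sig (d * F k1)" using k(1) k1 by simp
  hence "F h * (sig d ^ 2 * sig ell) ^ e = sig d * sig (F k1)"
    by (simp add: sig.hom_mult sig.hom_power sig_sig)
  hence "vd (F h * (sig d ^ 2 * sig ell) ^ e) = vd (sig d * sig (F k1))" by simp
  hence "vd (F h) + int e * (2 * (1 - 2 * int q) + (- 2 * dl)) = (1 - 2 * int q) + vd (sig (F k1))"
    using nz h0 by (simp add: vd.v_mult vd.v_power sd dl)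
  moreover have "vd (F h) = 0" using vd_F[OF h0] ordp_pos_iff[OF prime_dt h0] h(3) by simp
  moreover have "vd (sig (F k1)) \<ge> - 2 * int (tdeg k1)" using k2 by linarith
  moreover have "int (tdeg k1) = - int e + int e * (2 * int q + dl) - int q" using k(5) tk by simp
  ultimately show False by (simp add: algebra_simps)
qed

lemma sig_val_poly:
  assumes h: "hm e h" "h \<in> PV (coords q)" "h \<noteq> 0"
  shows "vd (sig (F h)) = vd (F h) - 2 * int e"
proof -
  obtain g where g: "h = dt q ^ ordp (dt q) h * g" "\<not> dt q dvd g" using ordp_decomp[OF prime_dt h(3)] by blast
  define n where "n = ordp (dt q) h"
  have hg: "h = dt q ^ n * g" using g n_def by simp
  have g0: "g \<noteq> 0" using g(2) by auto
  have gP: "g \<in> PV (coords q)" using PV_factor2[of "dt q ^ n" g] hg h by simp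
  have gh: "hm (tdeg g) g" using hm_factor[of e g "dt q ^ n"] hg h by (simp add: mult.commute)
  have "tdeg h = tdeg (dt q ^ n) + tdeg g" unfolding hg using g0 by (simp add: tdeg_mult)
  moreover have "tdeg (dt q ^ n) = n * q" by (rule hm_tdeg[OF hm_power[OF hm_dt]]) simp
  ultimately have e: "e = n * q + tdeg g" using hm_tdeg[OF h(1,3)] by simp
  have sd: "vd (sig d) = 1 - 2 * int q" using wtd_d hq_unique[OF _ hq_d] by (auto simp: wtd_def)
  have nz: "sig d \<noteq> 0" "sig (F g) \<noteq> 0" using g0 by (auto simp: sig_field)
  have "sig (F h) = sig d ^ n * sig (F g)" by (simp add: hg F_power sig.hom_mult sig.hom_power)
  hence "vd (sig (F h)) = int n * (1 - 2 * int q) - 2 * int (tdeg g)"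
    using nz sig_val_unit[OF gh gP g(2)] by (simp add: vd.v_mult vd.v_power sd)
  thus ?thesis using vd_F[OF h(3)] e by (simp add: n_def algebra_simps)
qed

text \<open>I J I maps the divisor \<open>det x = 0\<close> to itself, but the coordinates
  \<open>WW\<close> have a double pole there, which costs 2 for each degree.\<close>

theorem sig_val:
  assumes "hq e x" "x \<noteq> 0"
  shows "vd (sig x) = vd x - 2 * e"
proof -
  obtain a b k l where *: "hm k a" "hm l b" "b \<noteq> 0" "x = F a / F b" "e = int k - int l" "a \<in> PV (coords q)" "b \<in> PV (coords q)"
    using assms(1) unfolding hq_def by blast
  have a0: "a \<noteq> 0" using * assms by auto
  show ?thesis unfolding *(4) using a0 * sig_val_poly[OF *(1,6) a0] sig_val_poly[OF *(2,7,3)]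
    by (simp add: sig_field vd.v_divide)
qed

end

section \<open>Specialization at complex matrices\<close>

text \<open>Membership in the local ring at the point \<open>g\<close>, together with the value
  there.\<close>

definition reg :: "(var \<Rightarrow> complex) \<Rightarrow> mpoly fract \<Rightarrow> complex \<Rightarrow> bool" where
  "reg g x z \<longleftrightarrow> (\<exists>a b. x = F a / F b \<and> ev (\<lambda>c. c) g b \<noteq> 0 \<and> z = ev (\<lambda>c. c) g a / ev (\<lambda>c. c) g b)"

context
  fixes g :: "var \<Rightarrow> complex"
begin

interpretation g: comm_ring_hom "ev (\<lambda>c. c) g" by (rule ev_hom[OF id_hom])

lemma reg_F: "reg g (F a) (ev (\<lambda>c. c) g a)"
  unfolding reg_def by (rule exI[of _ a], rule exI[of _ 1]) simp

lemma reg_0: "reg g 0 0" and reg_1: "reg g 1 1"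
  using reg_F[of 0] reg_F[of 1] by simp_all

lemma reg_V: "reg g (F (V w)) (g w)"
  using reg_F[of "V w"] by (simp add: id_hom)

lemma reg_mult:
  assumes "reg g x z" "reg g x' z'" shows "reg g (x * x') (z * z')"
proof -
  obtain a b where 1: "x = F a / F b" "ev (\<lambda>c. c) g b \<noteq> 0" "z = ev (\<lambda>c. c) g a / ev (\<lambda>c. c) g b"
    using assms(1) unfolding reg_def by blast
  obtain a' b' where 2: "x' = F a' / F b'" "ev (\<lambda>c. c) g b' \<noteq> 0" "z' = ev (\<lambda>c. c) g a' / ev (\<lambda>c. c) g b'"
    using assms(2) unfolding reg_def by blast
  show ?thesis unfolding reg_def
    by (rule exI[of _ "a * a'"], rule exI[of _ "b * b'"]) (simp add: 1 2 g.hom_mult)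
qed

lemma reg_add:
  assumes "reg g x z" "reg g x' z'" shows "reg g (x + x') (z + z')"
proof -
  obtain a b where 1: "x = F a / F b" "ev (\<lambda>c. c) g b \<noteq> 0" "z = ev (\<lambda>c. c) g a / ev (\<lambda>c. c) g b"
    using assms(1) unfolding reg_def by blast
  obtain a' b' where 2: "x' = F a' / F b'" "ev (\<lambda>c. c) g b' \<noteq> 0" "z' = ev (\<lambda>c. c) g a' / ev (\<lambda>c. c) g b'"
    using assms(2) unfolding reg_def by blast
  have "b \<noteq> 0" "b' \<noteq> 0" using 1 2 by auto
  thus ?thesis unfolding reg_def using 1 2
    by (intro exI[of _ "a * b' + a' * b"] exI[of _ "b * b'"]) (simp add: g.hom_mult g.hom_add add_frac_eq)
qed

lemma reg_uminus: "reg g x z \<Longrightarrow> reg g (- x) (- z)"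
  using reg_mult[OF reg_F[of "- 1"], of x z] by (simp add: g.hom_uminus)

lemma reg_inverse:
  assumes "reg g x z" "z \<noteq> 0" shows "reg g (inverse x) (inverse z)"
proof -
  obtain a b where 1: "x = F a / F b" "ev (\<lambda>c. c) g b \<noteq> 0" "z = ev (\<lambda>c. c) g a / ev (\<lambda>c. c) g b"
    using assms(1) unfolding reg_def by blast
  show ?thesis unfolding reg_def
    by (rule exI[of _ b], rule exI[of _ a]) (use assms(2) in \<open>simp add: 1\<close>)
qed

lemma reg_sum: "(\<And>i. i \<in> S \<Longrightarrow> reg g (f i) (h i)) \<Longrightarrow> reg g (sum f S) (sum h S)"
  by (induction S rule: infinite_finite_induct) (simp_all add: reg_0 reg_add)

lemma reg_prod: "(\<And>i. i \<in> S \<Longrightarrow> reg g (f i) (h i)) \<Longrightarrow> reg g (prod f S) (prod h S)"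
  by (induction S rule: infinite_finite_induct) (simp_all add: reg_1 reg_mult)

definition regm :: "nat \<Rightarrow> mpoly fract mat \<Rightarrow> complex mat \<Rightarrow> bool" where
  "regm n A a \<longleftrightarrow> A \<in> carrier_mat n n \<and> a \<in> carrier_mat n n \<and> (\<forall>i<n. \<forall>j<n. reg g (A $$ (i, j)) (a $$ (i, j)))"

lemma reg_det:
  assumes "regm n A a" shows "reg g (det A) (det a)"
proof -
  have *: "A \<in> carrier_mat n n" "a \<in> carrier_mat n n" using assms by (auto simp: regm_def)
  show ?thesis unfolding det_def'[OF *(1)] det_def'[OF *(2)]
  proof (rule reg_sum)
    fix p assume "p \<in> {p. p permutes {0..<n}}"
    hence p: "p permutes {0..<n}" by simp
    have "reg g (\<Prod>i = 0..<n. A $$ (i, p i)) (\<Prod>i = 0..<n. a $$ (i, p i))"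
      by (rule reg_prod) (use assms permutes_in_image[OF p] in \<open>auto simp: regm_def\<close>)
    thus "reg g (signof p * (\<Prod>i = 0..<n. A $$ (i, p i))) (signof p * (\<Prod>i = 0..<n. a $$ (i, p i)))"
      by (cases p rule: sign_cases) (simp_all add: reg_uminus)
  qed
qed

lemma regm_Jm: "regm n A a \<Longrightarrow> (\<And>i j. i < n \<Longrightarrow> j < n \<Longrightarrow> a $$ (i, j) \<noteq> 0) \<Longrightarrow> regm n (Jm A) (Jm a)"
  by (auto simp: regm_def Jm_index[of _ n] intro: reg_inverse)

lemma regm_Iv:
  assumes "regm n A a" "det a \<noteq> 0" shows "regm n (Iv A) (Iv a)"
proof -
  have *: "A \<in> carrier_mat n n" "a \<in> carrier_mat n n" using assms by (auto simp: regm_def)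
  have "reg g (Iv A $$ (i, j)) (Iv a $$ (i, j))" if ij: "i < n" "j < n" for i j
  proof -
    have "regm (n - 1) (mat_delete A j i) (mat_delete a j i)"
      using assms(1) ij by (auto simp: regm_def mat_delete_def)
    hence r: "reg g (det (mat_delete A j i)) (det (mat_delete a j i))" by (rule reg_det)
    hence "reg g (adj_mat A $$ (i, j)) (adj_mat a $$ (i, j))"
      using ij * reg_uminus[OF r] by (cases "even (j + i)") (auto simp: adj_mat_def cofactor_def)
    thus ?thesis using ij * adj_mat(1)[OF *(1)] adj_mat(1)[OF *(2)] 
      by (auto simp: Iv_def intro!: reg_mult reg_inverse reg_det assms)
  qed
  thus ?thesis using * by (simp add: regm_def)
qed

end

text \<open>K can be applied \<open>n + 1\<close> times, starting at \<open>a\<close>, without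
  meeting a zero entry or a zero determinant; then specialization commutes with the
  iteration.\<close>

fun Good :: "nat \<Rightarrow> nat \<Rightarrow> 'a::field mat \<Rightarrow> bool" where
  "Good q 0 a \<longleftrightarrow> (\<forall>i<q. \<forall>j<q. a $$ (i, j) \<noteq> 0) \<and> det (Jm a) \<noteq> 0"
| "Good q (Suc n) a \<longleftrightarrow> (\<forall>i<q. \<forall>j<q. a $$ (i, j) \<noteq> 0) \<and> det (Jm a) \<noteq> 0 \<and> Good q n (Km a)"

lemma Good_0: "Good q n a \<Longrightarrow> (\<forall>i<q. \<forall>j<q. a $$ (i, j) \<noteq> 0) \<and> det (Jm a) \<noteq> 0"
  by (cases n) auto

lemma regm_Km: "regm g q A a \<Longrightarrow> Good q n a \<Longrightarrow> regm g q (Km A) (Km a)"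
  unfolding Km_def by (intro regm_Iv regm_Jm) (use Good_0 in blast)+

lemma regm_iter: "regm g q A a \<Longrightarrow> Good q n a \<Longrightarrow> regm g q ((Km ^^ n) A) ((Km ^^ n) a) \<and> Good q 0 ((Km ^^ n) a)"
proof (induction n arbitrary: A a)
  case (Suc n)
  have "regm g q (Km A) (Km a)" by (rule regm_Km[OF Suc.prems])
  from Suc.IH[OF this] Suc.prems(2) show ?case by (simp add: funpow_swap1)
qed auto

subsection \<open>Stability of good orbits\<close>

lemma tendsto_det:
  fixes B :: "'b \<Rightarrow> complex mat"
  assumes "\<And>s. B s \<in> carrier_mat n n" "A \<in> carrier_mat n n"
    "\<And>i j. i < n \<Longrightarrow> j < n \<Longrightarrow> ((\<lambda>s. B s $$ (i, j)) \<longlongrightarrow> A $$ (i, j)) G"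
  shows "((\<lambda>s. det (B s)) \<longlongrightarrow> det A) G"
  unfolding det_def'[OF assms(1)] det_def'[OF assms(2)]
proof (rule tendsto_sum)
  fix p assume "p \<in> {p. p permutes {0..<n}}"
  hence p: "p permutes {0..<n}" by simp
  show "((\<lambda>s. signof p * (\<Prod>i = 0..<n. B s $$ (i, p i))) \<longlongrightarrow> signof p * (\<Prod>i = 0..<n. A $$ (i, p i))) G"
    by (intro tendsto_mult tendsto_prod tendsto_const assms(3)) (use permutes_in_image[OF p] in auto)
qed

lemma tendsto_Iv:
  fixes B :: "'b \<Rightarrow> complex mat"
  assumes B: "\<And>s. B s \<in> carrier_mat n n" "A \<in> carrier_mat n n"
    "\<And>i j. i < n \<Longrightarrow> j < n \<Longrightarrow> ((\<lambda>s. B s $$ (i, j)) \<longlongrightarrow> A $$ (i, j)) G"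
    and "det A \<noteq> 0" and ij: "i < n" "j < n"
  shows "((\<lambda>s. Iv (B s) $$ (i, j)) \<longlongrightarrow> Iv A $$ (i, j)) G"
proof -
  have eq: "Iv M $$ (i, j) = inverse (det M) * ((-1) ^ (j + i) * det (mat_delete M j i))"
    if "M \<in> carrier_mat n n" for M :: "complex mat"
    using that ij adj_mat(1)[OF that] by (simp add: Iv_def adj_mat_def cofactor_def)
  have "((\<lambda>s. det (mat_delete (B s) j i)) \<longlongrightarrow> det (mat_delete A j i)) G"
  proof (rule tendsto_det[of _ "n - 1"])
    show "mat_delete (B s) j i \<in> carrier_mat (n - 1) (n - 1)" for s using B(1)[of s] by (auto simp: mat_delete_def)
    show "mat_delete A j i \<in> carrier_mat (n - 1) (n - 1)" using B(2) by (auto simp: mat_delete_def)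
    fix k l assume kl: "k < n - 1" "l < n - 1"
    have e: "mat_delete M j i $$ (k, l) = M $$ (if k < j then k else Suc k, if l < i then l else Suc l)"
      if "M \<in> carrier_mat n n" for M :: "complex mat" using that kl by (auto simp: mat_delete_def)
    show "((\<lambda>s. mat_delete (B s) j i $$ (k, l)) \<longlongrightarrow> mat_delete A j i $$ (k, l)) G"
      unfolding e[OF B(1)] e[OF B(2)] by (rule B(3)) (use kl in auto)
  qed
  thus ?thesis unfolding eq[OF B(1)] eq[OF B(2)]
    by (intro tendsto_mult tendsto_inverse tendsto_det[OF B] tendsto_const assms(4))
qed

text \<open>For fixed \<open>n\<close> this is an open condition, since determinants and inverses
  depend continuously on the entries. It serves to perturb a limit point whose orbit is
  known.\<close>

lemma Good_eventually:
  fixes B :: "'b \<Rightarrow> complex mat"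
  assumes "\<And>s. B s \<in> carrier_mat q q" "A \<in> carrier_mat q q"
    "\<And>i j. i < q \<Longrightarrow> j < q \<Longrightarrow> ((\<lambda>s. B s $$ (i, j)) \<longlongrightarrow> A $$ (i, j)) G"
    and "Good q n A"
  shows "eventually (\<lambda>s. Good q n (B s)) G"
  using assms
proof (induction n arbitrary: A B)
  case *: (0 A B)
  have e: "eventually (\<lambda>s. \<forall>i<q. \<forall>j<q. B s $$ (i, j) \<noteq> 0) G"
    using * by (auto intro!: eventually_ball_finite[of "{..<q}", simplified Ball_def lessThan_iff] tendsto_imp_eventually_ne)
  have J: "((\<lambda>s. Jm (B s) $$ (i, j)) \<longlongrightarrow> Jm A $$ (i, j)) G" if "i < q" "j < q" for i j
    using that * by (auto simp: Jm_index[of _ q] intro!: tendsto_inverse)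
  have "((\<lambda>s. det (Jm (B s))) \<longlongrightarrow> det (Jm A)) G" by (rule tendsto_det[of _ q]) (use * J in auto)
  hence "eventually (\<lambda>s. det (Jm (B s)) \<noteq> 0) G" using * by (intro tendsto_imp_eventually_ne) auto
  with e show ?case by eventually_elim simp
next
  case *: (Suc n A B)
  have "eventually (\<lambda>s. B s $$ (i, j) \<noteq> 0) G" if "i < q" "j < q" for i j
    using *(4)[OF that] *(5) that by (intro tendsto_imp_eventually_ne) auto
  hence e: "eventually (\<lambda>s. \<forall>i<q. \<forall>j<q. B s $$ (i, j) \<noteq> 0) G"
    by (auto intro!: eventually_ball_finite[of "{..<q}", simplified Ball_def lessThan_iff])
  have J: "((\<lambda>s. Jm (B s) $$ (i, j)) \<longlongrightarrow> Jm A $$ (i, j)) G" if "i < q" "j < q" for i j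
    using tendsto_inverse[OF *(4)[OF that]] that *(2,3,5) by (simp add: Jm_index[of _ q])
  have "((\<lambda>s. det (Jm (B s))) \<longlongrightarrow> det (Jm A)) G" by (rule tendsto_det[of "\<lambda>s. Jm (B s)" q "Jm A"]) (use *(2,3) J in simp_all)
  hence e2: "eventually (\<lambda>s. det (Jm (B s)) \<noteq> 0) G" using * by (intro tendsto_imp_eventually_ne) auto
  have "eventually (\<lambda>s. Good q n (Km (B s))) G"
  proof (rule *(1)[of _ "Km A"])
    show "((\<lambda>s. Km (B s) $$ (i, j)) \<longlongrightarrow> Km A $$ (i, j)) G" if "i < q" "j < q" for i j
      unfolding Km_def
    proof (rule tendsto_Iv[of "\<lambda>s. Jm (B s)" q "Jm A"])
      show "\<And>i j. i < q \<Longrightarrow> j < q \<Longrightarrow> ((\<lambda>s. Jm (B s) $$ (i, j)) \<longlongrightarrow> Jm A $$ (i, j)) G" by (rule J)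
    qed (use *(2,3,5) that in simp_all)
  qed (use *(2,3,5) in simp_all)
  with e e2 show ?case by eventually_elim simp
qed

subsection \<open>Matrices with constant diagonal and constant off-diagonal\<close>

definition At :: "nat \<Rightarrow> 'a::field \<Rightarrow> 'a mat" where
  "At q t = mat q q (\<lambda>(i, j). if i = j then t else 1)"

lemma At_carrier [simp]: "At q t \<in> carrier_mat q q" and At_dim [simp]: "dim_row (At q t) = q" "dim_col (At q t) = q"
  by (simp_all add: At_def)

lemma At_index [simp]: "i < q \<Longrightarrow> j < q \<Longrightarrow> At q t $$ (i, j) = (if i = j then t else 1)"
  by (simp add: At_def)

lemma sum_two:
  fixes a b c d :: "'a::field"
  assumes "finite S" "i \<in> S" "j \<in> S"
  shows "(\<Sum>k\<in>S. (if k = i then a else b) * (if k = j then c else e)) =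
    (if i = j then a * c + (of_nat (card S) - 1) * b * e else a * e + b * c + (of_nat (card S) - 2) * b * e)"
proof (cases "i = j")
  case True
  have "(\<Sum>k\<in>S. (if k = i then a else b) * (if k = j then c else e)) = (\<Sum>k\<in>S. b * e + (if k = i then a * c - b * e else 0))"
    by (rule sum.cong) (auto simp: True)
  also have "\<dots> = of_nat (card S) * (b * e) + (a * c - b * e)"
    using assms by (simp add: sum.distrib sum.delta)
  finally show ?thesis using True by (simp add: algebra_simps)
next
  case False
  have "(\<Sum>k\<in>S. (if k = i then a else b) * (if k = j then c else e)) =
     (\<Sum>k\<in>S. b * e + (if k = i then a * e - b * e else 0) + (if k = j then b * c - b * e else 0))"
    by (rule sum.cong) (use False in auto)
  also have "\<dots> = of_nat (card S) * (b * e) + (a * e - b * e) + (b * c - b * e)"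
    using assms by (simp add: sum.distrib sum.delta)
  finally show ?thesis using False by (simp add: algebra_simps)
qed

text \<open>The off-diagonal entry of the product of the matrices with parameters \<open>t\<close>
  and \<open>t'\<close> is \<open>t + t' + q - 2\<close>; its vanishing fixes the second
  parameter.\<close>

lemma At_mult: "At q t * At q (2 - of_nat q - t) = (- (t - 1) * (t + of_nat q - 1)) \<cdot>\<^sub>m 1\<^sub>m q"
proof (rule eq_matI)
  fix i j assume "i < dim_row ((- (t - 1) * (t + of_nat q - 1)) \<cdot>\<^sub>m 1\<^sub>m q)" "j < dim_col ((- (t - 1) * (t + of_nat q - 1)) \<cdot>\<^sub>m 1\<^sub>m q)"
  hence ij: "i < q" "j < q" by auto
  have "(At q t * At q (2 - of_nat q - t)) $$ (i, j) =
     (\<Sum>k = 0..<q. (if k = i then t else 1) * (if k = j then 2 - of_nat q - t else 1))"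
    using ij by (auto simp: scalar_prod_def intro!: sum.cong)
  also have "\<dots> = ((- (t - 1) * (t + of_nat q - 1)) \<cdot>\<^sub>m 1\<^sub>m q) $$ (i, j)"
    using ij by (subst sum_two) (auto simp: algebra_simps)
  finally show "(At q t * At q (2 - of_nat q - t)) $$ (i, j) = ((- (t - 1) * (t + of_nat q - 1)) \<cdot>\<^sub>m 1\<^sub>m q) $$ (i, j)" .
qed auto

lemma Iv_At:
  assumes "t \<noteq> 1" "t + of_nat q - 1 \<noteq> 0"
  shows "det (At q t) \<noteq> 0" "Iv (At q t) = scl q (\<lambda>_. inverse (- (t - 1) * (t + of_nat q - 1))) (At q (2 - of_nat q - t)) (\<lambda>_. 1)"
proof -
  let ?c = "- (t - 1) * (t + of_nat q - 1)"
  have c: "?c \<noteq> 0" using assms by simp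
  have eq: "scl q (\<lambda>_. inverse ?c) (At q (2 - of_nat q - t)) (\<lambda>_. 1) = inverse ?c \<cdot>\<^sub>m At q (2 - of_nat q - t)"
    by (rule eq_matI) auto
  have "At q t * (inverse ?c \<cdot>\<^sub>m At q (2 - of_nat q - t)) = inverse ?c \<cdot>\<^sub>m (?c \<cdot>\<^sub>m 1\<^sub>m q)"
    unfolding At_mult[symmetric] by (rule mult_smult_distrib) auto
  also have "\<dots> = 1\<^sub>m q"
  proof -
    have "inverse x \<cdot>\<^sub>m (x \<cdot>\<^sub>m 1\<^sub>m q) = 1\<^sub>m q" if "x \<noteq> 0" for x :: 'a
      using that by (intro eq_matI) auto
    from this[OF c] show ?thesis .
  qed
  finally have *: "At q t * (inverse ?c \<cdot>\<^sub>m At q (2 - of_nat q - t)) = 1\<^sub>m q" .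
  show "det (At q t) \<noteq> 0" "Iv (At q t) = scl q (\<lambda>_. inverse ?c) (At q (2 - of_nat q - t)) (\<lambda>_. 1)"
    unfolding eq by (rule Im_unique[OF At_carrier _ *], simp)+
qed

lemma Jm_At: "Jm (At q t) = At q (inverse t)"
  by (rule eq_matI) (auto simp: Jm_def At_def)

text \<open>Along the line of the matrices \<open>At q t\<close> the map is \<open>t \<mapsto> 2 - q - 1/t\<close>; for \<open>q \<ge> 4\<close> it
  maps the real half-line \<open>t \<le> -1\<close> into itself, away from the exceptional values.\<close>

lemma Good_At:
  assumes "4 \<le> q" "t \<le> (-1 :: real)" "c \<noteq> 0"
  shows "Good q n (scl q (\<lambda>_. c) (At q (complex_of_real t)) (\<lambda>_. 1))"
  using assms(2,3)
proof (induction n arbitrary: t c)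
  case *: (0 t c)
  have t: "inverse (complex_of_real t) \<noteq> 1" "inverse (complex_of_real t) + of_nat q - 1 \<noteq> 0"
  proof -
    have "inverse t < 0" using *(1) by simp
    hence "inverse t \<noteq> 1" by simp
    thus "inverse (complex_of_real t) \<noteq> 1" by (metis of_real_eq_1_iff of_real_inverse)
    have "inverse t \<ge> -1" using *(1) by (simp add: field_simps)
    hence "inverse t + real q - 1 \<noteq> 0" using assms(1) by linarith
    moreover have "inverse (complex_of_real t) + of_nat q - 1 = complex_of_real (inverse t + real q - 1)" by simp
    ultimately show "inverse (complex_of_real t) + of_nat q - 1 \<noteq> 0" by (metis of_real_eq_0_iff)
  qed
  show ?case using * Iv_At(1)[OF t] by (simp add: Jm_scl Jm_At det_scl)
next
  case *: (Suc n t c)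
  have inv: "inverse t < 0" "inverse t \<ge> -1" using *(2) by (auto simp: field_simps)
  have t: "inverse (complex_of_real t) \<noteq> 1" "inverse (complex_of_real t) + of_nat q - 1 \<noteq> 0"
  proof -
    have "inverse t \<noteq> 1" using inv by simp
    thus "inverse (complex_of_real t) \<noteq> 1" by (metis of_real_eq_1_iff of_real_inverse)
    have "inverse t + real q - 1 \<noteq> 0" using assms(1) inv by linarith
    moreover have "inverse (complex_of_real t) + of_nat q - 1 = complex_of_real (inverse t + real q - 1)" by simp
    ultimately show "inverse (complex_of_real t) + of_nat q - 1 \<noteq> 0" by (metis of_real_eq_0_iff)
  qed
  let ?t' = "2 - real q - inverse t"
  let ?e = "inverse (- (inverse (complex_of_real t) - 1) * (inverse (complex_of_real t) + of_nat q - 1))"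
  have "Km (scl q (\<lambda>_. c) (At q (complex_of_real t)) (\<lambda>_. 1)) = scl q (\<lambda>_. 1) (Km (At q (complex_of_real t))) (\<lambda>_. c)"
    by (rule Km_scl) (use * Iv_At(1)[OF t] in \<open>auto simp: Jm_At\<close>)
  also have "\<dots> = scl q (\<lambda>_. c * ?e) (At q (complex_of_real ?t')) (\<lambda>_. 1)"
    unfolding Km_def Jm_At Iv_At(2)[OF t] by (rule eq_matI) auto
  finally have K: "Km (scl q (\<lambda>_. c) (At q (complex_of_real t)) (\<lambda>_. 1)) = scl q (\<lambda>_. c * ?e) (At q (complex_of_real ?t')) (\<lambda>_. 1)" .
  \<comment> \<open>From \<open>t \<le> -1\<close> follows \<open>1/t \<ge> -1\<close>, so the new
    parameter is at most \<open>3 - q\<close>, and this is at most \<open>-1\<close> because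
    \<open>q \<ge> 4\<close>.\<close>
  have "Good q n (scl q (\<lambda>_. c * ?e) (At q (complex_of_real ?t')) (\<lambda>_. 1))"
    by (rule *(1)) (use assms(1) inv * t in auto)
  thus ?case using * Iv_At(1)[OF t] by (simp add: K Jm_scl Jm_At det_scl)
qed

text \<open>The point at which the orbit of the divisor \<open>x i i = 0\<close> is evaluated: its orbit tends to that of
  the matrix \<open>At q (2 - q)\<close> when \<open>s\<close> tends to 0.\<close>

definition Tau :: "nat \<Rightarrow> nat \<Rightarrow> complex \<Rightarrow> complex mat" where
  "Tau q i s = mat q q (\<lambda>(k, l). if k = l then (if k = i then 0 else s) else 1)"

text \<open>The construction runs backwards. \<open>hB\<close> is prescribed so that its entrywise
  inverse has the diagonal value \<open>s\<close> of \<open>Tau\<close>, and \<open>nB\<close> is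
  its inverse. Away from the index \<open>i\<close>, \<open>hB\<close> is the matrix
  \<open>At\<close> of size \<open>q - 1\<close> with parameter \<open>1/s\<close>; inverting it by
  \<open>Iv_At\<close> yields the scalar \<open>rpar\<close> and the diagonal parameter
  \<open>cpar + 1\<close>, and the column \<open>1 / cpar\<close> then completes the
  inverse.\<close>

definition cpar :: "nat \<Rightarrow> complex \<Rightarrow> complex" where "cpar q s = 2 - of_nat q - 1 / s"

definition rpar :: "nat \<Rightarrow> complex \<Rightarrow> complex" where "rpar q s = - 1 / (cpar q s * (cpar q s + of_nat q - 1))"

definition nB :: "nat \<Rightarrow> nat \<Rightarrow> complex \<Rightarrow> complex mat" where
  "nB q i s = mat q q (\<lambda>(k, l). if k = i then (if l = i then 1 else 0) else if l = i then 1 / cpar q s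
     else if k = l then rpar q s * (cpar q s + 1) else rpar q s)"

definition hB :: "nat \<Rightarrow> nat \<Rightarrow> complex \<Rightarrow> complex mat" where
  "hB q i s = mat q q (\<lambda>(k, l). if k = i then (if l = i then 1 else 0) else if k = l then 1 / s else 1)"

lemma nB_hB:
  assumes i: "i < q" and nz: "s \<noteq> 0" "cpar q s \<noteq> 0" "cpar q s + of_nat q - 1 \<noteq> 0"
  shows "nB q i s * hB q i s = 1\<^sub>m q"
proof (rule eq_matI)
  fix k l assume "k < dim_row (1\<^sub>m q :: complex mat)" "l < dim_col (1\<^sub>m q :: complex mat)"
  hence kl: "k < q" "l < q" by auto
  define a where "a = cpar q s"
  define \<rho> where "\<rho> = rpar q s"
  have s: "1 / s = 2 - of_nat q - a" by (simp add: a_def cpar_def)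
  have \<rho>: "\<rho> * (a * (a + of_nat q - 1)) = -1" using nz by (simp add: \<rho>_def rpar_def a_def)
  have a0: "a \<noteq> 0" using nz by (simp add: a_def)
  have S: "finite ({0..<q} - {i})" "card ({0..<q} - {i}) = q - 1" using i by auto
  have cq: "(of_nat (q - 1) :: complex) = of_nat q - 1" using i by (simp add: of_nat_diff)
  have "(nB q i s * hB q i s) $$ (k, l) = (\<Sum>m = 0..<q. nB q i s $$ (k, m) * hB q i s $$ (m, l))"
    using kl by (simp add: nB_def hB_def scalar_prod_def)
  also have "\<dots> = nB q i s $$ (k, i) * hB q i s $$ (i, l) + (\<Sum>m\<in>{0..<q} - {i}. nB q i s $$ (k, m) * hB q i s $$ (m, l))"
    by (rule sum.remove) (use i in auto)
  also have "\<dots> = (if k = l then 1 else 0)"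
  proof (cases "k = i")
    case True
    have "(\<Sum>m\<in>{0..<q} - {i}. nB q i s $$ (k, m) * hB q i s $$ (m, l)) = 0"
      by (rule sum.neutral) (use True i kl in \<open>auto simp: nB_def\<close>)
    thus ?thesis using True i kl by (auto simp: nB_def hB_def)
  next
    case ki: False
    have sum: "(\<Sum>m\<in>{0..<q} - {i}. nB q i s $$ (k, m) * hB q i s $$ (m, l)) =
      (\<Sum>m\<in>{0..<q} - {i}. (if m = k then \<rho> * (a + 1) else \<rho>) * (if m = l then 1 / s else 1))"
      by (rule sum.cong) (use ki i kl in \<open>auto simp: nB_def hB_def a_def \<rho>_def\<close>)
    show ?thesis
    proof (cases "l = i")
      case True
      have "(\<Sum>m\<in>{0..<q} - {i}. (if m = k then \<rho> * (a + 1) else \<rho>) * (if m = l then 1 / s else 1)) =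
         (\<Sum>m\<in>{0..<q} - {i}. (if m = k then \<rho> * (a + 1) else \<rho>) * (if m = k then 1 else 1))"
        by (rule sum.cong) (use True in auto)
      also have "\<dots> = \<rho> * (a + of_nat q - 1)"
        using ki kl S by (subst sum_two) (auto simp: cq algebra_simps)
      also have "\<dots> = - 1 / a" using \<rho> a0 by (simp add: field_simps)
      finally show ?thesis unfolding sum using True ki i kl by (simp add: nB_def hB_def flip: a_def)
    next
      case False
      have "(\<Sum>m\<in>{0..<q} - {i}. (if m = k then \<rho> * (a + 1) else \<rho>) * (if m = l then 1 / s else 1)) = (if k = l then 1 else 0)"
      proof (cases "k = l")
        case True
        have "(\<Sum>m\<in>{0..<q} - {i}. (if m = k then \<rho> * (a + 1) else \<rho>) * (if m = l then 1 / s else 1)) =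
          - (\<rho> * (a * (a + of_nat q - 1)))"
          unfolding s using ki kl S True by (subst sum_two) (auto simp: cq algebra_simps)
        thus ?thesis using \<rho> True by simp
      next
        case kl': False
        show ?thesis unfolding s using ki kl S False kl' by (subst sum_two) (auto simp: cq algebra_simps)
      qed
      thus ?thesis unfolding sum using False ki i kl by (simp add: nB_def hB_def)
    qed
  qed
  finally show "(nB q i s * hB q i s) $$ (k, l) = 1\<^sub>m q $$ (k, l)" using kl by simp
qed (auto simp: nB_def hB_def)

text \<open>The parameter may depend on \<open>n\<close>; this suffices because valuations are
  computed for one iterate at a time.\<close>

lemma good_parameter:
  assumes q: "4 \<le> q" and i: "i < q"
  shows "\<exists>s. s \<noteq> 0 \<and> cpar q s \<noteq> 0 \<and> cpar q s + 1 \<noteq> 0 \<and> cpar q s + of_nat q - 1 \<noteq> 0 \<and>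
     det (Tau q i s) \<noteq> 0 \<and> Good q n (Iv (Tau q i s))"
proof -
  have A0: "(0::complex) \<noteq> 1" "(0::complex) + of_nat q - 1 \<noteq> 0"
  proof -
    have "of_nat q \<noteq> (1 :: complex)" using q of_nat_eq_iff[of q 1, where ?'a = complex] by simp
    thus "(0::complex) + of_nat q - 1 \<noteq> 0" by simp
  qed simp
  have T: "((\<lambda>s. Tau q i s $$ (k, l)) \<longlongrightarrow> At q 0 $$ (k, l)) (at 0)" if "k < q" "l < q" for k l
    using that by (cases "k = l"; cases "k = i") (auto simp: Tau_def)
  have Tc: "Tau q i s \<in> carrier_mat q q" for s by (simp add: Tau_def)
  have "((\<lambda>s. det (Tau q i s)) \<longlongrightarrow> det (At q 0)) (at 0)" by (rule tendsto_det[OF Tc At_carrier T])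
  hence e1: "eventually (\<lambda>s. det (Tau q i s) \<noteq> 0) (at 0)"
    by (rule tendsto_imp_eventually_ne) (rule Iv_At(1)[OF A0])
  have "Good q n (Iv (At q (0::complex)))"
    unfolding Iv_At(2)[OF A0] using Good_At[OF q, of "2 - real q" "inverse (- (0 - 1) * (0 + of_nat q - 1))" n] A0 q
    by simp
  hence e2: "eventually (\<lambda>s. Good q n (Iv (Tau q i s))) (at 0)"
  proof (rule Good_eventually[rotated 3])
    show "((\<lambda>s. Iv (Tau q i s) $$ (k, l)) \<longlongrightarrow> Iv (At q 0) $$ (k, l)) (at 0)" if "k < q" "l < q" for k l
      by (rule tendsto_Iv[OF Tc At_carrier T Iv_At(1)[OF A0] that])
  qed (simp_all add: Tc)
  have e3: "eventually (\<lambda>s. s \<noteq> (0::complex)) (at 0)" by (simp add: eventually_at_filter)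
  \<comment> \<open>After multiplication by \<open>s\<close> the conditions on \<open>cpar\<close>
    become conditions on some \<open>b * s - 1\<close>, which tends to \<open>-1\<close>.\<close>
  have lin: "eventually (\<lambda>s. b * s - 1 \<noteq> (0::complex)) (at 0)" for b
  proof (rule tendsto_imp_eventually_ne)
    show "((\<lambda>s. b * s - 1) \<longlongrightarrow> b * 0 - 1) (at 0)" by (intro tendsto_intros)
  qed simp
  have "eventually (\<lambda>s. s \<noteq> 0 \<and> cpar q s \<noteq> 0 \<and> cpar q s + 1 \<noteq> 0 \<and> cpar q s + of_nat q - 1 \<noteq> 0 \<and>
     det (Tau q i s) \<noteq> 0 \<and> Good q n (Iv (Tau q i s))) (at 0)"
    using e1 e2 e3 lin[of "2 - of_nat q"] lin[of "3 - of_nat q"] lin[of 1]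
  proof eventually_elim
    case (elim s)
    have "cpar q s = ((2 - of_nat q) * s - 1) / s" "cpar q s + 1 = ((3 - of_nat q) * s - 1) / s"
      "cpar q s + of_nat q - 1 = (1 * s - 1) / s"
      using elim(3) by (simp_all add: cpar_def field_simps)
    thus ?case using elim by simp
  qed
  thus ?thesis by (rule eventually_happens'[rotated]) (rule at_neq_bot)
qed

section \<open>The divisors of the matrix entries\<close>

text \<open>Permutes rows and columns. K commutes with this up to exchanging the two permutations,
  so any entry can be moved onto the diagonal.\<close>

definition Pp :: "nat \<Rightarrow> (nat \<Rightarrow> nat) \<Rightarrow> (nat \<Rightarrow> nat) \<Rightarrow> 'a mat \<Rightarrow> 'a mat" where
  "Pp q \<sigma> \<tau> A = mat q q (\<lambda>(k, l). A $$ (\<sigma> k, \<tau> l))"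

lemma Pp_carrier [simp]: "Pp q \<sigma> \<tau> A \<in> carrier_mat q q"
  by (simp add: Pp_def)

lemma perm_lt: "\<sigma> permutes {0..<q} \<Longrightarrow> k < q \<Longrightarrow> \<sigma> k < (q :: nat)"
  using permutes_in_image[of \<sigma> "{0..<q}" k] by simp

lemma Jm_Pp:
  assumes "A \<in> carrier_mat q q" "\<sigma> permutes {0..<q}" "\<tau> permutes {0..<q}"
  shows "Jm (Pp q \<sigma> \<tau> A) = Pp q \<sigma> \<tau> (Jm A)"
proof (rule eq_matI)
  fix i j assume "i < dim_row (Pp q \<sigma> \<tau> (Jm A))" "j < dim_col (Pp q \<sigma> \<tau> (Jm A))"
  hence ij: "i < q" "j < q" by (auto simp: Pp_def)
  show "Jm (Pp q \<sigma> \<tau> A) $$ (i, j) = Pp q \<sigma> \<tau> (Jm A) $$ (i, j)"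
    using ij assms perm_lt[OF assms(2) ij(1)] perm_lt[OF assms(3) ij(2)]
    by (simp add: Jm_index[of _ q] Pp_def[of q \<sigma> \<tau> "Jm A"]) (simp add: Pp_def)
qed (auto simp: Pp_def)

lemma Pp_Pp:
  assumes "A \<in> carrier_mat q q" "B \<in> carrier_mat q q" "A * B = 1\<^sub>m q" "\<sigma> permutes {0..<q}" "\<tau> permutes {0..<q}"
  shows "Pp q \<sigma> \<tau> A * Pp q \<tau> \<sigma> B = (1\<^sub>m q :: 'a::field mat)"
proof (rule eq_matI)
  fix i j assume "i < dim_row (1\<^sub>m q :: 'a mat)" "j < dim_col (1\<^sub>m q :: 'a mat)"
  hence ij: "i < q" "j < q" by auto
  note lt = perm_lt[OF assms(4) ij(1)] perm_lt[OF assms(4) ij(2)]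
  have "(Pp q \<sigma> \<tau> A * Pp q \<tau> \<sigma> B) $$ (i, j) = (\<Sum>k = 0..<q. A $$ (\<sigma> i, \<tau> k) * B $$ (\<tau> k, \<sigma> j))"
    using ij by (simp add: Pp_def scalar_prod_def)
  also have "\<dots> = (\<Sum>k = 0..<q. A $$ (\<sigma> i, k) * B $$ (k, \<sigma> j))"
    using sum.permute[OF assms(5), of "\<lambda>k. A $$ (\<sigma> i, k) * B $$ (k, \<sigma> j)"] by (simp add: o_def)
  also have "\<dots> = (A * B) $$ (\<sigma> i, \<sigma> j)" using lt assms(1,2) by (simp add: scalar_prod_def)
  also have "\<dots> = (1\<^sub>m q :: 'a mat) $$ (i, j)"
    unfolding assms(3) using lt ij permutes_inj[OF assms(4)] by (auto simp: inj_def)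
  finally show "(Pp q \<sigma> \<tau> A * Pp q \<tau> \<sigma> B) $$ (i, j) = (1\<^sub>m q :: 'a mat) $$ (i, j)" .
qed (auto simp: Pp_def)

lemma Km_Pp:
  fixes A :: "'a::field mat"
  assumes "A \<in> carrier_mat q q" "\<sigma> permutes {0..<q}" "\<tau> permutes {0..<q}" "det (Jm A) \<noteq> 0"
  shows "Km (Pp q \<sigma> \<tau> A) = Pp q \<tau> \<sigma> (Km A)"
  unfolding Km_def Jm_Pp[OF assms(1-3)]
  by (rule Im_unique(2)[of _ q]) (use assms in \<open>auto intro!: Pp_Pp Im_inverse\<close>)

lemma det_Pp:
  fixes A :: "'a::field mat"
  assumes A: "A \<in> carrier_mat q q" and p: "\<sigma> permutes {0..<q}" "\<tau> permutes {0..<q}"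
  shows "det (Pp q \<sigma> \<tau> A) = det A \<or> det (Pp q \<sigma> \<tau> A) = - det A"
proof -
  let ?B = "mat q q (\<lambda>(i, j). A $$ (\<sigma> i, j))"
  let ?C = "mat q q (\<lambda>(i, j). transpose_mat ?B $$ (\<tau> i, j))"
  have "Pp q \<sigma> \<tau> A = transpose_mat ?C"
    by (rule eq_matI) (auto simp: Pp_def perm_lt[OF p(2)])
  hence "det (Pp q \<sigma> \<tau> A) = det ?C" by (simp add: det_transpose[of _ q])
  also have "\<dots> = signof \<tau> * det (transpose_mat ?B)" by (rule det_permute_rows) (use p in auto)
  also have "\<dots> = signof \<tau> * (signof \<sigma> * det A)"
    by (simp add: det_transpose[of _ q] det_permute_rows[OF A p(1)])
  finally have "det (Pp q \<sigma> \<tau> A) = signof \<tau> * (signof \<sigma> * det A)" .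
  thus ?thesis by (cases \<sigma> rule: sign_cases; cases \<tau> rule: sign_cases) simp_all
qed

section \<open>Valuations along a coordinate hyperplane\<close>

lemma prime_V: "prime_elem (V w)"
proof (rule irreducible_prime_elem, unfold irreducible_def, intro conjI allI impI)
  have t: "tdeg (V w) = 1" using hm_tdeg[OF hm_V V_neq_0] .
  show "V w \<noteq> 0" "\<not> V w dvd 1" using t by (auto simp: unit_iff)
  fix a b assume ab: "V w = a * b"
  hence nz: "a \<noteq> 0" "b \<noteq> 0" using V_neq_0[of w] by auto
  hence "tdeg a + tdeg b = 1" using t ab tdeg_mult by simp
  thus "a dvd 1 \<or> b dvd 1" using nz by (auto simp: unit_iff)
qed

text \<open>The point \<open>g\<close> lies on the hyperplane \<open>x_w = 0\<close>, so a numerator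
  or denominator that does not vanish there is not divisible by \<open>V w\<close>.\<close>

lemma reg_val:
  assumes "reg g x z" "z \<noteq> 0" "g w = 0"
  shows "x \<noteq> 0 \<and> valp (V w) x = 0"
proof -
  interpret g: comm_ring_hom "ev (\<lambda>c. c) g" by (rule ev_hom[OF id_hom])
  obtain a b where 1: "x = F a / F b" "ev (\<lambda>c. c) g b \<noteq> 0" "z = ev (\<lambda>c. c) g a / ev (\<lambda>c. c) g b"
    using assms(1) unfolding reg_def by blast
  have nd: "\<not> V w dvd f" if "ev (\<lambda>c. c) g f \<noteq> 0" for f
  proof
    assume "V w dvd f"
    then obtain h where "f = V w * h" ..
    thus False using that assms(3) by (simp add: g.hom_mult id_hom)
  qed
  have a: "ev (\<lambda>c. c) g a \<noteq> 0" using 1 assms(2) by auto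
  have nz: "a \<noteq> 0" "b \<noteq> 0" using a 1 by auto
  have "ordp (V w) a = 0" "ordp (V w) b = 0"
    using nd[OF a] nd[OF 1(2)] ordp_pos_iff[OF prime_V nz(1), of w] ordp_pos_iff[OF prime_V nz(2), of w] by auto
  thus ?thesis using 1 nz valp_F[OF prime_V, of a b w] by simp
qed

lemma valp_V: "valp (V w) (F (V w)) = 1"
  using valp_to_fract[OF prime_V V_neq_0] ordp_eqI[OF prime_V, of w 1 1] prime_V[of w] by (auto simp: prime_elem_def)

context mdim
begin

definition kn :: "nat \<Rightarrow> 'a::field mat \<Rightarrow> 'a mat" where "kn n A = (Km ^^ n) A"

lemma kn_0 [simp]: "kn 0 A = A" and kn_Suc: "kn (Suc n) A = kn n (Km A)" and kn_Suc': "kn (Suc n) A = Km (kn n A)"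
  by (simp_all add: kn_def funpow_swap1)

lemma kn_carrier [simp]: "A \<in> carrier_mat n n \<Longrightarrow> kn k A \<in> carrier_mat n n"
  by (induction k arbitrary: A) (auto simp: kn_Suc)

text \<open>The orders of the entries of the iterates along \<open>x i i = 0\<close>: a simple zero
  at one entry spreads to row and column \<open>i\<close> after one step; from the second step on,
  row \<open>i\<close> and column \<open>i\<close> of a matrix of units are each multiplied by
  \<open>x i i\<close>.\<close>

definition eord :: "nat \<Rightarrow> nat \<Rightarrow> nat \<Rightarrow> nat \<Rightarrow> int" where
  "eord i n k l = (if n = 0 then (if k = i \<and> l = i then 1 else 0)
     else if n = 1 then (if k = i \<or> l = i then 1 else 0)
     else (if k = i then 1 else 0) + (if l = i then 1 else 0))"

lemma kn_scl:
  assumes "regm g q A a" "Good q n a" "g w = 0" "\<And>k. k < q \<Longrightarrow> D k \<noteq> 0"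
  shows "kn n (scl q D A D) = scl q D (kn n A) D"
  using assms(1,2)
proof (induction n arbitrary: A a)
  case (Suc n)
  have A: "A \<in> carrier_mat q q" using Suc.prems by (simp add: regm_def)
  have rg: "reg g (det (Jm A)) (det (Jm a))"
    by (rule reg_det[of _ q], rule regm_Jm[OF Suc.prems(1)]) (use Suc.prems(2) in auto)
  hence "det (Jm A) \<noteq> 0" using reg_val[OF rg _ assms(3)] Suc.prems(2) by simp
  hence "Km (scl q D A D) = scl q D (Km A) D" by (rule Km_scl[OF A]) (use assms(4) in auto)
  moreover have "regm g q (Km A) (Km a)" by (rule regm_Km[OF Suc.prems])
  ultimately show ?case using Suc.IH[of "Km A" "Km a"] Suc.prems(2) by (simp add: kn_Suc)
qed simp

text \<open>Along the divisor the iterates degenerate, but the diagonal matrix \<open>D\<close> with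
  entry \<open>x_w\<close> at \<open>i\<close> repairs them: \<open>K A = H1 D = D H2\<close>, and
  \<open>J(K A)\<close> becomes regular with value \<open>Tau\<close> after multiplication by
  \<open>D\<close> on both sides. From \<open>K^2 A = D S D\<close> on, \<open>D\<close> is carried
  along by equivariance, and the orbit of \<open>S\<close> is good at the chosen point.\<close>

lemma divisor_orbit:
  fixes A :: "mpoly fract mat"
  assumes A: "A \<in> carrier_mat q q" and i: "i < q" and gw: "g w = 0" and Aii: "A $$ (i, i) = F (V w)"
    and Aii': "reg g (F (V w)) 0"
    and s: "s \<noteq> 0" "cpar q s \<noteq> 0" "cpar q s + 1 \<noteq> 0" "cpar q s + of_nat q - 1 \<noteq> 0" "det (Tau q i s) \<noteq> 0"
      "Good q (n - 2) (Iv (Tau q i s))"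
    and Aij: "\<And>k l. k < q \<Longrightarrow> l < q \<Longrightarrow> \<not> (k = i \<and> l = i) \<Longrightarrow> reg g (A $$ (k, l)) 
       (if k = i \<or> l = i then cpar q s else if k = l then 1 / (rpar q s * (cpar q s + 1)) else 1 / rpar q s)"
  shows "(\<forall>k<q. \<forall>l<q. kn n A $$ (k, l) \<noteq> 0 \<and> valp (V w) (kn n A $$ (k, l)) = eord i n k l) \<and>
    det (Jm (kn n A)) \<noteq> 0 \<and> valp (V w) (det (Jm (kn n A))) = (if n = 0 then -1 else -2)"
proof -
  let ?v = "valp (V w)"
  interpret v: valuation ?v by (rule valp_valuation[OF prime_V])
  have rv: "x \<noteq> 0 \<and> ?v x = 0" if "reg g x z" "z \<noteq> 0" for x z
    by (rule reg_val[OF that gw])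
  define \<epsilon> where "\<epsilon> = F (V w)"
  have \<epsilon>: "\<epsilon> \<noteq> 0" "?v \<epsilon> = 1" "reg g \<epsilon> 0" using valp_V Aii' by (auto simp: \<epsilon>_def)
  define D where "D k = (if k = i then \<epsilon> else 1)" for k
  have D0: "D k \<noteq> 0" for k using \<epsilon> by (simp add: D_def)
  have vD: "?v (D k) = (if k = i then 1 else 0)" for k using \<epsilon> by (simp add: D_def)
  have pD: "(\<Prod>k<q. D k) = \<epsilon>" unfolding D_def using i by (simp add: prod.delta)
  have \<rho>: "rpar q s \<noteq> 0" using s by (simp add: rpar_def)
  have nz: "A $$ (k, l) \<noteq> 0 \<and> ?v (A $$ (k, l)) = 0" if "k < q" "l < q" "\<not> (k = i \<and> l = i)" for k l
    by (rule rv[OF Aij[OF that]]) (use s \<rho> in auto)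
  have JA: "Jm A \<in> carrier_mat q q" using A by simp
  have inv: "reg g (inverse (A $$ (k, l))) (nB q i s $$ (k, l))" if "k < q" "l < q" "k \<noteq> i" for k l
    using reg_inverse[OF Aij, of k l] that s \<rho> by (auto simp: nB_def divide_inverse)
  have inv': "reg g (inverse (A $$ (k, l))) (nB q i s $$ (l, k))" if "k < q" "l < q" "l \<noteq> i" for k l
    using reg_inverse[OF Aij, of k l] that s \<rho> by (auto simp: nB_def divide_inverse)
  note H = Im_unique[OF _ _ nB_hB[OF i s(1,2,4)]]
  have nBc: "nB q i s \<in> carrier_mat q q" "hB q i s \<in> carrier_mat q q" by (auto simp: nB_def hB_def)
  note H = H[OF nBc]
  \<comment> \<open>\<open>J A\<close> has its only pole at \<open>(i, i)\<close>, which scaling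
    either row or column \<open>i\<close> removes. Both versions are used: the value
    \<open>hB\<close> of \<open>Iv N1\<close> vanishes in row \<open>i\<close> off the diagonal,
    where \<open>Iv N2\<close> shows the exact order.\<close>
  define N1 where "N1 = scl q D (Jm A) (\<lambda>_. 1)"
  define N2 where "N2 = scl q (\<lambda>_. 1) (Jm A) D"
  have N1: "regm g q N1 (nB q i s)"
    unfolding regm_def
  proof (intro conjI allI impI)
    fix k l assume kl: "k < q" "l < q"
    have N1kl: "N1 $$ (k, l) = D k * inverse (A $$ (k, l))" using kl A by (simp add: N1_def Jm_index[of _ q])
    show "reg g (N1 $$ (k, l)) (nB q i s $$ (k, l))"
    proof (cases "k = i")
      case True
      show ?thesis
      proof (cases "l = i")
        case True
        thus ?thesis unfolding N1kl using \<open>k = i\<close> i \<epsilon> Aii by (simp add: D_def nB_def reg_1 \<epsilon>_def)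
      next
        case False
        have "reg g (\<epsilon> * inverse (A $$ (k, l))) (0 * inverse (cpar q s))"
          by (intro reg_mult \<epsilon> reg_inverse) (use Aij[OF kl] True False s in auto)
        thus ?thesis unfolding N1kl using True False kl by (simp add: D_def nB_def)
      qed
    next
      case False
      thus ?thesis using inv[OF kl] by (simp add: N1kl D_def)
    qed
  qed (auto simp: N1_def nBc)
  let ?nt = "transpose_mat (nB q i s)" and ?ht = "transpose_mat (hB q i s)"
  have N2: "regm g q N2 ?nt"
    unfolding regm_def
  proof (intro conjI allI impI)
    fix k l assume kl: "k < q" "l < q"
    have N2kl: "N2 $$ (k, l) = inverse (A $$ (k, l)) * D l" using kl A by (simp add: N2_def Jm_index[of _ q])
    have t: "?nt $$ (k, l) = nB q i s $$ (l, k)" using kl nBc by simp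
    show "reg g (N2 $$ (k, l)) (?nt $$ (k, l))"
    proof (cases "l = i")
      case True
      show ?thesis
      proof (cases "k = i")
        case True
        thus ?thesis unfolding t N2kl using \<open>l = i\<close> i \<epsilon> Aii by (simp add: D_def nB_def reg_1 \<epsilon>_def)
      next
        case False
        have "reg g (inverse (A $$ (k, l)) * \<epsilon>) (inverse (cpar q s) * 0)"
          by (intro reg_mult \<epsilon> reg_inverse) (use Aij[OF kl] True False s in auto)
        thus ?thesis unfolding t N2kl using True False kl by (simp add: D_def nB_def)
      qed
    next
      case False
      thus ?thesis using inv'[OF kl] by (simp add: t N2kl D_def)
    qed
  qed (auto simp: N2_def nBc)
  have "?nt * ?ht = transpose_mat (hB q i s * nB q i s)" by (rule transpose_mult[OF nBc(2,1), symmetric])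
  also have "hB q i s * nB q i s = 1\<^sub>m q" using Im_inverse(2)[OF nBc(1) H(1)] H(2) by simp
  finally have nht: "?nt * ?ht = 1\<^sub>m q" by simp
  note Ht = Im_unique[OF _ _ nht]
  have ntc: "?nt \<in> carrier_mat q q" "?ht \<in> carrier_mat q q" using nBc by auto
  note Ht = Ht[OF ntc]
  have dN1: "det N1 \<noteq> 0" "?v (det N1) = 0" using rv[OF reg_det[OF N1] H(1)] by auto
  have "det N1 = \<epsilon> * det (Jm A)" unfolding N1_def by (simp add: det_scl[OF JA] pD)
  hence dJA: "det (Jm A) \<noteq> 0" "?v (det (Jm A)) = -1" using dN1 \<epsilon> by (auto simp: v.v_mult)
  show ?thesis
  proof (cases "n = 0")
    case True
    thus ?thesis using dJA nz Aii \<epsilon> by (auto simp: eord_def \<epsilon>_def)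
  next
    case n0: False
    define H1 where "H1 = Iv N1"
    define H2 where "H2 = Iv N2"
    have rH1: "regm g q H1 (hB q i s)" unfolding H1_def using regm_Iv[OF N1 H(1)] H(2) by simp
    have rH2: "regm g q H2 ?ht" unfolding H2_def using regm_Iv[OF N2 Ht(1)] Ht(2) by simp
    define M1 where "M1 = Km A"
    have M1c: "M1 \<in> carrier_mat q q" "Jm M1 \<in> carrier_mat q q" using A by (auto simp: M1_def)
    have "H1 = scl q (\<lambda>_. inverse 1) (Iv (Jm A)) (\<lambda>k. inverse (D k))"
      unfolding H1_def N1_def by (rule Im_scl[OF JA dJA(1)]) (auto simp: D0)
    hence M1_H1: "M1 $$ (k, l) = H1 $$ (k, l) * D l" if "k < q" "l < q" for k l
      using that D0 by (simp add: M1_def Km_def)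
    have "H2 = scl q (\<lambda>k. inverse (D k)) (Iv (Jm A)) (\<lambda>_. inverse 1)"
      unfolding H2_def N2_def by (rule Im_scl[OF JA dJA(1)]) (auto simp: D0)
    hence M1_H2: "M1 $$ (k, l) = D k * H2 $$ (k, l)" if "k < q" "l < q" for k l
      using that D0 by (simp add: M1_def Km_def)
    have h1: "reg g (H1 $$ (k, l)) (hB q i s $$ (k, l))" if "k < q" "l < q" for k l
      using rH1 that by (simp add: regm_def)
    have h2: "reg g (H2 $$ (k, l)) (hB q i s $$ (l, k))" if "k < q" "l < q" for k l
      using rH2 that nBc by (simp add: regm_def)
    have M1v: "M1 $$ (k, l) \<noteq> 0 \<and> ?v (M1 $$ (k, l)) = eord i 1 k l" if kl: "k < q" "l < q" for k l
    proof (cases "k = i \<and> l \<noteq> i")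
      case True
      have "H2 $$ (k, l) \<noteq> 0 \<and> ?v (H2 $$ (k, l)) = 0" by (rule rv[OF h2[OF kl]]) (use True kl s in \<open>auto simp: hB_def\<close>)
      thus ?thesis unfolding M1_H2[OF kl] using True \<epsilon> by (simp add: v.v_mult D_def eord_def)
    next
      case False
      have "H1 $$ (k, l) \<noteq> 0 \<and> ?v (H1 $$ (k, l)) = 0" by (rule rv[OF h1[OF kl]]) (use False kl s in \<open>auto simp: hB_def\<close>)
      thus ?thesis using False \<epsilon> by (simp add: M1_H1[OF kl] v.v_mult D_def eord_def)
    qed
    define T where "T = scl q D (Jm M1) D"
    have rT: "regm g q T (Tau q i s)"
      unfolding regm_def
    proof (intro conjI allI impI)
      fix k l assume kl: "k < q" "l < q"
      have Tkl: "T $$ (k, l) = D k * inverse (M1 $$ (k, l)) * D l" using kl M1c by (simp add: T_def Jm_index[of _ q])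
      show "reg g (T $$ (k, l)) (Tau q i s $$ (k, l))"
      proof (cases "k = i \<and> l \<noteq> i")
        case True
        have "T $$ (k, l) = inverse (H2 $$ (k, l))" unfolding Tkl M1_H2[OF kl] using True \<epsilon> by (simp add: D_def)
        moreover have "reg g (inverse (H2 $$ (k, l))) (inverse (hB q i s $$ (l, k)))"
          by (rule reg_inverse[OF h2[OF kl]]) (use True kl in \<open>auto simp: hB_def\<close>)
        ultimately show ?thesis using True kl by (simp add: hB_def Tau_def)
      next
        case False
        have "reg g (inverse (H1 $$ (k, l))) (inverse (hB q i s $$ (k, l)))"
          by (rule reg_inverse[OF h1[OF kl]]) (use False kl s in \<open>auto simp: hB_def\<close>)
        moreover have "T $$ (k, l) = D k * inverse (H1 $$ (k, l))" using \<epsilon> by (simp add: Tkl M1_H1[OF kl] D_def)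
        moreover have "reg g (D k) (if k = i then 0 else 1)" using \<epsilon> reg_1 by (simp add: D_def)
        ultimately have "reg g (T $$ (k, l)) ((if k = i then 0 else 1) * inverse (hB q i s $$ (k, l)))"
          using reg_mult by metis
        thus ?thesis using False kl by (auto simp: hB_def Tau_def split: if_splits)
      qed
    qed (auto simp: T_def Tau_def)
    have dT: "det T \<noteq> 0" "?v (det T) = 0" using rv[OF reg_det[OF rT] s(5)] by auto
    have "det T = \<epsilon> * det (Jm M1) * \<epsilon>" unfolding T_def by (simp add: det_scl[OF M1c(2)] pD)
    hence dJM1: "det (Jm M1) \<noteq> 0" "?v (det (Jm M1)) = -2" using dT \<epsilon> by (auto simp: v.v_mult)
    show ?thesis
    proof (cases "n = 1")
      case True
      thus ?thesis using dJM1 M1v by (simp add: kn_Suc M1_def)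
    next
      case n1: False
      define k0 where "k0 = n - 2"
      have n: "n = Suc (Suc k0)" using n0 n1 by (simp add: k0_def)
      define S where "S = Iv T"
      have rS: "regm g q S (Iv (Tau q i s))" unfolding S_def by (rule regm_Iv[OF rT s(5)])
      have "S = scl q (\<lambda>k. inverse (D k)) (Iv (Jm M1)) (\<lambda>k. inverse (D k))"
        unfolding S_def T_def by (rule Im_scl[OF M1c(2) dJM1(1)]) (auto simp: D0)
      hence "Km M1 = scl q D S D"
        using M1c D0 by (intro eq_matI) (auto simp: Km_def mult.assoc)
      moreover have G: "Good q k0 (Iv (Tau q i s))" using s(6) by (simp add: k0_def)
      ultimately have kn: "kn n A = scl q D (kn k0 S) D"
        unfolding n kn_Suc M1_def[symmetric] using kn_scl[OF rS G gw] D0 by simp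
      have rk: "regm g q (kn k0 S) (kn k0 (Iv (Tau q i s)))" "Good q 0 (kn k0 (Iv (Tau q i s)))"
        using regm_iter[OF rS G] by (auto simp: kn_def)
      have Sc: "S \<in> carrier_mat q q" "Jm (kn k0 S) \<in> carrier_mat q q" by (auto simp: S_def T_def)
      have unit: "kn k0 S $$ (k, l) \<noteq> 0 \<and> ?v (kn k0 S $$ (k, l)) = 0" if "k < q" "l < q" for k l
        by (rule rv) (use rk that in \<open>auto simp: regm_def\<close>)
      have "reg g (det (Jm (kn k0 S))) (det (Jm (kn k0 (Iv (Tau q i s)))))"
        by (rule reg_det[of _ q], rule regm_Jm[OF rk(1)]) (use rk(2) in auto)
      hence dk: "det (Jm (kn k0 S)) \<noteq> 0 \<and> ?v (det (Jm (kn k0 S))) = 0" using rv rk(2) by simp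
      have "Jm (kn n A) = scl q (\<lambda>k. inverse (D k)) (Jm (kn k0 S)) (\<lambda>k. inverse (D k))"
        unfolding kn by (rule Jm_scl) (use Sc in simp)
      moreover have "(\<Prod>k<q. inverse (D k)) = inverse \<epsilon>"
        using prod_inversef[of D "{..<q}"] pD by (simp add: o_def)
      ultimately have "det (Jm (kn n A)) = inverse \<epsilon> * det (Jm (kn k0 S)) * inverse \<epsilon>"
        by (simp add: det_scl[OF Sc(2)])
      hence "det (Jm (kn n A)) \<noteq> 0 \<and> ?v (det (Jm (kn n A))) = -2"
        using dk \<epsilon> by (simp add: v.v_mult v.v_inverse)
      moreover have "kn n A $$ (k, l) \<noteq> 0 \<and> ?v (kn n A $$ (k, l)) = eord i n k l" if kl: "k < q" "l < q" for k l
        unfolding kn using unit[OF kl] kl D0 n by (simp add: v.v_mult vD eord_def)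
      ultimately show ?thesis using n0 by simp
    qed
  qed
qed

section \<open>The three local sequences of the orbit of the generic matrix\<close>

definition mvl :: "('a::field \<Rightarrow> int) \<Rightarrow> 'a mat \<Rightarrow> int" where
  "mvl v A = Min ((\<lambda>w. v (A $$ w)) ` coords q)"

definition svl :: "('a::field \<Rightarrow> int) \<Rightarrow> 'a mat \<Rightarrow> int" where
  "svl v A = v (\<Prod>w\<in>coords q. A $$ w)"

definition cvl :: "('a::field \<Rightarrow> int) \<Rightarrow> 'a mat \<Rightarrow> int" where
  "cvl v A = v (det (Jm A))"

definition "phiK x = phiJ q (phiI q x)"

lemma phiK_hom: "comm_ring_hom phiK"
proof -
  interpret I: comm_ring_hom "phiI q" by (rule phiI_hom)
  interpret J: comm_ring_hom "phiJ q" by (rule phiJ_hom)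
  show ?thesis by unfold_locales (auto simp: phiK_def I.hom_add J.hom_add I.hom_mult J.hom_mult)
qed

lemma map_phiK_X: "map_mat phiK X = Km X"
proof -
  have "map_mat phiK X = map_mat (phiJ q) (map_mat (phiI q) X)" by (rule eq_matI) (auto simp: phiK_def)
  also have "\<dots> = Iv (Jm X)" by (simp add: map_phiI map_phiJ flip: Im_hom[OF phiJ_hom XF_carrier])
  finally show ?thesis by (simp add: Km_def)
qed

lemma kn_hom: "comm_ring_hom h \<Longrightarrow> A \<in> carrier_mat q q \<Longrightarrow> kn n (map_mat h A) = map_mat h (kn n A)"
  by (induction n) (simp_all add: kn_Suc' Km_hom[where n = q])

text \<open>The iterates of \<open>X\<close> are its images under powers of the field homomorphism
  \<open>phiK\<close>, which is injective; so nothing that is nonzero at the start can vanish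
  identically later.\<close>

lemma kn_X_nz:
  shows "i < q \<Longrightarrow> j < q \<Longrightarrow> kn n X $$ (i, j) \<noteq> 0" and "det (Jm (kn n X)) \<noteq> 0"
proof -
  interpret K: comm_ring_hom phiK by (rule phiK_hom)
  interpret J: comm_ring_hom "phiJ q" by (rule phiJ_hom)
  note f = field_hom_eq_0[OF phiK_hom]
  have S: "kn (Suc n) X = map_mat phiK (kn n X)" for n
    unfolding kn_Suc map_phiK_X[symmetric] by (rule kn_hom[OF phiK_hom]) simp
  have d: "dim_row (kn n X) = q" "dim_col (kn n X) = q" for n
    using carrier_matD[OF kn_carrier[OF XF_carrier, of n]] by auto
  show "i < q \<Longrightarrow> j < q \<Longrightarrow> kn n X $$ (i, j) \<noteq> 0"
    by (induction n) (simp_all add: S d f)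
  have "det (Jm X) = phiJ q (det X)" by (simp flip: map_phiJ J.hom_det)
  hence "det (Jm X) \<noteq> 0" by (simp add: field_hom_eq_0[OF phiJ_hom])
  thus "det (Jm (kn n X)) \<noteq> 0"
    by (induction n) (simp_all add: S Jm_hom[OF phiK_hom] f)
qed

lemma kn_Pp:
  assumes "A \<in> carrier_mat q q" "\<sigma> permutes {0..<q}" "\<tau> permutes {0..<q}" "\<And>n. det (Jm (kn n A)) \<noteq> 0"
  shows "kn n (Pp q \<sigma> \<tau> A) = (if even n then Pp q \<sigma> \<tau> (kn n A) else Pp q \<tau> \<sigma> (kn n A))"
  by (induction n) (use assms in \<open>auto simp: kn_Suc' Km_Pp\<close>)

lemma Pp_coords:
  assumes "\<sigma> permutes {0..<q}" "\<tau> permutes {0..<q}"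
  shows "bij_betw (\<lambda>(k, l). (\<sigma> k, \<tau> l)) (coords q) (coords q)"
proof -
  have "bij_betw (map_prod \<sigma> \<tau>) ({0..<q} \<times> {0..<q}) ({0..<q} \<times> {0..<q})"
    using assms by (intro bij_betw_map_prod permutes_imp_bij)
  thus ?thesis by (simp add: coords_def map_prod_def)
qed

lemma Pp_vl:
  assumes A: "A \<in> carrier_mat q q" and p: "\<sigma> permutes {0..<q}" "\<tau> permutes {0..<q}" and v: "valuation v"
  shows "mvl v (Pp q \<sigma> \<tau> A) = mvl v A" "svl v (Pp q \<sigma> \<tau> A) = svl v A" "cvl v (Pp q \<sigma> \<tau> A) = cvl v A"
proof -
  interpret v: valuation v by (rule v)
  let ?f = "\<lambda>(k, l). (\<sigma> k, \<tau> l)"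
  have eq: "Pp q \<sigma> \<tau> A $$ w = A $$ (?f w)" if "w \<in> coords q" for w
    using that by (auto simp: Pp_def coords_def)
  have "(\<lambda>w. v (Pp q \<sigma> \<tau> A $$ w)) ` coords q = (\<lambda>w. v (A $$ w)) ` ?f ` coords q"
    unfolding image_image by (rule image_cong) (simp_all add: eq)
  also have "?f ` coords q = coords q" using Pp_coords[OF p] by (simp add: bij_betw_def)
  finally show "mvl v (Pp q \<sigma> \<tau> A) = mvl v A" by (simp add: mvl_def)
  have "(\<Prod>w\<in>coords q. Pp q \<sigma> \<tau> A $$ w) = (\<Prod>w\<in>coords q. A $$ (?f w))" by (rule prod.cong) (simp_all add: eq)
  also have "\<dots> = (\<Prod>w\<in>coords q. A $$ w)" by (rule prod.reindex_bij_betw[OF Pp_coords[OF p]])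
  finally show "svl v (Pp q \<sigma> \<tau> A) = svl v A" by (simp add: svl_def)
  have "det (Pp q \<sigma> \<tau> (Jm A)) = det (Jm A) \<or> det (Pp q \<sigma> \<tau> (Jm A)) = - det (Jm A)"
    by (rule det_Pp[OF _ p]) (use A in simp)
  thus "cvl v (Pp q \<sigma> \<tau> A) = cvl v A" unfolding cvl_def Jm_Pp[OF A p] by (auto simp: v.v_uminus)
qed

lemma sum_eord:
  assumes i: "i < q"
  shows "(\<Sum>(k, l)\<in>coords q. eord i n k l) = (if n = 0 then 1 else if n = 1 then 2 * int q - 1 else 2 * int q)"
proof -
  have a: "(\<Sum>k = 0..<q. \<Sum>l = 0..<q. if k = i \<and> l = i then 1 else 0) = (1 :: int)"
  proof -
    have "(\<Sum>l = 0..<q. if k = i \<and> l = i then 1 else 0) = (if k = i then 1 else (0 :: int))" for k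
      using i by (auto simp: sum.delta)
    thus ?thesis using i by (simp add: sum.delta)
  qed
  have b: "(\<Sum>k = 0..<q. \<Sum>l = 0..<q. (if k = i then 1 else 0) + (if l = i then 1 else 0)) = (2 * int q)"
    using i by (simp add: sum.distrib sum.delta sum_distrib_left[symmetric] mult.commute)
  have c: "(\<Sum>k = 0..<q. \<Sum>l = 0..<q. if k = i \<or> l = i then 1 else 0) = (2 * int q - 1)"
  proof -
    have "(\<Sum>k = 0..<q. \<Sum>l = 0..<q. if k = i \<or> l = i then 1 else 0) =
      (\<Sum>k = 0..<q. \<Sum>l = 0..<q. ((if k = i then 1 else 0) + (if l = i then 1 else 0)) - (if k = i \<and> l = i then 1 else (0 :: int)))"
      by (intro sum.cong) auto
    also have "\<dots> = 2 * int q - 1" by (simp only: sum_subtractf a b)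
    finally show ?thesis .
  qed
  show ?thesis unfolding coords_def sum.cartesian_product[symmetric] eord_def
    using a b c by auto
qed

text \<open>Exchanging columns \<open>i\<close> and \<open>j\<close> reduces to the diagonal entry
  \<open>(i, i)\<close>, as the three sequences are invariant under permutations of rows and
  columns.\<close>

lemma divisor_V:
  assumes q4: "4 \<le> q" and w: "w \<in> coords q"
  shows "mvl (valp (V w)) (kn n X) = 0"
    and "svl (valp (V w)) (kn n X) = (if n = 0 then 1 else if n = 1 then 2 * int q - 1 else 2 * int q)"
    and "cvl (valp (V w)) (kn n X) = (if n = 0 then -1 else -2)"
proof -
  interpret v: valuation "valp (V w)" by (rule valp_valuation[OF prime_V])
  obtain i j where ij: "w = (i, j)" "i < q" "j < q" using w by (cases w) (auto simp: coords_def)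
  define \<pi> where "\<pi> = Transposition.transpose i j"
  have \<pi>: "\<pi> permutes {0..<q}" unfolding \<pi>_def by (rule permutes_swap_id) (use ij in auto)
  have \<pi>i: "\<pi> i = j" "\<And>k. \<pi> (\<pi> k) = k" by (simp_all add: \<pi>_def)
  have \<pi>lt: "k < q \<Longrightarrow> \<pi> k < q" for k by (rule perm_lt[OF \<pi>])
  obtain s where s: "s \<noteq> 0" "cpar q s \<noteq> 0" "cpar q s + 1 \<noteq> 0" "cpar q s + of_nat q - 1 \<noteq> 0" "det (Tau q i s) \<noteq> 0"
      "Good q (n - 2) (Iv (Tau q i s))" using good_parameter[OF q4 ij(2), of "n - 2"] by blast
  \<comment> \<open>The coordinates of the point of specialization: the inverses of the nonzero
    entries of \<open>nB\<close>, with column \<open>i\<close> copied to row \<open>i\<close>, and 0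
    at \<open>(i, i)\<close>.\<close>
  define cv where "cv k l = (if k = i \<and> l = i then 0 else if k = i \<or> l = i then cpar q s
    else if k = l then 1 / (rpar q s * (cpar q s + 1)) else 1 / rpar q s)" for k l
  define g where "g = (\<lambda>(k, l). cv k (\<pi> l))"
  define A where "A = Pp q id \<pi> X"
  have A: "A \<in> carrier_mat q q" by (simp add: A_def)
  have Akl: "A $$ (k, l) = F (V (k, \<pi> l))" if "k < q" "l < q" for k l
    using that \<pi>lt by (simp add: A_def Pp_def)
  have gkl: "g (k, \<pi> l) = cv k l" for k l by (simp add: g_def \<pi>i)
  have Acv: "reg g (A $$ (k, l)) (cv k l)" if "k < q" "l < q" for k l
    unfolding Akl[OF that] gkl[symmetric] by (rule reg_V)
  have Areg: "reg g (A $$ (k, l)) (if k = i \<or> l = i then cpar q s else if k = l then 1 / (rpar q s * (cpar q s + 1)) else 1 / rpar q s)"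
    if "k < q" "l < q" "\<not> (k = i \<and> l = i)" for k l
  proof -
    have "cv k l = (if k = i \<or> l = i then cpar q s else if k = l then 1 / (rpar q s * (cpar q s + 1)) else 1 / rpar q s)"
      using that(3) by (auto simp: cv_def)
    thus ?thesis using Acv[OF that(1,2)] by (simp only:)
  qed
  have gw: "g w = 0" using gkl[of i i] by (simp add: ij \<pi>i cv_def)
  have Aii: "A $$ (i, i) = F (V w)" using Akl ij by (simp add: \<pi>i)
  have Aii': "reg g (F (V w)) 0" using reg_V[of g w] gw by simp
  note orb = divisor_orbit[OF A ij(2) gw Aii Aii' s Areg]
  have nz: "kn n A $$ w' \<noteq> 0" if "w' \<in> coords q" for w' using orb that by (auto simp: coords_def)
  have vkl: "valp (V w) (kn n A $$ w') = (case w' of (k, l) \<Rightarrow> eord i n k l)" if "w' \<in> coords q" for w'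
    using orb that by (auto simp: coords_def)
  have "svl (valp (V w)) (kn n A) = (\<Sum>w'\<in>coords q. valp (V w) (kn n A $$ w'))"
    unfolding svl_def by (rule v.v_prod) (rule nz)
  also have "\<dots> = (\<Sum>(k, l)\<in>coords q. eord i n k l)" by (rule sum.cong) (simp_all add: vkl)
  finally have 1: "svl (valp (V w)) (kn n A) = (if n = 0 then 1 else if n = 1 then 2 * int q - 1 else 2 * int q)"
    using sum_eord[OF ij(2)] by simp
  have "mvl (valp (V w)) (kn n A) = 0"
    unfolding mvl_def
  proof (rule Min_eqI)
    \<comment> \<open>A diagonal entry away from \<open>i\<close> keeps order 0 throughout, which
      pins the minimum to 0.\<close>
    obtain k where k: "k < q" "k \<noteq> i" using q4 that[of "if i = 0 then 1 else 0"] by auto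
    have "valp (V w) (kn n A $$ (k, k)) = 0" using vkl[of "(k, k)"] k by (simp add: coords_def eord_def)
    thus "0 \<in> (\<lambda>w'. valp (V w) (kn n A $$ w')) ` coords q" using k by (force simp: coords_def)
    show "0 \<le> y" if "y \<in> (\<lambda>w'. valp (V w) (kn n A $$ w')) ` coords q" for y
      using that vkl by (auto simp: eord_def)
  qed simp
  moreover have "cvl (valp (V w)) (kn n A) = (if n = 0 then -1 else -2)" using orb by (simp add: cvl_def)
  moreover have "kn n A = (if even n then Pp q id \<pi> (kn n X) else Pp q \<pi> id (kn n X))"
    unfolding A_def by (rule kn_Pp) (use \<pi> kn_X_nz in \<open>auto simp: permutes_id\<close>)
  hence "mvl (valp (V w)) (kn n A) = mvl (valp (V w)) (kn n X)" "svl (valp (V w)) (kn n A) = svl (valp (V w)) (kn n X)"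
    "cvl (valp (V w)) (kn n A) = cvl (valp (V w)) (kn n X)"
    using Pp_vl[OF _ permutes_id \<pi> v.valuation_axioms, of "kn n X"] Pp_vl[OF _ \<pi> permutes_id v.valuation_axioms, of "kn n X"]
    by (auto simp: id_def)
  ultimately show "mvl (valp (V w)) (kn n X) = 0"
    "svl (valp (V w)) (kn n X) = (if n = 0 then 1 else if n = 1 then 2 * int q - 1 else 2 * int q)"
    "cvl (valp (V w)) (kn n X) = (if n = 0 then -1 else -2)" using 1 by simp_all
qed

end

section \<open>The local identity\<close>

lemma (in valuation) v_power_int: "x \<noteq> 0 \<Longrightarrow> v (x powi n) = n * v x"
  by (auto simp: power_int_def v_power v_inverse)

lemma valp_assoc:
  assumes p: "prime_elem p" "prime_elem r" "p dvd r"
  shows "valp p x = valp r x"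
proof -
  obtain u where u: "r = p * u" using p(3) ..
  have "u dvd 1" using prime_elem_imp_irreducible[OF p(2)] u p(1)
    by (auto simp: irreducible_def prime_elem_def)
  then obtain u' where u': "1 = u * u'" ..
  have "p = r * u'" using u u' by (simp add: mult.assoc flip: u')
  hence "r dvd p" by simp
  have eq: "ordp p f = ordp r f" if "f \<noteq> 0" for f
  proof (rule antisym)
    have "p ^ ordp p f dvd f" "r ^ ordp r f dvd f" using ordp_ge[OF p(1) that] ordp_ge[OF p(2) that] by auto
    moreover have "r ^ n dvd p ^ n" "p ^ n dvd r ^ n" for n using p(3) \<open>r dvd p\<close> by (auto intro: dvd_power_same)
    ultimately show "ordp p f \<le> ordp r f" "ordp r f \<le> ordp p f"
      using ordp_ge[OF p(1) that] ordp_ge[OF p(2) that] by (meson dvd_trans)+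
  qed
  obtain a b where ab: "x = F a / F b" "b \<noteq> 0" by (rule fract_cases)
  show ?thesis
  proof (cases "a = 0")
    case False
    thus ?thesis using ab eq valp_F[OF p(1)] valp_F[OF p(2)] by simp
  next
    case True
    \<comment> \<open>At 0 both valuations are the same arbitrary value
      \<open>SOME n. False\<close>, so the equality holds for every \<open>x\<close> and the two
      functions can be identified.\<close>
    hence x: "x = 0" using ab by simp
    have "a = 0 \<or> b = 0" if "0 = F a / F b" for a b :: mpoly
      using that by (metis divide_eq_0_iff to_fract_eq_0_iff)
    hence "valp p 0 = (SOME n. False)" "valp r 0 = (SOME n. False)"
      unfolding valp_def by (metis (no_types, lifting))+
    thus ?thesis using x by simp
  qed
qed

context mdim
begin

lemma coords_ne: "coords q \<noteq> {}"
  using q0 by (auto simp: coords_def)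

lemma vl_hom:
  assumes h: "comm_ring_hom h" and A: "A \<in> carrier_mat q q" "\<And>w. w \<in> coords q \<Longrightarrow> A $$ w \<noteq> 0" "det (Jm A) \<noteq> 0"
    and v: "\<And>x. x \<noteq> 0 \<Longrightarrow> v (h x) = v' x"
  shows "mvl v (map_mat h A) = mvl v' A" "svl v (map_mat h A) = svl v' A" "cvl v (map_mat h A) = cvl v' A"
proof -
  interpret comm_ring_hom h by fact
  have eq: "map_mat h A $$ w = h (A $$ w)" if "w \<in> coords q" for w
    using that A(1) by (auto simp: coords_def)
  show "mvl v (map_mat h A) = mvl v' A" unfolding mvl_def
    by (rule arg_cong[where f = Min], rule image_cong) (simp_all add: eq v A)
  have "(\<Prod>w\<in>coords q. map_mat h A $$ w) = (\<Prod>w\<in>coords q. h (A $$ w))" by (rule prod.cong) (simp_all add: eq)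
  hence "(\<Prod>w\<in>coords q. map_mat h A $$ w) = h (\<Prod>w\<in>coords q. A $$ w)" by (simp add: hom_prod)
  moreover have "(\<Prod>w\<in>coords q. A $$ w) \<noteq> 0" using A by simp
  ultimately show "svl v (map_mat h A) = svl v' A" by (simp add: svl_def v)
  show "cvl v (map_mat h A) = cvl v' A" using A by (simp add: cvl_def Jm_hom[OF h] v)
qed

lemma kn_X_nz': "w \<in> coords q \<Longrightarrow> kn n X $$ w \<noteq> 0"
  using kn_X_nz(1) by (auto simp: coords_def)

lemma kn_nz_map:
  assumes h: "comm_ring_hom (h :: mpoly fract \<Rightarrow> mpoly fract)" and e: "kn n X = map_mat h (kn n B)" and B: "B \<in> carrier_mat q q"
  shows "w \<in> coords q \<Longrightarrow> kn n B $$ w \<noteq> 0" "det (Jm (kn n B)) \<noteq> 0"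
proof -
  interpret comm_ring_hom h by fact
  have c: "kn n B \<in> carrier_mat q q" using B by simp
  show "kn n B $$ w \<noteq> 0" if w: "w \<in> coords q"
  proof
    assume "kn n B $$ w = 0"
    hence "kn n X $$ w = 0" unfolding e using w c by (auto simp: coords_def)
    thus False using kn_X_nz'[OF w] by simp
  qed
  have "det (Jm (kn n X)) = h (det (Jm (kn n B)))" by (simp add: e Jm_hom[OF h])
  thus "det (Jm (kn n B)) \<noteq> 0" using kn_X_nz(2)[of n] by auto
qed

lemma hq_kn: "i < q \<Longrightarrow> j < q \<Longrightarrow> hq 1 (kn n X $$ (i, j))"
proof (induction n arbitrary: i j)
  case (Suc n)
  have "hq (- (- 1)) (Iv (Jm (kn n X)) $$ (i, j))"
    by (rule hq_Iv) (use Suc hq_Jm[of "kn n X" 1] in auto)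
  thus ?case by (simp add: kn_Suc' Km_def)
qed (simp add: hq_V coords_def)

lemma hq_kn': "w \<in> coords q \<Longrightarrow> hq 1 (kn n X $$ w)"
  using hq_kn by (auto simp: coords_def)

lemma hq_det_Jm_kn: "hq (- int q) (det (Jm (kn n X)))"
proof -
  have "hq (int q * (- 1)) (det (Jm (kn n X)))"
    by (rule hq_det) (use hq_Jm[of "kn n X" 1] hq_kn in auto)
  thus ?thesis by simp
qed

lemma card_coords: "card (coords q) = q * q"
  by (simp add: coords_def)

lemma hq_prod_kn: "hq (int q * int q) (\<Prod>w\<in>coords q. kn n X $$ w)"
proof -
  have "hq (\<Sum>w\<in>coords q. 1) (\<Prod>w\<in>coords q. kn n X $$ w)" by (rule hq_prod) (simp_all add: hq_kn')
  thus ?thesis by (simp add: card_coords)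
qed

text \<open>The orbit of \<open>X\<close> is the image under \<open>phiJ\<close> of the orbit of
  \<open>J X\<close>, whose next term is \<open>I X\<close>. So \<open>p\<close> is first moved by J
  to a prime \<open>p'\<close> and, unless \<open>p'\<close> is the determinant, then by I, at the
  cost of one step of the iteration. If \<open>p'\<close> is the determinant, two steps are used up
  and \<open>sig\<close> takes the place of I.\<close>

lemma prime_steps:
  assumes p: "prime_elem p"
  obtains (V) w where "w \<in> coords q" "\<And>x. valp p x = valp (V w) x"
  | (generic) p' where "prime_elem p'" "mvl (valp p) (kn 0 X) = 0" "svl (valp p) (kn 0 X) = 0" "cvl (valp p) (kn 0 X) = 0"
      "\<And>n. mvl (valp p) (kn (Suc n) X) = mvl (valp p') (kn n X)"
      "\<And>n. svl (valp p) (kn (Suc n) X) = svl (valp p') (kn n X)"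
      "\<And>n. cvl (valp p) (kn (Suc n) X) = cvl (valp p') (kn n X)"
  | (det) "mvl (valp p) (kn 0 X) = 0" "svl (valp p) (kn 0 X) = 0" "cvl (valp p) (kn 0 X) = 1"
      "mvl (valp p) (kn 1 X) = -1" "svl (valp p) (kn 1 X) = - (int q * int q)" "cvl (valp p) (kn 1 X) = 2 * int q - 1"
      "\<And>n. mvl (valp p) (kn (Suc (Suc n)) X) = mvl (valp (dt q)) (kn n X) - 2"
      "\<And>n. svl (valp p) (kn (Suc (Suc n)) X) = svl (valp (dt q)) (kn n X) - 2 * (int q * int q)"
      "\<And>n. cvl (valp p) (kn (Suc (Suc n)) X) = cvl (valp (dt q)) (kn n X) + 2 * int q"
proof (cases "p dvd pX q")
  case True
  have *: "\<exists>w\<in>S. p dvd V w" if "p dvd (\<Prod>w\<in>S. V w)" "finite S" for S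
    using that(2,1)
  proof (induction S rule: finite_induct)
    case empty
    thus ?case using p by (simp add: prime_elem_def)
  next
    case (insert x S)
    thus ?case using p by (auto simp: prime_elem_dvd_mult_iff)
  qed
  have "\<exists>w\<in>coords q. p dvd V w" by (rule *) (use True in \<open>simp_all add: pX_def\<close>)
  then obtain w where w: "w \<in> coords q" "p dvd V w" by blast
  show ?thesis by (rule V[OF w(1)]) (rule valp_assoc[OF p prime_V w(2)])
next
  case False
  obtain p' where p': "prime_elem p'" "\<not> p' dvd pX q" "\<And>x. x \<noteq> 0 \<Longrightarrow> valp p (phiJ q x) = valp p' x"
    using transport[OF phiJ_hom phiJ_phiJ pX_nz _ phiJ_pol p False] evM_J_pX by (auto simp: phiJ_F)
  interpret v: valuation "valp p" by (rule valp_valuation[OF p])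
  have v0: "valp p (F (V w)) = 0" if "w \<in> coords q" for w
  proof -
    have "\<not> p dvd V w" using False that by (metis dvd_trans dvd_prodI finite_coords pX_def)
    hence "\<not> 0 < ordp p (V w)" using ordp_pos_iff[OF p V_neq_0, of w] by blast
    thus ?thesis using valp_to_fract[OF p V_neq_0, of w] by simp
  qed
  have X: "X $$ w = F (V w)" if "w \<in> coords q" for w using that by (auto simp: coords_def)
  have m0: "mvl (valp p) (kn 0 X) = 0"
  proof -
    have "(\<lambda>w. valp p (X $$ w)) ` coords q = {0}" using coords_ne by (auto simp: X v0)
    thus ?thesis by (simp add: mvl_def)
  qed
  have s0: "svl (valp p) (kn 0 X) = 0"
    unfolding svl_def kn_0 by (subst v.v_prod) (auto simp: X v0)
  have eJ: "kn n X = map_mat (phiJ q) (kn n (Jm X))" for n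
  proof -
    have "map_mat (phiJ q) (Jm X) = X" by (simp add: map_phiJ flip: Jm_hom[OF phiJ_hom])
    thus ?thesis using kn_hom[OF phiJ_hom, of "Jm X" n q] by simp
  qed
  note nzJ = kn_nz_map[OF phiJ_hom eJ Jm_carrier[OF XF_carrier]]
  have vJ: "mvl (valp p) (kn n X) = mvl (valp p') (kn n (Jm X))" "svl (valp p) (kn n X) = svl (valp p') (kn n (Jm X))"
    "cvl (valp p) (kn n X) = cvl (valp p') (kn n (Jm X))" for n
    unfolding eJ[of n]
    by (intro vl_hom[where h = "phiJ q" and A = "kn n (Jm X)" and v = "valp p" and v' = "valp p'"]
      phiJ_hom nzJ p'(3); simp)+
  have SJ: "kn (Suc n) (Jm X) = kn n (Iv X)" for n by (simp add: kn_Suc Km_def)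
  have c0: "cvl (valp p) (kn 0 X) = valp p' d" unfolding vJ by (simp add: cvl_def F_dt)
  show ?thesis
  proof (cases "p' dvd dt q")
    case False
    have "\<not> 0 < ordp p' (dt q)" using False ordp_pos_iff[OF p'(1) dt_nz, of q] by blast
    hence vd0: "valp p' d = 0" using valp_to_fract[OF p'(1) dt_nz, of q] by simp
    have E: "phiI q (F (dt q)) = inverse (F (dt q))" by (simp add: phiI_F evM_I_dt)
    obtain p2 where p2: "prime_elem p2" "\<And>x. x \<noteq> 0 \<Longrightarrow> valp p' (phiI q x) = valp p2 x"
      using transport[OF phiI_hom phiI_phiI dt_nz E phiI_pol p'(1) False] by blast
    have eI: "kn n (Iv X) = map_mat (phiI q) (kn n X)" for n
      using kn_hom[OF phiI_hom XF_carrier, of n q] by (simp add: map_phiI)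
    have vI: "mvl (valp p') (kn n (Iv X)) = mvl (valp p2) (kn n X)" "svl (valp p') (kn n (Iv X)) = svl (valp p2) (kn n X)"
      "cvl (valp p') (kn n (Iv X)) = cvl (valp p2) (kn n X)" for n
      unfolding eI[of n]
      by (intro vl_hom[where h = "phiI q" and A = "kn n X" and v = "valp p'" and v' = "valp p2"]
        phiI_hom kn_X_nz' kn_X_nz(2) p2(2); simp)+
    show ?thesis
    proof (rule generic[OF p2(1) m0 s0])
      show "cvl (valp p) (kn 0 X) = 0" unfolding c0 by (rule vd0)
    qed (simp_all only: vJ SJ vI)
  next
    case True
    have vd: "valp p' = vd" unfolding vd_def by (rule ext) (rule valp_assoc[OF p'(1) prime_dt True])
    have YY: "kn 1 (Jm X) = YY" using SJ[of 0] by (simp add: YY_def)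
    have vY: "vd (YY $$ w) = -1" "YY $$ w \<noteq> 0" if "w \<in> coords q" for w
      using that r_nz vd_rp by (auto simp: coords_def YY_r vd.v_divide vd_dt)
    have m1: "mvl vd YY = -1"
    proof -
      have "(\<lambda>w. vd (YY $$ w)) ` coords q = {-1}" using coords_ne by (auto simp: vY)
      thus ?thesis by (simp add: mvl_def)
    qed
    have s1: "svl vd YY = - (int q * int q)"
      unfolding svl_def by (subst vd.v_prod) (simp_all add: vY card_coords)
    have c1: "cvl vd YY = 2 * int q - 1" using vd_det_ZZ by (simp add: cvl_def ZZ_def)
    have e2: "kn (Suc (Suc n)) (Jm X) = map_mat sig (kn n X)" for n
      using kn_hom[OF sig_hom XF_carrier, of n] by (simp add: SJ kn_Suc map_sig_X) (simp add: Km_def WW_def ZZ_def YY_def)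
    have idx: "map_mat sig (kn n X) $$ w = sig (kn n X $$ w)" if "w \<in> coords q" for n w
      using that carrier_matD[OF kn_carrier[OF XF_carrier, of n]] by (auto simp: coords_def)
    \<comment> \<open>Entries, their product and \<open>det (J M)\<close> have degrees
      \<open>1\<close>, \<open>q^2\<close> and \<open>-q\<close>; this yields the shifts
      \<open>-2\<close>, \<open>-2 q^2\<close> and \<open>2 q\<close>.\<close>
    have sv: "vd (sig x) = vd x - 2 * e" if "hq e x" "x \<noteq> 0" for e x by (rule sig_val[OF that])
    have m2: "mvl vd (map_mat sig (kn n X)) = mvl vd (kn n X) - 2" for n
    proof -
      let ?S = "(\<lambda>w. vd (kn n X $$ w)) ` coords q"
      have "(\<lambda>w. vd (map_mat sig (kn n X) $$ w)) ` coords q = (\<lambda>x. x - 2) ` ?S"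
        unfolding image_image by (rule image_cong) (simp_all add: idx sv[OF hq_kn' kn_X_nz'])
      moreover have "Min ((\<lambda>x. x - 2) ` ?S) = Min ?S - 2"
        by (rule mono_Min_commute[symmetric]) (use coords_ne in \<open>auto simp: mono_def\<close>)
      ultimately show ?thesis by (simp add: mvl_def)
    qed
    have s2: "svl vd (map_mat sig (kn n X)) = svl vd (kn n X) - 2 * (int q * int q)" for n
    proof -
      have "(\<Prod>w\<in>coords q. map_mat sig (kn n X) $$ w) = sig (\<Prod>w\<in>coords q. kn n X $$ w)"
        unfolding sig.hom_prod by (rule prod.cong) (simp_all add: idx)
      thus ?thesis unfolding svl_def using sv[OF hq_prod_kn] kn_X_nz' by simp
    qed
    have c2: "cvl vd (map_mat sig (kn n X)) = cvl vd (kn n X) + 2 * int q" for n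
      unfolding cvl_def Jm_hom[OF sig_hom] sig.hom_det using sv[OF hq_det_Jm_kn kn_X_nz(2)] by simp
    show ?thesis
    proof (rule det[OF m0 s0])
      show "cvl (valp p) (kn 0 X) = 1" unfolding c0 vd by (rule vd_dt)
    qed (simp_all only: vJ vd YY m1 s1 c1 e2 m2 s2 c2 flip: vd_def)
  qed
qed

section \<open>Generating functions of the local sequences\<close>

definition mF :: "mpoly \<Rightarrow> int fps" where "mF p = Abs_fps (\<lambda>n. mvl (valp p) (kn n X))"
definition sF :: "mpoly \<Rightarrow> int fps" where "sF p = Abs_fps (\<lambda>n. svl (valp p) (kn n X))"
definition cF :: "mpoly \<Rightarrow> int fps" where "cF p = Abs_fps (\<lambda>n. cvl (valp p) (kn n X))"

abbreviation "zz \<equiv> (fps_X :: int fps)"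
abbreviation "qq \<equiv> (of_nat q :: int fps)"
text \<open>The divisor \<open>x_ij = 0\<close> gives series \<open>c : m : s\<close> in the ratio
  \<open>-(1 + z) : 0 : P\<close>, which forces \<open>A1 : A3 = P : (1 + z)\<close>. The correction
  at the determinant has the ratio \<open>P : -z(1 + z) : -q^2 z(1 + z)\<close>; the common factor
  \<open>z(1 + z)\<close> in \<open>A1\<close> and \<open>A3\<close> is what makes the remaining
  coefficient \<open>B2\<close> a polynomial.\<close>

definition "PP = 1 + (2 * qq - 2) * zz + zz ^ 2"
definition "A1 = zz * (1 + zz) * PP"
definition "A3 = zz * (1 + zz) ^ 2"
definition "B2 = PP ^ 2 - qq ^ 2 * A3"
definition "LF p = cF p * A1 + mF p * B2 + sF p * A3"
text \<open>The geometric series \<open>1/(1 - z)\<close>.\<close>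

definition "gg = (Abs_fps (\<lambda>_. 1) :: int fps)"

lemma gg: "(1 - zz) * gg = 1"
  by (rule fps_ext) (auto simp: gg_def left_diff_distrib)

lemma one_minus_z_nz: "1 - zz \<noteq> 0"
  using gg by auto

lemma cancel_z: "(1 - zz) * f = 0 \<Longrightarrow> f = 0"
  using one_minus_z_nz by simp

lemma fps_split1: "Abs_fps f = fps_const (f 0) + zz * Abs_fps (\<lambda>n. f (Suc n))"
  by (rule fps_ext) (auto simp: fps_X_mult_nth)

lemma fps_split2: "Abs_fps f = fps_const (f 0) + zz * fps_const (f 1) + zz ^ 2 * Abs_fps (\<lambda>n. f (Suc (Suc n)))"
  by (subst fps_split1, subst fps_split1[of "\<lambda>n. f (Suc n)"]) (simp add: algebra_simps power2_eq_square)

text \<open>After multiplication by \<open>1 - z\<close> the series become polynomials, and the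
  claim reads \<open>-(1 + z) A1 + P A3 = 0\<close>.\<close>

lemma LF_V:
  assumes q4: "4 \<le> q" and w: "w \<in> coords q" and p: "\<And>x. valp p x = valp (V w) x"
  shows "LF p = 0"
proof -
  have vp: "valp p = valp (V w)" using p by blast
  have m: "mF p = 0" unfolding mF_def vp by (rule fps_ext) (simp add: divisor_V[OF q4 w])
  have c: "cF p = - 1 - 2 * zz * gg" unfolding cF_def vp
    by (rule fps_ext) (simp add: divisor_V[OF q4 w] gg_def mult.assoc numeral_fps_const)
  have s: "sF p = 1 + (2 * qq - 1) * zz + 2 * qq * zz ^ 2 * gg"
  proof -
    have "sF p = fps_const 1 + zz * fps_const (2 * int q - 1) + zz ^ 2 * Abs_fps (\<lambda>n. 2 * int q)"
      unfolding sF_def vp by (subst fps_split2) (simp add: divisor_V[OF q4 w] divisor_V[OF q4 w, of 0, simplified])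
    also have "Abs_fps (\<lambda>n. 2 * int q) = 2 * qq * gg"
      by (rule fps_ext) (simp add: gg_def mult.assoc numeral_fps_const flip: fps_of_nat)
    also have "fps_const (2 * int q - 1) = 2 * qq - 1"
      by (rule fps_ext) (simp add: numeral_fps_const flip: fps_of_nat)
    finally show ?thesis by (simp add: algebra_simps)
  qed
  have "(1 - zz) * cF p = - (1 - zz) - 2 * zz * ((1 - zz) * gg)" unfolding c by (simp add: algebra_simps)
  hence c': "(1 - zz) * cF p = - (1 + zz)" unfolding gg by simp
  have "(1 - zz) * sF p = (1 - zz) * (1 + (2 * qq - 1) * zz) + 2 * qq * zz ^ 2 * ((1 - zz) * gg)"
    unfolding s by (simp add: algebra_simps)
  hence s': "(1 - zz) * sF p = PP" unfolding gg PP_def by (simp add: algebra_simps power2_eq_square)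
  have "(1 - zz) * LF p = ((1 - zz) * cF p) * A1 + ((1 - zz) * sF p) * A3"
    unfolding LF_def m by (simp add: algebra_simps)
  also have "\<dots> = 0" unfolding c' s' A1_def A3_def by (simp add: algebra_simps power2_eq_square)
  finally show ?thesis by (rule cancel_z)
qed

text \<open>The terms that do not come from \<open>p'\<close> cancel: multiplied by
  \<open>1 - z\<close>, they are \<open>P A1 - z(1 + z) P^2 = 0\<close>.\<close>

lemma LF_det:
  assumes "mF p = - zz + zz ^ 2 * (mF p' - 2 * gg)" "sF p = - (qq ^ 2 * zz) + zz ^ 2 * (sF p' - 2 * qq ^ 2 * gg)"
    "cF p = 1 + (2 * qq - 1) * zz + zz ^ 2 * (cF p' + 2 * qq * gg)"
  shows "LF p = zz ^ 2 * LF p'"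
proof -
  define c where "c = 1 + (2 * qq - 1) * zz + 2 * qq * zz ^ 2 * gg"
  define m where "m = - zz - 2 * zz ^ 2 * gg"
  have "(1 - zz) * c = (1 - zz) * (1 + (2 * qq - 1) * zz) + 2 * qq * zz ^ 2 * ((1 - zz) * gg)"
    unfolding c_def by (simp add: algebra_simps)
  hence c': "(1 - zz) * c = PP" unfolding gg PP_def by (simp add: algebra_simps power2_eq_square)
  have "(1 - zz) * m = - zz * (1 - zz) - 2 * zz ^ 2 * ((1 - zz) * gg)"
    unfolding m_def by (simp add: algebra_simps)
  hence m': "(1 - zz) * m = - (zz * (1 + zz))" unfolding gg by (simp add: algebra_simps power2_eq_square)
  have "LF p - zz ^ 2 * LF p' = c * A1 + m * B2 + qq ^ 2 * m * A3"
    unfolding LF_def assms c_def m_def by (simp add: algebra_simps)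
  also have "\<dots> = c * A1 + m * PP ^ 2" unfolding B2_def by (simp add: algebra_simps)
  finally have "(1 - zz) * (LF p - zz ^ 2 * LF p') = ((1 - zz) * c) * A1 + ((1 - zz) * m) * PP ^ 2"
    by (simp add: algebra_simps)
  also have "\<dots> = 0" unfolding c' m' A1_def by (simp add: algebra_simps power2_eq_square)
  finally show ?thesis using cancel_z by fastforce
qed

text \<open>Unless \<open>p\<close> is a coordinate hyperplane, \<open>LF\<close> at
  \<open>p\<close> is \<open>z\<close> or \<open>z^2\<close> times \<open>LF\<close> at another
  prime, so coefficient \<open>n\<close> reduces to a smaller index. No classification of the orbit
  of \<open>p\<close> enters.\<close>

theorem LF_nth:
  assumes q4: "4 \<le> q" and "prime_elem p"
  shows "fps_nth (LF p) n = 0"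
  using assms(2)
proof (induction n arbitrary: p rule: less_induct)
  case (less n)
  from less.prems show ?case
  proof (cases rule: prime_steps)
    case (V w)
    thus ?thesis using LF_V[OF q4] by simp
  next
    case (generic p')
    have "mF p = zz * mF p'" "sF p = zz * sF p'" "cF p = zz * cF p'"
      unfolding mF_def sF_def cF_def
      by (subst fps_split1, use generic in simp)+
    hence "LF p = zz * LF p'" by (simp add: LF_def algebra_simps)
    thus ?thesis using less.IH[of "n - 1" p'] generic(1) by (cases n) (auto simp: fps_X_mult_nth)
  next
    case det
    have k: "fps_const (- 1 :: int) = - 1" "fps_const (1 :: int) = 1" "fps_const (0 :: int) = 0" by simp_all
    have cc: "fps_const (2 * int q - 1) = 2 * qq - 1" "fps_const (- (int q * int q)) = - (qq ^ 2)"
      by (rule fps_ext, simp add: numeral_fps_const power2_eq_square flip: fps_of_nat)+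
    have g: "Abs_fps (\<lambda>n. f n - 2) = Abs_fps f - 2 * gg" "Abs_fps (\<lambda>n. f n - 2 * (int q * int q)) = Abs_fps f - 2 * qq ^ 2 * gg"
      "Abs_fps (\<lambda>n. f n + 2 * int q) = Abs_fps f + 2 * qq * gg" for f :: "nat \<Rightarrow> int"
      by (rule fps_ext, simp add: gg_def numeral_fps_const power2_eq_square mult.assoc flip: fps_of_nat)+
    have "LF p = zz ^ 2 * LF (dt q)"
    proof (rule LF_det)
      show "mF p = - zz + zz ^ 2 * (mF (dt q) - 2 * gg)"
        unfolding mF_def by (subst fps_split2) (simp only: det k g, simp)
      show "sF p = - (qq ^ 2 * zz) + zz ^ 2 * (sF (dt q) - 2 * qq ^ 2 * gg)"
        unfolding sF_def by (subst fps_split2) (simp only: det k g cc, simp)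
      show "cF p = 1 + (2 * qq - 1) * zz + zz ^ 2 * (cF (dt q) + 2 * qq * gg)"
        unfolding cF_def by (subst fps_split2) (simp only: det k g cc, simp)
    qed
    thus ?thesis using less.IH[of "n - 2" "dt q"] prime_dt by (auto simp: fps_X_power_mult_nth)
  qed
qed

end

section \<open>The degree series\<close>

context mdim
begin

lemma hq_power_int: "hq e x \<Longrightarrow> hq (n * e) (x powi n)"
  using hq_power[of e x "nat n"] hq_inverse[OF hq_power[of e x "nat (- n)"]]
  by (auto simp: power_int_def power_inverse)

text \<open>Homogeneous polynomial coordinates \<open>G\<close> of degree \<open>N\<close> for the
  iterate; \<open>\<psi>\<close> collects the common factor and the denominator of the
  entries.\<close>

definition Tup :: "nat \<Rightarrow> nat \<Rightarrow> (var \<Rightarrow> mpoly) \<Rightarrow> mpoly fract \<Rightarrow> bool" where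
  "Tup n N G \<psi> \<longleftrightarrow> \<psi> \<noteq> 0 \<and>
     (\<forall>w\<in>coords q. hm N (G w) \<and> G w \<in> PV (coords q) \<and> kn n X $$ w = \<psi> * F (G w))"

lemma common_denominator:
  assumes "finite S" "\<And>w. w \<in> S \<Longrightarrow> hq e (x w)"
  shows "\<exists>B k. B \<noteq> 0 \<and> hq k (F B) \<and> (\<forall>w\<in>S. \<exists>g. F g = F B * x w)"
  using assms
proof (induction S rule: finite_induct)
  case empty
  show ?case using hq_1 by (intro exI[of _ 1] exI[of _ 0]) auto
next
  case (insert u S)
  then obtain B k where B: "B \<noteq> 0" "hq k (F B)" "\<And>w. w \<in> S \<Longrightarrow> \<exists>g. F g = F B * x w" by auto
  obtain a b m n where ab: "a \<in> PV (coords q)" "b \<in> PV (coords q)" "hm n b" "b \<noteq> 0" "x u = F a / F b"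
    using insert.prems[of u] unfolding hq_def by auto
  have "\<exists>g. F g = F (b * B) * x u" by (rule exI[of _ "a * B"]) (use ab in simp)
  moreover have "\<exists>g. F g = F (b * B) * x w" if w: "w \<in> S" for w
  proof -
    obtain g where "F g = F B * x w" using B(3)[OF w] by blast
    hence "F (b * g) = F (b * B) * x w" by simp
    thus ?thesis by blast
  qed
  moreover have "hq (int n + k) (F (b * B))" using hq_mult[OF hq_F[OF ab(3,2)] B(2)] by simp
  ultimately show ?case using ab(4) B(1)
    by (intro exI[of _ "b * B"] exI[of _ "int n + k"]) simp
qed

lemma Tup_exists: "\<exists>N G \<psi>. Tup n N G \<psi>"
proof -
  obtain B k where B: "B \<noteq> 0" "hq k (F B)" "\<And>w. w \<in> coords q \<Longrightarrow> \<exists>g. F g = F B * kn n X $$ w"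
    using common_denominator[OF finite_coords[of q], of 1 "\<lambda>w. kn n X $$ w"] hq_kn'[of _ n] by auto
  define G where "G w = (SOME g. F g = F B * kn n X $$ w)" for w
  have G: "F (G w) = F B * kn n X $$ w" if "w \<in> coords q" for w
    unfolding G_def by (rule someI_ex) (rule B(3)[OF that])
  have nz: "G w \<noteq> 0" if "w \<in> coords q" for w
  proof
    assume "G w = 0"
    hence "F B * kn n X $$ w = 0" using G[OF that] by simp
    thus False using B(1) kn_X_nz'[OF that] by simp
  qed
  have H: "hm (tdeg (G w)) (G w) \<and> k + 1 = int (tdeg (G w)) \<and> G w \<in> PV (coords q)" if "w \<in> coords q" for w
  proof (rule hq_F_iff[OF _ nz[OF that]])
    show "hq (k + 1) (F (G w))" unfolding G[OF that] by (rule hq_mult[OF B(2) hq_kn'[OF that]])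
  qed
  have "Tup n (nat (k + 1)) G (inverse (F B))"
    unfolding Tup_def
  proof (intro conjI ballI)
    fix w assume w: "w \<in> coords q"
    show "hm (nat (k + 1)) (G w)" "G w \<in> PV (coords q)" using H[OF w] by (simp_all del: One_nat_def)
    show "kn n X $$ w = inverse (F B) * F (G w)" using G[OF w] B(1) by simp
  qed (use B in simp)
  thus ?thesis by blast
qed

lemma Tup_nz:
  assumes "Tup n N G \<psi>" "w \<in> coords q" shows "G w \<noteq> 0"
proof
  assume "G w = 0"
  hence "kn n X $$ w = 0" using assms by (simp add: Tup_def)
  thus False using kn_X_nz'[OF assms(2)] by simp
qed

definition reduced :: "(var \<Rightarrow> mpoly) \<Rightarrow> bool" where
  "reduced G \<longleftrightarrow> (\<forall>p. prime_elem p \<longrightarrow> (\<exists>w\<in>coords q. \<not> p dvd G w))"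

definition dg :: "nat \<Rightarrow> nat" where "dg n = (LEAST N. \<exists>G \<psi>. Tup n N G \<psi>)"

lemma reduced_Tup_exists: "\<exists>G \<psi>. Tup n (dg n) G \<psi> \<and> reduced G"
proof -
  obtain G \<psi> where T: "Tup n (dg n) G \<psi>"
    using LeastI_ex[OF Tup_exists[of n]] unfolding dg_def[symmetric] by blast
  have "reduced G" unfolding reduced_def
  proof (intro allI impI, rule ccontr)
    fix p assume p: "prime_elem p" and "\<not> (\<exists>w\<in>coords q. \<not> p dvd G w)"
    hence dv: "p dvd G w" if "w \<in> coords q" for w using that by simp
    define G' where "G' w = (SOME g. G w = p * g)" for w
    have G': "G w = p * G' w" if "w \<in> coords q" for w
      unfolding G'_def by (rule someI_ex) (use dv[OF that] in \<open>simp add: dvd_def\<close>)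
    have p0: "p \<noteq> 0" using p by (simp add: prime_elem_def)
    have H: "hm (dg n - tdeg p) (G' w) \<and> G' w \<in> PV (coords q) \<and> tdeg p \<le> dg n" if w: "w \<in> coords q" for w
    proof -
      have nz: "p * G' w \<noteq> 0" using Tup_nz[OF T w] G'[OF w] by simp
      have h: "hm (dg n) (G' w * p)" "G w \<in> PV (coords q)" using T w by (simp_all add: Tup_def G' mult.commute)
      have t: "dg n = tdeg p + tdeg (G' w)"
        using hm_tdeg[OF h(1)] nz tdeg_mult[of p "G' w"] by (auto simp: mult.commute)
      have "hm (tdeg (G' w)) (G' w)" by (rule hm_factor[OF h(1)]) (use nz in simp)
      thus ?thesis using t h(2) PV_factor2[of p "G' w" "coords q"] nz G'[OF w] by simp
    qed
    have "Tup n (dg n - tdeg p) G' (\<psi> * F p)"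
      using T H G' p0 by (simp add: Tup_def)
    hence "dg n \<le> dg n - tdeg p" unfolding dg_def by (intro Least_le) blast
    moreover obtain w where "w \<in> coords q" using coords_ne by blast
    ultimately show False using H prime_tdeg[OF p] by fastforce
  qed
  thus ?thesis using T by blast
qed

text \<open>Some coordinate is prime to \<open>p\<close>, so \<open>\<psi>\<close> carries exactly
  the multiplicity \<open>m(n)\<close> at every prime. Together with \<open>hq_Tup\<close> this ties
  \<open>dg\<close> to the local sequences.\<close>

lemma reduced_Tup_val:
  assumes T: "Tup n N G \<psi>" and red: "reduced G" and p: "prime_elem p"
  shows "valp p \<psi> = mvl (valp p) (kn n X)"
proof -
  interpret v: valuation "valp p" by (rule valp_valuation[OF p])
  have e: "valp p (kn n X $$ w) = valp p \<psi> + int (ordp p (G w))" if "w \<in> coords q" for w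
    using T that Tup_nz[OF T that] valp_to_fract[OF p, of "G w"] by (simp add: Tup_def v.v_mult)
  obtain w where w: "w \<in> coords q" "\<not> p dvd G w" using red p unfolding reduced_def by blast
  hence "ordp p (G w) = 0" using ordp_pos_iff[OF p Tup_nz[OF T w(1)]] by simp
  hence "valp p (kn n X $$ w) = valp p \<psi>" using e[OF w(1)] by simp
  thus ?thesis unfolding mvl_def by (intro Min_eqI[symmetric]) (use e w(1) in \<open>auto intro: rev_image_eqI\<close>)
qed

lemma hq_Tup:
  assumes T: "Tup n N G \<psi>" shows "hq (1 - int N) \<psi>"
proof -
  obtain w where w: "w \<in> coords q" using coords_ne by blast
  have "hq (1 - int N) (kn n X $$ w / F (G w))"
    using T w by (intro hq_divide hq_kn' hq_F) (auto simp: Tup_def)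
  moreover have "kn n X $$ w / F (G w) = \<psi>" using T w Tup_nz[OF T w] by (simp add: Tup_def)
  ultimately show ?thesis by simp
qed

definition DF :: "int fps" where "DF = Abs_fps (\<lambda>n. int (dg n))"

text \<open>The product below has valuation 0 at every prime by the local identity
  \<open>LF_nth\<close>, hence is homogeneous of degree 0.\<close>

lemma degree_identity:
  assumes q4: "4 \<le> q"
  shows "- (qq * gg) * A1 + (gg - DF) * B2 + qq ^ 2 * gg * A3 = 0"
proof (rule fps_ext)
  fix n
  have ex: "\<forall>k. \<exists>y. Tup k (dg k) (fst y) (snd y) \<and> reduced (fst y)"
  proof
    fix k
    obtain G \<psi> where "Tup k (dg k) G \<psi> \<and> reduced G" using reduced_Tup_exists by blast
    thus "\<exists>y. Tup k (dg k) (fst y) (snd y) \<and> reduced (fst y)" by (intro exI[of _ "(G, \<psi>)"]) simp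
  qed
  obtain y where y: "\<forall>k. Tup k (dg k) (fst (y k)) (snd (y k)) \<and> reduced (fst (y k))"
    using choice[OF ex] by (elim exE)
  define G where "G k = fst (y k)" for k
  define \<psi> where "\<psi> k = snd (y k)" for k
  have T: "Tup k (dg k) (G k) (\<psi> k)" and red: "reduced (G k)" for k
    using y by (simp_all add: G_def \<psi>_def)
  \<comment> \<open>The exponents are those of a convolution: the valuation of the product over
    \<open>k\<close> is coefficient \<open>n\<close> of \<open>LF p\<close>, and its homogeneous
    degree is coefficient \<open>n\<close> of the series in the claim.\<close>
  define t where "t k = det (Jm (kn k X)) powi fps_nth A1 (n - k) * \<psi> k powi fps_nth B2 (n - k) *
     (\<Prod>w\<in>coords q. kn k X $$ w) powi fps_nth A3 (n - k)" for k
  define e where "e k = fps_nth A1 (n - k) * - int q + fps_nth B2 (n - k) * (1 - int (dg k)) +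
     fps_nth A3 (n - k) * (int q * int q)" for k
  have nz: "\<psi> k \<noteq> 0" "det (Jm (kn k X)) \<noteq> 0" "(\<Prod>w\<in>coords q. kn k X $$ w) \<noteq> 0" for k
    using T[of k] kn_X_nz(2)[of k] kn_X_nz'[of _ k] by (auto simp: Tup_def)
  have t0: "t k \<noteq> 0" for k unfolding t_def by (auto simp: nz kn_X_nz')
  have hT: "hq (\<Sum>k\<in>{0..n}. e k) (\<Prod>k\<in>{0..n}. t k)"
    unfolding e_def t_def
    by (rule hq_prod) (simp, rule hq_mult[OF hq_mult], rule hq_power_int[OF hq_det_Jm_kn],
      rule hq_power_int[OF hq_Tup[OF T]], rule hq_power_int[OF hq_prod_kn])
  have vT: "valp p (\<Prod>k\<in>{0..n}. t k) = 0" if p: "prime_elem p" for p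
  proof -
    interpret v: valuation "valp p" by (rule valp_valuation[OF p])
    have vt: "valp p (t k) = cvl (valp p) (kn k X) * fps_nth A1 (n - k) + mvl (valp p) (kn k X) * fps_nth B2 (n - k) +
        svl (valp p) (kn k X) * fps_nth A3 (n - k)" for k
    proof -
      have "valp p (t k) = fps_nth A1 (n - k) * valp p (det (Jm (kn k X))) + fps_nth B2 (n - k) * valp p (\<psi> k) +
        fps_nth A3 (n - k) * valp p (\<Prod>w\<in>coords q. kn k X $$ w)"
        unfolding t_def by (simp add: v.v_mult v.v_power_int nz del: prod_zero_iff)
      thus ?thesis by (simp add: reduced_Tup_val[OF T red p] cvl_def svl_def mult.commute)
    qed
    have "valp p (\<Prod>k\<in>{0..n}. t k) = (\<Sum>k\<in>{0..n}. valp p (t k))" by (rule v.v_prod) (rule t0)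
    also have "\<dots> = fps_nth (LF p) n"
      by (simp add: vt LF_def fps_mult_nth sum.distrib mF_def sF_def cF_def)
    finally show ?thesis using LF_nth[OF q4 p] by simp
  qed
  have nz': "(\<Prod>k\<in>{0..n}. t k) \<noteq> 0" unfolding prod_zero_iff[OF finite_atLeastAtMost] using t0 by blast
  have E: "(\<Sum>k\<in>{0..n}. e k) = 0"
    by (rule hq_val_0[OF hT nz' vT])
  have g: "- (qq * gg) = Abs_fps (\<lambda>_. - int q)" "gg - DF = Abs_fps (\<lambda>n. 1 - int (dg n))" "qq ^ 2 * gg = Abs_fps (\<lambda>_. int q * int q)"
    by (rule fps_ext, simp add: gg_def DF_def power2_eq_square mult.assoc flip: fps_of_nat)+
  show "fps_nth (- (qq * gg) * A1 + (gg - DF) * B2 + qq ^ 2 * gg * A3) n = fps_nth 0 n"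
    using E unfolding e_def g fps_add_nth fps_mult_nth fps_nth_Abs_fps sum.distrib
    by (simp only: mult.commute fps_zero_nth)
qed

text \<open>With \<open>P = (1 - z)^2 + 2qz\<close> and \<open>(1 + z)^2 = (1 - z)^2 + 4z\<close>
  the terms \<open>4 q^2 z^2\<close> in \<open>B2\<close> cancel and \<open>(1 - z)^2\<close> can be
  taken out. On the other side \<open>P - q z(1 + z)\<close> contributes a factor
  \<open>1 - z\<close> that cancels \<open>gg\<close>.\<close>

theorem degree_series:
  assumes "4 \<le> q"
  shows "DF * (1 - zz) ^ 2 * (1 - (qq ^ 2 - 4 * qq + 2) * zz + zz ^ 2) = PP * (1 + (qq - 1) * zz)"
proof -
  have B: "B2 = (1 - zz) ^ 2 * (1 - (qq ^ 2 - 4 * qq + 2) * zz + zz ^ 2)"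
    unfolding B2_def A3_def PP_def by (simp add: algebra_simps power2_eq_square)
  have "DF * B2 = gg * (B2 + qq ^ 2 * A3 - qq * A1)"
    using degree_identity[OF assms] by (simp add: algebra_simps)
  also have "B2 + qq ^ 2 * A3 - qq * A1 = PP * (PP - qq * (zz * (1 + zz)))"
    unfolding B2_def A1_def by (simp add: algebra_simps power2_eq_square)
  also have "PP - qq * (zz * (1 + zz)) = (1 - zz) * (1 + (qq - 1) * zz)"
    unfolding PP_def by (simp add: algebra_simps power2_eq_square)
  also have "gg * (PP * ((1 - zz) * (1 + (qq - 1) * zz))) = ((1 - zz) * gg) * (PP * (1 + (qq - 1) * zz))"
    by (simp only: mult_ac)
  finally show ?thesis unfolding gg B by (simp add: mult.assoc)
qed

end

section \<open>Growth of the coefficients\<close>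

text \<open>The n-th roots of constants and of fixed powers of \<open>n\<close> tend to 1, so the
  two bounds meet.\<close>

lemma root_limit:
  fixes a :: "nat \<Rightarrow> real"
  assumes \<delta>: "1 \<le> \<delta>" and lo: "\<And>n. \<delta> ^ n \<le> a n" and hi: "\<And>n. a n \<le> K * real (n + 1) ^ k * \<delta> ^ n"
  shows "(\<lambda>n. root n (a n)) \<longlonglongrightarrow> \<delta>"
proof -
  have K: "1 \<le> K" using lo[of 0] hi[of 0] by simp
  have b: "\<delta> \<le> root n (a n) \<and> root n (a n) \<le> root n K * (root n 2 * root n (real n)) ^ k * \<delta>" if n: "0 < n" for n
  proof
    have "root n (\<delta> ^ n) \<le> root n (a n)" using n lo by simp
    thus "\<delta> \<le> root n (a n)" using n \<delta> by (simp add: real_root_power_cancel)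
    have "a n \<le> K * real (n + 1) ^ k * \<delta> ^ n" by (rule hi)
    also have "\<dots> \<le> K * (2 * real n) ^ k * \<delta> ^ n"
      using n K \<delta> by (intro mult_right_mono mult_left_mono power_mono) auto
    finally have "root n (a n) \<le> root n (K * (2 * real n) ^ k * \<delta> ^ n)" using n by simp
    thus "root n (a n) \<le> root n K * (root n 2 * root n (real n)) ^ k * \<delta>"
      using n \<delta> by (simp add: real_root_mult real_root_power real_root_power_cancel power_mult_distrib)
  qed
  have "(\<lambda>n. root n K * (root n 2 * root n (real n)) ^ k * \<delta>) \<longlonglongrightarrow> 1 * (1 * 1) ^ k * \<delta>"
    using K by (intro tendsto_intros LIMSEQ_root_const LIMSEQ_root) auto
  hence u: "(\<lambda>n. root n K * (root n 2 * root n (real n)) ^ k * \<delta>) \<longlonglongrightarrow> \<delta>" by simp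
  show ?thesis
    by (rule tendsto_sandwich[OF _ _ tendsto_const u]; rule eventually_mono[OF eventually_gt_at_top[of 0]]) (use b in auto)
qed

text \<open>Nonnegative coefficients growing at most like a polynomial times
  \<open>\<delta> ^ n\<close>. The unspecified polynomial keeps the class closed under products even
  when poles coincide.\<close>

definition pbound :: "real \<Rightarrow> real fps \<Rightarrow> bool" where
  "pbound \<delta> f \<longleftrightarrow> (\<exists>K k. \<forall>n. 0 \<le> fps_nth f n \<and> fps_nth f n \<le> K * real (n + 1) ^ k * \<delta> ^ n)"

lemma pbound_mult:
  assumes \<delta>: "0 < \<delta>" and f: "pbound \<delta> f" and g: "pbound \<delta> g"
  shows "pbound \<delta> (f * g)"
proof -
  obtain K k where f: "\<And>n. 0 \<le> fps_nth f n" "\<And>n. fps_nth f n \<le> K * real (n + 1) ^ k * \<delta> ^ n"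
    using f unfolding pbound_def by blast
  obtain L l where g: "\<And>n. 0 \<le> fps_nth g n" "\<And>n. fps_nth g n \<le> L * real (n + 1) ^ l * \<delta> ^ n"
    using g unfolding pbound_def by blast
  have KL: "0 \<le> K" "0 \<le> L" using f(1,2)[of 0] g(1,2)[of 0] by auto
  have "fps_nth (f * g) n \<le> (K * L) * real (n + 1) ^ (k + l + 1) * \<delta> ^ n" for n
  proof -
    have "fps_nth f i * fps_nth g (n - i) \<le> (K * L) * real (n + 1) ^ (k + l) * \<delta> ^ n" if "i \<in> {0..n}" for i
    proof -
      have "fps_nth f i * fps_nth g (n - i) \<le> (K * real (n + 1) ^ k * \<delta> ^ i) * (L * real (n + 1) ^ l * \<delta> ^ (n - i))"
      proof (rule mult_mono)
        show "fps_nth f i \<le> K * real (n + 1) ^ k * \<delta> ^ i"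
          by (rule order_trans[OF f(2)]) (use that KL \<delta> in \<open>auto intro!: mult_right_mono mult_left_mono power_mono\<close>)
        show "fps_nth g (n - i) \<le> L * real (n + 1) ^ l * \<delta> ^ (n - i)"
          by (rule order_trans[OF g(2)]) (use that KL \<delta> in \<open>auto intro!: mult_right_mono mult_left_mono power_mono\<close>)
      qed (use f g KL \<delta> in auto)
      also have "\<dots> = (K * L) * real (n + 1) ^ (k + l) * \<delta> ^ n"
        using that by (simp add: power_add flip: power_add[of \<delta>])
      finally show ?thesis .
    qed
    hence "fps_nth (f * g) n \<le> (\<Sum>i\<in>{0..n}. (K * L) * real (n + 1) ^ (k + l) * \<delta> ^ n)"
      unfolding fps_mult_nth by (rule sum_mono)
    also have "\<dots> = (K * L) * real (n + 1) ^ (k + l + 1) * \<delta> ^ n" by (simp add: algebra_simps)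
    finally show ?thesis .
  qed
  moreover have "0 \<le> fps_nth (f * g) n" for n
    unfolding fps_mult_nth by (rule sum_nonneg) (use f g in auto)
  ultimately show ?thesis unfolding pbound_def by blast
qed

lemma pbound_add:
  assumes \<delta>: "0 < \<delta>" and f: "pbound \<delta> f" and g: "pbound \<delta> g"
  shows "pbound \<delta> (f + g)"
proof -
  obtain K k where f: "\<And>n. 0 \<le> fps_nth f n" "\<And>n. fps_nth f n \<le> K * real (n + 1) ^ k * \<delta> ^ n"
    using f unfolding pbound_def by blast
  obtain L l where g: "\<And>n. 0 \<le> fps_nth g n" "\<And>n. fps_nth g n \<le> L * real (n + 1) ^ l * \<delta> ^ n"
    using g unfolding pbound_def by blast
  have KL: "0 \<le> K" "0 \<le> L" using f(1,2)[of 0] g(1,2)[of 0] by auto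
  have "fps_nth (f + g) n \<le> (K + L) * real (n + 1) ^ (k + l) * \<delta> ^ n" for n
  proof -
    have "fps_nth (f + g) n \<le> K * real (n + 1) ^ k * \<delta> ^ n + L * real (n + 1) ^ l * \<delta> ^ n"
      using f(2)[of n] g(2)[of n] by simp
    also have "\<dots> \<le> K * real (n + 1) ^ (k + l) * \<delta> ^ n + L * real (n + 1) ^ (k + l) * \<delta> ^ n"
      using KL \<delta> by (intro add_mono mult_right_mono mult_left_mono power_increasing) auto
    finally show ?thesis by (simp add: algebra_simps)
  qed
  moreover have "0 \<le> fps_nth (f + g) n" for n using f g by simp
  ultimately show ?thesis unfolding pbound_def by blast
qed

lemma pbound_power: "0 \<le> a \<Longrightarrow> a \<le> \<delta> \<Longrightarrow> pbound \<delta> (Abs_fps (\<lambda>n. a ^ n))"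
  unfolding pbound_def by (intro exI[of _ 1] exI[of _ 0]) (auto intro: power_mono)

lemma pbound_const: "0 \<le> c \<Longrightarrow> 0 < \<delta> \<Longrightarrow> pbound \<delta> (fps_const c)"
  unfolding pbound_def by (intro exI[of _ c] exI[of _ 0]) auto

lemma pbound_X: "1 \<le> \<delta> \<Longrightarrow> pbound \<delta> fps_X"
  unfolding pbound_def by (intro exI[of _ 1] exI[of _ 0]) (auto simp: fps_X_def)

lemma geometric_fps: "(1 - fps_const a * fps_X) * Abs_fps (\<lambda>n. a ^ n) = (1 :: real fps)"
proof (rule fps_ext)
  fix n show "fps_nth ((1 - fps_const a * fps_X) * Abs_fps (\<lambda>n. a ^ n)) n = fps_nth 1 n"
    by (cases n) (auto simp: left_diff_distrib mult.assoc fps_X_mult_nth)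
qed

text \<open>\<open>D\<close> is the product of \<open>N\<close> with geometric series, which gives
  the upper bound. All coefficients are nonnegative and \<open>H\<close> has constant term 1, so
  \<open>D\<close> dominates the series of \<open>1/(1 - \<delta> z)\<close>. The case
  \<open>\<delta> = 1\<close>, which occurs for \<open>q = 4\<close>, is included.\<close>

lemma rational_series_growth:
  fixes D N :: "real fps"
  assumes \<delta>: "1 \<le> \<delta>" and N: "pbound \<delta> N" "fps_nth N 0 = 1"
    and eq: "D * (1 - fps_X) ^ 2 * (1 - fps_const (\<delta> + inverse \<delta>) * fps_X + fps_X ^ 2) = N"
  shows "(\<lambda>n. root n (fps_nth D n)) \<longlonglongrightarrow> \<delta>"
proof -
  define w where "w = inverse \<delta>"
  have w1: "w \<le> 1" unfolding w_def using \<delta> by (simp add: inverse_le_1_iff)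
  have w: "0 \<le> w" "w \<le> \<delta>" "\<delta> * w = 1" using \<delta> w1 by (auto simp: w_def)
  define h :: "real \<Rightarrow> real fps" where "h a = Abs_fps (\<lambda>n. a ^ n)" for a
  have h: "(1 - fps_const a * fps_X) * h a = 1" for a unfolding h_def by (rule geometric_fps)
  have fac: "1 - fps_const (\<delta> + inverse \<delta>) * fps_X + fps_X ^ 2 = (1 - fps_const \<delta> * fps_X) * (1 - fps_const w * fps_X)"
  proof -
    have "fps_const \<delta> * fps_const w = 1" using w(3) by simp
    hence "fps_const \<delta> * fps_X * (fps_const w * fps_X) = fps_X ^ 2" by (simp add: power2_eq_square algebra_simps)
    thus ?thesis by (simp add: algebra_simps w_def flip: fps_const_add)
  qed
  define H where "H = N * h 1 * h 1 * h w"
  have "H * h \<delta> = D * ((1 - fps_const 1 * fps_X) * h 1) * ((1 - fps_const 1 * fps_X) * h 1) *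
      ((1 - fps_const \<delta> * fps_X) * h \<delta>) * ((1 - fps_const w * fps_X) * h w)"
    unfolding H_def eq[symmetric] fac unfolding power2_eq_square fps_const_1_eq_1 mult_1_left by (simp only: mult_ac)
  hence D: "D = H * h \<delta>" unfolding h by simp
  have hp: "pbound \<delta> (h a)" if "0 \<le> a" "a \<le> \<delta>" for a unfolding h_def by (rule pbound_power[OF that])
  have d0: "0 < \<delta>" using \<delta> by simp
  have Hp: "pbound \<delta> H" unfolding H_def by (intro pbound_mult[OF d0] N hp) (use w \<delta> in auto)
  have "pbound \<delta> D" unfolding D by (intro pbound_mult[OF d0] Hp hp) (use \<delta> in auto)
  then obtain K k where up: "\<And>n. fps_nth D n \<le> K * real (n + 1) ^ k * \<delta> ^ n" unfolding pbound_def by blast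
  have H0: "fps_nth H 0 = 1" by (simp add: H_def h_def N)
  have "\<delta> ^ n \<le> fps_nth D n" for n
  proof -
    have Hn: "0 \<le> fps_nth H i" for i using Hp unfolding pbound_def by blast
    have "\<delta> ^ n = (\<Sum>i\<in>{0}. fps_nth H i * \<delta> ^ (n - i))" by (simp add: H0)
    also have "\<dots> \<le> (\<Sum>i\<in>{0..n}. fps_nth H i * \<delta> ^ (n - i))"
      by (rule sum_mono2) (use Hn \<delta> in auto)
    finally show ?thesis unfolding D fps_mult_nth h_def by simp
  qed
  thus ?thesis using root_limit[OF \<delta> _ up] by blast
qed

definition rfps :: "int fps \<Rightarrow> real fps" where "rfps f = Abs_fps (\<lambda>n. real_of_int (fps_nth f n))"

lemma rfps_hom: "comm_ring_hom rfps"
proof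
  show "rfps (x * y) = rfps x * rfps y" for x y
    by (rule fps_ext) (simp add: rfps_def fps_mult_nth)
qed (rule fps_ext, simp add: rfps_def)+

context mdim
begin

lemma dg_growth:
  assumes q4: "4 \<le> q" and \<delta>: "1 \<le> \<delta>" "\<delta> + inverse \<delta> = (real q)\<^sup>2 - 4 * real q + 2"
  shows "(\<lambda>n. root n (real (dg n))) \<longlonglongrightarrow> \<delta>"
proof -
  interpret R: comm_ring_hom rfps by (rule rfps_hom)
  let ?X = "fps_X :: real fps" and ?q = "fps_const (real q)"
  have X: "rfps zz = ?X" by (rule fps_ext) (simp add: rfps_def fps_X_def)
  have qq: "rfps qq = ?q" by (rule fps_ext) (simp add: rfps_def flip: fps_of_nat)
  have num: "rfps 2 = fps_const 2" "rfps 4 = fps_const 4"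
    by (rule fps_ext, simp add: rfps_def numeral_fps_const)+
  have "rfps (DF * (1 - zz) ^ 2 * (1 - (qq ^ 2 - 4 * qq + 2) * zz + zz ^ 2)) = rfps (PP * (1 + (qq - 1) * zz))"
    by (simp only: degree_series[OF q4])
  hence E: "rfps DF * (1 - ?X) ^ 2 * (1 - (?q ^ 2 - fps_const 4 * ?q + fps_const 2) * ?X + ?X ^ 2) =
      (1 + (fps_const 2 * ?q - fps_const 2) * ?X + ?X ^ 2) * (1 + (?q - 1) * ?X)"
    by (simp only: PP_def R.hom_mult R.hom_add R.hom_minus R.hom_power R.hom_one X qq num)
  have c: "?q ^ 2 - fps_const 4 * ?q + fps_const 2 = fps_const (\<delta> + inverse \<delta>)" unfolding \<delta>(2)
    by (simp add: fps_const_power)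
  have d: "fps_const 2 * ?q - fps_const 2 = fps_const (2 * real q - 2)" "?q - 1 = fps_const (real q - 1)"
    by (simp_all flip: fps_const_1_eq_1)
  have d0: "0 < \<delta>" using \<delta> by simp
  have one: "pbound \<delta> 1" using pbound_const[of 1 \<delta>] d0 by simp
  have "(\<lambda>n. root n (fps_nth (rfps DF) n)) \<longlonglongrightarrow> \<delta>"
  proof (rule rational_series_growth[OF \<delta>(1) _ _ E[unfolded c]])
    show "pbound \<delta> ((1 + (fps_const 2 * ?q - fps_const 2) * ?X + ?X ^ 2) * (1 + (?q - 1) * ?X))"
      unfolding d power2_eq_square
      by (intro pbound_mult[OF d0] pbound_add[OF d0] one pbound_const pbound_X \<delta> d0) (use q4 in auto)
  qed simp
  thus ?thesis by (simp add: rfps_def DF_def)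
qed

end

lemma max_root_q4:
  fixes \<delta> :: real
  assumes \<delta>: "1 \<le> \<delta>" and t: "\<delta> + inverse \<delta> = real_of_int t"
  shows "Max {cmod z | z :: complex. z\<^sup>2 - of_int t * z + 1 = 0} = \<delta>"
proof -
  have ct: "(of_int t :: complex) = of_real (\<delta> + inverse \<delta>)" unfolding t by simp
  have 1: "(of_real \<delta> :: complex) * of_real (inverse \<delta>) = 1" using \<delta> by (simp flip: of_real_mult)
  have "z\<^sup>2 - of_int t * z + 1 = (z - of_real \<delta>) * (z - of_real (inverse \<delta>))" for z :: complex
    unfolding ct using 1 by (simp add: algebra_simps power2_eq_square)
  hence "{cmod z | z :: complex. z\<^sup>2 - of_int t * z + 1 = 0} = {cmod (of_real \<delta>), cmod (of_real (inverse \<delta>))}"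
    by (auto simp del: of_real_inverse norm_of_real)
  also have "\<dots> = {\<delta>, inverse \<delta>}" using \<delta> by (simp only: norm_of_real) simp
  finally have e: "{cmod z | z :: complex. z\<^sup>2 - of_int t * z + 1 = 0} = {\<delta>, inverse \<delta>}" .
  have "inverse \<delta> \<le> 1" using \<delta> by (simp add: inverse_le_1_iff)
  thus ?thesis unfolding e using \<delta> by (simp add: max_def)
qed

text \<open>For \<open>q = 3\<close> the polynomial is \<open>z^2 + z + 1\<close>, and its roots are
  the primitive cube roots of unity.\<close>

lemma max_root_q3: "Max {cmod z | z :: complex. z\<^sup>2 - of_int (- 1) * z + 1 = 0} = 1"
proof -
  have "cmod z = 1" if "z\<^sup>2 - of_int (- 1) * z + 1 = 0" for z
  proof -
    have "z ^ 3 - 1 = (z - 1) * (z\<^sup>2 - of_int (- 1) * z + 1)" by (simp add: algebra_simps power2_eq_square power3_eq_cube)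
    hence "z ^ 3 = 1" using that by simp
    hence "cmod z ^ 3 = 1 ^ 3" by (metis norm_one norm_power power_one)
    thus ?thesis by (subst (asm) power_eq_iff_eq_base) auto
  qed
  moreover have "\<exists>z :: complex. z\<^sup>2 - of_int (- 1) * z + 1 = 0"
    by (rule exI[of _ "Complex (- 1 / 2) (sqrt 3 / 2)"]) (simp add: complex_eq_iff power2_eq_square)
  ultimately have "{cmod z | z :: complex. z\<^sup>2 - of_int (- 1) * z + 1 = 0} = {1}" by force
  thus ?thesis by simp
qed

section \<open>Degrees of the iterates as rational maps\<close>

lemma abs_mp_hom: "comm_ring_hom abs_mp"
  by unfold_locales (simp_all add: zero_mpoly_def one_mpoly_def plus_mpoly.abs_eq times_mpoly.abs_eq)

lemma rep_mp_hom: "comm_ring_hom rep_mp"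
  by unfold_locales (simp_all add: zero_mpoly.rep_eq one_mpoly.rep_eq plus_mpoly.rep_eq times_mpoly.rep_eq)

lemma abs_mp_inject' [simp]: "abs_mp f = abs_mp g \<longleftrightarrow> f = g"
  by (simp add: abs_mp_inject)

lemma rep_abs [simp]: "rep_mp (abs_mp f) = f" and abs_rep [simp]: "abs_mp (rep_mp g) = g"
  by (simp_all add: abs_mp_inverse rep_mp_inverse)

lemma comm_ring_hom_comp:
  assumes "comm_ring_hom f" "comm_ring_hom g" shows "comm_ring_hom (\<lambda>x. g (f x))"
proof -
  interpret f: comm_ring_hom f by fact
  interpret g: comm_ring_hom g by fact
  show ?thesis by unfold_locales (simp_all add: f.hom_add f.hom_mult g.hom_add g.hom_mult)
qed

lemma abs_mp_dvd: "abs_mp f dvd abs_mp g \<longleftrightarrow> f dvd g"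
proof
  assume "abs_mp f dvd abs_mp g"
  then obtain h where "abs_mp g = abs_mp f * h" ..
  also have "\<dots> = abs_mp (f * rep_mp h)" by (subst abs_rep[of h, symmetric]) (simp only: times_mpoly.abs_eq)
  finally show "f dvd g" by simp
next
  assume "f dvd g"
  then obtain h where "g = f * h" ..
  thus "abs_mp f dvd abs_mp g" by (simp flip: times_mpoly.abs_eq)
qed

lemma abs_mp_pvar: "abs_mp (pvar v) = V v" and abs_mp_pconst: "abs_mp (pconst c) = C c"
  by (simp_all add: V_def C_def)

lemma abs_mp_psubst: "abs_mp (psubst H p) = ev C (\<lambda>v. abs_mp (H v)) (abs_mp p)"
proof -
  interpret A: comm_ring_hom abs_mp by (rule abs_mp_hom)
  interpret R: comm_ring_hom rep_mp by (rule rep_mp_hom)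
  have "comm_ring_hom (\<lambda>f. abs_mp (psubst H (rep_mp f)))"
    unfolding psubst_ins
    by unfold_locales (simp_all add: R.hom_add R.hom_mult ins_0[OF pconst_hom] ins_1[OF pconst_hom]
      ins_add[OF pconst_hom] ins_mult[OF pconst_hom] A.hom_add A.hom_mult)
  from hom_unique[OF this ev_hom[OF C_hom], of "\<lambda>v. abs_mp (H v)" "abs_mp p"]
  show ?thesis
    by (simp add: C.rep_eq V.rep_eq psubst_ins ins_pconst[OF pconst_hom] ins_pvar[OF pconst_hom]
      abs_mp_pconst ev_C[OF C_hom] ev_V[OF C_hom])
qed

text \<open>The cofactor is the determinant of \<open>A\<close> with row \<open>i\<close> replaced
  by the unit vector at \<open>j\<close>; its Leibniz formula keeps only the permutations with
  \<open>s i = j\<close>.\<close>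

lemma adj_mat_leibniz:
  fixes A :: "'a::comm_ring_1 mat"
  assumes A: "A \<in> carrier_mat n n" and ij: "i < n" "j < n"
  shows "adj_mat A $$ (j, i) = (\<Sum>s | s permutes {0..<n} \<and> s i = j. of_int (sign s) * (\<Prod>k\<in>{0..<n} - {i}. A $$ (k, s k)))"
proof -
  define B where "B = mat n n (\<lambda>(k, l). if k = i then (if l = j then 1 else 0) else A $$ (k, l))"
  have B: "B \<in> carrier_mat n n" by (simp add: B_def)
  have del: "mat_delete B i j = mat_delete A i j"
    using A ij by (intro eq_matI) (auto simp: B_def mat_delete_def)
  have "det B = (\<Sum>l<n. B $$ (i, l) * cofactor B i l)" by (rule laplace_expansion_row[OF B ij(1)])
  also have "\<dots> = (\<Sum>l<n. if l = j then cofactor B i l else 0)"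
    by (rule sum.cong) (use ij in \<open>auto simp: B_def\<close>)
  also have "\<dots> = cofactor A i j" using ij by (simp add: cofactor_def del)
  finally have "adj_mat A $$ (j, i) = det B" using A ij by (simp add: adj_mat_def)
  also have "\<dots> = (\<Sum>s\<in>{s. s permutes {0..<n}}. if s i = j then of_int (sign s) * (\<Prod>k\<in>{0..<n} - {i}. A $$ (k, s k)) else 0)"
    unfolding det_def'[OF B]
  proof (rule sum.cong)
    fix s assume "s \<in> {s. s permutes {0..<n}}"
    hence s: "s permutes {0..<n}" by simp
    have lt: "k < n \<Longrightarrow> s k < n" for k using permutes_in_image[OF s, of k] by simp
    have "(\<Prod>k = 0..<n. B $$ (k, s k)) = B $$ (i, s i) * (\<Prod>k\<in>{0..<n} - {i}. B $$ (k, s k))"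
      by (rule prod.remove) (use ij in auto)
    also have "(\<Prod>k\<in>{0..<n} - {i}. B $$ (k, s k)) = (\<Prod>k\<in>{0..<n} - {i}. A $$ (k, s k))"
      by (rule prod.cong) (auto simp: B_def lt)
    also have "B $$ (i, s i) = (if s i = j then 1 else 0)" using ij lt by (simp add: B_def)
    finally show "signof s * (\<Prod>k = 0..<n. B $$ (k, s k)) =
        (if s i = j then of_int (sign s) * (\<Prod>k\<in>{0..<n} - {i}. A $$ (k, s k)) else 0)"
      by (cases s rule: sign_cases) simp_all
  qed simp
  also have "\<dots> = (\<Sum>s | s permutes {0..<n} \<and> s i = j. of_int (sign s) * (\<Prod>k\<in>{0..<n} - {i}. A $$ (k, s k)))"
    by (subst sum.inter_filter[symmetric]) (simp_all add: finite_permutations)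
  finally show ?thesis .
qed

lemma abs_mp_I:
  assumes "i < q" "j < q" shows "abs_mp (I_map q (j, i)) = adj_mat (XP q) $$ (j, i)"
proof -
  interpret A: comm_ring_hom abs_mp by (rule abs_mp_hom)
  interpret C: comm_ring_hom C by (rule C_hom)
  have "abs_mp (I_map q (j, i)) = (\<Sum>s | s permutes {0..<q} \<and> s i = j.
      C (of_int (sign s)) * (\<Prod>k\<in>{0..<q} - {i}. V (k, s k)))"
    by (simp add: I_map_def A.hom_sum A.hom_mult A.hom_prod abs_mp_pvar abs_mp_pconst)
  also have "\<dots> = (\<Sum>s | s permutes {0..<q} \<and> s i = j.
      of_int (sign s) * (\<Prod>k\<in>{0..<q} - {i}. XP q $$ (k, s k)))"
  proof (rule sum.cong)
    fix s assume "s \<in> {s. s permutes {0..<q} \<and> s i = j}"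
    hence s: "s permutes {0..<q}" by simp
    have lt: "k < q \<Longrightarrow> s k < q" for k using permutes_in_image[OF s, of k] by simp
    have "(\<Prod>k\<in>{0..<q} - {i}. V (k, s k)) = (\<Prod>k\<in>{0..<q} - {i}. XP q $$ (k, s k))"
      by (rule prod.cong) (simp_all add: lt)
    thus "C (of_int (sign s)) * (\<Prod>k\<in>{0..<q} - {i}. V (k, s k)) =
        of_int (sign s) * (\<Prod>k\<in>{0..<q} - {i}. XP q $$ (k, s k))"
      by (cases s rule: sign_cases) (simp_all add: C.hom_uminus)
  qed simp
  finally show ?thesis by (simp add: adj_mat_leibniz[OF XP_carrier assms])
qed

text \<open>\<open>GR\<close> multiplies each term by \<open>t\<close> to the power of its degree.
  For the converse, terms of one degree cannot cancel, because they are supported at distinct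
  monomials.\<close>

lemma homogeneous_hm_iff: "homogeneous_of_degree e p \<longleftrightarrow> hm e (abs_mp p)"
proof -
  interpret A: comm_ring_hom abs_mp by (rule abs_mp_hom)
  define T where "T m = C (Poly_Mapping.lookup p m) * mon_val V m" for m
  let ?K = "Poly_Mapping.keys p"
  have p: "abs_mp p = (\<Sum>m\<in>?K. T m)" using mpoly_expand[of "abs_mp p"] by (simp add: T_def)
  interpret G: comm_ring_hom GR by (rule GR_hom)
  have mv: "GR (mon_val V m) = monom (mon_val V m) (mon_deg m)" for m
  proof -
    have 1: "GR (V v) ^ k = monom (V v ^ k) k" for v k
      by (induction k) (auto simp: monom_altdef mult_monom[of _ 1, simplified monom_altdef] power_mult_distrib GR_V mult.commute)
    have "(\<Prod>v\<in>S. monom (f v) (g v)) = monom (\<Prod>v\<in>S. f v :: mpoly) (\<Sum>v\<in>S. g v)" for S and f :: "var \<Rightarrow> mpoly" and g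
      by (induction S rule: infinite_finite_induct) (auto simp: mult_monom)
    thus ?thesis by (simp only: mon_val_def G.hom_prod GR_power 1 mon_deg_def)
  qed
  have GT: "GR (T m) = monom (T m) (mon_deg m)" for m
    by (simp add: T_def GR_mult mv smult_monom)
  show ?thesis
  proof
    assume "homogeneous_of_degree e p"
    hence "hm e (T m)" if "m \<in> ?K" for m using that GT by (simp add: hm_def homogeneous_of_degree_def)
    thus "hm e (abs_mp p)" unfolding p by (rule hm_sum)
  next
    assume h: "hm e (abs_mp p)"
    show "homogeneous_of_degree e p" unfolding homogeneous_of_degree_def
    proof (rule ballI, rule ccontr)
      fix m assume m: "m \<in> ?K" "mon_deg m \<noteq> e"
      define S where "S = {m' \<in> ?K. mon_deg m' = mon_deg m}"
      have "coeff (GR (abs_mp p)) (mon_deg m) = (\<Sum>m'\<in>?K. if mon_deg m' = mon_deg m then T m' else 0)"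
        unfolding p G.hom_sum GT coeff_sum by (rule sum.cong) auto
      also have "\<dots> = (\<Sum>m'\<in>S. T m')" unfolding S_def by (subst sum.inter_filter[symmetric]) auto
      finally have 0: "(\<Sum>m'\<in>S. T m') = 0" using h m(2) by (simp add: hm_def)
      have "T m' = abs_mp (Poly_Mapping.single m' (Poly_Mapping.lookup p m'))" for m'
      proof -
        have "mon_val V m' = abs_mp (mon_val pvar m')"
          by (simp add: mon_val_def A.hom_prod A.hom_power abs_mp_pvar)
        thus ?thesis by (simp add: T_def mon_val_pvar pconst_def mult_single times_mpoly.abs_eq flip: abs_mp_pconst)
      qed
      hence "abs_mp (\<Sum>m'\<in>S. Poly_Mapping.single m' (Poly_Mapping.lookup p m')) = abs_mp 0"
        using 0 by (simp add: A.hom_sum)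
      hence "(\<Sum>m'\<in>S. Poly_Mapping.single m' (Poly_Mapping.lookup p m')) = 0" by (simp only: abs_mp_inject')
      hence "Poly_Mapping.lookup (\<Sum>m'\<in>S. Poly_Mapping.single m' (Poly_Mapping.lookup p m')) m = 0" by simp
      hence "(\<Sum>m'\<in>S. if m' = m then Poly_Mapping.lookup p m' else 0) = 0"
        by (simp add: lookup_sum lookup_single when_def)
      moreover have "finite S" "m \<in> S" using m by (auto simp: S_def)
      ultimately show False using m(1) by (simp add: in_keys_iff)
    qed
  qed
qed

context mdim
begin

section \<open>The formal iterates compared with the orbit of the generic matrix\<close>

definition ti :: "nat \<Rightarrow> var \<Rightarrow> mpoly" where "ti n v = abs_mp (titer (K_map q) n v)"

lemma ti_0: "ti 0 v = V v"
  by (simp add: ti_def titer_def abs_mp_pvar)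

lemma F_ti_Suc:
  assumes "i < q" "j < q" and nz: "\<And>w. w \<in> coords q \<Longrightarrow> ti n w \<noteq> 0"
  shows "F (ti (Suc n) (j, i)) = adj_mat (mat q q (\<lambda>w. (\<Prod>u\<in>coords q. F (ti n u)) * inverse (F (ti n w)))) $$ (j, i)"
proof -
  interpret A: comm_ring_hom abs_mp by (rule abs_mp_hom)
  define h where "h f = F (ev C (ti n) (ev C (\<lambda>v. abs_mp (J_map q v)) f))" for f
  have h: "comm_ring_hom h" unfolding h_def
    by (rule comm_ring_hom_comp[OF comm_ring_hom_comp[OF ev_hom[OF C_hom] ev_hom[OF C_hom]] F_hom])
  have "F (ti (Suc n) (j, i)) = h (adj_mat (XP q) $$ (j, i))"
    unfolding h_def abs_mp_I[OF assms(1,2), symmetric]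
    by (simp add: ti_def[abs_def] titer_def tcomp_def K_map_def abs_mp_psubst)
  also have "\<dots> = adj_mat (map_mat h (XP q)) $$ (j, i)"
    using adj_mat_hom[OF h XP_carrier, of q] adj_mat(1)[OF XP_carrier, of q] assms by simp
  also have "map_mat h (XP q) = mat q q (\<lambda>w. (\<Prod>u\<in>coords q. F (ti n u)) * inverse (F (ti n w)))"
  proof (rule eq_matI)
    fix k l assume "k < dim_row (mat q q (\<lambda>w. (\<Prod>u\<in>coords q. F (ti n u)) * inverse (F (ti n w))))"
      "l < dim_col (mat q q (\<lambda>w. (\<Prod>u\<in>coords q. F (ti n u)) * inverse (F (ti n w))))"
    hence kl: "k < q" "l < q" "(k, l) \<in> coords q" by (auto simp: coords_def)
    interpret E: comm_ring_hom "ev C (ti n)" by (rule ev_hom[OF C_hom])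
    have "h (V (k, l)) = (\<Prod>u\<in>coords q - {(k, l)}. F (ti n u))"
      by (simp add: h_def C_hom J_map_def A.hom_prod E.hom_prod F_prod abs_mp_pvar)
    moreover have "(\<Prod>u\<in>coords q. F (ti n u)) = F (ti n (k, l)) * (\<Prod>u\<in>coords q - {(k, l)}. F (ti n u))"
      by (rule prod.remove) (use kl in auto)
    ultimately show "map_mat h (XP q) $$ (k, l) = mat q q (\<lambda>w. (\<Prod>u\<in>coords q. F (ti n u)) * inverse (F (ti n w))) $$ (k, l)"
      using kl nz by simp
  qed auto
  finally show ?thesis .
qed

text \<open>Homogenizing J and taking the adjugate for I change the matrix only by nonzero scalars.
  These accumulate in \<open>\<phi>\<close>, common factors of the formal iterates included.\<close>

lemma ti_proportional: "\<exists>\<phi>. \<phi> \<noteq> 0 \<and> (\<forall>v\<in>coords q. F (ti n v) = \<phi> * kn n X $$ v)"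
proof (induction n)
  case 0
  show ?case by (rule exI[of _ 1]) (auto simp: ti_0 coords_def)
next
  case (Suc n)
  then obtain \<phi> where \<phi>: "\<phi> \<noteq> 0" "\<And>v. v \<in> coords q \<Longrightarrow> F (ti n v) = \<phi> * kn n X $$ v" by blast
  have nzF: "F (ti n v) \<noteq> 0" if "v \<in> coords q" for v using \<phi> kn_X_nz' that by simp
  hence nz: "ti n v \<noteq> 0" if "v \<in> coords q" for v using that by fastforce
  define c where "c = (\<Prod>u\<in>coords q. F (ti n u)) * inverse \<phi>"
  have c0: "c \<noteq> 0" using nzF \<phi> by (simp add: c_def)
  let ?B = "Jm (kn n X)"
  have B: "?B \<in> carrier_mat q q" by simp
  define M where "M = scl q (\<lambda>_. c) ?B (\<lambda>_. 1)"
  have M: "M \<in> carrier_mat q q" by (simp add: M_def)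
  have dM: "det M \<noteq> 0" using c0 kn_X_nz(2)[of n] by (simp add: M_def det_scl[OF B])
  have e: "mat q q (\<lambda>w. (\<Prod>u\<in>coords q. F (ti n u)) * inverse (F (ti n w))) = M"
    by (rule eq_matI) (auto simp: M_def c_def \<phi> coords_def Jm_index[of _ q])
  have IM: "Iv M = scl q (\<lambda>_. 1) (Iv ?B) (\<lambda>_. inverse c)"
    unfolding M_def by (subst Im_scl[OF B]) (use c0 kn_X_nz(2)[of n] in auto)
  have "F (ti (Suc n) v) = (det M * inverse c) * kn (Suc n) X $$ v" if v: "v \<in> coords q" for v
  proof -
    obtain i j where ij: "v = (j, i)" "i < q" "j < q" using v by (cases v) (auto simp: coords_def)
    have "F (ti (Suc n) v) = det M * Iv M $$ (j, i)"
      unfolding ij(1) using F_ti_Suc[OF ij(2,3) nz] adj_Im_index[OF M dM ij(3,2)] by (simp add: e)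
    thus ?thesis using ij by (simp add: IM kn_Suc' Km_def)
  qed
  thus ?case using dM c0 by (intro exI[of _ "det M * inverse c"]) auto
qed

text \<open>Existence comes from \<open>reduced_Tup_exists\<close>. For uniqueness, two proportional
  tuples without common factor have equal orders at every prime and therefore equal degrees.\<close>

theorem rat_map_deg_eq: "rat_map_deg (coords q) (titer (K_map q) n) = dg n"
  unfolding rat_map_deg_def
proof (rule the_equality)
  obtain \<phi> where \<phi>: "\<phi> \<noteq> 0" "\<And>v. v \<in> coords q \<Longrightarrow> F (ti n v) = \<phi> * kn n X $$ v" using ti_proportional by blast
  obtain G \<psi> where T: "Tup n (dg n) G \<psi>" and red: "reduced G" using reduced_Tup_exists by blast
  have FG: "F (ti n v) = \<phi> * \<psi> * F (G v)" if "v \<in> coords q" for v using T \<phi>(2)[OF that] that by (simp add: Tup_def)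
  have \<phi>\<psi>: "\<phi> * \<psi> \<noteq> 0" using \<phi> T by (simp add: Tup_def)
  obtain v0 where v0: "v0 \<in> coords q" using coords_ne by blast
  show "\<exists>G. (\<forall>v\<in>coords q. homogeneous_of_degree (dg n) (G v)) \<and> (\<exists>v\<in>coords q. G v \<noteq> 0) \<and>
      (\<forall>h. (\<forall>v\<in>coords q. h dvd G v) \<longrightarrow> h dvd 1) \<and>
      (\<forall>v\<in>coords q. \<forall>w\<in>coords q. titer (K_map q) n v * G w = titer (K_map q) n w * G v)"
  proof (intro exI[of _ "\<lambda>v. rep_mp (G v)"] conjI allI impI ballI)
    fix v assume "v \<in> coords q"
    thus "homogeneous_of_degree (dg n) (rep_mp (G v))" using T by (simp add: homogeneous_hm_iff Tup_def)
  next
    have "rep_mp (G v0) \<noteq> 0" using Tup_nz[OF T v0] by (metis abs_rep zero_mpoly_def)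
    thus "\<exists>v\<in>coords q. rep_mp (G v) \<noteq> 0" using v0 by blast
  next
    fix h assume h: "\<forall>v\<in>coords q. h dvd rep_mp (G v)"
    hence h': "abs_mp h dvd G v" if "v \<in> coords q" for v using that abs_mp_dvd[of h "rep_mp (G v)"] by simp
    have "abs_mp h dvd 1"
    proof (rule ccontr)
      assume "\<not> abs_mp h dvd 1"
      moreover have "abs_mp h \<noteq> 0" using h'[OF v0] Tup_nz[OF T v0] by auto
      ultimately obtain p where p: "prime_elem p" "p dvd abs_mp h" using prime_factor_exists by blast
      hence "p dvd G v" if "v \<in> coords q" for v using h'[OF that] dvd_trans by blast
      thus False using red p(1) unfolding reduced_def by blast
    qed
    thus "h dvd 1" by (simp flip: abs_mp_dvd one_mpoly_def)
  next
    fix v w assume vw: "v \<in> coords q" "w \<in> coords q"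
    have "F (ti n v * G w) = F (ti n w * G v)" using FG vw by simp
    hence "abs_mp (titer (K_map q) n v * rep_mp (G w)) = abs_mp (titer (K_map q) n w * rep_mp (G v))"
      unfolding to_fract_eq_iff by (simp add: ti_def times_mpoly.abs_eq[symmetric])
    thus "titer (K_map q) n v * rep_mp (G w) = titer (K_map q) n w * rep_mp (G v)" by simp
  qed
  fix e assume "\<exists>G. (\<forall>v\<in>coords q. homogeneous_of_degree e (G v)) \<and> (\<exists>v\<in>coords q. G v \<noteq> 0) \<and>
      (\<forall>h. (\<forall>v\<in>coords q. h dvd G v) \<longrightarrow> h dvd 1) \<and>
      (\<forall>v\<in>coords q. \<forall>w\<in>coords q. titer (K_map q) n v * G w = titer (K_map q) n w * G v)"
  then obtain H' where H': "\<And>v. v \<in> coords q \<Longrightarrow> homogeneous_of_degree e (H' v)" "\<exists>v\<in>coords q. H' v \<noteq> 0"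
     "\<And>h. (\<forall>v\<in>coords q. h dvd H' v) \<Longrightarrow> h dvd 1"
     "\<And>v w. v \<in> coords q \<Longrightarrow> w \<in> coords q \<Longrightarrow> titer (K_map q) n v * H' w = titer (K_map q) n w * H' v" by (elim exE conjE) (rule that, blast+)
  define H where "H v = abs_mp (H' v)" for v
  have hmH: "hm e (H v)" if "v \<in> coords q" for v using H'(1)[OF that] by (simp add: H_def homogeneous_hm_iff)
  have GH: "G v * H w = G w * H v" if vw: "v \<in> coords q" "w \<in> coords q" for v w
  proof -
    have "ti n v * H w = ti n w * H v" using H'(4)[OF vw] by (simp add: ti_def H_def times_mpoly.abs_eq)
    hence "F (ti n v) * F (H w) = F (ti n w) * F (H v)" by (metis to_fract_mult)
    hence "F (G v * H w) = F (G w * H v)" using FG vw \<phi>\<psi> by (simp add: mult.assoc)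
    thus ?thesis by (simp only: to_fract_eq_iff)
  qed
  obtain v1 where v1: "v1 \<in> coords q" "H v1 \<noteq> 0"
    using H'(2) by (metis H_def abs_mp_inject' zero_mpoly_def)
  have Hnz: "H v \<noteq> 0" if "v \<in> coords q" for v
    using GH[OF that v1(1)] v1(2) Tup_nz[OF T that] Tup_nz[OF T v1(1)] by auto
  have redH: "reduced H" unfolding reduced_def
  proof (intro allI impI, rule ccontr)
    fix p :: mpoly assume p: "prime_elem p" "\<not> (\<exists>w\<in>coords q. \<not> p dvd H w)"
    hence "rep_mp p dvd H' v" if "v \<in> coords q" for v using that abs_mp_dvd[of "rep_mp p" "H' v"] by (simp add: H_def)
    hence "rep_mp p dvd 1" using H'(3) by blast
    hence "p dvd 1" using abs_mp_dvd[of "rep_mp p" 1] by (simp add: one_mpoly_def)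
    thus False using p(1) by (simp add: prime_elem_def)
  qed
  have "tdeg (H v0) = tdeg (G v0)"
  proof (rule tdeg_eq_of_ordp[OF Hnz[OF v0] Tup_nz[OF T v0]])
    fix p :: mpoly assume p: "prime_elem p"
    have o: "ordp p (G v) + ordp p (H w) = ordp p (G w) + ordp p (H v)" if "v \<in> coords q" "w \<in> coords q" for v w
      using arg_cong[OF GH[OF that], of "ordp p"] that by (simp add: ordp_mult[OF p] Hnz Tup_nz[OF T])
    obtain v where v: "v \<in> coords q" "\<not> p dvd G v" using red p unfolding reduced_def by blast
    obtain w where w: "w \<in> coords q" "\<not> p dvd H w" using redH p unfolding reduced_def by blast
    have "ordp p (G v) = 0" "ordp p (H w) = 0"
      using ordp_pos_iff[OF p Tup_nz[OF T v(1)]] ordp_pos_iff[OF p Hnz[OF w(1)]] v w by auto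
    thus "ordp p (H v0) = ordp p (G v0)" using o[OF v(1) w(1)] o[OF v(1) v0] by simp
  qed
  moreover have "tdeg (H v0) = e" by (rule hm_tdeg[OF hmH[OF v0] Hnz[OF v0]])
  moreover have "tdeg (G v0) = dg n" using T v0 by (intro hm_tdeg Tup_nz[OF T v0]) (simp add: Tup_def)
  ultimately show "e = dg n" by simp
qed

text \<open>In degree 0, two entries of the iterate would be proportional over the complex numbers.
  The iterate acts on the function field by an injective homomorphism that fixes constants, so two
  entries of \<open>X\<close> itself would already be proportional.\<close>

lemma dg_pos:
  assumes q2: "2 \<le> q" shows "1 \<le> dg n"
proof (rule ccontr)
  assume "\<not> 1 \<le> dg n"
  hence d0: "dg n = 0" by simp
  obtain G \<psi> where T: "Tup n (dg n) G \<psi>" using reduced_Tup_exists by blast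
  have c: "(0, 0) \<in> coords q" "(0, 1) \<in> coords q" using q2 by (auto simp: coords_def)
  have "\<exists>a. G w = C a" if "w \<in> coords q" for w
    using T that hm_tdeg[of "dg n" "G w"] Tup_nz[OF T that] tdeg_0_const[of "G w"] d0 by (simp add: Tup_def)
  then obtain a b where ab: "G (0, 0) = C a" "G (0, 1) = C b" using c by metis
  have b0: "C b \<noteq> 0" "C a \<noteq> 0" using Tup_nz[OF T c(2)] Tup_nz[OF T c(1)] ab by auto
  have eq: "F (C b) * kn n X $$ (0, 0) = F (C a) * kn n X $$ (0, 1)"
    using T c ab by (simp add: Tup_def mult_ac)
  define h where "h = phiK ^^ n"
  have h: "comm_ring_hom h" unfolding h_def
  proof (induction n)
    case 0 show ?case by unfold_locales auto
  next
    case (Suc n)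
    interpret a: comm_ring_hom "phiK ^^ n" by fact
    interpret b: comm_ring_hom phiK by (rule phiK_hom)
    show ?case by unfold_locales (simp_all add: a.hom_add a.hom_mult b.hom_add b.hom_mult)
  qed
  interpret h: comm_ring_hom h by (rule h)
  have hC: "h (F (C c)) = F (C c)" for c unfolding h_def
    by (induction n) (simp_all add: phiK_def phiI_F phiJ_F)
  have hX: "kn n X = map_mat h X" unfolding h_def
  proof (induction n)
    case (Suc n)
    have "kn (Suc n) X = map_mat phiK (kn n X)"
      by (simp add: kn_Suc kn_hom[OF phiK_hom XF_carrier] flip: map_phiK_X)
    thus ?case by (simp add: Suc) (rule eq_matI, auto)
  qed (rule eq_matI, auto)
  have "h (F (C b * V (0, 0))) = h (F (C a * V (0, 1)))"
    using eq q2 by (simp add: hX h.hom_mult hC)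
  hence "h (F (C b * V (0, 0)) - F (C a * V (0, 1))) = 0" by (simp add: h.hom_minus)
  hence "F (C b * V (0, 0)) = F (C a * V (0, 1))" using field_hom_eq_0[OF h] by simp
  hence "C b * V (0, 0) = C a * V (0, 1)" by (simp only: to_fract_eq_iff)
  hence e: "ev (\<lambda>x. x) (\<lambda>v. if v = (0, 0) then 1 else 0) (C b * V (0, 0)) =
      ev (\<lambda>x. x) (\<lambda>v. if v = (0, 0) then 1 else 0) (C a * V (0, 1))" by simp
  interpret e: comm_ring_hom "ev (\<lambda>x::complex. x) (\<lambda>v. if v = (0, 0) then 1 else 0)" by (rule ev_hom[OF id_hom])
  have "b = 0" using e by (simp add: e.hom_mult id_hom)
  thus False using b0 by simp
qed

end

section \<open>The case of three by three matrices\<close>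

lemma prod_3: "(\<Prod>k<(3::nat). f k) = f 0 * f 1 * (f 2 :: 'a::comm_monoid_mult)"
  by (simp add: lessThan_Suc numeral_3_eq_3 numeral_2_eq_2 mult_ac)

text \<open>Cyclic indices modulo 3 absorb the signs of the cofactors.\<close>

lemma adj_mat_3:
  fixes A :: "'a::comm_ring_1 mat"
  assumes A: "A \<in> carrier_mat 3 3" and ij: "i < 3" "j < 3"
  shows "adj_mat A $$ (j, i) =
    A $$ ((i + 1) mod 3, (j + 1) mod 3) * A $$ ((i + 2) mod 3, (j + 2) mod 3) -
    A $$ ((i + 1) mod 3, (j + 2) mod 3) * A $$ ((i + 2) mod 3, (j + 1) mod 3)"
proof -
  have det2: "det B = B $$ (0, 0) * B $$ (1, 1) - B $$ (0, 1) * B $$ (1, 0)" if B: "B \<in> carrier_mat 2 2" for B :: "'a mat"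
  proof -
    have c: "cofactor B 0 0 = B $$ (1, 1)" "cofactor B 0 1 = - B $$ (1, 0)"
      unfolding cofactor_def using B
      by (subst det_single; simp add: mat_delete_def)+
    have "det B = (\<Sum>j<2. B $$ (0, j) * cofactor B 0 j)" by (rule laplace_expansion_row[OF B]) simp
    also have "{..<2::nat} = {0, 1}" by auto
    finally show ?thesis using c by simp
  qed
  have "mat_delete A i j \<in> carrier_mat 2 2" using A by (auto simp: mat_delete_def)
  from det2[OF this] have "adj_mat A $$ (j, i) = (-1) ^ (i + j) *
     (mat_delete A i j $$ (0, 0) * mat_delete A i j $$ (1, 1) - mat_delete A i j $$ (0, 1) * mat_delete A i j $$ (1, 0))"
    using A ij by (simp add: adj_mat_def cofactor_def)
  moreover have "i = 0 \<or> i = 1 \<or> i = 2" "j = 0 \<or> j = 1 \<or> j = 2" using ij by auto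
  ultimately show ?thesis using A by (elim disjE) (simp_all add: mat_delete_def)
qed

lemma prod_mod_3:
  "i < 3 \<Longrightarrow> (\<Prod>k<(3::nat). f k) = f i * f ((i + 1) mod 3) * (f ((i + 2) mod 3) :: 'a::comm_monoid_mult)"
proof -
  assume "i < 3"
  hence "i = 0 \<or> i = 1 \<or> i = 2" by auto
  thus ?thesis by (elim disjE) (simp_all add: prod_3 mult_ac numeral_2_eq_2)
qed

definition rowp :: "'a::field mat \<Rightarrow> nat \<Rightarrow> 'a" where "rowp A i = (\<Prod>l<3. A $$ (i, l))"
definition colp :: "'a::field mat \<Rightarrow> nat \<Rightarrow> 'a" where "colp A j = (\<Prod>k<3. A $$ (k, j))"
definition allp :: "'a::field mat \<Rightarrow> 'a" where "allp A = (\<Prod>k<3. rowp A k)"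
definition alp :: "'a::field mat \<Rightarrow> 'a" where "alp A = - det A / (allp A * det (Jm A))"

text \<open>The 2 by 2 minors satisfy \<open>1/(ad) - 1/(bc) = -(ad - bc)/(abcd)\<close>, so the inverse of
  \<open>J x\<close> is, up to multiplying rows and columns by scalars, the entrywise quotient of \<open>x\<^sup>-\<^sup>1\<close> by
  the transpose of \<open>x\<close>.\<close>

lemma Km_3:
  fixes A :: "'a::field mat"
  assumes A: "A \<in> carrier_mat 3 3" and nz: "\<And>i j. i < 3 \<Longrightarrow> j < 3 \<Longrightarrow> A $$ (i, j) \<noteq> 0"
    and d: "det A \<noteq> 0" and ij: "i < 3" "j < 3"
  shows "Km A $$ (j, i) = alp A * colp A j * (Iv A $$ (j, i) / A $$ (i, j)) * rowp A i"
proof -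
  define i1 i2 j1 j2 where "i1 = (i + 1) mod 3" "i2 = (i + 2) mod 3" "j1 = (j + 1) mod 3" "j2 = (j + 2) mod 3"
  note def = this
  have lt: "i1 < 3" "i2 < 3" "j1 < 3" "j2 < 3" by (simp_all add: def)
  define a b c e where "a = A $$ (i1, j1)" "b = A $$ (i1, j2)" "c = A $$ (i2, j1)" "e = A $$ (i2, j2)"
  note def2 = this
  define s t u v w where "s = A $$ (i, j)" "t = A $$ (i, j1)" "u = A $$ (i, j2)" "v = A $$ (i1, j)" "w = A $$ (i2, j)"
  note def3 = this
  have n0: "a \<noteq> 0" "b \<noteq> 0" "c \<noteq> 0" "e \<noteq> 0" "s \<noteq> 0" "t \<noteq> 0" "u \<noteq> 0" "v \<noteq> 0" "w \<noteq> 0"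
    using nz lt ij by (simp_all add: def2 def3)
  have R: "rowp A i = s * t * u" and C: "colp A j = s * v * w"
    unfolding rowp_def colp_def prod_mod_3[OF ij(2), of "\<lambda>l. A $$ (i, l)"] prod_mod_3[OF ij(1), of "\<lambda>k. A $$ (k, j)"]
    by (simp_all only: def def3)
  have P: "allp A = (s * t * u) * (v * a * b) * (w * c * e)"
    unfolding allp_def rowp_def prod_mod_3[OF ij(1), of "\<lambda>k. \<Prod>l<3. A $$ (k, l)"] 
      prod_mod_3[OF ij(2), of "\<lambda>l. A $$ (i, l)"] prod_mod_3[OF ij(2), of "\<lambda>l. A $$ ((i + 1) mod 3, l)"]
      prod_mod_3[OF ij(2), of "\<lambda>l. A $$ ((i + 2) mod 3, l)"]
    by (simp only: def def2 def3)
  have aA: "adj_mat A $$ (j, i) = a * e - b * c"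
    unfolding adj_mat_3[OF A ij] by (simp only: def def2)
  have "adj_mat (Jm A) $$ (j, i) = inverse a * inverse e - inverse b * inverse c"
    unfolding adj_mat_3[OF Jm_carrier[OF A] ij] def[symmetric] using lt by (simp only: def2 Jm_index[OF A])
  \<comment> \<open>\<open>colp A j * rowp A i / (allp A * s)\<close> is the inverse of
    \<open>a * b * c * e\<close>, the product of the four entries outside row \<open>i\<close> and
    column \<open>j\<close>.\<close>
  hence aJ: "adj_mat (Jm A) $$ (j, i) = - adj_mat A $$ (j, i) * colp A j * rowp A i / (allp A * s)"
    unfolding R C P aA using n0 by (simp add: divide_simps) (simp add: algebra_simps)?
  have I: "Iv A $$ (j, i) = adj_mat A $$ (j, i) / det A"
    using adj_Im_index[OF A d ij(2,1)] d by simp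
  have "Km A $$ (j, i) = adj_mat (Jm A) $$ (j, i) / det (Jm A)"
    unfolding Km_def Iv_def using ij adj_mat(1)[OF Jm_carrier[OF A]] by (simp add: field_simps)
  thus ?thesis unfolding aJ I alp_def def3(1)[symmetric] using d by (simp add: field_simps)
qed

lemma Iv_transpose:
  fixes A :: "'a::field mat"
  assumes A: "A \<in> carrier_mat n n" and "det A \<noteq> 0"
  shows "Iv (transpose_mat A) = transpose_mat (Iv A)"
proof (rule Im_unique(2)[of _ n])
  show "transpose_mat A * transpose_mat (Iv A) = 1\<^sub>m n"
    using transpose_mult[OF Im_carrier[OF A] A] Im_inverse(2)[OF assms] by simp
qed (use A in auto)

lemma Jm_transpose: "Jm (transpose_mat A) = transpose_mat (Jm A)"
  by (rule eq_matI) (auto simp: Jm_def)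

lemma Km_transpose: "A \<in> carrier_mat n n \<Longrightarrow> det (Jm A) \<noteq> 0 \<Longrightarrow> Km (transpose_mat A) = transpose_mat (Km A)"
  unfolding Km_def Jm_transpose by (rule Iv_transpose) auto

lemma scl_scl: "scl n a (scl n b A c) e = scl n (\<lambda>i. a i * b i) A (\<lambda>i. c i * e i)"
  by (rule eq_matI) (auto simp: mult_ac)

lemma transpose_scl: "A \<in> carrier_mat n n \<Longrightarrow> transpose_mat (scl n a A b) = scl n b (transpose_mat A) a"
  by (rule eq_matI) (auto simp: mult_ac)

lemma rowcol_nz:
  assumes nz: "\<And>i j. i < 3 \<Longrightarrow> j < 3 \<Longrightarrow> A $$ (i, j) \<noteq> 0"
  shows "i < 3 \<Longrightarrow> rowp A i \<noteq> 0" "i < 3 \<Longrightarrow> colp A i \<noteq> 0" "allp A \<noteq> 0"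
  using nz by (auto simp: rowp_def colp_def allp_def)

context mdim
begin

abbreviation "ZT \<equiv> transpose_mat YY"
definition "LS i = alp X * colp X i * (alp ZT * colp ZT i)"
definition "RS i = rowp X i * rowp ZT i"

text \<open>Up to row and column scalings, \<open>K X\<close> is the entrywise quotient
  \<open>W\<close> of the inverse of \<open>X\<close> by its transpose. The same formula at
  \<open>ZT\<close>, whose inverse is the transpose of \<open>X\<close>, produces the entrywise
  inverse of \<open>W\<close>. So \<open>J(K X)\<close> is a scaling of \<open>I(J ZT)\<close>, the
  second iterate one of \<open>J ZT\<close>, and the third one of \<open>I ZT\<close>.\<close>

lemma kn_3:
  assumes q3: "q = 3"
  shows "kn 3 X = scl 3 LS (transpose_mat X) RS"
    and "i < 3 \<Longrightarrow> LS i \<noteq> 0" and "i < 3 \<Longrightarrow> RS i \<noteq> 0"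
proof -
  have Xc: "X \<in> carrier_mat 3 3" using XF_carrier[of q] q3 by simp
  have Xnz: "X $$ (i, j) \<noteq> 0" if "i < 3" "j < 3" for i j using that q3 by simp
  have Y: "YY \<in> carrier_mat 3 3" using Xc by (simp add: YY_def)
  have Zc: "ZT \<in> carrier_mat 3 3" using Y by simp
  have Ynz: "YY $$ (i, j) \<noteq> 0" if "i < 3" "j < 3" for i j
  proof -
    have ij: "i < q" "j < q" using that q3 by simp_all
    show ?thesis unfolding YY_r[OF ij] using r_nz[OF ij] by simp
  qed
  have ZY: "ZT $$ (i, j) = YY $$ (j, i)" if "i < 3" "j < 3" for i j
    by (rule index_transpose_mat(1)) (simp_all only: carrier_matD[OF Y] that)
  have Znz: "ZT $$ (i, j) \<noteq> 0" if "i < 3" "j < 3" for i j unfolding ZY[OF that] by (rule Ynz[OF that(2,1)])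
  have XT: "transpose_mat X $$ (i, j) = X $$ (j, i)" if "i < 3" "j < 3" for i j using that carrier_matD[OF Xc] by simp
  have dY: "det YY \<noteq> 0" unfolding YY_def by (subst det_Im[of _ q]) auto
  have dZ: "det ZT \<noteq> 0" using dY det_transpose[OF Y] by simp
  have "Iv YY = X" unfolding YY_def by (rule Im_Im[OF XF_carrier det_XF_nz])
  hence IZ: "Iv ZT = transpose_mat X" unfolding Iv_transpose[OF Y dY] by simp
  have dJX: "det (Jm X) \<noteq> 0" using kn_X_nz(2)[of 0] by simp
  have dJZ: "det (Jm ZT) \<noteq> 0"
    unfolding Jm_transpose using det_transpose[OF Jm_carrier[OF Y]] det_ZZ_nz by (simp add: ZZ_def)
  define W where "W = mat 3 3 (\<lambda>(j, i). YY $$ (j, i) / X $$ (i, j))"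
  have Wc: "W \<in> carrier_mat 3 3" by (simp add: W_def)
  have al: "alp X \<noteq> 0" "alp ZT \<noteq> 0"
    using dJX dJZ dZ rowcol_nz(3)[of X, OF Xnz] rowcol_nz(3)[of ZT, OF Znz] by (auto simp: alp_def)
  note rcX = rowcol_nz(1,2)[of X, OF Xnz] and rcZ = rowcol_nz(1,2)[of ZT, OF Znz]
  show L: "LS i \<noteq> 0" if "i < 3" for i using al rcX rcZ that by (simp add: LS_def)
  show R: "RS i \<noteq> 0" if "i < 3" for i using rcX rcZ that by (simp add: RS_def)
  have K1: "Km X = scl 3 (\<lambda>j. alp X * colp X j) W (rowp X)"
  proof (rule eq_matI)
    fix j i assume "j < dim_row (scl 3 (\<lambda>j. alp X * colp X j) W (rowp X))" "i < dim_col (scl 3 (\<lambda>j. alp X * colp X j) W (rowp X))"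
    hence ij: "i < 3" "j < 3" by simp_all
    show "Km X $$ (j, i) = scl 3 (\<lambda>j. alp X * colp X j) W (rowp X) $$ (j, i)"
      using Km_3[OF Xc Xnz det_XF_nz ij] ij by (simp add: W_def YY_def)
  qed (use Xc in auto)
  have KZ: "Km ZT = scl 3 (\<lambda>j. alp ZT * colp ZT j) (Jm W) (rowp ZT)"
  proof (rule eq_matI)
    fix j i assume "j < dim_row (scl 3 (\<lambda>j. alp ZT * colp ZT j) (Jm W) (rowp ZT))" "i < dim_col (scl 3 (\<lambda>j. alp ZT * colp ZT j) (Jm W) (rowp ZT))"
    hence ij: "i < 3" "j < 3" by simp_all
    show "Km ZT $$ (j, i) = scl 3 (\<lambda>j. alp ZT * colp ZT j) (Jm W) (rowp ZT) $$ (j, i)"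
      using Km_3[OF Zc Znz dZ ij] ij by (simp add: IZ Jm_index[OF Wc] XT ZY) (simp add: W_def)
  qed (use Y in auto)
  have KZ': "Km ZT = Iv (Jm ZT)" by (simp add: Km_def)
  have "Jm W = scl 3 (\<lambda>j. inverse (alp ZT * colp ZT j)) (Km ZT) (\<lambda>j. inverse (rowp ZT j))"
  proof (rule eq_matI)
    fix i j assume "i < dim_row (scl 3 (\<lambda>j. inverse (alp ZT * colp ZT j)) (Km ZT) (\<lambda>j. inverse (rowp ZT j)))"
      "j < dim_col (scl 3 (\<lambda>j. inverse (alp ZT * colp ZT j)) (Km ZT) (\<lambda>j. inverse (rowp ZT j)))"
    hence ij: "i < 3" "j < 3" by simp_all
    show "Jm W $$ (i, j) = scl 3 (\<lambda>j. inverse (alp ZT * colp ZT j)) (Km ZT) (\<lambda>j. inverse (rowp ZT j)) $$ (i, j)"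
      using ij al rcZ by (simp add: KZ field_simps)
  qed (use Wc in auto)
  hence JK: "Jm (Km X) = scl 3 (\<lambda>j. inverse (LS j)) (Iv (Jm ZT)) (\<lambda>j. inverse (RS j))"
    unfolding K1 Jm_scl[OF Wc] KZ'[symmetric] scl_scl
    by (simp add: scl_scl) (simp add: LS_def RS_def scl_def mult_ac)
  have dI: "det (Iv (Jm ZT)) \<noteq> 0" using det_Im[OF Jm_carrier[OF Zc] dJZ] dJZ by simp
  have "Km (Km X) = scl 3 (\<lambda>i. inverse (inverse (RS i))) (Iv (Iv (Jm ZT))) (\<lambda>i. inverse (inverse (LS i)))"
    unfolding Km_def[of "Km X"] JK by (rule Im_scl) (use Y dI L R in auto)
  hence K2: "Km (Km X) = scl 3 RS (Jm ZT) LS"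
    using Im_Im[OF Jm_carrier[OF Zc] dJZ] by simp
  have "Km (Km (Km X)) = scl 3 LS (Km (Jm ZT)) RS"
    unfolding K2 by (rule Km_scl) (use Y dZ L R in auto)
  also have "Km (Jm ZT) = transpose_mat X" by (simp add: Km_def IZ)
  finally show "kn 3 X = scl 3 LS (transpose_mat X) RS"
    by (simp add: numeral_3_eq_3 kn_Suc)
qed

lemma kn_add: "kn (k + l) A = kn k (kn l A)"
  by (simp add: kn_def funpow_add)

lemma kn_scl_even_odd:
  fixes A :: "'a::field mat"
  assumes A: "A \<in> carrier_mat n n" and nz: "\<And>k. det (Jm (kn k A)) \<noteq> 0"
    "\<And>i. i < n \<Longrightarrow> a i \<noteq> 0" "\<And>i. i < n \<Longrightarrow> c i \<noteq> 0"
  shows "kn k (scl n a A c) = (if even k then scl n a (kn k A) c else scl n c (kn k A) a)"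
  by (induction k) (use assms in \<open>auto simp: kn_Suc' Km_scl kn_carrier\<close>)

lemma kn_transpose:
  fixes A :: "'a::field mat"
  assumes A: "A \<in> carrier_mat n n" and nz: "\<And>k. det (Jm (kn k A)) \<noteq> 0"
  shows "kn k (transpose_mat A) = transpose_mat (kn k A)"
  by (induction k) (use assms in \<open>auto simp: kn_Suc' Km_transpose[of _ n] kn_carrier\<close>)

text \<open>A second round of \<open>kn_3\<close> undoes the transposition. Since odd iterates
  exchange the two sides, both rounds contribute \<open>RS\<close> on the left and \<open>LS\<close>
  on the right.\<close>

lemma kn_6_mult:
  assumes q3: "q = 3"
  shows "kn (6 * k) X = scl 3 (\<lambda>i. RS i ^ (2 * k)) X (\<lambda>i. LS i ^ (2 * k))"
proof (induction k)
  case 0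
  show ?case by (rule eq_matI) (simp_all add: q3)
next
  case (Suc k)
  note nz = kn_X_nz(2) kn_3(2,3)[OF q3]
  have Xc: "X \<in> carrier_mat 3 3" using XF_carrier[of q] q3 by simp
  have kc: "kn m X \<in> carrier_mat 3 3" for m by (rule kn_carrier[OF Xc])
  have T: "transpose_mat X \<in> carrier_mat 3 3" using Xc by simp
  have nzT: "det (Jm (kn m (transpose_mat X))) \<noteq> 0" for m
    unfolding kn_transpose[OF Xc nz(1)] Jm_transpose using det_transpose[OF Jm_carrier[OF kc]] nz(1) by simp
  have "kn 6 X = kn 3 (kn 3 X)" using kn_add[of 3 3 X] by simp
  also have "\<dots> = scl 3 RS (kn 3 (transpose_mat X)) LS"
    unfolding kn_3(1)[OF q3] using kn_scl_even_odd[OF T nzT, where a = LS and c = RS and k = 3] nz(2,3) by simp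
  also have "kn 3 (transpose_mat X) = scl 3 RS X LS"
    unfolding kn_transpose[OF Xc nz(1)] kn_3(1)[OF q3] transpose_scl[OF T] by simp
  finally have 6: "kn 6 X = scl 3 (\<lambda>i. RS i * RS i) X (\<lambda>i. LS i * LS i)" by (simp add: scl_scl)
  have "kn (6 * Suc k) X = kn 6 (kn (6 * k) X)" by (simp flip: kn_add)
  also have "\<dots> = scl 3 (\<lambda>i. RS i ^ (2 * k)) (kn 6 X) (\<lambda>i. LS i ^ (2 * k))"
    unfolding Suc using kn_scl_even_odd[OF Xc nz(1), of "\<lambda>i. RS i ^ (2 * k)" "\<lambda>i. LS i ^ (2 * k)" 6] nz(2,3) by simp
  finally show ?case unfolding 6 scl_scl by (simp add: mult_ac)
qed

lemma Tup_scl: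
  assumes T: "Tup l N G \<psi>" and k: "kn n X = scl q a (kn l X) c"
    and u: "B \<noteq> 0" "\<And>i. i < q \<Longrightarrow> F (u i) = F B * a i \<and> hm du (u i) \<and> u i \<in> PV (coords q)"
    and v: "B' \<noteq> 0" "\<And>i. i < q \<Longrightarrow> F (v i) = F B' * c i \<and> hm dv (v i) \<and> v i \<in> PV (coords q)"
  shows "Tup n (du + N + dv) (\<lambda>w. u (fst w) * G w * v (snd w)) (\<psi> / (F B * F B'))"
  unfolding Tup_def
proof (intro conjI ballI)
  show "\<psi> / (F B * F B') \<noteq> 0" using T u v by (simp add: Tup_def)
  fix w assume w: "w \<in> coords q"
  obtain i j where ij: "w = (i, j)" "i < q" "j < q" using w by (cases w) (auto simp: coords_def)
  have G: "hm N (G w)" "G w \<in> PV (coords q)" "kn l X $$ w = \<psi> * F (G w)" using T w by (auto simp: Tup_def)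
  show "hm (du + N + dv) (u (fst w) * G w * v (snd w))"
    using u(2)[OF ij(2)] v(2)[OF ij(3)] G by (auto simp: ij(1) intro!: hm_mult)
  show "u (fst w) * G w * v (snd w) \<in> PV (coords q)"
    using u(2)[OF ij(2)] v(2)[OF ij(3)] G by (auto simp: ij(1) intro!: PV_mult)
  show "kn n X $$ w = \<psi> / (F B * F B') * F (u (fst w) * G w * v (snd w))"
    using u v ij G(3) by (simp add: k)
qed

lemma hq_row_col:
  assumes q3: "q = 3" and A: "A \<in> carrier_mat 3 3" and e: "\<And>i j. i < 3 \<Longrightarrow> j < 3 \<Longrightarrow> hq e (A $$ (i, j))"
  shows "i < 3 \<Longrightarrow> hq (3 * e) (rowp A i)" and "i < 3 \<Longrightarrow> hq 0 (alp A * colp A i)"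
proof -
  have R: "hq (3 * e) (rowp A i)" if "i < 3" for i
    using hq_prod[of "{..<3}" "\<lambda>_. e" "\<lambda>l. A $$ (i, l)"] e that by (simp add: rowp_def)
  have C: "hq (3 * e) (colp A i)" if "i < 3" for i
    using hq_prod[of "{..<3}" "\<lambda>_. e" "\<lambda>l. A $$ (l, i)"] e that by (simp add: colp_def)
  have P: "hq (9 * e) (allp A)"
    using hq_prod[of "{..<3}" "\<lambda>_. 3 * e" "rowp A"] R by (simp add: allp_def)
  have D: "hq (3 * e) (det A)" using hq_det[OF A e] by simp
  have J: "hq (3 * (- e)) (det (Jm A))"
  proof -
    have "hq (int 3 * (- e)) (det (Jm A))"
      by (rule hq_det[OF Jm_carrier[OF A]]) (use e in \<open>simp add: Jm_index[OF A] hq_inverse\<close>)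
    thus ?thesis by simp
  qed
  have "hq (3 * e - (9 * e + 3 * (- e))) (alp A)"
    unfolding alp_def by (intro hq_divide hq_uminus hq_mult D P J)
  from hq_mult[OF this C, of i] show "i < 3 \<Longrightarrow> hq 0 (alp A * colp A i)" if "i < 3"
    using that by simp
  show "i < 3 \<Longrightarrow> hq (3 * e) (rowp A i)" by (rule R)
qed

lemma scaling_numerators:
  assumes hq: "\<And>i. i < q \<Longrightarrow> hq e (a i)" and nz: "\<And>i. i < q \<Longrightarrow> a i \<noteq> 0"
  shows "\<exists>B u k. B \<noteq> 0 \<and> (\<forall>i<q. F (u i) = F B * a i \<and> hm k (u i) \<and> u i \<in> PV (coords q))"
proof -
  obtain B k where B: "B \<noteq> 0" "hq k (F B)" "\<And>w. w \<in> {..<q} \<Longrightarrow> \<exists>g. F g = F B * a w"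
    using common_denominator[of "{..<q}" e a] hq by auto
  define u where "u i = (SOME g. F g = F B * a i)" for i
  have u: "F (u i) = F B * a i" if "i < q" for i
    unfolding u_def by (rule someI_ex) (rule B(3), use that in simp)
  have "hm (nat (k + e)) (u i) \<and> u i \<in> PV (coords q)" if i: "i < q" for i
  proof -
    have "F (u i) \<noteq> 0" using u[OF i] B(1) nz[OF i] by simp
    hence nz: "u i \<noteq> 0" by fastforce
    have "hq (k + e) (F (u i))" unfolding u[OF i] by (rule hq_mult[OF B(2) hq[OF i]])
    from hq_F_iff[OF this nz] show ?thesis by (simp del: One_nat_def)
  qed
  thus ?thesis using B(1) u by blast
qed

text \<open>Six further steps only multiply rows and columns by two more powers of \<open>RS\<close>
  and \<open>LS\<close>; clearing their denominators raises the degree by at most a constant for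
  every six steps.\<close>

lemma dg_linear_3:
  assumes q3: "q = 3"
  shows "\<exists>K. \<forall>n. real (dg n) \<le> K * real (n + 1)"
proof -
  have Xc: "X \<in> carrier_mat 3 3" using XF_carrier[of q] q3 by simp
  have Y: "YY \<in> carrier_mat 3 3" using Xc by (simp add: YY_def)
  have ZY: "ZT $$ (i, j) = YY $$ (j, i)" if "i < 3" "j < 3" for i j
    by (rule index_transpose_mat(1)) (simp_all only: carrier_matD[OF Y] that)
  have hX: "hq 1 (X $$ (i, j))" if "i < 3" "j < 3" for i j by (rule hq_X) (use that q3 in simp_all)
  have hZ: "hq (-1) (ZT $$ (i, j))" if "i < 3" "j < 3" for i j
    unfolding ZY[OF that] by (rule hq_YY) (use that q3 in simp_all)
  have Zc: "ZT \<in> carrier_mat 3 3" using Y by simp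
  note rcX = hq_row_col[OF q3 Xc hX] and rcZ = hq_row_col[OF q3 Zc hZ]
  have "hq (3 * 1 + 3 * (- 1)) (RS i)" if "i < q" for i
    unfolding RS_def by (rule hq_mult[OF rcX(1) rcZ(1)]) (use that q3 in simp_all)
  then obtain B u k where u: "B \<noteq> 0" "\<And>i. i < q \<Longrightarrow> F (u i) = F B * RS i \<and> hm k (u i) \<and> u i \<in> PV (coords q)"
    using scaling_numerators[of _ RS] kn_3(3)[OF q3] q3 by blast
  have "hq (0 + 0) (LS i)" if "i < q" for i
    unfolding LS_def by (rule hq_mult[OF rcX(2) rcZ(2)]) (use that q3 in simp_all)
  then obtain B' u' k' where u': "B' \<noteq> 0" "\<And>i. i < q \<Longrightarrow> F (u' i) = F B' * LS i \<and> hm k' (u' i) \<and> u' i \<in> PV (coords q)"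
    using scaling_numerators[of _ LS] kn_3(2)[OF q3] q3 by blast
  have pu: "F (u i ^ t) = F (B ^ t) * RS i ^ t \<and> hm (t * k) (u i ^ t) \<and> u i ^ t \<in> PV (coords q)" if "i < q" for i t
    using u(2)[OF that] by (auto simp: F_power power_mult_distrib intro: hm_power PV_power)
  have pu': "F (u' i ^ t) = F (B' ^ t) * LS i ^ t \<and> hm (t * k') (u' i ^ t) \<and> u' i ^ t \<in> PV (coords q)" if "i < q" for i t
    using u'(2)[OF that] by (auto simp: F_power power_mult_distrib intro: hm_power PV_power)
  have step: "dg (m + 6 * l) \<le> 2 * l * (k + k') + dg m" for m l
  proof -
    obtain G \<psi> where T: "Tup m (dg m) G \<psi>" using reduced_Tup_exists by blast
    have kn: "kn (m + 6 * l) X = (if even m then scl q (\<lambda>i. RS i ^ (2 * l)) (kn m X) (\<lambda>i. LS i ^ (2 * l))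
       else scl q (\<lambda>i. LS i ^ (2 * l)) (kn m X) (\<lambda>i. RS i ^ (2 * l)))"
      unfolding kn_add kn_6_mult[OF q3] using kn_scl_even_odd[OF Xc kn_X_nz(2), of "\<lambda>i. RS i ^ (2 * l)" "\<lambda>i. LS i ^ (2 * l)" m]
        kn_3(2,3)[OF q3] by (simp add: q3)
    have "\<exists>G \<psi>. Tup (m + 6 * l) (2 * l * (k + k') + dg m) G \<psi>"
    proof (cases "even m")
      case True
      have "Tup (m + 6 * l) (2 * l * k + dg m + 2 * l * k') (\<lambda>w. u (fst w) ^ (2 * l) * G w * u' (snd w) ^ (2 * l))
          (\<psi> / (F (B ^ (2 * l)) * F (B' ^ (2 * l))))"
        by (rule Tup_scl[OF T _ _ pu _ pu']) (use True kn u(1) u'(1) in simp_all)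
      thus ?thesis by (auto simp: algebra_simps)
    next
      case False
      have "Tup (m + 6 * l) (2 * l * k' + dg m + 2 * l * k) (\<lambda>w. u' (fst w) ^ (2 * l) * G w * u (snd w) ^ (2 * l))
          (\<psi> / (F (B' ^ (2 * l)) * F (B ^ (2 * l))))"
        by (rule Tup_scl[OF T _ _ pu' _ pu]) (use False kn u(1) u'(1) in simp_all)
      thus ?thesis by (auto simp: algebra_simps)
    qed
    thus ?thesis unfolding dg_def[of "m + 6 * l"] by (rule Least_le)
  qed
  \<comment> \<open>Bounds the degrees at the remainders of \<open>n\<close> modulo 6.\<close>
  define M where "M = (\<Sum>m<6. dg m)"
  have "dg n \<le> (2 * (k + k') + M) * (n + 1)" for n
  proof -
    have "dg n \<le> 2 * (n div 6) * (k + k') + dg (n mod 6)" using step[of "n mod 6" "n div 6"] by simp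
    also have "dg (n mod 6) \<le> M" unfolding M_def by (rule member_le_sum) auto
    also have "2 * (n div 6) * (k + k') + M \<le> 2 * (n + 1) * (k + k') + M * (n + 1)"
      by (intro add_mono mult_right_mono mult_left_mono) auto
    finally show ?thesis by (simp add: algebra_simps)
  qed
  hence "real (dg n) \<le> real (2 * (k + k') + M) * real (n + 1)" for n
    by (metis of_nat_le_iff of_nat_mult)
  thus ?thesis by blast
qed

end

theorem mainTheorem1:
  fixes q :: nat
  assumes "q \<ge> 3"
  shows "(\<lambda>n. root n (real (rat_map_deg (coords q) (titer (K_map q) n))))
      \<longlonglongrightarrow> Max {cmod z | z :: complex.
            z\<^sup>2 - of_int (int q ^ 2 - 4 * int q + 2) * z + 1 = 0}"
proof -
  interpret mdim q by unfold_locales (use assms in simp)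
  show ?thesis
  proof (cases "q = 3")
    case True
    obtain K where K: "\<And>n. real (dg n) \<le> K * real (n + 1)" using dg_linear_3[OF True] by blast
    have "(\<lambda>n. root n (real (dg n))) \<longlonglongrightarrow> 1"
      by (rule root_limit[of 1 _ K 1]) (use K dg_pos assms in auto)
    moreover have "int q ^ 2 - 4 * int q + 2 = - 1" using True by simp
    ultimately show ?thesis unfolding rat_map_deg_eq by (simp only: max_root_q3)
  next
    case False
    hence q4: "4 \<le> q" using assms by simp
    define \<tau> where "\<tau> = int q ^ 2 - 4 * int q + 2"
    \<comment> \<open>For \<open>q \<ge> 4\<close> the sum \<open>\<tau>\<close> of the roots is at
      least 2, so the roots are real with product 1, and \<open>\<delta>\<close> is the one that is
      at least 1.\<close>
    have "0 \<le> int q * (int q - 4)" using q4 by simp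
    hence "2 \<le> \<tau>" by (simp add: \<tau>_def power2_eq_square algebra_simps)
    hence t2: "2 \<le> real_of_int \<tau>" by simp
    define s where "s = sqrt ((real_of_int \<tau>)\<^sup>2 - 4)"
    have s0: "0 \<le> s" unfolding s_def using power_mono[OF t2, of 2] by simp
    have s2: "s * s = (real_of_int \<tau>)\<^sup>2 - 4" unfolding s_def using power_mono[OF t2, of 2] by simp
    define \<delta> where "\<delta> = (real_of_int \<tau> + s) / 2"
    have \<delta>1: "1 \<le> \<delta>" using t2 s0 by (simp add: \<delta>_def)
    have "\<delta> * ((real_of_int \<tau> - s) / 2) = 1" using s2 by (simp add: \<delta>_def algebra_simps power2_eq_square)
    hence "inverse \<delta> = (real_of_int \<tau> - s) / 2" by (rule inverse_unique)
    hence \<delta>t: "\<delta> + inverse \<delta> = real_of_int \<tau>" by (simp add: \<delta>_def field_simps)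
    hence "\<delta> + inverse \<delta> = (real q)\<^sup>2 - 4 * real q + 2" by (simp add: \<tau>_def)
    from dg_growth[OF q4 \<delta>1 this] show ?thesis
      unfolding rat_map_deg_eq \<tau>_def[symmetric] max_root_q4[OF \<delta>1 \<delta>t] .
  qed
qed

end
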